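(* (i) There is an absolute constant $C>0$ such that for every $M\geq 1$ and every finite set $A\subset\mathbb{R}$ with $|A|>1$, $0\notin A$ and $|AA|\leq M|A|$, $$\mathsf{E}(A)\leq C\,M^{8/5}|A|^{49/20}\log^{1/5}|A|.$$ (ii) There is an absolute constant $C>0$ such that for every prime $p$ and every multiplicative subgroup $\Gamma\subseteq\mathbb{F}_p^\times$ with $1<|\Gamma|\leq\sqrt{p}$, $$\mathsf{E}(\Gamma)\leq C\,|\Gamma|^{49/20}\log^{1/5}|\Gamma|.$$
   Context: $AA=\{ab:a,b\in A\}$. For a finite set $A$ in an abelian group, $r_{A-A}(x)=|\{(a,b)\in A\times A: a-b=x\}|$ and the additive energy is $\mathsf{E}(A)=\sum_x r_{A-A}(x)^2$, i.e. the number of solutions of $a_1+a_2=a_3+a_4$ with $a_i\in A$. Logarithms are base $2$. *)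

theory Defs
  imports
    Complex_Main
    "HOL-Library.Set_Algebras"
    "HOL-Number_Theory.Residues"
begin

definition diff_rep :: "'a::ab_group_add set \<Rightarrow> 'a \<Rightarrow> nat"
  where "diff_rep A x = card {(a, b) \<in> A \<times> A. a - b = x}"

text \<open>The sum ranges over the difference set, i.e. the support of \<open>diff_rep A\<close>:
  a \<open>sum\<close> over the whole type would be \<open>0\<close> by convention when the type is infinite.\<close>

definition additive_energy :: "'a::ab_group_add set \<Rightarrow> nat"
  where "additive_energy A = (\<Sum>x \<in> (\<lambda>(a, b). a - b) ` (A \<times> A). (diff_rep A x)\<^sup>2)"

text \<open>The same notions in the additive group of a ring given by a record.  They are needed
  because the modulus of \<^const>\<open>residue_ring\<close> is quantified inside a formula.\<close>

definition ring_diff_rep :: "('a, 'm) ring_scheme \<Rightarrow> 'a set \<Rightarrow> 'a \<Rightarrow> nat"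
  where "ring_diff_rep R A x = card {(a, b) \<in> A \<times> A. a \<ominus>\<^bsub>R\<^esub> b = x}"

definition ring_additive_energy :: "('a, 'm) ring_scheme \<Rightarrow> 'a set \<Rightarrow> nat"
  where "ring_additive_energy R A =
    (\<Sum>x \<in> (\<lambda>(a, b). a \<ominus>\<^bsub>R\<^esub> b) ` (A \<times> A). (ring_diff_rep R A x)\<^sup>2)"

lemma sum_card_fibres_squared:
  assumes "finite S"
  shows "(\<Sum>x \<in> f ` S. (card {s \<in> S. f s = x})\<^sup>2) = card {(s, t) \<in> S \<times> S. f s = f t}"
proof -
  let ?F = "\<lambda>x. {s \<in> S. f s = x}"
  have "{(s, t) \<in> S \<times> S. f s = f t} = (\<Union>x \<in> f ` S. ?F x \<times> ?F x)"
    by auto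
  also have "card \<dots> = (\<Sum>x \<in> f ` S. card (?F x \<times> ?F x))"
    using assms by (intro card_UN_disjoint) auto
  finally show ?thesis
    by (simp add: card_cartesian_product power2_eq_square)
qed

lemma additive_energy_eq_card:
  assumes "finite A"
  shows "additive_energy A =
    card {((a1, a4), (a3, a2)) \<in> (A \<times> A) \<times> (A \<times> A). a1 + a2 = a3 + a4}"
proof -
  have "additive_energy A = (\<Sum>x \<in> (\<lambda>(a, b). a - b) ` (A \<times> A).
      (card {s \<in> A \<times> A. (\<lambda>(a, b). a - b) s = x})\<^sup>2)"
    unfolding additive_energy_def diff_rep_def
    by (intro sum.cong refl arg_cong[where f = "\<lambda>S. (card S)\<^sup>2"]) auto
  also have "\<dots> = card {(s, t) \<in> (A \<times> A) \<times> (A \<times> A). (\<lambda>(a, b). a - b) s = (\<lambda>(a, b). a - b) t}"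
    using assms by (intro sum_card_fibres_squared) auto
  also have "{(s, t) \<in> (A \<times> A) \<times> (A \<times> A). (\<lambda>(a, b). a - b) s = (\<lambda>(a, b). a - b) t} =
      {((a1, a4), (a3, a2)) \<in> (A \<times> A) \<times> (A \<times> A). a1 + a2 = a3 + a4}"
    by (auto simp: diff_eq_eq algebra_simps)
  finally show ?thesis .
qed

end

theory Submission
  imports "HOL-Real_Asymp.Real_Asymp" Defs "HOL-Computational_Algebra.Polynomial"
begin

text \<open>
  Let \<open>t\<close> be the size of the set, \<open>r\<close> its representation function and \<open>E\<close> its energy. Triples
  \<open>(y, x, x')\<close> weighted by \<open>r(x - y) r(x' - y) r(x - x')\<close> have total weight at least \<open>E\<^sup>3 / t\<^sup>3\<close>.
  Grouping them by \<open>(u, v) = (x - y, x' - y)\<close>, Cauchy-Schwarz bounds the square of that weight by the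
  third moment of \<open>r\<close> times \<open>Y = \<Sum> r(u)\<^sup>2 r(v)\<^sup>2 r(u - v)\<^sup>2\<close>. So one has to bound the third moment and
  the number of solutions of \<open>u - v = w\<close> in level sets of \<open>r\<close>.

  For reals, if \<open>r(x) \<ge> s\<close> then \<open>x = c\<^sup>-\<^sup>1 v - b\<close> has at least \<open>s t\<close> solutions with \<open>v \<in> AA\<close> and \<open>b, c \<in> A\<close>,
  and the Szemeredi-Trotter bound for grids shows that there are \<open>O(M\<^sup>2 t\<^sup>3 / s\<^sup>3)\<close> such \<open>x\<close>. Petridis'
  lemma gives \<open>X \<subseteq> A\<close> with \<open>|X| \<ge> t / 2\<close> and \<open>|XAA| \<le> 4 M\<^sup>2 t\<close>, so that the dilates of a level set by \<open>X\<close>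
  are not much more numerous than the level set itself. Multiplying \<open>u - v = w\<close> by the elements of \<open>X\<close>
  turns it into an incidence problem again. Up to logarithms this gives the main term
  \<open>M\<^bsup>13/9\<^esup> t\<^bsup>22/9\<^esup>\<close>, and \<open>22/9 < 49/20\<close>.

  For subgroups, Stepanov's method bounds by \<open>O(t\<^sup>4 / s\<^sup>3)\<close> the number of \<open>(\<rho>, z)\<close> for which \<open>a - \<rho> b = z\<close>
  has at least \<open>s\<close> solutions. By invariance, \<open>t\<^sup>2 Y\<close> is a weighted sum of these numbers of solutions. The
  second moment of the weights is controlled by the correlations \<open>\<epsilon>(\<rho>) = \<Sum> r(x) r(\<rho> x)\<close>, whose large
  values are bounded by a second use of the weighted triples. Up to logarithms the resulting
  exponent is \<open>610/249 < 49/20\<close>.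
\<close>


section \<open>Additive energy and triples of differences\<close>

text \<open>The matrix \<open>r (x - y)\<close>, indexed by the set, is a Gram matrix, hence
  positive semidefinite. The weighted triples are the trace of its cube, and its largest eigenvalue
  is at least \<open>E / t\<close>; this is the source of the lower bound, although only
  Cauchy-Schwarz is used below. The third moment of \<open>r\<close> has order \<open>t^3\<close> up
  to logarithms (for bounded \<open>M\<close>), and \<open>E^2 <= t^2 * sum r^3\<close> then yields
  the exponent \<open>5/2\<close>. To go lower one must use that \<open>u\<close>, \<open>v\<close>
  and \<open>u - v\<close> are popular differences at the same time, which is what \<open>Y\<close>
  measures. For subgroups the obstacle is that Stepanov's bound holds only on average over the pairs
  \<open>(rho, z)\<close>: it is a weak \<open>L^3\<close> bound. It can be tested against a weight
  with known first and second moments, but says little about a single slope. The detour through the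
  correlations supplies the second moment. Both exponents reached are strictly below
  \<open>49/20\<close>. One parameter \<open>L\<close> of order \<open>log t\<close> may therefore
  absorb constants and dyadic losses, at the price of high powers of \<open>L\<close>, and sets too
  small for the asymptotics are covered by \<open>E <= t^3\<close>.\<close>

definition diff_set :: "'a::ab_group_add set \<Rightarrow> 'a set"
  where "diff_set A = (\<lambda>(a, b). a - b) ` (A \<times> A)"

definition rep :: "'a::ab_group_add set \<Rightarrow> 'a \<Rightarrow> real"
  where "rep A x = real (diff_rep A x)"

definition third_energy :: "'a::ab_group_add set \<Rightarrow> real"
  where "third_energy A = (\<Sum>x\<in>diff_set A. rep A x ^ 3)"

lemma finite_diff_set [simp]: "finite A \<Longrightarrow> finite (diff_set A)"
  by (simp add: diff_set_def)

lemma diff_in_diff_set [simp]: "a \<in> A \<Longrightarrow> b \<in> A \<Longrightarrow> a - b \<in> diff_set A"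
  by (auto simp: diff_set_def)

lemma rep_nonneg [simp]: "0 \<le> rep A x"
  by (simp add: rep_def)

lemma energy_eq_sum_rep: "real (additive_energy A) = (\<Sum>x\<in>diff_set A. (rep A x)\<^sup>2)"
  by (simp add: additive_energy_def rep_def diff_set_def)

lemma diff_rep_eq_0: "x \<notin> diff_set A \<Longrightarrow> diff_rep A x = 0"
proof -
  assume "x \<notin> diff_set A"
  then have "{(a, b) \<in> A \<times> A. a - b = x} = {}" by (auto simp: diff_set_def)
  then show ?thesis by (simp only: diff_rep_def card.empty)
qed

lemma rep_eq_0: "x \<notin> diff_set A \<Longrightarrow> rep A x = 0"
  by (simp add: rep_def diff_rep_eq_0)

lemma sum_diffs_eq:
  assumes "finite A"
  shows "(\<Sum>a\<in>A. \<Sum>b\<in>A. g (a - b)) = (\<Sum>x\<in>diff_set A. rep A x * g x)"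
proof -
  let ?f = "\<lambda>(a, b). a - b"
  have "(\<Sum>a\<in>A. \<Sum>b\<in>A. g (a - b)) = (\<Sum>s\<in>A \<times> A. g (?f s))"
    by (simp add: sum.cartesian_product split_def)
  also have "\<dots> = (\<Sum>x\<in>?f ` (A \<times> A). \<Sum>s\<in>{s \<in> A \<times> A. ?f s = x}. g (?f s))"
    using assms by (intro sum.image_gen) auto
  also have "\<dots> = (\<Sum>x\<in>diff_set A. rep A x * g x)"
    unfolding diff_set_def
  proof (rule sum.cong[OF refl])
    fix x
    have "(\<Sum>s\<in>{s \<in> A \<times> A. ?f s = x}. g (?f s)) = (\<Sum>s\<in>{s \<in> A \<times> A. ?f s = x}. g x)"
      by (rule sum.cong) auto
    also have "\<dots> = real (card {s \<in> A \<times> A. ?f s = x}) * g x" by simp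
    also have "card {s \<in> A \<times> A. ?f s = x} = diff_rep A x"
      unfolding diff_rep_def by (rule arg_cong[where f = card]) auto
    finally show "(\<Sum>s\<in>{s \<in> A \<times> A. ?f s = x}. g (?f s)) = rep A x * g x"
      by (simp add: rep_def)
  qed
  finally show ?thesis .
qed

lemma sum_rep: "finite A \<Longrightarrow> (\<Sum>x\<in>diff_set A. rep A x) = (real (card A))\<^sup>2"
  using sum_diffs_eq[of A "\<lambda>_. 1"] by (simp add: power2_eq_square)

lemma diff_rep_alt: "diff_rep A w = card {x \<in> A. x - w \<in> A}"
  unfolding diff_rep_def
  by (rule bij_betw_same_card[of fst], rule bij_betwI[of _ _ _ "\<lambda>x. (x, x - w)"])
     (auto simp: algebra_simps)

lemma diff_rep_uminus: "diff_rep A (- w) = diff_rep A w"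
  unfolding diff_rep_def
  by (rule bij_betw_same_card[of "\<lambda>(a, b). (b, a)"], rule bij_betwI[of _ _ _ "\<lambda>(a, b). (b, a)"])
     (auto simp: algebra_simps)

lemma rep_uminus: "rep A (- w) = rep A w"
  by (simp add: rep_def diff_rep_uminus)

lemma diff_rep_le_card: "finite A \<Longrightarrow> diff_rep A w \<le> card A"
  unfolding diff_rep_alt by (intro card_mono) auto

lemma rep_0: "rep A 0 = real (card A)"
  by (simp add: rep_def diff_rep_alt)

lemma sum_filter_of_bool:
  fixes f :: "'a \<Rightarrow> real"
  assumes "finite A"
  shows "(\<Sum>x\<in>{x \<in> A. P x}. f x) = (\<Sum>x\<in>A. f x * of_bool (P x))"
  unfolding sum.inter_filter[OF assms] by (rule sum.cong) auto

text \<open>The shift \<open>w = x - a\<close> turns a representation \<open>x - x' = a - b\<close>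
  into a translate of \<open>A\<close> containing both \<open>x\<close> and \<open>x'\<close>. This
  exhibits \<open>rep A (x - x')\<close> as a Gram kernel.\<close>

lemma rep_diff_eq_card_shifts:
  assumes "finite A" "x \<in> A"
  shows "rep A (x - x') = (\<Sum>w\<in>diff_set A. of_bool (x - w \<in> A \<and> x' - w \<in> A))"
proof -
  have "card {(a, b) \<in> A \<times> A. a - b = x - x'} = card {w \<in> diff_set A. x - w \<in> A \<and> x' - w \<in> A}"
    by (rule bij_betw_same_card[of "\<lambda>(a, b). x - a"],
        rule bij_betwI[of _ _ _ "\<lambda>w. (x - w, x' - w)"])
       (use assms in \<open>auto simp: algebra_simps\<close>)
  then show ?thesis
    using sum_filter_of_bool[OF finite_diff_set[OF assms(1)],
        of "\<lambda>_. 1" "\<lambda>w. x - w \<in> A \<and> x' - w \<in> A"]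
    by (simp add: rep_def diff_rep_def)
qed

section \<open>Cauchy-Schwarz and lower bounds for weighted triples\<close>

lemma cauchy_schwarz_sum:
  fixes f g :: "'a \<Rightarrow> real"
  shows "(\<Sum>i\<in>I. f i * g i)\<^sup>2 \<le> (\<Sum>i\<in>I. (f i)\<^sup>2) * (\<Sum>i\<in>I. (g i)\<^sup>2)"
proof -
  have "0 \<le> (\<Sum>i\<in>I. \<Sum>j\<in>I. (f i * g j - f j * g i)\<^sup>2)"
    by (intro sum_nonneg) auto
  also have "\<dots> = (\<Sum>i\<in>I. \<Sum>j\<in>I. (f i)\<^sup>2 * (g j)\<^sup>2 + (f j)\<^sup>2 * (g i)\<^sup>2 - 2 * (f i * g i) * (f j * g j))"
    by (intro sum.cong refl) (simp add: power2_eq_square algebra_simps)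
  also have "\<dots> = (\<Sum>i\<in>I. (f i)\<^sup>2) * (\<Sum>i\<in>I. (g i)\<^sup>2) + (\<Sum>i\<in>I. (f i)\<^sup>2) * (\<Sum>i\<in>I. (g i)\<^sup>2)
      - 2 * (\<Sum>i\<in>I. f i * g i)\<^sup>2"
  proof -
    have "(\<Sum>i\<in>I. \<Sum>j\<in>I. (f j)\<^sup>2 * (g i)\<^sup>2) = (\<Sum>i\<in>I. (f i)\<^sup>2) * (\<Sum>i\<in>I. (g i)\<^sup>2)"
      by (subst sum.swap) (simp add: sum_product)
    moreover have "(\<Sum>i\<in>I. \<Sum>j\<in>I. (f i)\<^sup>2 * (g j)\<^sup>2) = (\<Sum>i\<in>I. (f i)\<^sup>2) * (\<Sum>i\<in>I. (g i)\<^sup>2)"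
      by (simp add: sum_product)
    moreover have "(\<Sum>i\<in>I. \<Sum>j\<in>I. 2 * (f i * g i) * (f j * g j)) = 2 * (\<Sum>i\<in>I. f i * g i)\<^sup>2"
      unfolding power2_eq_square sum_product by (simp only: sum_distrib_left mult.assoc)
    ultimately show ?thesis by (simp only: sum.distrib sum_subtractf)
  qed
  finally show ?thesis by simp
qed

lemma sum_squared_le:
  fixes f :: "'a \<Rightarrow> real"
  shows "(\<Sum>i\<in>I. f i)\<^sup>2 \<le> real (card I) * (\<Sum>i\<in>I. (f i)\<^sup>2)"
  using cauchy_schwarz_sum[of "\<lambda>_. 1" f I] by simp

text \<open>For fixed \<open>y\<close> the Gram form of \<open>rep A (x - x')\<close> makes the sum
  over \<open>x\<close> and \<open>x'\<close> a sum over \<open>w\<close> of squares; Cauchy-Schwarz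
  in \<open>y\<close> then moves the sum over \<open>B\<close> inside the square. The weight
  \<open>k\<close> and the set \<open>B\<close> stay general because triples are also needed for a
  truncated \<open>rep\<close> and for the indicator function of a level set.\<close>

lemma weighted_triples_ge:
  fixes A B :: "'a::ab_group_add set"
  assumes A: "finite A" and B: "finite B"
  shows "(\<Sum>w\<in>diff_set A. (\<Sum>x\<in>{x \<in> A. x - w \<in> A}. \<Sum>y\<in>B. k (x - y))\<^sup>2) \<le>
    real (card B) * (\<Sum>y\<in>B. \<Sum>x\<in>A. \<Sum>x'\<in>A. k (x - y) * k (x' - y) * rep A (x - x'))"
proof -
  let ?A = "\<lambda>w. {x \<in> A. x - w \<in> A}"
  have eq: "(\<Sum>x\<in>A. \<Sum>x'\<in>A. k (x - y) * k (x' - y) * rep A (x - x')) =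
    (\<Sum>w\<in>diff_set A. (\<Sum>x\<in>?A w. k (x - y))\<^sup>2)" for y
  proof -
    have "(\<Sum>x\<in>A. \<Sum>x'\<in>A. k (x - y) * k (x' - y) * rep A (x - x')) =
      (\<Sum>x\<in>A. \<Sum>x'\<in>A. \<Sum>w\<in>diff_set A. k (x - y) * of_bool (x - w \<in> A) * (k (x' - y) * of_bool (x' - w \<in> A)))"
      by (intro sum.cong refl) (auto simp: rep_diff_eq_card_shifts[OF A] sum_distrib_left of_bool_conj mult_ac)
    also have "\<dots> = (\<Sum>x\<in>A. \<Sum>w\<in>diff_set A. \<Sum>x'\<in>A. k (x - y) * of_bool (x - w \<in> A) * (k (x' - y) * of_bool (x' - w \<in> A)))"
      by (rule sum.cong[OF refl], rule sum.swap)
    also have "\<dots> = (\<Sum>w\<in>diff_set A. \<Sum>x\<in>A. \<Sum>x'\<in>A. k (x - y) * of_bool (x - w \<in> A) * (k (x' - y) * of_bool (x' - w \<in> A)))"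
      by (rule sum.swap)
    also have "\<dots> = (\<Sum>w\<in>diff_set A. (\<Sum>x\<in>A. k (x - y) * of_bool (x - w \<in> A))\<^sup>2)"
      by (simp add: power2_eq_square sum_product)
    also have "\<dots> = (\<Sum>w\<in>diff_set A. (\<Sum>x\<in>?A w. k (x - y))\<^sup>2)"
      by (simp only: sum_filter_of_bool[OF A])
    finally show ?thesis .
  qed
  have "(\<Sum>w\<in>diff_set A. (\<Sum>x\<in>?A w. \<Sum>y\<in>B. k (x - y))\<^sup>2) =
    (\<Sum>w\<in>diff_set A. (\<Sum>y\<in>B. \<Sum>x\<in>?A w. k (x - y))\<^sup>2)"
    by (rule sum.cong[OF refl], subst sum.swap, rule refl)
  also have "\<dots> \<le> (\<Sum>w\<in>diff_set A. real (card B) * (\<Sum>y\<in>B. (\<Sum>x\<in>?A w. k (x - y))\<^sup>2))"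
    by (intro sum_mono sum_squared_le)
  also have "\<dots> = real (card B) * (\<Sum>y\<in>B. \<Sum>w\<in>diff_set A. (\<Sum>x\<in>?A w. k (x - y))\<^sup>2)"
    by (subst sum.swap) (simp only: sum_distrib_left)
  finally show ?thesis by (simp add: eq)
qed

text \<open>If all points of \<open>A\<close> have the same degree \<open>d\<close>, the inner sum
  at \<open>w\<close> is \<open>rep A w * d\<close> exactly, and only one application of
  Cauchy-Schwarz is left. Weights invariant under a subgroup have this property.\<close>

lemma regular_triples_ge:
  fixes A B :: "'a::ab_group_add set"
  assumes A: "finite A" and B: "finite B" and d: "\<And>x. x \<in> A \<Longrightarrow> (\<Sum>y\<in>B. k (x - y)) = d"
  shows "d\<^sup>2 * real (additive_energy A) \<le>
    real (card B) * (\<Sum>y\<in>B. \<Sum>x\<in>A. \<Sum>x'\<in>A. k (x - y) * k (x' - y) * rep A (x - x'))"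
proof -
  have "(\<Sum>w\<in>diff_set A. (\<Sum>x\<in>{x \<in> A. x - w \<in> A}. \<Sum>y\<in>B. k (x - y))\<^sup>2) =
    (\<Sum>w\<in>diff_set A. (rep A w * d)\<^sup>2)"
    by (intro sum.cong refl arg_cong[where f = "\<lambda>x. x\<^sup>2"]) (simp add: d rep_def diff_rep_alt)
  also have "\<dots> = d\<^sup>2 * real (additive_energy A)"
    by (simp add: energy_eq_sum_rep power_mult_distrib sum_distrib_left mult_ac)
  finally show ?thesis using weighted_triples_ge[OF A B, of k] by simp
qed

text \<open>Two uses of Cauchy-Schwarz replace the spectral argument. The degrees sum to
  \<open>E\<close>, so their squares sum to at least \<open>E^2 / t\<close>. Regrouped by the
  difference \<open>w = x - y\<close>, this sum of squares is the inner product of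
  \<open>rep A\<close> with the sums of \<open>deg\<close> over \<open>A\<close> intersected with
  \<open>A + w\<close>, and \<open>weighted_triples_ge\<close> controls the squares of the
  latter.\<close>

lemma rep_triples_ge:
  fixes A :: "'a::ab_group_add set"
  assumes A: "finite A"
  shows "real (additive_energy A) ^ 3 \<le>
    real (card A) ^ 3 * (\<Sum>y\<in>A. \<Sum>x\<in>A. \<Sum>x'\<in>A. rep A (x - y) * rep A (x' - y) * rep A (x - x'))"
    (is "?E ^ 3 \<le> ?t ^ 3 * ?S")
proof (cases "A = {}")
  case True
  then show ?thesis by (simp add: additive_energy_def)
next
  case False
  define deg where "deg x = (\<Sum>y\<in>A. rep A (x - y))" for x
  let ?A = "\<lambda>w. {x \<in> A. x - w \<in> A}"
  have t: "?t > 0" using False A by (simp add: card_gt_0_iff)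
  have deg_sum: "(\<Sum>x\<in>A. deg x) = ?E"
    unfolding deg_def using sum_diffs_eq[OF A, of "rep A"] by (simp add: energy_eq_sum_rep power2_eq_square)
  have E: "?E > 0"
  proof -
    have "0 \<in> diff_set A" using False by (auto simp: diff_set_def image_iff)
    then have "(rep A 0)\<^sup>2 \<le> ?E" unfolding energy_eq_sum_rep using A by (intro member_le_sum) auto
    moreover have "(rep A 0)\<^sup>2 > 0" using t by (simp add: rep_0)
    ultimately show ?thesis by linarith
  qed
  have "?E\<^sup>2 \<le> ?t * (\<Sum>x\<in>A. (deg x)\<^sup>2)"
    using sum_squared_le[of deg A] by (simp add: deg_sum)
  also have "(\<Sum>x\<in>A. (deg x)\<^sup>2) = (\<Sum>w\<in>diff_set A. rep A w * (\<Sum>x\<in>?A w. deg x))"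
  proof -
    have "(\<Sum>w\<in>diff_set A. rep A w * (\<Sum>x\<in>?A w. deg x)) =
      (\<Sum>w\<in>diff_set A. \<Sum>x\<in>A. rep A w * deg x * of_bool (x - w \<in> A))"
      by (simp only: sum_filter_of_bool[OF A] sum_distrib_left mult.assoc)
    also have "\<dots> = (\<Sum>x\<in>A. \<Sum>w\<in>diff_set A. rep A w * deg x * of_bool (x - w \<in> A))"
      by (rule sum.swap)
    also have "\<dots> = (\<Sum>x\<in>A. (deg x)\<^sup>2)"
    proof (rule sum.cong[OF refl])
      fix x assume x: "x \<in> A"
      have "(\<Sum>w\<in>diff_set A. rep A w * deg x * of_bool (x - w \<in> A)) =
        deg x * (\<Sum>w\<in>{w \<in> diff_set A. x - w \<in> A}. rep A w)"
        by (simp only: sum_filter_of_bool[OF finite_diff_set[OF A]] sum_distrib_left mult_ac)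
      also have "(\<Sum>w\<in>{w \<in> diff_set A. x - w \<in> A}. rep A w) = deg x"
        unfolding deg_def
        by (rule sum.reindex_bij_witness[of _ "\<lambda>y. x - y" "\<lambda>w. x - w"]) (use x in auto)
      finally show "(\<Sum>w\<in>diff_set A. rep A w * deg x * of_bool (x - w \<in> A)) = (deg x)\<^sup>2"
        by (simp add: power2_eq_square)
    qed
    finally show ?thesis ..
  qed
  finally have "?E\<^sup>2 \<le> ?t * (\<Sum>w\<in>diff_set A. rep A w * (\<Sum>x\<in>?A w. deg x))" .
  then have "(?E\<^sup>2)\<^sup>2 \<le> (?t * (\<Sum>w\<in>diff_set A. rep A w * (\<Sum>x\<in>?A w. deg x)))\<^sup>2"
    by (intro power_mono) auto
  also have "\<dots> \<le> ?t\<^sup>2 * (?E * (\<Sum>w\<in>diff_set A. (\<Sum>x\<in>?A w. deg x)\<^sup>2))"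
    unfolding power_mult_distrib energy_eq_sum_rep by (intro mult_left_mono cauchy_schwarz_sum) auto
  also have "\<dots> \<le> ?t\<^sup>2 * (?E * (?t * ?S))"
    unfolding deg_def using weighted_triples_ge[OF A A, of "rep A"] E by (intro mult_left_mono) auto
  finally have "?E * ?E ^ 3 \<le> ?E * (?t ^ 3 * ?S)"
    by (simp add: power2_eq_square power3_eq_cube mult_ac)
  then show ?thesis using E by simp
qed

section \<open>Grouping triples by two differences\<close>

text \<open>Two triples with equal differences are translates of each other by one \<open>w\<close>,
  which is a difference of elements of \<open>B\<close> and, twice, of elements of \<open>A\<close>.
  The resulting mixed moment is separated by \<open>3 a b^2 <= a^3 + 2 b^3\<close>.\<close>

lemma card_congruent_triples_le:
  fixes A B :: "'a::ab_group_add set"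
  assumes A: "finite A" and B: "finite B"
    and p_def: "p = (\<lambda>(y, x, x'). (x - y, x' - y))" and T_def: "T = B \<times> A \<times> A"
  shows "real (card {(s, s') \<in> T \<times> T. p s = p s'}) \<le> (third_energy B + 2 * third_energy A) / 3"
proof -
  let ?P = "\<lambda>A w. {(a, b) \<in> A \<times> A. a - b = w}"
  let ?U = "SIGMA w : diff_set B. ?P B w \<times> ?P A w \<times> ?P A w"
  have fP: "finite (?P A w)" if "finite A" for A :: "'a set" and w
    by (rule finite_subset[of _ "A \<times> A"]) (use that in auto)
  have "card {(s, s') \<in> T \<times> T. p s = p s'} \<le> card ?U"
  proof (rule card_inj_on_le)
    let ?g = "\<lambda>((y, x, x'), (z, u, u')). (y - z, ((y, z), (x, u), (x', u')))"
    show "inj_on ?g {(s, s') \<in> T \<times> T. p s = p s'}" by (auto simp: inj_on_def)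
    show "?g ` {(s, s') \<in> T \<times> T. p s = p s'} \<subseteq> ?U"
      unfolding T_def p_def by (auto simp: algebra_simps)
    show "finite ?U" using A B fP by auto
  qed
  also have "card ?U = (\<Sum>w\<in>diff_set B. diff_rep B w * (diff_rep A w * diff_rep A w))"
    using A B fP by (simp add: card_SigmaI card_cartesian_product diff_rep_def)
  finally have "real (card {(s, s') \<in> T \<times> T. p s = p s'}) \<le>
      real (\<Sum>w\<in>diff_set B. diff_rep B w * (diff_rep A w * diff_rep A w))"
    by (rule of_nat_mono)
  also have "\<dots> = (\<Sum>w\<in>diff_set B. rep B w * (rep A w)\<^sup>2)"
    by (simp add: rep_def power2_eq_square)
  also have "\<dots> \<le> (\<Sum>w\<in>diff_set B. (rep B w ^ 3 + 2 * rep A w ^ 3) / 3)"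
  proof (rule sum_mono)
    fix w
    \<comment> \<open>Factorisation
      \<open>a^3 - 3 a b^2 + 2 b^3 = (a - b)^2 (a + 2 b)\<close>.\<close>
    have "0 \<le> (rep B w - rep A w)\<^sup>2 * (rep B w + 2 * rep A w)" by simp
    then show "rep B w * (rep A w)\<^sup>2 \<le> (rep B w ^ 3 + 2 * rep A w ^ 3) / 3"
      by (simp add: power2_eq_square power3_eq_cube algebra_simps)
  qed
  also have "\<dots> = (third_energy B + 2 * (\<Sum>w\<in>diff_set B. rep A w ^ 3)) / 3"
    by (simp add: third_energy_def sum.distrib sum_divide_distrib[symmetric] sum_distrib_left)
  also have "(\<Sum>w\<in>diff_set B. rep A w ^ 3) \<le> third_energy A"
  proof -
    have "(\<Sum>w\<in>diff_set B. rep A w ^ 3) = (\<Sum>w\<in>diff_set B \<inter> diff_set A. rep A w ^ 3)"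
      using B by (intro sum.mono_neutral_right) (auto simp: rep_eq_0)
    also have "\<dots> \<le> third_energy A"
      unfolding third_energy_def using A by (intro sum_mono2) auto
    finally show ?thesis .
  qed
  finally show ?thesis by (simp add: divide_right_mono)
qed

text \<open>Cauchy-Schwarz over the fibres of \<open>(u, v)\<close>: the squares of the fibre sizes
  add up to the number of pairs of congruent triples. Two sets are allowed because \<open>B\<close>
  will also be a dilate of \<open>A\<close>.\<close>

lemma triples_cauchy:
  fixes A B :: "'a::ab_group_add set" and f :: "'a \<Rightarrow> 'a \<Rightarrow> real"
  assumes A: "finite A" and B: "finite B" and S: "finite S"
    and sup: "\<And>x x' y. x \<in> A \<Longrightarrow> x' \<in> A \<Longrightarrow> y \<in> B \<Longrightarrow> f (x - y) (x' - y) \<noteq> 0 \<Longrightarrow> (x - y, x' - y) \<in> S"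
    and Q: "third_energy A \<le> Q" "third_energy B \<le> Q"
  shows "(\<Sum>y\<in>B. \<Sum>x\<in>A. \<Sum>x'\<in>A. f (x - y) (x' - y))\<^sup>2 \<le> Q * (\<Sum>(u, v)\<in>S. (f u v)\<^sup>2)"
proof -
  define p where "p = (\<lambda>(y, x, x'). (x - y, x' - y :: 'a))"
  define T where "T = B \<times> A \<times> A"
  have finT: "finite T" using A B by (simp add: T_def)
  let ?n = "\<lambda>c. real (card {s \<in> T. p s = c})"
  let ?f = "\<lambda>(u, v). f u v"
  have "(\<Sum>y\<in>B. \<Sum>x\<in>A. \<Sum>x'\<in>A. f (x - y) (x' - y)) = (\<Sum>s\<in>T. ?f (p s))"
    by (simp add: T_def p_def sum.cartesian_product split_def)
  also have "\<dots> = (\<Sum>c\<in>p ` T. \<Sum>s\<in>{s \<in> T. p s = c}. ?f (p s))"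
    by (rule sum.image_gen[OF finT])
  also have "\<dots> = (\<Sum>c\<in>p ` T. ?n c * ?f c)"
    by (intro sum.cong refl) simp
  finally have "(\<Sum>y\<in>B. \<Sum>x\<in>A. \<Sum>x'\<in>A. f (x - y) (x' - y))\<^sup>2 \<le>
      (\<Sum>c\<in>p ` T. (?n c)\<^sup>2) * (\<Sum>c\<in>p ` T. (?f c)\<^sup>2)"
    by (simp only: cauchy_schwarz_sum)
  also have "\<dots> \<le> Q * (\<Sum>c\<in>S. (?f c)\<^sup>2)"
  proof (rule mult_mono)
    have "(\<Sum>c\<in>p ` T. (?n c)\<^sup>2) = real (\<Sum>c\<in>p ` T. (card {s \<in> T. p s = c})\<^sup>2)" by simp
    also have "\<dots> = real (card {(s, s') \<in> T \<times> T. p s = p s'})"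
      by (simp only: sum_card_fibres_squared[OF finT])
    also have "\<dots> \<le> Q" by (rule order_trans[OF card_congruent_triples_le[OF A B p_def T_def]]) (use Q in simp)
    finally show "(\<Sum>c\<in>p ` T. (?n c)\<^sup>2) \<le> Q" .
    then show "0 \<le> Q" by (rule order_trans[rotated]) (intro sum_nonneg, auto)
    have "(\<Sum>c\<in>p ` T. (?f c)\<^sup>2) = (\<Sum>c\<in>p ` T \<inter> S. (?f c)\<^sup>2)"
    proof (rule sum.mono_neutral_right)
      show "\<forall>c\<in>p ` T - p ` T \<inter> S. (?f c)\<^sup>2 = 0"
      proof
        fix c assume c: "c \<in> p ` T - p ` T \<inter> S"
        then obtain y x x' where "c = (x - y, x' - y)" "y \<in> B" "x \<in> A" "x' \<in> A"
          by (auto simp: T_def p_def)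
        with sup[of x x' y] c show "(?f c)\<^sup>2 = 0" by auto
      qed
    qed (use finT in auto)
    also have "\<dots> \<le> (\<Sum>c\<in>S. (?f c)\<^sup>2)" using S by (intro sum_mono2) auto
    finally show "(\<Sum>c\<in>p ` T. (?f c)\<^sup>2) \<le> (\<Sum>c\<in>S. (?f c)\<^sup>2)" .
  qed (auto intro: sum_nonneg)
  finally show ?thesis by (simp add: split_def)
qed

section \<open>Multiplicative subgroups of a finite field\<close>

lemma card_pairs_eq_sum:
  assumes "finite A" "finite B"
  shows "real (card {(a, b) \<in> A \<times> B. P a b}) = (\<Sum>a\<in>A. \<Sum>b\<in>B. of_bool (P a b))"
proof -
  have "real (card {(a, b) \<in> A \<times> B. P a b}) = (\<Sum>s\<in>{s \<in> A \<times> B. case s of (a, b) \<Rightarrow> P a b}. 1)"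
    by (simp add: Collect_case_prod_Sigma split_def mem_Times_iff)
  also have "\<dots> = (\<Sum>s\<in>A \<times> B. 1 * of_bool (case s of (a, b) \<Rightarrow> P a b))"
    by (rule sum_filter_of_bool) (use assms in auto)
  finally show ?thesis by (simp add: sum.cartesian_product split_def)
qed

lemma sum_of_bool_delta:
  fixes g :: "'a \<Rightarrow> real"
  assumes "finite F" "w \<in> F"
  shows "(\<Sum>z\<in>F. of_bool (w = z) * g z) = g w"
  using assms by (simp add: of_bool_def if_distrib if_distribR sum.delta cong: if_cong)

lemma le_of_power_le:
  fixes x y :: real
  assumes "0 < n" "x ^ n \<le> y ^ n" "0 \<le> y"
  shows "x \<le> y"
  using assms power_le_imp_le_base[of x "n - 1" y] by (simp add: Suc_diff_1 del: power_Suc)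

lemma power_8_eq: "(8::real) ^ j = (2 ^ j) ^ 3"
proof -
  have "(8::real) ^ j = (2 ^ 3) ^ j" by simp
  then show ?thesis by (simp only: power_mult[symmetric] mult.commute)
qed

lemma power_4_eq: "(4::real) ^ j = (2 ^ j) ^ 2"
proof -
  have "(4::real) ^ j = (2 ^ 2) ^ j" by simp
  then show ?thesis by (simp only: power_mult[symmetric] mult.commute)
qed

definition dyadic_level :: "('a \<Rightarrow> nat) \<Rightarrow> 'a set \<Rightarrow> nat \<Rightarrow> 'a set"
  where "dyadic_level g X j = {x \<in> X. 2 ^ j \<le> g x \<and> g x < 2 ^ Suc j}"

lemma finite_dyadic_level [simp]: "finite X \<Longrightarrow> finite (dyadic_level g X j)"
  by (simp add: dyadic_level_def)

lemma dyadic_exponent: "0 < n \<Longrightarrow> \<exists>j. 2 ^ j \<le> n \<and> n < (2::nat) ^ Suc j"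
proof -
  assume n: "0 < n"
  define k where "k = (LEAST k. n < (2::nat) ^ k)"
  have k: "n < 2 ^ k" unfolding k_def by (rule LeastI[of _ n]) (rule less_exp)
  with n have "k \<noteq> 0" by (cases k) auto
  then obtain j where j: "k = Suc j" by (cases k) auto
  have "\<not> n < 2 ^ j" using not_less_Least[of j "\<lambda>k. n < 2 ^ k"] j unfolding k_def by simp
  with k j show ?thesis by (intro exI[of _ j]) auto
qed

text \<open>A point with \<open>g x = 0\<close> lies in no level, so \<open>f\<close> has to vanish
  there.\<close>

lemma dyadic_sum:
  fixes f :: "'a \<Rightarrow> real"
  assumes X: "finite X" and g: "\<And>x. x \<in> X \<Longrightarrow> g x < 2 ^ J" and f: "\<And>x. x \<in> X \<Longrightarrow> g x = 0 \<Longrightarrow> f x = 0"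
  shows "sum f X = (\<Sum>j<J. sum f (dyadic_level g X j))"
proof -
  have disj: "dyadic_level g X i \<inter> dyadic_level g X j = {}" if "i < j" for i j
  proof -
    have "(2::nat) ^ Suc i \<le> 2 ^ j" using that by (intro power_increasing) auto
    then show ?thesis by (auto simp: dyadic_level_def)
  qed
  have "(\<Sum>j<J. sum f (dyadic_level g X j)) = sum f (\<Union>j<J. dyadic_level g X j)"
    using X disj by (intro sum.UNION_disjoint[symmetric]) (auto simp: neq_iff)
  also have "\<dots> = sum f X"
  proof (rule sum.mono_neutral_left)
    show "\<forall>x\<in>X - (\<Union>j<J. dyadic_level g X j). f x = 0"
    proof
      fix x assume x: "x \<in> X - (\<Union>j<J. dyadic_level g X j)"
      show "f x = 0"
      proof (cases "g x = 0")
        case False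
        then obtain j where j: "2 ^ j \<le> g x" "g x < 2 ^ Suc j" using dyadic_exponent[of "g x"] by auto
        have "(2::nat) ^ j < 2 ^ J" by (rule le_less_trans[OF j(1) g]) (use x in auto)
        then have "j < J" by (rule power_less_imp_less_exp[rotated]) simp
        with j x show ?thesis by (auto simp: dyadic_level_def)
      qed (use f x in auto)
    qed
  qed (use X in \<open>auto simp: dyadic_level_def\<close>)
  finally show ?thesis ..
qed

text \<open>\<open>F\<close> is a finite field with unit \<open>e\<close> inside an arbitrary ambient ring, which need not have a unit itself.
  The assumption \<open>level\<close> is what Stepanov's method provides.\<close>

locale subgroup_energy =
  fixes F G :: "'a::comm_ring set" and e :: 'a and L :: real and J :: nat
  assumes finF: "finite F"
    and F_diff: "x \<in> F \<Longrightarrow> y \<in> F \<Longrightarrow> x - y \<in> F"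
    and F_mult: "x \<in> F \<Longrightarrow> y \<in> F \<Longrightarrow> x * y \<in> F"
    and e_mult: "x \<in> F \<Longrightarrow> e * x = x"
    and F_inv: "x \<in> F \<Longrightarrow> x \<noteq> 0 \<Longrightarrow> \<exists>y\<in>F. y * x = e"
    and G_sub: "G \<subseteq> F - {0}" and e_G: "e \<in> G"
    and G_mult: "x \<in> G \<Longrightarrow> y \<in> G \<Longrightarrow> x * y \<in> G"
    and card_G: "card G < 2 ^ J"
    and L: "1024 \<le> L" "real J \<le> L"
    and level: "1024 \<le> s \<Longrightarrow>
      real (card {(r, z) \<in> (F - {0}) \<times> (F - {0}). s \<le> card {(a, b) \<in> G \<times> G. a - r * b = z}}) * real s ^ 3
        \<le> L * real (card G) ^ 4"
begin

abbreviation "U \<equiv> F - {0}"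
abbreviation "t \<equiv> real (card G)"
abbreviation "E \<equiv> real (additive_energy G)"

section \<open>Arithmetic of the field and its subgroup\<close>

lemmas [simp] = finF

lemma finU: "finite U" by simp

lemma G_F: "x \<in> G \<Longrightarrow> x \<in> F" "x \<in> G \<Longrightarrow> x \<noteq> 0" "x \<in> G \<Longrightarrow> x \<in> U"
  using G_sub by auto

lemma finG [simp]: "finite G"
  using G_sub finF finite_subset by blast

lemma e_F: "e \<in> F" "e \<noteq> 0" "e \<in> U"
  using e_G G_F by auto

lemma e_mult_right: "x \<in> F \<Longrightarrow> x * e = x"
  by (metis e_mult mult.commute)

lemma F_0: "0 \<in> F"
  using F_diff[OF e_F(1) e_F(1)] by simp

lemma F_uminus: "x \<in> F \<Longrightarrow> - x \<in> F"
  using F_diff[OF F_0, of x] by simp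

lemma F_add: "x \<in> F \<Longrightarrow> y \<in> F \<Longrightarrow> x + y \<in> F"
  using F_diff[of x "- y"] F_uminus[of y] by simp

lemma U_cancel: "r \<in> U \<Longrightarrow> x \<in> F \<Longrightarrow> y \<in> F \<Longrightarrow> r * x = r * y \<Longrightarrow> x = y"
  using F_inv[of r] by (metis Diff_iff insert_iff e_mult mult.assoc)

lemma U_mult: "x \<in> U \<Longrightarrow> y \<in> U \<Longrightarrow> x * y \<in> U"
  using U_cancel[of x y 0] F_mult F_0 by auto

lemma bij_mult_U: "r \<in> U \<Longrightarrow> bij_betw ((*) r) U U"
proof -
  assume r: "r \<in> U"
  have inj: "inj_on ((*) r) U" using U_cancel[OF r] by (auto simp: inj_on_def)
  moreover have "(*) r ` U \<subseteq> U" using U_mult[OF r] by auto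
  ultimately show ?thesis by (metis bij_betw_def endo_inj_surj finU)
qed

lemma bij_mult_F: "r \<in> U \<Longrightarrow> bij_betw ((*) r) F F"
proof -
  assume r: "r \<in> U"
  have inj: "inj_on ((*) r) F" using U_cancel[OF r] by (auto simp: inj_on_def)
  moreover have "(*) r ` F \<subseteq> F" using F_mult r by auto
  ultimately show ?thesis by (metis bij_betw_def endo_inj_surj finF)
qed

lemma bij_mult_G: "r \<in> G \<Longrightarrow> bij_betw ((*) r) G G"
proof -
  assume r: "r \<in> G"
  have inj: "inj_on ((*) r) G" using U_cancel[OF G_F(3)[OF r]] G_F by (auto simp: inj_on_def)
  moreover have "(*) r ` G \<subseteq> G" using G_mult r by auto
  ultimately show ?thesis by (metis bij_betw_def endo_inj_surj finG)
qed

lemma sum_mult_U: "r \<in> U \<Longrightarrow> (\<Sum>x\<in>U. g (r * x)) = (\<Sum>x\<in>U. g x)"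
  using sum.reindex_bij_betw[OF bij_mult_U] .

lemma sum_mult_F: "r \<in> U \<Longrightarrow> (\<Sum>x\<in>F. g (r * x)) = (\<Sum>x\<in>F. g x)"
  using sum.reindex_bij_betw[OF bij_mult_F] .

lemma sum_mult_G: "r \<in> G \<Longrightarrow> (\<Sum>x\<in>G. g (r * x)) = (\<Sum>x\<in>G. g x)"
  using sum.reindex_bij_betw[OF bij_mult_G] .

lemma sum_mult_U': "r \<in> U \<Longrightarrow> (\<Sum>x\<in>U. g (x * r)) = (\<Sum>x\<in>U. g x)"
  using sum_mult_U[of r g] by (simp add: mult.commute)

lemma t_ge_1: "1 \<le> t"
  using e_G finG by (metis One_nat_def Suc_leI card_gt_0_iff empty_iff of_nat_1 of_nat_mono)

section \<open>Solutions of \<open>a - r * b = z\<close>\<close>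

definition qn :: "'a \<Rightarrow> 'a \<Rightarrow> nat"
  where "qn r z = card {(a, b) \<in> G \<times> G. a - r * b = z}"

abbreviation q :: "'a \<Rightarrow> 'a \<Rightarrow> real"
  where "q r z \<equiv> real (qn r z)"

lemma q_eq_sum: "q r z = (\<Sum>a\<in>G. \<Sum>b\<in>G. of_bool (a - r * b = z))"
  unfolding qn_def by (rule card_pairs_eq_sum) auto

lemma qn_le: "qn r z \<le> card G"
  unfolding qn_def
  by (rule card_inj_on_le[where f = snd]) (auto simp: inj_on_def)

lemma qn_less: "qn r z < 2 ^ J"
  using qn_le card_G by (rule le_less_trans)

lemma q_mult_left: "g \<in> G \<Longrightarrow> r \<in> F \<Longrightarrow> z \<in> F \<Longrightarrow> q r (g * z) = q r z"
proof -
  assume g: "g \<in> G" and r: "r \<in> F" and z: "z \<in> F"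
  have "q r (g * z) = (\<Sum>a\<in>G. \<Sum>b\<in>G. of_bool (g * a - r * (g * b) = g * z))"
    unfolding q_eq_sum by (subst sum_mult_G[OF g, symmetric], rule sum.cong[OF refl])
      (subst sum_mult_G[OF g, symmetric], rule refl)
  also have "\<dots> = q r z"
    unfolding q_eq_sum
  proof (intro sum.cong refl arg_cong[where f = of_bool])
    fix a b assume "a \<in> G" "b \<in> G"
    then have "a - r * b \<in> F" using r by (simp add: F_diff F_mult G_F)
    then have "g * (a - r * b) = g * z \<longleftrightarrow> a - r * b = z"
      using U_cancel[OF G_F(3)[OF g]] z by blast
    then show "g * a - r * (g * b) = g * z \<longleftrightarrow> a - r * b = z"
      by (simp add: algebra_simps)
  qed
  finally show ?thesis .
qed

lemma q_mult_slope: "g \<in> G \<Longrightarrow> q (g * r) z = q r z"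
proof -
  assume g: "g \<in> G"
  have "q r z = (\<Sum>a\<in>G. \<Sum>b\<in>G. of_bool (a - r * (g * b) = z))"
    unfolding q_eq_sum by (rule sum.cong[OF refl], subst sum_mult_G[OF g, symmetric], rule refl)
  also have "\<dots> = q (g * r) z"
    unfolding q_eq_sum by (simp add: mult_ac)
  finally show ?thesis ..
qed

lemma rep_eq_q: "rep G z = q e z"
proof -
  have "{(a, b) \<in> G \<times> G. a - b = z} = {(a, b) \<in> G \<times> G. a - e * b = z}"
    by (auto simp: e_mult G_F)
  then show ?thesis by (simp only: rep_def diff_rep_def qn_def)
qed

lemma rep_mult: "g \<in> G \<Longrightarrow> z \<in> F \<Longrightarrow> rep G (g * z) = rep G z"
  unfolding rep_eq_q by (rule q_mult_left[OF _ e_F(1)])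

lemma diff_set_G: "diff_set G \<subseteq> F"
  by (auto simp: diff_set_def G_F F_diff)

lemma sum_diff_set:
  assumes "\<And>x. rep G x = 0 \<Longrightarrow> g x = 0"
  shows "(\<Sum>x\<in>diff_set G. g x) = (\<Sum>x\<in>F. g x)"
  by (rule sum.mono_neutral_left) (use finF diff_set_G assms in \<open>auto simp: rep_eq_0\<close>)

lemma energy_eq: "E = (\<Sum>x\<in>F. (rep G x)\<^sup>2)"
  unfolding energy_eq_sum_rep by (rule sum_diff_set) auto

lemma third_energy_eq: "third_energy G = (\<Sum>x\<in>F. rep G x ^ 3)"
  unfolding third_energy_def by (rule sum_diff_set) auto

lemma sum_F_U: "(\<Sum>x\<in>F. g x) = g 0 + (\<Sum>x\<in>U. g x)" for g :: "'a \<Rightarrow> real"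
  by (rule sum.remove) (use finF F_0 in auto)

lemma sum_q: "r \<in> F \<Longrightarrow> (\<Sum>z\<in>F. q r z) = t\<^sup>2"
proof -
  assume r: "r \<in> F"
  have "(\<Sum>z\<in>F. q r z) = (\<Sum>a\<in>G. \<Sum>b\<in>G. \<Sum>z\<in>F. of_bool (a - r * b = z))"
    unfolding q_eq_sum by (subst sum.swap, rule sum.cong[OF refl], rule sum.swap)
  also have "\<dots> = (\<Sum>a\<in>G. \<Sum>b\<in>G. 1)"
  proof (intro sum.cong refl)
    fix a b assume "a \<in> G" "b \<in> G"
    then have "a - r * b \<in> F" using r by (simp add: F_diff F_mult G_F)
    from sum_of_bool_delta[OF finF this, of "\<lambda>_. 1"]
    show "(\<Sum>z\<in>F. of_bool (a - r * b = z)) = (1::real)" by simp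
  qed
  finally show ?thesis by (simp add: power2_eq_square)
qed

lemma sum_q_U_le: "r \<in> F \<Longrightarrow> (\<Sum>z\<in>U. q r z) \<le> t\<^sup>2"
  using sum_q[of r] sum_F_U[of "q r"] by simp

text \<open>The assumption \<open>level\<close> places \<open>q\<close> in weak \<open>L^3\<close>,
  and \<open>S1 * S2\<close> bounds the cube of the \<open>L^(3/2)\<close> norm of \<open>om\<close>
  by interpolation between \<open>L^1\<close> and \<open>L^2\<close>. In dyadic terms, the weight of
  a level is at most \<open>S1\<close> and its square is at most \<open>S2\<close> times the size of
  the level; the product of the two estimates meets \<open>level\<close> exactly.\<close>

lemma weighted_q_sum_le:
  fixes om :: "'a \<times> 'a \<Rightarrow> real"
  assumes om: "\<And>x. x \<in> U \<times> U \<Longrightarrow> 0 \<le> om x"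
    and S1: "(\<Sum>x\<in>U \<times> U. om x) \<le> S1" and S2: "(\<Sum>x\<in>U \<times> U. (om x)\<^sup>2) \<le> S2"
    and K: "0 \<le> K" "S1 * S2 * (L * t ^ 4) \<le> K ^ 3"
  shows "(\<Sum>(r, z)\<in>U \<times> U. om (r, z) * q r z) \<le> 1024 * S1 + 2 * real J * K"
proof -
  let ?g = "\<lambda>(r, z). qn r z"
  let ?X = "\<lambda>j. dyadic_level ?g (U \<times> U) j"
  let ?f = "\<lambda>x. om x * real (?g x)"
  have S1': "0 \<le> S1" using S1 om by (meson order_trans sum_nonneg)
  have S2': "0 \<le> S2" using S2 by (meson order_trans sum_nonneg zero_le_power2)
  have sub: "?X j \<subseteq> U \<times> U" for j by (auto simp: dyadic_level_def)
  have "(\<Sum>(r, z)\<in>U \<times> U. om (r, z) * q r z) = sum ?f (U \<times> U)"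
    by (simp add: split_def)
  also have "\<dots> = (\<Sum>j<J. sum ?f (?X j))"
    by (rule dyadic_sum) (auto simp: qn_less)
  also have "\<dots> \<le> (\<Sum>j<J. (if 2 ^ j < (1024::nat) then 1024 * sum om (?X j) else 0) + 2 * K)"
  proof (rule sum_mono)
    fix j assume "j \<in> {..<J}"
    have f_le: "sum ?f (?X j) \<le> 2 ^ Suc j * sum om (?X j)"
      unfolding sum_distrib_left
    proof (rule sum_mono)
      fix x assume x: "x \<in> ?X j"
      then have "?g x \<le> 2 ^ Suc j" by (auto simp: dyadic_level_def)
      then have "real (?g x) \<le> 2 ^ Suc j" by (metis of_nat_le_iff of_nat_numeral of_nat_power)
      moreover have "0 \<le> om x" using om x sub by blast
      ultimately show "?f x \<le> 2 ^ Suc j * om x"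
        using mult_left_mono[of "real (?g x)" "2 ^ Suc j" "om x"] by (simp only: mult.commute)
    qed
    have nn: "0 \<le> sum om (?X j)" by (rule sum_nonneg) (use om sub in blast)
    show "sum ?f (?X j) \<le> (if 2 ^ j < (1024::nat) then 1024 * sum om (?X j) else 0) + 2 * K"
    \<comment> \<open>Below \<open>1024\<close> no level bound is available; these levels cost at
      most \<open>1024\<close> times their weight.\<close>
    proof (cases "2 ^ j < (1024::nat)")
      case True
      have "j < 10"
      proof (rule ccontr)
        assume "\<not> j < 10"
        then have "(2::nat) ^ 10 \<le> 2 ^ j" by (intro power_increasing) auto
        with True show False by simp
      qed
      then have "(2::real) ^ Suc j \<le> 2 ^ 10" by (intro power_increasing) auto
      then have "2 ^ Suc j * sum om (?X j) \<le> 1024 * sum om (?X j)"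
        using nn by (intro mult_right_mono) auto
      with f_le True K show ?thesis by simp
    next
      case False
      let ?s = "sum om (?X j)"
      have c: "real (card (?X j)) * 8 ^ j \<le> L * t ^ 4"
      proof -
        have "?X j \<subseteq> {(r, z) \<in> U \<times> U. 2 ^ j \<le> qn r z}" by (auto simp: dyadic_level_def)
        moreover have "finite {(r, z) \<in> U \<times> U. 2 ^ j \<le> qn r z}"
          by (rule finite_subset[of _ "U \<times> U"]) auto
        ultimately have "card (?X j) \<le> card {(r, z) \<in> U \<times> U. 2 ^ j \<le> qn r z}"
          by (rule card_mono[rotated])
        then have "real (card (?X j)) * 8 ^ j \<le> real (card {(r, z) \<in> U \<times> U. 2 ^ j \<le> qn r z}) * 8 ^ j"
          by (intro mult_right_mono) auto
        also have "\<dots> = real (card {(r, z) \<in> U \<times> U. 2 ^ j \<le> qn r z}) * real (2 ^ j) ^ 3"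
          by (simp add: power_8_eq)
        also have "\<dots> \<le> L * t ^ 4"
          unfolding qn_def by (rule level) (use False in auto)
        finally show ?thesis .
      qed
      have s1: "?s \<le> S1"
        by (rule order_trans[OF _ S1], rule sum_mono2) (use om sub in auto)
      have "?s\<^sup>2 \<le> real (card (?X j)) * (\<Sum>x\<in>?X j. (om x)\<^sup>2)" by (rule sum_squared_le)
      also have "(\<Sum>x\<in>?X j. (om x)\<^sup>2) \<le> S2"
        by (rule order_trans[OF _ S2], rule sum_mono2) (use sub in auto)
      finally have s2: "?s\<^sup>2 \<le> real (card (?X j)) * S2" by (simp add: mult_left_mono)
      have "(2 ^ j * ?s) ^ 3 = 8 ^ j * (?s * ?s\<^sup>2)"
        unfolding power_8_eq by (simp add: power3_eq_cube power2_eq_square)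
      also have "\<dots> \<le> 8 ^ j * (S1 * (real (card (?X j)) * S2))"
        using s1 s2 nn S1' by (intro mult_left_mono mult_mono) auto
      also have "\<dots> = S1 * S2 * (real (card (?X j)) * 8 ^ j)" by simp
      also have "\<dots> \<le> S1 * S2 * (L * t ^ 4)" using c S1' S2' by (intro mult_left_mono) auto
      also have "\<dots> \<le> K ^ 3" by (rule K)
      finally have "2 ^ j * ?s \<le> K" using K(1) by (rule le_of_power_le[of 3, rotated]) simp
      with f_le False show ?thesis by simp
    qed
  qed
  also have "\<dots> = (\<Sum>j<J. if 2 ^ j < (1024::nat) then 1024 * sum om (?X j) else 0) + 2 * real J * K"
    by (simp add: sum.distrib)
  also have "(\<Sum>j<J. if 2 ^ j < (1024::nat) then 1024 * sum om (?X j) else 0) \<le> (\<Sum>j<J. 1024 * sum om (?X j))"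
    by (rule sum_mono) (auto intro!: sum_nonneg om dest: subsetD[OF sub])
  also have "\<dots> = 1024 * (\<Sum>j<J. sum om (?X j))" by (simp add: sum_distrib_left)
  also have "(\<Sum>j<J. sum om (?X j)) \<le> S1"
  proof -
    have "(\<Sum>j<J. sum om (?X j)) = (\<Sum>j<J. sum (\<lambda>x. om x * of_bool (?g x \<noteq> 0)) (?X j))"
      by (intro sum.cong refl) (auto simp: dyadic_level_def)
    also have "\<dots> = (\<Sum>x\<in>U \<times> U. om x * of_bool (?g x \<noteq> 0))"
      by (rule dyadic_sum[symmetric]) (auto simp: qn_less)
    also have "\<dots> \<le> (\<Sum>x\<in>U \<times> U. om x)" by (intro sum_mono) (use om in auto)
    finally show ?thesis using S1 by simp
  qed
  finally show ?thesis by simp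
qed

lemma L_pos: "0 < L" "1 \<le> L" "0 \<le> L" using L by auto

lemma t_pos: "0 < t" "0 < t ^ n" "0 \<le> t ^ n" "1 \<le> t ^ n"
  using t_ge_1 by (auto simp del: of_nat_power of_nat_le_iff of_nat_1_eq_iff intro: less_le_trans[OF zero_less_one])

lemma q_G: "g \<in> G \<Longrightarrow> qn g z = diff_rep G z"
proof -
  assume g: "g \<in> G"
  have "q g z = q (g * e) z" using g by (simp add: e_mult_right G_F)
  also have "\<dots> = rep G z" using q_mult_slope[OF g] rep_eq_q by simp
  finally show ?thesis by (simp add: rep_def)
qed

section \<open>Level sets of the representation function\<close>

text \<open>Every slope \<open>g\<close> in \<open>G\<close> has the same counts as slope
  \<open>e\<close>, namely \<open>rep G\<close>. One popular difference therefore contributes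
  \<open>t\<close> pairs to \<open>level\<close>, which saves a factor \<open>t\<close>. Below
  \<open>1024\<close> the first moment suffices, since \<open>n^2 <= L^2\<close>.\<close>

lemma card_rep_level:
  "real (card {x \<in> U. n \<le> diff_rep G x}) * real n ^ 3 \<le> L\<^sup>2 * t ^ 3"
proof (cases "1024 \<le> n")
  case True
  let ?X = "{x \<in> U. n \<le> diff_rep G x}"
  have "card (G \<times> ?X) \<le> card {(r, z) \<in> U \<times> U. n \<le> qn r z}"
  proof (rule card_mono)
    show "finite {(r, z) \<in> U \<times> U. n \<le> qn r z}" by (rule finite_subset[of _ "U \<times> U"]) auto
    show "G \<times> ?X \<subseteq> {(r, z) \<in> U \<times> U. n \<le> qn r z}" using G_F by (auto simp: q_G)
  qed
  then have "real (card (G \<times> ?X)) * real n ^ 3 \<le> real (card {(r, z) \<in> U \<times> U. n \<le> qn r z}) * real n ^ 3"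
    by (intro mult_right_mono of_nat_mono) auto
  also have "\<dots> \<le> L * t ^ 4" unfolding qn_def by (rule level[OF True])
  finally have "t * (real (card ?X) * real n ^ 3) \<le> t * (L * t ^ 3)"
    by (simp add: card_cartesian_product power4_eq_xxxx power3_eq_cube mult_ac)
  then have "real (card ?X) * real n ^ 3 \<le> L * t ^ 3" using t_ge_1 by simp
  also have "\<dots> \<le> L\<^sup>2 * t ^ 3" using L_pos by (intro mult_right_mono) (auto simp: power2_eq_square)
  finally show ?thesis .
next
  case False
  let ?X = "{x \<in> U. n \<le> diff_rep G x}"
  have "real (card ?X) * real n \<le> (\<Sum>x\<in>?X. rep G x)"
    using sum_bounded_below[of ?X "real n" "rep G"] by (simp add: rep_def)
  also have "\<dots> \<le> (\<Sum>x\<in>F. rep G x)" by (rule sum_mono2) auto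
  also have "\<dots> = t\<^sup>2" using sum_q[OF e_F(1)] by (simp add: rep_eq_q)
  finally have 1: "real (card ?X) * real n \<le> t\<^sup>2" .
  have "real n \<le> L" using False L by simp
  then have "(real n)\<^sup>2 \<le> L\<^sup>2" by (intro power_mono) auto
  with 1 have "real (card ?X) * real n * (real n)\<^sup>2 \<le> t\<^sup>2 * L\<^sup>2" by (intro mult_mono) auto
  also have "\<dots> \<le> t ^ 3 * L\<^sup>2" using t_ge_1 by (intro mult_right_mono power_increasing) auto
  finally show ?thesis by (simp add: power3_eq_cube power2_eq_square mult_ac)
qed

abbreviation "P j \<equiv> dyadic_level (diff_rep G) U j"

lemma P_sub: "P j \<subseteq> U" by (auto simp: dyadic_level_def)

lemma card_P: "real (card (P j)) * 8 ^ j \<le> L\<^sup>2 * t ^ 3"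
proof -
  have "real (card (P j)) * 8 ^ j \<le> real (card {x \<in> U. 2 ^ j \<le> diff_rep G x}) * 8 ^ j"
    by (intro mult_right_mono of_nat_mono card_mono) (auto simp: dyadic_level_def)
  also have "\<dots> \<le> L\<^sup>2 * t ^ 3" using card_rep_level[of "2 ^ j"] by (simp add: power_8_eq)
  finally show ?thesis .
qed

lemma rep_P: "x \<in> P j \<Longrightarrow> 2 ^ j \<le> rep G x" "x \<in> P j \<Longrightarrow> rep G x \<le> 2 * 2 ^ j"
proof -
  assume x: "x \<in> P j"
  then have "2 ^ j \<le> diff_rep G x" "diff_rep G x \<le> 2 * 2 ^ j" by (auto simp: dyadic_level_def)
  then have "real (2 ^ j) \<le> real (diff_rep G x)" "real (diff_rep G x) \<le> real (2 * 2 ^ j)"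
    using of_nat_le_iff by blast+
  then show "2 ^ j \<le> rep G x" "rep G x \<le> 2 * 2 ^ j" by (auto simp: rep_def)
qed

lemma sum_U_dyadic:
  fixes f :: "'a \<Rightarrow> real"
  assumes "\<And>x. x \<in> U \<Longrightarrow> rep G x = 0 \<Longrightarrow> f x = 0"
  shows "sum f U = (\<Sum>j<J. sum f (P j))"
  by (rule dyadic_sum) (use assms diff_rep_le_card[OF finG] card_G in
    \<open>auto simp: rep_def intro: le_less_trans\<close>)

lemma energy_U: "E = t\<^sup>2 + (\<Sum>x\<in>U. (rep G x)\<^sup>2)"
  unfolding energy_eq sum_F_U[of "\<lambda>x. (rep G x)\<^sup>2"] by (simp add: rep_0)

lemma E_pos: "t\<^sup>2 \<le> E" "0 < E" "1 \<le> E"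
proof -
  show 1: "t\<^sup>2 \<le> E" unfolding energy_U by (simp add: sum_nonneg)
  have "1 \<le> t\<^sup>2" using t_ge_1 by simp
  with 1 show "0 < E" "1 \<le> E" by linarith+
qed

lemma card_P_energy: "real (card (P j)) * 4 ^ j \<le> E"
proof -
  have "real (card (P j)) * 4 ^ j \<le> (\<Sum>x\<in>P j. (rep G x)\<^sup>2)"
    using sum_bounded_below[of "P j" "4 ^ j" "\<lambda>x. (rep G x)\<^sup>2"]
    by (simp add: power_4_eq power_mono rep_P)
  also have "\<dots> \<le> (\<Sum>x\<in>U. (rep G x)\<^sup>2)" by (rule sum_mono2) (use P_sub in auto)
  also have "\<dots> \<le> E" unfolding energy_U by simp
  finally show ?thesis .
qed

lemma third_energy_le: "third_energy G \<le> L ^ 4 * t ^ 3"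
proof -
  have "third_energy G = t ^ 3 + (\<Sum>x\<in>U. rep G x ^ 3)"
    unfolding third_energy_eq sum_F_U[of "\<lambda>x. rep G x ^ 3"] by (simp add: rep_0)
  also have "(\<Sum>x\<in>U. rep G x ^ 3) = (\<Sum>j<J. \<Sum>x\<in>P j. rep G x ^ 3)"
    by (rule sum_U_dyadic) auto
  also have "\<dots> \<le> (\<Sum>j<J. 8 * (L\<^sup>2 * t ^ 3))"
  proof (rule sum_mono)
    fix j
    have "(\<Sum>x\<in>P j. rep G x ^ 3) \<le> (\<Sum>x\<in>P j. (2 * 2 ^ j) ^ 3)"
      by (intro sum_mono power_mono rep_P) auto
    also have "\<dots> = 8 * (real (card (P j)) * 8 ^ j)"
      by (simp add: power_8_eq power_mult_distrib)
    finally show "(\<Sum>x\<in>P j. rep G x ^ 3) \<le> 8 * (L\<^sup>2 * t ^ 3)" using card_P[of j] by linarith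
  qed
  also have "\<dots> = real J * (8 * (L\<^sup>2 * t ^ 3))" by simp
  also have "\<dots> \<le> L * (8 * (L\<^sup>2 * t ^ 3))" using L by (intro mult_right_mono) auto
  finally have "third_energy G \<le> (1 + 8 * L ^ 3) * t ^ 3"
    by (simp add: power3_eq_cube power2_eq_square algebra_simps)
  also have "1 + 8 * L ^ 3 \<le> L ^ 4"
  proof -
    have "1 \<le> L ^ 3" using L_pos by simp
    then have "1 + 8 * L ^ 3 \<le> 9 * L ^ 3" by simp
    also have "\<dots> \<le> L * L ^ 3" using L L_pos by (intro mult_right_mono) auto
    finally show ?thesis by (simp add: power4_eq_xxxx power3_eq_cube)
  qed
  finally show ?thesis by (simp add: mult_right_mono)
qed

section \<open>Differences between the subgroup and an invariant set\<close>

definition invariant :: "'a set \<Rightarrow> bool"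
  where "invariant Q \<longleftrightarrow> Q \<subseteq> U \<and> (\<forall>g\<in>G. \<forall>x\<in>Q. g * x \<in> Q)"

lemma invariant_finite: "invariant Q \<Longrightarrow> finite Q"
  using finU finite_subset unfolding invariant_def by blast

lemma invariant_bij: "invariant Q \<Longrightarrow> g \<in> G \<Longrightarrow> bij_betw ((*) g) Q Q"
proof -
  assume Q: "invariant Q" and g: "g \<in> G"
  have inj: "inj_on ((*) g) Q" using U_cancel[OF G_F(3)[OF g]] Q by (auto simp: inj_on_def invariant_def)
  moreover have "(*) g ` Q \<subseteq> Q" using Q g by (auto simp: invariant_def)
  ultimately show ?thesis using invariant_finite[OF Q] by (metis bij_betw_def endo_inj_surj)
qed

lemma invariant_card_ge: "invariant Q \<Longrightarrow> Q \<noteq> {} \<Longrightarrow> card G \<le> card Q"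
proof -
  assume Q: "invariant Q" and ne: "Q \<noteq> {}"
  then obtain x where x: "x \<in> Q" by auto
  then have xU: "x \<in> U" using Q by (auto simp: invariant_def)
  show ?thesis
  proof (rule card_inj_on_le)
    show "inj_on (\<lambda>g. g * x) G" using U_cancel[OF xU] G_F by (auto simp: inj_on_def mult.commute)
    show "(\<lambda>g. g * x) ` G \<subseteq> Q" using Q x by (auto simp: invariant_def)
  qed (rule invariant_finite[OF Q])
qed

definition Tn :: "'a set \<Rightarrow> 'a \<Rightarrow> nat"
  where "Tn Q z = card {(a, b) \<in> G \<times> Q. a - b = z}"

lemma Tn_eq_sum: "finite Q \<Longrightarrow> real (Tn Q z) = (\<Sum>a\<in>G. \<Sum>b\<in>Q. of_bool (a - b = z))"
  unfolding Tn_def by (rule card_pairs_eq_sum) auto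

lemma Tn_le: "Tn Q z \<le> card G"
  unfolding Tn_def by (rule card_inj_on_le[where f = fst]) (auto simp: inj_on_def)

text \<open>Multiplying \<open>b\<close> by an element of \<open>G\<close> permutes
  \<open>Q\<close>. Averaging over \<open>G\<close> thus turns a count in one variable
  \<open>z\<close> into values of \<open>q\<close> with slopes in \<open>Q\<close>, where
  \<open>level\<close> applies.\<close>

lemma Tn_eq_sum_q:
  assumes "invariant Q"
  shows "t * real (Tn Q z) = (\<Sum>r\<in>Q. q r z)"
proof -
  note [simp] = invariant_finite[OF assms]
  have "(\<Sum>r\<in>Q. q r z) = (\<Sum>b\<in>G. \<Sum>a\<in>G. \<Sum>r\<in>Q. of_bool (a - b * r = z))"
  proof -
    have "(\<Sum>r\<in>Q. q r z) = (\<Sum>r\<in>Q. \<Sum>b\<in>G. \<Sum>a\<in>G. of_bool (a - b * r = z))"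
      unfolding q_eq_sum by (rule sum.cong[OF refl], subst sum.swap, simp add: mult.commute)
    also have "\<dots> = (\<Sum>b\<in>G. \<Sum>r\<in>Q. \<Sum>a\<in>G. of_bool (a - b * r = z))" by (rule sum.swap)
    also have "\<dots> = (\<Sum>b\<in>G. \<Sum>a\<in>G. \<Sum>r\<in>Q. of_bool (a - b * r = z))"
      by (rule sum.cong[OF refl], rule sum.swap)
    finally show ?thesis .
  qed
  also have "\<dots> = (\<Sum>b\<in>G. real (Tn Q z))"
  proof (rule sum.cong[OF refl])
    fix b assume b: "b \<in> G"
    have "(\<Sum>a\<in>G. \<Sum>r\<in>Q. of_bool (a - b * r = z)) = (\<Sum>a\<in>G. \<Sum>r\<in>Q. (of_bool (a - r = z) :: real))"
      by (rule sum.cong[OF refl])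
         (rule sum.reindex_bij_betw[OF invariant_bij[OF assms b], where g = "\<lambda>r. of_bool (_ - r = z)"])
    then show "(\<Sum>a\<in>G. \<Sum>r\<in>Q. of_bool (a - b * r = z)) = real (Tn Q z)"
      by (simp add: Tn_eq_sum)
  qed
  finally show ?thesis by simp
qed

lemma sum_Tn:
  assumes "invariant Q"
  shows "(\<Sum>z\<in>F. real (Tn Q z)) = t * real (card Q)"
proof -
  have "t * (\<Sum>z\<in>F. real (Tn Q z)) = (\<Sum>z\<in>F. \<Sum>r\<in>Q. q r z)"
    by (simp add: sum_distrib_left Tn_eq_sum_q[OF assms])
  also have "\<dots> = (\<Sum>r\<in>Q. \<Sum>z\<in>F. q r z)" by (rule sum.swap)
  also have "\<dots> = (\<Sum>r\<in>Q. t\<^sup>2)"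
    using assms by (intro sum.cong refl sum_q) (auto simp: invariant_def)
  finally have "t * (\<Sum>z\<in>F. real (Tn Q z)) = t * (t * real (card Q))"
    by (simp add: power2_eq_square mult_ac)
  then show ?thesis using e_G by auto
qed

text \<open>The indicator function of \<open>Q\<close> times a level set of \<open>Tn Q\<close> is
  tested against \<open>q\<close>, with both moments equal to its size. The term
  \<open>1024 * ?c\<close> is absorbed on the left unless \<open>2 ^ j\<close> is below
  \<open>2048 * card Q / t\<close>, and there the first moment of \<open>Tn Q\<close> is
  enough.\<close>

lemma Tn_level:
  assumes Q: "invariant Q" and cQ: "real (card Q) \<le> t\<^sup>2"
  shows "real (card (dyadic_level (Tn Q) U j)) * 8 ^ j \<le> 64 * L ^ 4 * (t * (real (card Q))\<^sup>2)"
proof (cases "2048 * real (card Q) \<le> t * 2 ^ j")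
  case True
  let ?Z = "dyadic_level (Tn Q) U j"
  let ?c = "real (card Q) * real (card ?Z)"
  define K where "K = root 3 (?c * ?c * (L * t ^ 4))"
  have K: "K ^ 3 = ?c * ?c * (L * t ^ 4)" unfolding K_def using L_pos by (intro real_root_pow_pos2) auto
  have K0: "0 \<le> K" unfolding K_def using L_pos by simp
  note [simp] = invariant_finite[OF Q]
  have sub: "Q \<times> ?Z \<subseteq> U \<times> U" using Q by (auto simp: invariant_def dyadic_level_def)
  have one: "(\<Sum>x\<in>U \<times> U. of_bool (x \<in> Q \<times> ?Z)) = ?c"
  proof -
    have "(\<Sum>x\<in>U \<times> U. of_bool (x \<in> Q \<times> ?Z)) = (\<Sum>x\<in>Q \<times> ?Z. (1::real))"
      by (rule sum.mono_neutral_cong_right) (use sub in auto)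
    then show ?thesis by (simp add: card_cartesian_product)
  qed
  have "(\<Sum>(r, z)\<in>U \<times> U. of_bool ((r, z) \<in> Q \<times> ?Z) * q r z) \<le> 1024 * ?c + 2 * real J * K"
  proof (rule weighted_q_sum_le)
    show "(\<Sum>x\<in>U \<times> U. (of_bool (x \<in> Q \<times> ?Z))\<^sup>2) \<le> ?c" using one by (simp add: power2_eq_square)
  qed (use one K K0 in auto)
  moreover have "(\<Sum>(r, z)\<in>U \<times> U. of_bool ((r, z) \<in> Q \<times> ?Z) * q r z) = (\<Sum>(r, z)\<in>Q \<times> ?Z. q r z)"
    by (rule sum.mono_neutral_cong_right) (use sub in auto)
  moreover have "(\<Sum>(r, z)\<in>Q \<times> ?Z. q r z) = (\<Sum>z\<in>?Z. t * real (Tn Q z))"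
    unfolding Tn_eq_sum_q[OF Q] by (simp add: sum.cartesian_product[symmetric]) (rule sum.swap)
  moreover have "(\<Sum>z\<in>?Z. t * 2 ^ j) \<le> (\<Sum>z\<in>?Z. t * real (Tn Q z))"
  proof (intro sum_mono mult_left_mono)
    fix z assume "z \<in> ?Z"
    then have "2 ^ j \<le> Tn Q z" by (auto simp: dyadic_level_def)
    then show "2 ^ j \<le> real (Tn Q z)" by (metis of_nat_le_iff of_nat_numeral of_nat_power)
  qed auto
  ultimately have "real (card ?Z) * (t * 2 ^ j) \<le> 1024 * ?c + 2 * real J * K" by simp
  moreover have "1024 * ?c \<le> real (card ?Z) * (t * 2 ^ j) / 2"
    using mult_left_mono[OF True, of "real (card ?Z)"] by (simp add: algebra_simps)
  ultimately have "real (card ?Z) * (t * 2 ^ j) \<le> 4 * (real J * K)" by linarith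
  also have "\<dots> \<le> 4 * (L * K)" using L K0 by (intro mult_left_mono mult_right_mono) auto
  finally have "(real (card ?Z) * (t * 2 ^ j)) ^ 3 \<le> (4 * (L * K)) ^ 3" by (intro power_mono) auto
  also have "\<dots> = 64 * L ^ 3 * (?c * ?c * (L * t ^ 4))" by (simp add: power_mult_distrib K)
  finally have "((real (card ?Z))\<^sup>2 * t ^ 3) * (real (card ?Z) * 8 ^ j) \<le>
      ((real (card ?Z))\<^sup>2 * t ^ 3) * (64 * L ^ 4 * (t * (real (card Q))\<^sup>2))"
    unfolding power_8_eq by (simp add: power2_eq_square power3_eq_cube power4_eq_xxxx mult_ac)
  moreover have "(real (card ?Z))\<^sup>2 * t ^ 3 > 0" if "real (card ?Z) > 0"
    using t_ge_1 that by (intro mult_pos_pos zero_less_power) auto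
  ultimately have "real (card ?Z) > 0 \<Longrightarrow> ?thesis" by (simp only: mult_le_cancel_left_pos)
  moreover have "real (card ?Z) = 0 \<Longrightarrow> ?thesis" using L_pos by simp
  ultimately show ?thesis by (cases "real (card ?Z) = 0") auto
next
  case False
  let ?Z = "dyadic_level (Tn Q) U j"
  have "real (card ?Z) * 2 ^ j \<le> (\<Sum>z\<in>?Z. real (Tn Q z))"
  proof (rule sum_bounded_below)
    fix z assume "z \<in> ?Z"
    then have "2 ^ j \<le> Tn Q z" by (auto simp: dyadic_level_def)
    then show "2 ^ j \<le> real (Tn Q z)" by (metis of_nat_le_iff of_nat_numeral of_nat_power)
  qed
  also have "\<dots> \<le> (\<Sum>z\<in>F. real (Tn Q z))" by (rule sum_mono2) (auto simp: dyadic_level_def)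
  finally have 1: "real (card ?Z) * 2 ^ j \<le> t * real (card Q)" by (simp add: sum_Tn[OF Q])
  have "(t * 2 ^ j)\<^sup>2 \<le> (2048 * real (card Q))\<^sup>2" using False by (intro power_mono) auto
  then have "(t * 2 ^ j)\<^sup>2 * (real (card ?Z) * 2 ^ j) \<le> (2048 * real (card Q))\<^sup>2 * (t * real (card Q))"
    using 1 by (rule mult_mono) auto
  \<comment> \<open>The bound on \<open>card Q\<close> turns its third power into \<open>t^2\<close>
    times its square.\<close>
  also have "\<dots> \<le> (2048 * real (card Q))\<^sup>2 * (t * t\<^sup>2)" using cQ by (intro mult_left_mono) auto
  finally have "t\<^sup>2 * (real (card ?Z) * 8 ^ j) \<le> t\<^sup>2 * (2048\<^sup>2 * (t * (real (card Q))\<^sup>2))"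
    unfolding power_8_eq by (simp add: power_mult_distrib power2_eq_square power3_eq_cube mult_ac)
  then have "real (card ?Z) * 8 ^ j \<le> 2048\<^sup>2 * (t * (real (card Q))\<^sup>2)"
    using t_pos(2)[of 2] by (rule mult_left_le_imp_le)
  also have "\<dots> \<le> 64 * L ^ 4 * (t * (real (card Q))\<^sup>2)"
  proof (rule mult_right_mono)
    have "(1024::real) ^ 4 \<le> L ^ 4" using L by (intro power_mono) auto
    then show "2048\<^sup>2 \<le> 64 * L ^ 4" by simp
  qed auto
  finally show ?thesis .
qed

lemma Tn_third_moment:
  assumes Q: "invariant Q" and cQ: "real (card Q) \<le> t\<^sup>2"
  shows "(\<Sum>z\<in>F. real (Tn Q z) ^ 3) \<le> L ^ 6 * (t * (real (card Q))\<^sup>2)"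
proof -
  let ?w = "t * (real (card Q))\<^sup>2"
  have "(\<Sum>z\<in>U. real (Tn Q z) ^ 3) = (\<Sum>j<J. \<Sum>z\<in>dyadic_level (Tn Q) U j. real (Tn Q z) ^ 3)"
    by (rule dyadic_sum) (use Tn_le card_G in \<open>auto intro: le_less_trans\<close>)
  also have "\<dots> \<le> (\<Sum>j<J. 512 * L ^ 4 * ?w)"
  proof (rule sum_mono)
    fix j
    have "(\<Sum>z\<in>dyadic_level (Tn Q) U j. real (Tn Q z) ^ 3) \<le> (\<Sum>z\<in>dyadic_level (Tn Q) U j. (2 * 2 ^ j) ^ 3)"
    proof (intro sum_mono power_mono)
      fix z assume "z \<in> dyadic_level (Tn Q) U j"
      then have "Tn Q z \<le> 2 * 2 ^ j" by (auto simp: dyadic_level_def)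
      then have "real (Tn Q z) \<le> real (2 * 2 ^ j)" using of_nat_le_iff by blast
      then show "real (Tn Q z) \<le> 2 * 2 ^ j" by simp
    qed auto
    also have "\<dots> = 8 * (real (card (dyadic_level (Tn Q) U j)) * 8 ^ j)"
      by (simp add: power_8_eq power_mult_distrib)
    finally show "(\<Sum>z\<in>dyadic_level (Tn Q) U j. real (Tn Q z) ^ 3) \<le> 512 * L ^ 4 * ?w"
      using Tn_level[OF Q cQ, of j] by linarith
  qed
  also have "\<dots> = real J * (512 * L ^ 4 * ?w)" by simp
  also have "\<dots> \<le> L * (512 * L ^ 4 * ?w)" using L L_pos by (intro mult_right_mono) auto
  finally have 1: "(\<Sum>z\<in>U. real (Tn Q z) ^ 3) \<le> 512 * L ^ 5 * ?w"
    by (simp add: power_numeral_reduce mult_ac)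
  \<comment> \<open>At \<open>z = 0\<close> the count is at most \<open>t\<close>, and a nonempty
    invariant set has at least \<open>t\<close> elements.\<close>
  have 2: "real (Tn Q 0) ^ 3 \<le> ?w"
  proof (cases "Q = {}")
    case True
    then show ?thesis by (simp add: Tn_def)
  next
    case False
    have "real (Tn Q 0) ^ 3 \<le> t ^ 3" using Tn_le by (intro power_mono) auto
    also have "\<dots> = t * t\<^sup>2" by (simp add: power3_eq_cube power2_eq_square)
    also have "\<dots> \<le> ?w" using invariant_card_ge[OF Q False] by (intro mult_left_mono power_mono) auto
    finally show ?thesis .
  qed
  have w: "0 \<le> ?w" by simp
  have "1 \<le> L ^ 5" using L_pos by simp
  then have "1 + 512 * L ^ 5 \<le> 1024 * L ^ 5" by simp
  also have "\<dots> \<le> L * L ^ 5" using L L_pos by (intro mult_right_mono) auto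
  finally have "1 + 512 * L ^ 5 \<le> L ^ 6" by (simp add: power_numeral_reduce)
  then have "(1 + 512 * L ^ 5) * ?w \<le> L ^ 6 * ?w" using w by (rule mult_right_mono)
  with 1 2 show ?thesis unfolding sum_F_U[of "\<lambda>z. real (Tn Q z) ^ 3"] by (simp add: algebra_simps)
qed

end

text \<open>After normalising by \<open>a^3 = sum x^3\<close> and \<open>b^3 = sum y^3\<close>, this
  is the sum of the pointwise inequalities \<open>3 u^2 v <= 2 u^3 + v^3\<close>.\<close>

lemma holder_3:
  fixes x y :: "'a \<Rightarrow> real"
  assumes "\<And>i. i \<in> I \<Longrightarrow> 0 \<le> x i" "\<And>i. i \<in> I \<Longrightarrow> 0 \<le> y i"
  shows "(\<Sum>i\<in>I. (x i)\<^sup>2 * y i) ^ 3 \<le> (\<Sum>i\<in>I. x i ^ 3)\<^sup>2 * (\<Sum>i\<in>I. y i ^ 3)"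
proof (cases "finite I")
  case fin: True
  let ?X = "\<Sum>i\<in>I. x i ^ 3" and ?Y = "\<Sum>i\<in>I. y i ^ 3"
  have X0: "0 \<le> ?X" and Y0: "0 \<le> ?Y" using assms by (auto intro!: sum_nonneg)
  show ?thesis
  proof (cases "?X = 0 \<or> ?Y = 0")
    case True
    then have "(\<forall>i\<in>I. x i = 0) \<or> (\<forall>i\<in>I. y i = 0)"
      using assms fin by (auto simp: sum_nonneg_eq_0_iff)
    then have "(\<Sum>i\<in>I. (x i)\<^sup>2 * y i) = 0" by (auto intro!: sum.neutral)
    then show ?thesis using X0 Y0 by simp
  next
    case False
    define a b where "a = root 3 ?X" and "b = root 3 ?Y"
    have a: "a > 0" "a ^ 3 = ?X" and b: "b > 0" "b ^ 3 = ?Y"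
      using X0 Y0 False unfolding a_def b_def by (auto simp: real_root_pow_pos2)
    have "(x i)\<^sup>2 * y i \<le> a\<^sup>2 * b * ((2 * (x i ^ 3 / a ^ 3) + y i ^ 3 / b ^ 3) / 3)" if i: "i \<in> I" for i
    proof -
      define u v where "u = x i / a" and "v = y i / b"
      have uv: "0 \<le> u" "0 \<le> v" using assms i a b by (auto simp: u_def v_def)
      have "0 \<le> (u - v)\<^sup>2 * (2 * u + v)" using uv by simp
      then have "u\<^sup>2 * v \<le> (2 * u ^ 3 + v ^ 3) / 3"
        by (simp add: power2_eq_square power3_eq_cube algebra_simps)
      then have "a\<^sup>2 * b * (u\<^sup>2 * v) \<le> a\<^sup>2 * b * ((2 * u ^ 3 + v ^ 3) / 3)"
        using a b by (intro mult_left_mono) auto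
      moreover have "a\<^sup>2 * b * (u\<^sup>2 * v) = (x i)\<^sup>2 * y i"
        using a b by (simp add: u_def v_def power_divide)
      ultimately show ?thesis by (simp add: u_def v_def power_divide)
    qed
    then have "(\<Sum>i\<in>I. (x i)\<^sup>2 * y i) \<le> (\<Sum>i\<in>I. a\<^sup>2 * b * ((2 * (x i ^ 3 / a ^ 3) + y i ^ 3 / b ^ 3) / 3))"
      by (rule sum_mono)
    also have "\<dots> = a\<^sup>2 * b * ((2 * (?X / a ^ 3) + ?Y / b ^ 3) / 3)"
      by (simp add: sum_distrib_left[symmetric] sum_divide_distrib[symmetric] sum.distrib)
    also have "\<dots> = a\<^sup>2 * b" using a b False by simp
    finally have "(\<Sum>i\<in>I. (x i)\<^sup>2 * y i) ^ 3 \<le> (a\<^sup>2 * b) ^ 3"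
      using assms by (intro power_mono) (auto intro!: sum_nonneg)
    also have "\<dots> = (a ^ 3)\<^sup>2 * b ^ 3" by (simp add: power2_eq_square power3_eq_cube)
    finally show ?thesis using a b by simp
  qed
qed auto

context subgroup_energy begin

section \<open>Correlations of the representation function with its dilates\<close>

text \<open>The term \<open>x = 0\<close> would contribute \<open>t^2\<close> for every
  \<open>r\<close>; it is left out so that the small values of \<open>eps\<close> stay
  small.\<close>

definition eps :: "'a \<Rightarrow> nat"
  where "eps r = (\<Sum>x\<in>U. diff_rep G x * diff_rep G (r * x))"

lemma eps_eq: "real (eps r) = (\<Sum>x\<in>U. rep G x * rep G (r * x))"
  by (simp add: eps_def rep_def)

lemma eps_total: "real (eps r) + t\<^sup>2 = (\<Sum>x\<in>F. rep G x * rep G (r * x))"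
  unfolding sum_F_U[of "\<lambda>x. rep G x * rep G (r * x)"] eps_eq by (simp add: rep_0 power2_eq_square)

lemma rep_eq_sum: "rep G z = (\<Sum>a\<in>G. \<Sum>b\<in>G. of_bool (a - b = z))"
  unfolding rep_def diff_rep_def by (rule card_pairs_eq_sum) auto

text \<open>Both sides count quadruples, because \<open>a - r b = c - r d\<close> is the same
  equation as \<open>c - a = r (d - b)\<close>.\<close>

lemma sum_q_squared:
  assumes r: "r \<in> F"
  shows "(\<Sum>z\<in>F. (q r z)\<^sup>2) = (\<Sum>x\<in>F. rep G x * rep G (r * x))"
proof -
  let ?f = "\<lambda>a b c d. of_bool (c - r * d = a - r * b) :: real"
  have "(\<Sum>z\<in>F. (q r z)\<^sup>2) = (\<Sum>z\<in>F. \<Sum>a\<in>G. \<Sum>b\<in>G. of_bool (a - r * b = z) * q r z)"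
    by (rule sum.cong[OF refl], subst power2_eq_square, subst (1) q_eq_sum)
       (simp add: sum_distrib_right)
  also have "\<dots> = (\<Sum>a\<in>G. \<Sum>z\<in>F. \<Sum>b\<in>G. of_bool (a - r * b = z) * q r z)" by (rule sum.swap)
  also have "\<dots> = (\<Sum>a\<in>G. \<Sum>b\<in>G. \<Sum>z\<in>F. of_bool (a - r * b = z) * q r z)"
    by (rule sum.cong[OF refl], rule sum.swap)
  also have "\<dots> = (\<Sum>a\<in>G. \<Sum>b\<in>G. q r (a - r * b))"
    by (intro sum.cong refl sum_of_bool_delta) (use r in \<open>simp_all add: F_diff F_mult G_F\<close>)
  also have "\<dots> = (\<Sum>a\<in>G. \<Sum>b\<in>G. \<Sum>c\<in>G. \<Sum>d\<in>G. ?f a b c d)" by (simp only: q_eq_sum)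
  also have "\<dots> = (\<Sum>b\<in>G. \<Sum>a\<in>G. \<Sum>c\<in>G. \<Sum>d\<in>G. ?f a b c d)" by (rule sum.swap)
  also have "\<dots> = (\<Sum>b\<in>G. \<Sum>a\<in>G. \<Sum>d\<in>G. \<Sum>c\<in>G. ?f a b c d)"
    by (rule sum.cong[OF refl], rule sum.cong[OF refl], rule sum.swap)
  also have "\<dots> = (\<Sum>b\<in>G. \<Sum>d\<in>G. \<Sum>a\<in>G. \<Sum>c\<in>G. ?f a b c d)"
    by (rule sum.cong[OF refl], rule sum.swap)
  also have "\<dots> = (\<Sum>d\<in>G. \<Sum>b\<in>G. \<Sum>a\<in>G. \<Sum>c\<in>G. ?f a b c d)" by (rule sum.swap)
  also have "\<dots> = (\<Sum>d\<in>G. \<Sum>b\<in>G. \<Sum>c\<in>G. \<Sum>a\<in>G. ?f a b c d)"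
    by (rule sum.cong[OF refl], rule sum.cong[OF refl], rule sum.swap)
  also have "\<dots> = (\<Sum>d\<in>G. \<Sum>b\<in>G. rep G (r * (d - b)))"
    by (intro sum.cong refl, subst rep_eq_sum)
       (simp add: algebra_simps)
  also have "\<dots> = (\<Sum>x\<in>diff_set G. rep G x * rep G (r * x))"
    using sum_diffs_eq[of G "\<lambda>x. rep G (r * x)"] by simp
  also have "\<dots> = (\<Sum>x\<in>F. rep G x * rep G (r * x))" by (rule sum_diff_set) auto
  finally show ?thesis .
qed

lemma correlation_le:
  assumes r: "r \<in> U"
  shows "(\<Sum>x\<in>F. rep G x * rep G (r * x)) \<le> E"
proof -
  have "(\<Sum>x\<in>F. rep G x * rep G (r * x)) \<le> (\<Sum>x\<in>F. ((rep G x)\<^sup>2 + (rep G (r * x))\<^sup>2) / 2)"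
  proof (rule sum_mono)
    fix x
    have "0 \<le> (rep G x - rep G (r * x))\<^sup>2" by simp
    then show "rep G x * rep G (r * x) \<le> ((rep G x)\<^sup>2 + (rep G (r * x))\<^sup>2) / 2"
      by (simp add: power2_eq_square algebra_simps)
  qed
  also have "\<dots> = ((\<Sum>x\<in>F. (rep G x)\<^sup>2) + (\<Sum>x\<in>F. (rep G (r * x))\<^sup>2)) / 2"
    by (simp only: sum_divide_distrib[symmetric] sum.distrib)
  also have "(\<Sum>x\<in>F. (rep G (r * x))\<^sup>2) = (\<Sum>x\<in>F. (rep G x)\<^sup>2)" by (rule sum_mult_F[OF r])
  finally show ?thesis by (simp add: energy_eq)
qed

lemma eps_le_E: "r \<in> U \<Longrightarrow> real (eps r) \<le> E"
proof -
  assume "r \<in> U"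
  then have "real (eps r) + t\<^sup>2 \<le> E" unfolding eps_total by (rule correlation_le)
  then show ?thesis using t_pos(3)[of 2] by linarith
qed

text \<open>Zero may be discarded on both sides of \<open>sum_q_squared\<close>:
  \<open>x = 0\<close> contributes exactly \<open>t^2\<close>, while \<open>z = 0\<close>
  contributes at most \<open>t^2\<close>.\<close>

lemma eps_le: "r \<in> U \<Longrightarrow> real (eps r) \<le> (\<Sum>z\<in>U. (q r z)\<^sup>2)"
proof -
  assume r: "r \<in> U"
  have "real (eps r) + t\<^sup>2 = (q r 0)\<^sup>2 + (\<Sum>z\<in>U. (q r z)\<^sup>2)"
    using sum_q_squared[of r] r unfolding eps_total sum_F_U[of "\<lambda>z. (q r z)\<^sup>2"] by simp
  moreover have "(q r 0)\<^sup>2 \<le> t\<^sup>2" using qn_le by (intro power_mono) auto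
  ultimately show ?thesis by linarith
qed

lemma sum_q_squared_le: "r \<in> U \<Longrightarrow> (\<Sum>z\<in>U. (q r z)\<^sup>2) \<le> E"
proof -
  assume r: "r \<in> U"
  have "(\<Sum>z\<in>U. (q r z)\<^sup>2) \<le> (\<Sum>z\<in>F. (q r z)\<^sup>2)" by (rule sum_mono2) auto
  also have "\<dots> \<le> E" using sum_q_squared[of r] correlation_le[OF r] r by simp
  finally show ?thesis .
qed

lemma sum_eps_le: "(\<Sum>r\<in>U. real (eps r)) \<le> t ^ 4"
proof -
  have s: "(\<Sum>x\<in>U. rep G x) \<le> t\<^sup>2" unfolding rep_eq_q by (rule sum_q_U_le[OF e_F(1)])
  have "(\<Sum>r\<in>U. real (eps r)) = (\<Sum>x\<in>U. \<Sum>r\<in>U. rep G x * rep G (r * x))"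
    unfolding eps_eq by (rule sum.swap)
  also have "\<dots> = (\<Sum>x\<in>U. rep G x * (\<Sum>r\<in>U. rep G r))"
    by (intro sum.cong refl) (simp add: sum_distrib_left[symmetric] sum_mult_U')
  also have "\<dots> = (\<Sum>x\<in>U. rep G x) * (\<Sum>r\<in>U. rep G r)" by (simp add: sum_distrib_right)
  also have "\<dots> \<le> t\<^sup>2 * t\<^sup>2" using s by (rule mult_mono) (use s in \<open>auto intro: sum_nonneg\<close>)
  finally show ?thesis by (simp add: power4_eq_xxxx power2_eq_square)
qed

section \<open>Level sets of a single slope and slopes of large correlation\<close>

abbreviation "D r j \<equiv> dyadic_level (qn r) U j"

lemma D_sub: "D r j \<subseteq> U" by (auto simp: dyadic_level_def)

lemma q_D: "z \<in> D r j \<Longrightarrow> 2 ^ j \<le> q r z" "z \<in> D r j \<Longrightarrow> q r z \<le> 2 * 2 ^ j"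
proof -
  assume z: "z \<in> D r j"
  then have "2 ^ j \<le> qn r z" "qn r z \<le> 2 * 2 ^ j" by (auto simp: dyadic_level_def)
  then have "real (2 ^ j) \<le> q r z" "q r z \<le> real (2 * 2 ^ j)"
    using of_nat_le_iff by blast+
  then show "2 ^ j \<le> q r z" "q r z \<le> 2 * 2 ^ j" by auto
qed

lemma invariant_D: "r \<in> F \<Longrightarrow> invariant (D r j)"
proof -
  assume r: "r \<in> F"
  have "g * x \<in> D r j" if "g \<in> G" "x \<in> D r j" for g x
  proof -
    have x: "x \<in> U" "2 ^ j \<le> qn r x" "qn r x < 2 ^ Suc j"
      using that(2) unfolding dyadic_level_def by blast+
    have "qn r (g * x) = qn r x"
      using q_mult_left[OF that(1) r, of x] x(1) by simp
    then show ?thesis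
      using x U_mult[OF G_F(3)[OF that(1)] x(1)] unfolding dyadic_level_def by simp
  qed
  then show ?thesis unfolding invariant_def dyadic_level_def by blast
qed

lemma card_D_le: "r \<in> F \<Longrightarrow> real (card (D r j)) * 2 ^ j \<le> t\<^sup>2"
proof -
  assume r: "r \<in> F"
  have "real (card (D r j)) * 2 ^ j \<le> (\<Sum>z\<in>D r j. q r z)"
    by (rule sum_bounded_below) (rule q_D)
  also have "\<dots> \<le> (\<Sum>z\<in>U. q r z)" by (rule sum_mono2) (use D_sub in auto)
  also have "\<dots> \<le> t\<^sup>2" by (rule sum_q_U_le[OF r])
  finally show ?thesis .
qed

lemma card_D_le2: "r \<in> F \<Longrightarrow> real (card (D r j)) \<le> t\<^sup>2"
proof -
  assume "r \<in> F"
  have "real (card (D r j)) * 1 \<le> real (card (D r j)) * 2 ^ j" by (intro mult_left_mono) auto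
  with card_D_le[OF \<open>r \<in> F\<close>, of j] show ?thesis by linarith
qed

lemma card_D_energy: "r \<in> U \<Longrightarrow> real (card (D r j)) * 4 ^ j \<le> E"
proof -
  assume r: "r \<in> U"
  have "real (card (D r j)) * 4 ^ j \<le> (\<Sum>z\<in>D r j. (q r z)\<^sup>2)"
    unfolding power_4_eq by (rule sum_bounded_below) (intro power_mono q_D, auto)
  also have "\<dots> \<le> (\<Sum>z\<in>U. (q r z)\<^sup>2)" by (rule sum_mono2) (use D_sub in auto)
  also have "\<dots> \<le> E" by (rule sum_q_squared_le[OF r])
  finally show ?thesis .
qed

definition R :: "real \<Rightarrow> 'a set"
  where "R e0 = {r \<in> U. e0 \<le> real (eps r)}"

text \<open>By dyadic pigeonholing over \<open>q r\<close>, each \<open>r \<in> R e0\<close> lies in some \<open>Rj e0 j\<close>.\<close>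

definition Rj :: "real \<Rightarrow> nat \<Rightarrow> 'a set"
  where "Rj e0 j = {r \<in> R e0. e0 \<le> 4 * L * 4 ^ j * real (card (D r j))}"

lemma R_sub: "R e0 \<subseteq> U" "Rj e0 j \<subseteq> U" "Rj e0 j \<subseteq> R e0" by (auto simp: R_def Rj_def)

lemma finite_R: "finite (R e0)" "finite (Rj e0 j)" by (auto simp: R_def Rj_def)

lemma J_pos: "0 < J"
  using card_G t_ge_1 by (cases J) auto

lemma R_cover: "R e0 \<subseteq> (\<Union>j<J. Rj e0 j)" if e0: "0 < e0"
proof
  fix r assume r: "r \<in> R e0"
  then have rU: "r \<in> U" by (auto simp: R_def)
  have "e0 \<le> (\<Sum>z\<in>U. (q r z)\<^sup>2)" using r eps_le[OF rU] by (auto simp: R_def)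
  also have "\<dots> = (\<Sum>j<J. \<Sum>z\<in>D r j. (q r z)\<^sup>2)" by (rule dyadic_sum) (auto simp: qn_less)
  also have "\<dots> \<le> (\<Sum>j<J. 4 * 4 ^ j * real (card (D r j)))"
  proof (rule sum_mono)
    fix j
    have "(\<Sum>z\<in>D r j. (q r z)\<^sup>2) \<le> (\<Sum>z\<in>D r j. (2 * 2 ^ j)\<^sup>2)"
      by (intro sum_mono power_mono q_D) auto
    also have "\<dots> = 4 * 4 ^ j * real (card (D r j))" by (simp add: power_4_eq power_mult_distrib)
    finally show "(\<Sum>z\<in>D r j. (q r z)\<^sup>2) \<le> 4 * 4 ^ j * real (card (D r j))" .
  qed
  finally have le: "e0 \<le> (\<Sum>j<J. 4 * 4 ^ j * real (card (D r j)))" .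
  show "r \<in> (\<Union>j<J. Rj e0 j)"
  proof (rule ccontr)
    assume "r \<notin> (\<Union>j<J. Rj e0 j)"
    then have lt: "4 * L * 4 ^ j * real (card (D r j)) < e0" if "j < J" for j
      using r that by (auto simp: Rj_def not_le)
    have "L * e0 \<le> (\<Sum>j<J. 4 * L * 4 ^ j * real (card (D r j)))"
      using mult_left_mono[OF le, of L] L_pos by (simp add: sum_distrib_left mult_ac)
    also have "\<dots> < (\<Sum>j<J. e0)" by (rule sum_strict_mono) (use lt J_pos in auto)
    also have "\<dots> \<le> L * e0" using L e0 by simp
    finally show False by simp
  qed
qed

text \<open>The pairs \<open>(r, z)\<close> with \<open>r\<close> in \<open>Rj e0 j\<close> and
  \<open>z\<close> in \<open>D r j\<close> are counted from below by the definition of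
  \<open>Rj\<close> and from above by \<open>level\<close>.\<close>

lemma card_Rj: "real (card (Rj e0 j)) * e0 * 2 ^ j \<le> 4 * L\<^sup>2 * t ^ 4" if j: "1024 \<le> (2::nat) ^ j"
proof -
  have "real (card (Rj e0 j)) * e0 \<le> (\<Sum>r\<in>Rj e0 j. 4 * L * 4 ^ j * real (card (D r j)))"
    by (rule sum_bounded_below) (auto simp: Rj_def)
  also have "\<dots> = 4 * L * 4 ^ j * real (\<Sum>r\<in>Rj e0 j. card (D r j))" by (simp add: sum_distrib_left)
  also have "(\<Sum>r\<in>Rj e0 j. card (D r j)) = card (SIGMA r : Rj e0 j. D r j)"
    by (rule card_SigmaI[symmetric]) (auto simp: finite_R)
  finally have 1: "real (card (Rj e0 j)) * e0 \<le> 4 * L * 4 ^ j * real (card (SIGMA r : Rj e0 j. D r j))" .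
  have "card (SIGMA r : Rj e0 j. D r j) \<le> card {(r, z) \<in> U \<times> U. 2 ^ j \<le> qn r z}"
  proof (rule card_mono)
    show "finite {(r, z) \<in> U \<times> U. 2 ^ j \<le> qn r z}" by (rule finite_subset[of _ "U \<times> U"]) auto
    show "(SIGMA r : Rj e0 j. D r j) \<subseteq> {(r, z) \<in> U \<times> U. 2 ^ j \<le> qn r z}"
      using R_sub(2)[of e0 j] by (auto simp: dyadic_level_def)
  qed
  then have "real (card (SIGMA r : Rj e0 j. D r j)) * 8 ^ j \<le>
      real (card {(r, z) \<in> U \<times> U. 2 ^ j \<le> qn r z}) * real (2 ^ j) ^ 3"
    unfolding power_8_eq by (intro mult_mono of_nat_mono) auto
  also have "\<dots> \<le> L * t ^ 4" unfolding qn_def by (rule level[OF j])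
  finally have 2: "real (card (SIGMA r : Rj e0 j. D r j)) * 8 ^ j \<le> L * t ^ 4" .
  have "real (card (Rj e0 j)) * e0 * 2 ^ j \<le> 4 * L * 4 ^ j * real (card (SIGMA r : Rj e0 j. D r j)) * 2 ^ j"
    using 1 by (rule mult_right_mono) simp
  also have "\<dots> = 4 * L * (real (card (SIGMA r : Rj e0 j. D r j)) * 8 ^ j)"
    unfolding power_8_eq power_4_eq by (simp add: power2_eq_square power3_eq_cube)
  also have "\<dots> \<le> 4 * L * (L * t ^ 4)" using 2 L_pos by (intro mult_left_mono) auto
  finally show ?thesis by (simp add: power2_eq_square)
qed

lemma Rj_le: "r \<in> Rj e0 j \<Longrightarrow> e0 \<le> 4 * L * t\<^sup>2 * 2 ^ j"
proof -
  assume r: "r \<in> Rj e0 j"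
  then have rF: "r \<in> F" using R_sub(2)[of e0 j] by auto
  have "e0 \<le> 4 * L * 4 ^ j * real (card (D r j))" using r by (simp add: Rj_def)
  also have "\<dots> = 4 * L * 2 ^ j * (real (card (D r j)) * 2 ^ j)"
    unfolding power_4_eq by (simp add: power2_eq_square)
  also have "\<dots> \<le> 4 * L * 2 ^ j * t\<^sup>2" using card_D_le[OF rF] L_pos by (intro mult_left_mono) auto
  finally show ?thesis by (simp add: mult_ac)
qed

text \<open>The first moment of \<open>q r\<close> limits the size of \<open>D r j\<close>, so a
  level with few solutions per point cannot carry a large correlation. This brings
  \<open>2 ^ j\<close> into the range of \<open>level\<close>.\<close>

lemma Rj_large:
  assumes e0: "4096 * L * t\<^sup>2 \<le> e0" and r: "r \<in> Rj e0 j"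
  shows "1024 \<le> (2::nat) ^ j"
proof -
  have "(4 * L * t\<^sup>2) * 1024 \<le> (4 * L * t\<^sup>2) * 2 ^ j" using e0 Rj_le[OF r] by linarith
  moreover have "0 < 4 * L * t\<^sup>2" using L_pos t_pos(2)[of 2] by (intro mult_pos_pos) auto
  ultimately have "(1024::real) \<le> 2 ^ j" by (rule mult_left_le_imp_le)
  then have "real 1024 \<le> real (2 ^ j)" by simp
  then show ?thesis by (simp only: of_nat_le_iff)
qed

lemma card_R_le_sum: "0 < e0 \<Longrightarrow> real (card (R e0)) \<le> (\<Sum>j<J. real (card (Rj e0 j)))"
proof -
  assume "0 < e0"
  then have "card (R e0) \<le> card (\<Union>j<J. Rj e0 j)"
    by (intro card_mono R_cover) (auto simp: finite_R)
  also have "\<dots> \<le> (\<Sum>j<J. card (Rj e0 j))" by (rule card_UN_le) simp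
  finally have "real (card (R e0)) \<le> real (\<Sum>j<J. card (Rj e0 j))" by (rule of_nat_mono)
  then show ?thesis by simp
qed

text \<open>Combining \<open>card_Rj\<close> with \<open>Rj_le\<close> eliminates
  \<open>2 ^ j\<close>; for small \<open>e0\<close> the first moment of \<open>eps\<close> suffices.
  This bound serves moderate correlations, and \<open>card_R_bound_large\<close> the largest
  ones.\<close>

lemma card_R_bound: "real (card (R e0)) * e0\<^sup>2 \<le> 16 * L ^ 4 * t ^ 6" if e0: "0 < e0"
proof (cases "4096 * L * t\<^sup>2 \<le> e0")
  case True
  have "real (card (Rj e0 j)) * e0\<^sup>2 \<le> 16 * L ^ 3 * t ^ 6" for j
  proof (cases "Rj e0 j = {}")
    case True
    then show ?thesis using L_pos by simp
  next
    case False
    then obtain r where r: "r \<in> Rj e0 j" by auto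
    have "real (card (Rj e0 j)) * e0\<^sup>2 \<le> real (card (Rj e0 j)) * (e0 * (4 * L * t\<^sup>2 * 2 ^ j))"
      unfolding power2_eq_square using Rj_le[OF r] e0 by (intro mult_left_mono) (auto simp: power2_eq_square)
    also have "\<dots> = 4 * L * t\<^sup>2 * (real (card (Rj e0 j)) * e0 * 2 ^ j)" by simp
    also have "\<dots> \<le> 4 * L * t\<^sup>2 * (4 * L\<^sup>2 * t ^ 4)"
      using card_Rj[OF Rj_large[OF True r]] L_pos by (intro mult_left_mono) auto
    also have "\<dots> = 16 * L ^ 3 * t ^ 6" by (simp add: power_numeral_reduce)
    finally show ?thesis .
  qed
  then have "(\<Sum>j<J. real (card (Rj e0 j)) * e0\<^sup>2) \<le> (\<Sum>j<J. 16 * L ^ 3 * t ^ 6)" by (rule sum_mono)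
  also have "\<dots> = real J * (16 * L ^ 3 * t ^ 6)" by simp
  also have "\<dots> \<le> L * (16 * L ^ 3 * t ^ 6)" using L L_pos by (intro mult_right_mono) auto
  finally have "(\<Sum>j<J. real (card (Rj e0 j))) * e0\<^sup>2 \<le> 16 * L ^ 4 * t ^ 6"
    by (simp add: sum_distrib_right power_numeral_reduce)
  moreover have "real (card (R e0)) * e0\<^sup>2 \<le> (\<Sum>j<J. real (card (Rj e0 j))) * e0\<^sup>2"
    using card_R_le_sum[OF e0] by (rule mult_right_mono) simp
  ultimately show ?thesis by linarith
next
  case False
  have "real (card (R e0)) * e0 \<le> (\<Sum>r\<in>R e0. real (eps r))"
    by (rule sum_bounded_below) (auto simp: R_def)
  also have "\<dots> \<le> (\<Sum>r\<in>U. real (eps r))" by (rule sum_mono2) (use R_sub in auto)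
  also have "\<dots> \<le> t ^ 4" by (rule sum_eps_le)
  finally have "real (card (R e0)) * e0 * e0 \<le> t ^ 4 * (4096 * L * t\<^sup>2)"
    using False e0 by (intro mult_mono) auto
  also have "\<dots> = 4096 * L * t ^ 6" by (simp add: power_numeral_reduce)
  also have "\<dots> \<le> 16 * L ^ 4 * t ^ 6"
  proof (rule mult_right_mono)
    have "1024 ^ 1 \<le> L ^ 1" "1 \<le> L\<^sup>2" using L L_pos by auto
    then have "256 * 1 \<le> L * L\<^sup>2" by (intro mult_mono) auto
    then have "16 * L * 256 \<le> 16 * L * (L * L\<^sup>2)" using L_pos by (intro mult_left_mono) auto
    then show "4096 * L \<le> 16 * L ^ 4" by (simp add: power_numeral_reduce)
  qed simp
  finally show ?thesis by (simp add: power2_eq_square mult_ac)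
qed

section \<open>Regular weights, and differences inside one level set of a slope\<close>

lemma sum_line_q:
  assumes r: "r \<in> F"
  shows "(\<Sum>a\<in>G. \<Sum>b\<in>G. k (a - r * b)) = (\<Sum>z\<in>F. q r z * k z)"
proof -
  have "(\<Sum>z\<in>F. q r z * k z) = (\<Sum>z\<in>F. \<Sum>a\<in>G. \<Sum>b\<in>G. of_bool (a - r * b = z) * k z)"
    unfolding q_eq_sum by (simp only: sum_distrib_right)
  also have "\<dots> = (\<Sum>a\<in>G. \<Sum>z\<in>F. \<Sum>b\<in>G. of_bool (a - r * b = z) * k z)" by (rule sum.swap)
  also have "\<dots> = (\<Sum>a\<in>G. \<Sum>b\<in>G. \<Sum>z\<in>F. of_bool (a - r * b = z) * k z)"
    by (rule sum.cong[OF refl], rule sum.swap)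
  also have "\<dots> = (\<Sum>a\<in>G. \<Sum>b\<in>G. k (a - r * b))"
    by (intro sum.cong refl sum_of_bool_delta) (use r in \<open>simp_all add: F_diff F_mult G_F\<close>)
  finally show ?thesis ..
qed

text \<open>Substituting \<open>x * b\<close> for \<open>b\<close> pulls \<open>x\<close> out of the
  argument, where invariance of \<open>k\<close> removes it. This is the constant degree asked for
  in \<open>regular_triples_ge\<close>.\<close>

lemma regular_sum:
  assumes r: "r \<in> F" and x: "x \<in> G" and k: "\<And>g z. g \<in> G \<Longrightarrow> z \<in> F \<Longrightarrow> k (g * z) = k z"
  shows "(\<Sum>b\<in>G. k (x - r * b)) = (\<Sum>b\<in>G. k (e - r * b))"
proof -
  have "(\<Sum>b\<in>G. k (x - r * b)) = (\<Sum>b\<in>G. k (x - r * (x * b)))"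
    by (rule sum_mult_G[OF x, symmetric])
  also have "\<dots> = (\<Sum>b\<in>G. k (e - r * b))"
  proof (rule sum.cong[OF refl])
    fix b assume b: "b \<in> G"
    have "x - r * (x * b) = x * (e - r * b)"
      using x by (simp add: right_diff_distrib e_mult G_F mult_ac)
    then show "k (x - r * (x * b)) = k (e - r * b)"
      using k[OF x, of "e - r * b"] r b by (simp add: F_diff F_mult G_F e_F)
  qed
  finally show ?thesis .
qed

text \<open>Needed for triples whose vertex \<open>y\<close> runs over the dilate of
  \<open>G\<close> by \<open>r\<close>.\<close>

lemma third_energy_dilate:
  assumes r: "r \<in> U"
  shows "third_energy ((*) r ` G) = third_energy G"
proof -
  let ?B = "(*) r ` G"
  have inj: "inj_on ((*) r) F" using U_cancel[OF r] by (auto simp: inj_on_def)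
  have ds: "diff_set ?B = (*) r ` diff_set G"
  proof (intro equalityI subsetI)
    fix x assume "x \<in> diff_set ?B"
    then obtain a b where ab: "a \<in> G" "b \<in> G" "x = r * a - r * b" by (auto simp: diff_set_def)
    then have "x = r * (a - b)" by (simp add: right_diff_distrib)
    then show "x \<in> (*) r ` diff_set G" using ab by auto
  next
    fix x assume "x \<in> (*) r ` diff_set G"
    then obtain a b where ab: "a \<in> G" "b \<in> G" "x = r * (a - b)" by (auto simp: diff_set_def)
    then have "x = r * a - r * b" by (simp add: right_diff_distrib)
    then show "x \<in> diff_set ?B" using ab by auto
  qed
  have rp: "rep ?B (r * x) = rep G x" if x: "x \<in> F" for x
  proof -
    have "diff_rep ?B (r * x) = diff_rep G x"
      unfolding diff_rep_def
    proof (rule bij_betw_same_card[symmetric, of "\<lambda>(a, b). (r * a, r * b)"], rule bij_betw_imageI)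
      show "inj_on (\<lambda>(a, b). (r * a, r * b)) {(a, b) \<in> G \<times> G. a - b = x}"
        using inj G_F by (auto simp: inj_on_def)
      show "(\<lambda>(a, b). (r * a, r * b)) ` {(a, b) \<in> G \<times> G. a - b = x} = {(a, b) \<in> ?B \<times> ?B. a - b = r * x}"
      proof safe
        fix a b assume "a \<in> G" "b \<in> G" "r * a - r * b = r * x"
        then have "r * (a - b) = r * x" by (simp add: algebra_simps)
        then have "a - b = x" using U_cancel[OF r] x \<open>a \<in> G\<close> \<open>b \<in> G\<close> by (simp add: F_diff G_F)
        then show "(r * a, r * b) \<in> (\<lambda>(a, b). (r * a, r * b)) ` {(a, b) \<in> G \<times> G. a - b = x}"
          using \<open>a \<in> G\<close> \<open>b \<in> G\<close> by auto
      qed (auto simp: algebra_simps)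
    qed
    then show ?thesis by (simp add: rep_def)
  qed
  have "inj_on ((*) r) (diff_set G)" using inj diff_set_G inj_on_subset by blast
  then show ?thesis
    unfolding third_energy_def ds using diff_set_G by (simp add: sum.reindex rp subset_iff)
qed

lemma invariant_P: "invariant (P j)"
proof -
  have "g * x \<in> P j" if "g \<in> G" "x \<in> P j" for g x
  proof -
    have x: "x \<in> U" "2 ^ j \<le> diff_rep G x" "diff_rep G x < 2 ^ Suc j"
      using that(2) unfolding dyadic_level_def by blast+
    have "diff_rep G (g * x) = diff_rep G x"
      using rep_mult[OF that(1), of x] x(1) by (simp add: rep_def)
    then show ?thesis
      using x U_mult[OF G_F(3)[OF that(1)] x(1)] unfolding dyadic_level_def by simp
  qed
  then show ?thesis unfolding invariant_def dyadic_level_def by blast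
qed

lemma card_P_le: "real (card (P j)) \<le> t\<^sup>2"
proof -
  have "real (card (P j)) * 1 \<le> (\<Sum>x\<in>P j. rep G x)"
  proof (rule sum_bounded_below)
    fix x assume "x \<in> P j"
    have "(1::real) \<le> 2 ^ j" by simp
    also have "\<dots> \<le> rep G x" by (rule rep_P) fact
    finally show "1 \<le> rep G x" .
  qed
  also have "\<dots> \<le> (\<Sum>x\<in>U. rep G x)" by (rule sum_mono2) (use P_sub in auto)
  also have "\<dots> \<le> t\<^sup>2" unfolding rep_eq_q by (rule sum_q_U_le[OF e_F(1)])
  finally show ?thesis by simp
qed

definition T2 :: "'a \<Rightarrow> nat \<Rightarrow> 'a \<Rightarrow> real"
  where "T2 r i z = (\<Sum>b\<in>G. \<Sum>w\<in>P i. of_bool (r * b + w = z))"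

text \<open>Division by \<open>r\<close> turns \<open>r b + w\<close> into \<open>b + w / r\<close>.
  Hence \<open>T2\<close> is a dilate of the count \<open>Tn\<close> for the invariant set of all
  \<open>- w / r\<close>.\<close>

lemma T2_moments:
  assumes r: "r \<in> U"
  shows "(\<Sum>z\<in>F. T2 r i z) = t * real (card (P i))"
    and "(\<Sum>z\<in>F. T2 r i z ^ 3) \<le> L ^ 6 * (t * (real (card (P i)))\<^sup>2)"
proof -
  obtain s where s: "s \<in> F" "s * r = e" using F_inv[of r] r by auto
  have sU: "s \<in> U" using s e_F by auto
  let ?Q = "(\<lambda>w. - (s * w)) ` P i"
  have inj: "inj_on (\<lambda>w. - (s * w)) (P i)"
    using U_cancel[OF sU] P_sub[of i] by (auto simp: inj_on_def)
  have cQ: "card ?Q = card (P i)" by (rule card_image[OF inj])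
  have Q: "invariant ?Q"
    unfolding invariant_def
  proof (intro conjI ballI subsetI)
    fix x assume "x \<in> ?Q"
    then obtain w where w: "w \<in> P i" "x = - (s * w)" by auto
    then have "s * w \<in> U" using P_sub[of i] sU U_mult by blast
    then show "x \<in> U" using w F_uminus by auto
  next
    fix g x assume g: "g \<in> G" and "x \<in> ?Q"
    then obtain w where w: "w \<in> P i" "x = - (s * w)" by auto
    have "g * x = - (s * (g * w))" using w by (simp add: mult_ac)
    moreover have "g * w \<in> P i" using invariant_P[of i] g w by (auto simp: invariant_def)
    ultimately show "g * x \<in> ?Q" by auto
  qed
  have T: "T2 r i (r * z) = real (Tn ?Q z)" if z: "z \<in> F" for z
  proof -
    have "real (Tn ?Q z) = (\<Sum>b\<in>G. \<Sum>w\<in>P i. of_bool (b - - (s * w) = z))"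
      unfolding Tn_eq_sum[OF invariant_finite[OF Q]] sum.reindex[OF inj] by simp
    also have "\<dots> = T2 r i (r * z)"
      unfolding T2_def
    proof (intro sum.cong refl arg_cong[where f = of_bool])
      fix b w assume b: "b \<in> G" and w: "w \<in> P i"
      have wF: "w \<in> F" using w P_sub by auto
      have "r * (b + s * w) = r * b + (s * r) * w" by (simp add: algebra_simps)
      also have "\<dots> = r * b + w" using s e_mult[OF wF] by simp
      finally have *: "r * (b + s * w) = r * b + w" .
      have "b + s * w \<in> F" using b s wF by (simp add: F_add F_mult G_F)
      then show "b - - (s * w) = z \<longleftrightarrow> r * b + w = r * z"
        using U_cancel[OF r, of "b + s * w" z] z * by auto
    qed
    finally show ?thesis ..
  qed
  have "(\<Sum>z\<in>F. T2 r i z) = (\<Sum>z\<in>F. T2 r i (r * z))" by (rule sum_mult_F[OF r, symmetric])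
  also have "\<dots> = (\<Sum>z\<in>F. real (Tn ?Q z))" by (rule sum.cong[OF refl]) (rule T)
  finally show "(\<Sum>z\<in>F. T2 r i z) = t * real (card (P i))" using sum_Tn[OF Q] cQ by simp
  have "(\<Sum>z\<in>F. T2 r i z ^ 3) = (\<Sum>z\<in>F. T2 r i (r * z) ^ 3)" by (rule sum_mult_F[OF r, symmetric])
  also have "\<dots> = (\<Sum>z\<in>F. real (Tn ?Q z) ^ 3)" by (rule sum.cong[OF refl]) (simp add: T)
  finally show "(\<Sum>z\<in>F. T2 r i z ^ 3) \<le> L ^ 6 * (t * (real (card (P i)))\<^sup>2)"
    using Tn_third_moment[OF Q] cQ card_P_le[of i] by simp
qed

lemma T2_nonneg: "0 \<le> T2 r i z"
  by (simp add: T2_def sum_nonneg)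

text \<open>Each \<open>u\<close> in \<open>D r j\<close> has at least \<open>2 ^ j\<close>
  representations \<open>a - r b\<close>. With \<open>u = v + w\<close> the equation becomes
  \<open>a - v = r b + w\<close>, so the weighted count is at most the inner product of
  \<open>Tn (D r j)\<close> and \<open>T2 r i\<close>, whose third moments are known.\<close>

lemma level_pairs_le:
  assumes r: "r \<in> U"
  shows "(2 ^ j * (\<Sum>w\<in>P i. \<Sum>v\<in>D r j. \<Sum>u\<in>D r j. of_bool (u - v = w))) ^ 6
    \<le> L ^ 18 * t ^ 6 * real (card (D r j)) ^ 4 * real (card (P i)) ^ 5"
proof -
  let ?D = "D r j" and ?T1 = "\<lambda>z. real (Tn (D r j) z)" and ?T2 = "T2 r i"
  have rF: "r \<in> F" using r by auto
  have D: "invariant ?D" by (rule invariant_D[OF rF])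
  have DF: "v \<in> ?D \<Longrightarrow> v \<in> F" for v using D_sub by auto
  have PF: "w \<in> P i \<Longrightarrow> w \<in> F" for w using P_sub by auto
  have "(2::real) ^ j * (\<Sum>w\<in>P i. \<Sum>v\<in>?D. \<Sum>u\<in>?D. of_bool (u - v = w)) =
    (\<Sum>w\<in>P i. \<Sum>v\<in>?D. \<Sum>u\<in>?D. of_bool (u - v = w) * 2 ^ j)"
    by (simp only: sum_distrib_left mult.commute)
  also have "\<dots> \<le> (\<Sum>w\<in>P i. \<Sum>v\<in>?D. q r (v + w))"
  proof (intro sum_mono)
    fix w v assume w: "w \<in> P i" and v: "v \<in> ?D"
    have "(\<Sum>u\<in>?D. of_bool (u - v = w) * 2 ^ j) = (\<Sum>u\<in>?D. of_bool (v + w = u) * (2 ^ j :: real))"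
      by (rule sum.cong[OF refl]) (auto simp: algebra_simps)
    also have "\<dots> \<le> q r (v + w)"
    proof (cases "v + w \<in> ?D")
      case True
      then have "(\<Sum>u\<in>?D. of_bool (v + w = u) * (2 ^ j :: real)) = 2 ^ j"
        by (intro sum_of_bool_delta) auto
      then show ?thesis using q_D(1)[OF True] by simp
    next
      case False
      then have "(\<Sum>u\<in>?D. of_bool (v + w = u) * (2 ^ j :: real)) = 0"
        by (intro sum.neutral) auto
      then show ?thesis by simp
    qed
    finally show "(\<Sum>u\<in>?D. of_bool (u - v = w) * 2 ^ j) \<le> q r (v + w)" .
  qed
  also have "\<dots> = (\<Sum>w\<in>P i. \<Sum>v\<in>?D. \<Sum>a\<in>G. \<Sum>b\<in>G. of_bool (r * b + w = a - v))"
    unfolding q_eq_sum by (intro sum.cong refl) (auto simp: algebra_simps)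
  also have "\<dots> = (\<Sum>v\<in>?D. \<Sum>w\<in>P i. \<Sum>a\<in>G. \<Sum>b\<in>G. of_bool (r * b + w = a - v))" by (rule sum.swap)
  also have "\<dots> = (\<Sum>v\<in>?D. \<Sum>a\<in>G. \<Sum>w\<in>P i. \<Sum>b\<in>G. of_bool (r * b + w = a - v))"
    by (rule sum.cong[OF refl], rule sum.swap)
  also have "\<dots> = (\<Sum>v\<in>?D. \<Sum>a\<in>G. ?T2 (a - v))"
    unfolding T2_def by (rule sum.cong[OF refl], rule sum.cong[OF refl], rule sum.swap)
  also have "\<dots> = (\<Sum>a\<in>G. \<Sum>v\<in>?D. ?T2 (a - v))" by (rule sum.swap)
  also have "\<dots> = (\<Sum>a\<in>G. \<Sum>v\<in>?D. \<Sum>z\<in>F. of_bool (a - v = z) * ?T2 z)"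
    by (intro sum.cong refl sum_of_bool_delta[symmetric]) (simp_all add: DF F_diff G_F)
  also have "\<dots> = (\<Sum>a\<in>G. \<Sum>z\<in>F. \<Sum>v\<in>?D. of_bool (a - v = z) * ?T2 z)"
    by (rule sum.cong[OF refl], rule sum.swap)
  also have "\<dots> = (\<Sum>z\<in>F. \<Sum>a\<in>G. \<Sum>v\<in>?D. of_bool (a - v = z) * ?T2 z)" by (rule sum.swap)
  also have "\<dots> = (\<Sum>z\<in>F. ?T1 z * ?T2 z)"
    unfolding Tn_eq_sum[OF invariant_finite[OF D]] by (simp only: sum_distrib_right)
  finally have le: "2 ^ j * (\<Sum>w\<in>P i. \<Sum>v\<in>?D. \<Sum>u\<in>?D. of_bool (u - v = w)) \<le> (\<Sum>z\<in>F. ?T1 z * ?T2 z)" .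
  have T12: "0 \<le> (\<Sum>z\<in>F. ?T1 z * ?T2 z)" by (intro sum_nonneg) (simp add: T2_nonneg)
  \<comment> \<open>Splitting off \<open>sqrt (T2)\<close> separates the first moment of
    \<open>T2\<close>, which is known exactly, from a mixed third moment fit for Hoelder's
    inequality.\<close>
  have "(\<Sum>z\<in>F. ?T1 z * ?T2 z)\<^sup>2 = (\<Sum>z\<in>F. sqrt (?T2 z) * (?T1 z * sqrt (?T2 z)))\<^sup>2"
  proof (intro arg_cong[where f = "\<lambda>x. x\<^sup>2"] sum.cong refl)
    fix z
    have "sqrt (?T2 z) * (?T1 z * sqrt (?T2 z)) = ?T1 z * (sqrt (?T2 z) * sqrt (?T2 z))"
      by (simp only: mult_ac)
    then show "?T1 z * ?T2 z = sqrt (?T2 z) * (?T1 z * sqrt (?T2 z))" by (simp add: T2_nonneg)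
  qed
  also have "\<dots> \<le> (\<Sum>z\<in>F. (sqrt (?T2 z))\<^sup>2) * (\<Sum>z\<in>F. (?T1 z * sqrt (?T2 z))\<^sup>2)"
    by (rule cauchy_schwarz_sum)
  also have "\<dots> = (\<Sum>z\<in>F. ?T2 z) * (\<Sum>z\<in>F. (?T1 z)\<^sup>2 * ?T2 z)"
    by (simp add: power_mult_distrib T2_nonneg)
  finally have 1: "(\<Sum>z\<in>F. ?T1 z * ?T2 z)\<^sup>2 \<le> (\<Sum>z\<in>F. ?T2 z) * (\<Sum>z\<in>F. (?T1 z)\<^sup>2 * ?T2 z)" .
  have 2: "(\<Sum>z\<in>F. (?T1 z)\<^sup>2 * ?T2 z) ^ 3 \<le>
      (L ^ 6 * (t * (real (card ?D))\<^sup>2))\<^sup>2 * (L ^ 6 * (t * (real (card (P i)))\<^sup>2))"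
  proof (rule order_trans[OF holder_3])
    show "(\<Sum>z\<in>F. ?T1 z ^ 3)\<^sup>2 * (\<Sum>z\<in>F. ?T2 z ^ 3) \<le>
      (L ^ 6 * (t * (real (card ?D))\<^sup>2))\<^sup>2 * (L ^ 6 * (t * (real (card (P i)))\<^sup>2))"
      by (rule mult_mono[OF power_mono[OF Tn_third_moment[OF D card_D_le2[OF rF]]] T2_moments(2)[OF r]])
         (auto intro!: sum_nonneg simp: T2_nonneg)
  qed (auto simp: T2_nonneg)
  have "(2 ^ j * (\<Sum>w\<in>P i. \<Sum>v\<in>?D. \<Sum>u\<in>?D. of_bool (u - v = w))) ^ 6 \<le> (\<Sum>z\<in>F. ?T1 z * ?T2 z) ^ 6"
    using le by (rule power_mono) (simp add: sum_nonneg)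
  also have "\<dots> = ((\<Sum>z\<in>F. ?T1 z * ?T2 z)\<^sup>2) ^ 3" by (simp flip: power_mult)
  also have "\<dots> \<le> ((\<Sum>z\<in>F. ?T2 z) * (\<Sum>z\<in>F. (?T1 z)\<^sup>2 * ?T2 z)) ^ 3"
    using 1 by (rule power_mono) simp
  also have "\<dots> = (t * real (card (P i))) ^ 3 * (\<Sum>z\<in>F. (?T1 z)\<^sup>2 * ?T2 z) ^ 3"
    by (simp only: power_mult_distrib T2_moments(1)[OF r])
  also have "\<dots> \<le> (t * real (card (P i))) ^ 3 *
      ((L ^ 6 * (t * (real (card ?D))\<^sup>2))\<^sup>2 * (L ^ 6 * (t * (real (card (P i)))\<^sup>2)))"
    using 2 by (rule mult_left_mono) simp
  also have "\<dots> = L ^ 18 * t ^ 6 * real (card ?D) ^ 4 * real (card (P i)) ^ 5"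
    by (simp add: power_numeral_reduce mult_ac)
  finally show ?thesis .
qed

text \<open>Here \<open>level_pairs_le\<close> is summed over \<open>i\<close>. Of its five factors
  \<open>card (P i)\<close>, three are paired with \<open>4 ^ i\<close> and bounded by the energy,
  and two are paired with \<open>8 ^ i\<close> and bounded by \<open>card_P\<close>. This uses up
  \<open>(4 ^ i) ^ 6\<close> exactly, so that no level is worse than another.\<close>

lemma pair_energy_D_le:
  assumes r: "r \<in> U" and ne: "D r j \<noteq> {}"
  shows "(2 ^ j * (\<Sum>v\<in>D r j. \<Sum>u\<in>D r j. (rep G (u - v))\<^sup>2)) ^ 6 \<le> L ^ 30 * t ^ 12 * real (card (D r j)) ^ 4 * E ^ 3"
proof -
  let ?D = "D r j" and ?d = "real (card (D r j))"
  define \<tau> :: real where "\<tau> = 2 ^ j"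
  have \<tau>: "0 < \<tau>" by (simp add: \<tau>_def)
  have DF: "v \<in> ?D \<Longrightarrow> v \<in> F" for v using D_sub by auto
  define nu where "nu w = (\<Sum>v\<in>?D. \<Sum>u\<in>?D. of_bool (u - v = w) :: real)" for w
  have nu0: "0 \<le> nu w" for w by (simp add: nu_def sum_nonneg)
  have "(\<Sum>v\<in>?D. \<Sum>u\<in>?D. (rep G (u - v))\<^sup>2) = (\<Sum>v\<in>?D. \<Sum>u\<in>?D. \<Sum>w\<in>F. of_bool (u - v = w) * (rep G w)\<^sup>2)"
    by (intro sum.cong refl sum_of_bool_delta[symmetric]) (simp_all add: DF F_diff)
  also have "\<dots> = (\<Sum>v\<in>?D. \<Sum>w\<in>F. \<Sum>u\<in>?D. of_bool (u - v = w) * (rep G w)\<^sup>2)"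
    by (rule sum.cong[OF refl], rule sum.swap)
  also have "\<dots> = (\<Sum>w\<in>F. \<Sum>v\<in>?D. \<Sum>u\<in>?D. of_bool (u - v = w) * (rep G w)\<^sup>2)" by (rule sum.swap)
  also have "\<dots> = (\<Sum>w\<in>F. nu w * (rep G w)\<^sup>2)" unfolding nu_def by (simp only: sum_distrib_right)
  also have "\<dots> = nu 0 * (rep G 0)\<^sup>2 + (\<Sum>w\<in>U. nu w * (rep G w)\<^sup>2)" by (rule sum_F_U)
  also have "nu 0 = ?d"
  proof -
    have "nu 0 = (\<Sum>v\<in>?D. \<Sum>u\<in>?D. of_bool (v = u) * 1)"
      unfolding nu_def by (intro sum.cong refl) auto
    also have "\<dots> = (\<Sum>v\<in>?D. 1)" by (rule sum.cong[OF refl], rule sum_of_bool_delta) auto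
    finally show ?thesis by simp
  qed
  also have "(\<Sum>w\<in>U. nu w * (rep G w)\<^sup>2) = (\<Sum>i<J. \<Sum>w\<in>P i. nu w * (rep G w)\<^sup>2)"
    by (rule sum_U_dyadic) auto
  also have "\<dots> \<le> (\<Sum>i<J. 4 * 4 ^ i * (\<Sum>w\<in>P i. nu w))"
  proof (rule sum_mono)
    fix i
    have "(\<Sum>w\<in>P i. nu w * (rep G w)\<^sup>2) \<le> (\<Sum>w\<in>P i. nu w * (2 * 2 ^ i)\<^sup>2)"
      by (intro sum_mono mult_left_mono power_mono rep_P nu0) auto
    also have "\<dots> = 4 * 4 ^ i * (\<Sum>w\<in>P i. nu w)"
      by (simp add: sum_distrib_left power_4_eq power_mult_distrib mult_ac)
    finally show "(\<Sum>w\<in>P i. nu w * (rep G w)\<^sup>2) \<le> 4 * 4 ^ i * (\<Sum>w\<in>P i. nu w)" .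
  qed
  finally have X: "(\<Sum>v\<in>?D. \<Sum>u\<in>?D. (rep G (u - v))\<^sup>2) \<le> ?d * t\<^sup>2 + (\<Sum>i<J. 4 * 4 ^ i * (\<Sum>w\<in>P i. nu w))"
    by (simp add: rep_0)
  define M where "M = L ^ 22 * t ^ 12 * ?d ^ 4 * E ^ 3"
  define m where "m = root 6 M"
  have M0: "0 \<le> M" unfolding M_def using L_pos E_pos by (intro mult_nonneg_nonneg) auto
  have m: "m ^ 6 = M" "0 \<le> m" unfolding m_def using M0 by auto
  have d1: "1 \<le> ?d" using ne by (simp add: Suc_le_eq card_gt_0_iff)
  have De: "?d * \<tau>\<^sup>2 \<le> E" using card_D_energy[OF r, of j] by (simp add: \<tau>_def power_4_eq)
  have te: "\<tau>\<^sup>2 \<le> E"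
  proof -
    have "1 * \<tau>\<^sup>2 \<le> ?d * \<tau>\<^sup>2" using d1 by (rule mult_right_mono) simp
    with De show ?thesis by simp
  qed
  \<comment> \<open>The diagonal \<open>u = v\<close>, where \<open>rep G\<close> equals
    \<open>t\<close>.\<close>
  have zero: "\<tau> * (?d * t\<^sup>2) \<le> m"
  proof (rule le_of_power_le[of 6])
    have "(\<tau> * (?d * t\<^sup>2)) ^ 6 = t ^ 12 * ?d ^ 4 * ((?d * \<tau>\<^sup>2)\<^sup>2 * \<tau>\<^sup>2)"
      by (simp add: power_numeral_reduce mult_ac)
    also have "\<dots> \<le> t ^ 12 * ?d ^ 4 * (E\<^sup>2 * E)"
      using De te by (intro mult_left_mono mult_mono power_mono) auto
    also have "\<dots> = 1 * (t ^ 12 * ?d ^ 4 * E ^ 3)" by (simp add: power_numeral_reduce)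
    also have "\<dots> \<le> L ^ 22 * (t ^ 12 * ?d ^ 4 * E ^ 3)"
      using L_pos E_pos by (intro mult_right_mono) auto
    finally show "(\<tau> * (?d * t\<^sup>2)) ^ 6 \<le> m ^ 6" by (simp add: m M_def mult.assoc)
  qed (use m in auto)
  have lev: "\<tau> * (4 ^ i * (\<Sum>w\<in>P i. nu w)) \<le> m" for i
  proof (rule le_of_power_le[of 6])
    let ?p = "real (card (P i))"
    have "(\<tau> * (4 ^ i * (\<Sum>w\<in>P i. nu w))) ^ 6 = (4 ^ i) ^ 6 * (\<tau> * (\<Sum>w\<in>P i. nu w)) ^ 6"
      by (simp add: power_mult_distrib)
    also have "\<dots> \<le> (4 ^ i) ^ 6 * (L ^ 18 * t ^ 6 * ?d ^ 4 * ?p ^ 5)"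
      unfolding \<tau>_def nu_def by (intro mult_left_mono level_pairs_le[OF r]) auto
    also have "\<dots> = L ^ 18 * t ^ 6 * ?d ^ 4 * ((?p * 4 ^ i) ^ 3 * (?p * 8 ^ i)\<^sup>2)"
      unfolding power_4_eq power_8_eq by (simp add: power_numeral_reduce mult_ac)
    also have "\<dots> \<le> L ^ 18 * t ^ 6 * ?d ^ 4 * (E ^ 3 * (L\<^sup>2 * t ^ 3)\<^sup>2)"
      by (rule mult_left_mono[OF mult_mono[OF power_mono[OF card_P_energy] power_mono[OF card_P]]])
         (use L_pos E_pos in auto)
    also have "\<dots> = m ^ 6" unfolding m M_def by (simp add: power_numeral_reduce mult_ac)
    finally show "(\<tau> * (4 ^ i * (\<Sum>w\<in>P i. nu w))) ^ 6 \<le> m ^ 6" .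
  qed (use m in auto)
  have "\<tau> * (\<Sum>v\<in>?D. \<Sum>u\<in>?D. (rep G (u - v))\<^sup>2) \<le> \<tau> * (?d * t\<^sup>2 + (\<Sum>i<J. 4 * 4 ^ i * (\<Sum>w\<in>P i. nu w)))"
    using X \<tau> by (intro mult_left_mono) auto
  also have "\<dots> = \<tau> * (?d * t\<^sup>2) + (\<Sum>i<J. 4 * (\<tau> * (4 ^ i * (\<Sum>w\<in>P i. nu w))))"
    by (simp only: distrib_left sum_distrib_left mult_ac)
  also have "\<dots> \<le> m + (\<Sum>i<J. 4 * m)" using zero lev by (intro add_mono sum_mono mult_left_mono) auto
  also have "\<dots> = (1 + 4 * real J) * m" by (simp add: algebra_simps)
  also have "\<dots> \<le> (5 * L) * m" using L m by (intro mult_right_mono) auto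
  finally have "(\<tau> * (\<Sum>v\<in>?D. \<Sum>u\<in>?D. (rep G (u - v))\<^sup>2)) ^ 6 \<le> (5 * L * m) ^ 6"
    using \<tau> by (intro power_mono) (auto intro!: mult_nonneg_nonneg sum_nonneg)
  also have "\<dots> = 15625 * L ^ 6 * M" by (simp add: power_mult_distrib m)
  also have "\<dots> \<le> L\<^sup>2 * L ^ 6 * M"
  proof -
    have "(1024::real)\<^sup>2 \<le> L\<^sup>2" using L by (intro power_mono) auto
    then show ?thesis using M0 L_pos by (intro mult_right_mono) auto
  qed
  also have "\<dots> = L ^ 30 * t ^ 12 * ?d ^ 4 * E ^ 3" unfolding M_def by (simp add: power_numeral_reduce mult_ac)
  finally show ?thesis by (simp add: \<tau>_def)
qed

text \<open>The set \<open>D r j\<close> is invariant under \<open>G\<close>, so every \<open>a \<in> G\<close> has the same number of \<open>b \<in> G\<close> with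
  \<open>a - r * b \<in> D r j\<close>. The weighted triples can therefore be run with the indicator function of \<open>D r j\<close>.\<close>

lemma level_size_bound:
  assumes r: "r \<in> U" and ne: "D r j \<noteq> {}"
  shows "(2 ^ j) ^ 30 * real (card (D r j)) ^ 20 * E ^ 9 \<le> L ^ 54 * t ^ 66"
proof -
  let ?D = "D r j" and ?d = "real (card (D r j))" and ?B = "(*) r ` G"
  define \<tau> :: real where "\<tau> = 2 ^ j"
  have \<tau>: "0 < \<tau>" by (simp add: \<tau>_def)
  have rF: "r \<in> F" using r by auto
  have injB: "inj_on ((*) r) G" using U_cancel[OF r] G_F by (auto simp: inj_on_def)
  have cB: "card ?B = card G" by (rule card_image[OF injB])
  define k where "k x = (of_bool (x \<in> ?D) :: real)" for x
  have kinv: "k (g * z) = k z" if g: "g \<in> G" and z: "z \<in> F" for g z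
  proof -
    have "g * z \<noteq> 0 \<longleftrightarrow> z \<noteq> 0" using U_cancel[OF G_F(3)[OF g], of z 0] z F_0 by auto
    then show ?thesis
      using q_mult_left[OF g rF z] F_mult[OF G_F(1)[OF g] z] z by (simp add: k_def dyadic_level_def)
  qed
  define \<delta> where "\<delta> = (\<Sum>b\<in>G. k (e - r * b))"
  have deg: "(\<Sum>y\<in>?B. k (x - y)) = \<delta>" if x: "x \<in> G" for x
    unfolding \<delta>_def sum.reindex[OF injB] using regular_sum[OF rF x, of k] kinv by simp
  \<comment> \<open>The pairs \<open>(a, b)\<close> with \<open>a - r * b\<close> in
    \<open>D r j\<close> number \<open>t\<close> times the common degree, and at least
    \<open>2 ^ j\<close> of them lie over each point of \<open>D r j\<close>.\<close>
  have "t * \<delta> = (\<Sum>a\<in>G. \<Sum>b\<in>G. k (a - r * b))"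
    using regular_sum[OF rF _ kinv] by (simp add: \<delta>_def)
  also have "\<dots> = (\<Sum>z\<in>F. q r z * k z)" by (rule sum_line_q[OF rF])
  also have "\<dots> \<ge> (\<Sum>z\<in>?D. q r z * k z)" by (rule sum_mono2) (use D_sub in \<open>auto simp: k_def\<close>)
  finally have "(\<Sum>z\<in>?D. q r z * k z) \<le> t * \<delta>" .
  moreover have "(\<Sum>z\<in>?D. \<tau>) \<le> (\<Sum>z\<in>?D. q r z * k z)"
    by (rule sum_mono) (use q_D(1) in \<open>auto simp: k_def \<tau>_def\<close>)
  ultimately have d\<delta>: "\<tau> * ?d \<le> t * \<delta>" by (simp add: mult.commute)
  define S where "S = (\<Sum>y\<in>?B. \<Sum>x\<in>G. \<Sum>x'\<in>G. k (x - y) * k (x' - y) * rep G (x - x'))"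
  have 1: "\<delta>\<^sup>2 * E \<le> t * S"
    unfolding S_def using regular_triples_ge[of G ?B k \<delta>] deg cB by simp
  have "(\<Sum>y\<in>?B. \<Sum>x\<in>G. \<Sum>x'\<in>G. k (x - y) * k (x' - y) * rep G ((x - y) - (x' - y)))\<^sup>2 \<le>
      (L ^ 4 * t ^ 3) * (\<Sum>(u, v)\<in>?D \<times> ?D. (k u * k v * rep G (u - v))\<^sup>2)"
    by (rule triples_cauchy) (use third_energy_le third_energy_dilate[OF r] in \<open>auto simp: k_def\<close>)
  then have 2: "S\<^sup>2 \<le> (L ^ 4 * t ^ 3) * (\<Sum>(u, v)\<in>?D \<times> ?D. (k u * k v * rep G (u - v))\<^sup>2)"
    by (simp add: S_def)
  define X where "X = (\<Sum>v\<in>?D. \<Sum>u\<in>?D. (rep G (u - v))\<^sup>2)"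
  have "(\<Sum>(u, v)\<in>?D \<times> ?D. (k u * k v * rep G (u - v))\<^sup>2) = (\<Sum>u\<in>?D. \<Sum>v\<in>?D. (rep G (u - v))\<^sup>2)"
    by (simp add: sum.cartesian_product[symmetric] k_def)
  also have "\<dots> = X" unfolding X_def by (rule sum.swap)
  finally have 2: "S\<^sup>2 \<le> L ^ 4 * t ^ 3 * X" using 2 by simp
  have X0: "0 \<le> X" unfolding X_def by (intro sum_nonneg) auto
  have "(\<tau> * ?d)\<^sup>2 * E \<le> (t * \<delta>)\<^sup>2 * E"
    using d\<delta> \<tau> E_pos by (intro mult_right_mono power_mono) auto
  also have "\<dots> = t\<^sup>2 * (\<delta>\<^sup>2 * E)" by (simp add: power_mult_distrib)
  also have "\<dots> \<le> t\<^sup>2 * (t * S)" using 1 by (intro mult_left_mono) auto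
  finally have "(\<tau> * ?d)\<^sup>2 * E \<le> t ^ 3 * S" by (simp add: power3_eq_cube power2_eq_square mult_ac)
  then have "((\<tau> * ?d)\<^sup>2 * E)\<^sup>2 \<le> (t ^ 3 * S)\<^sup>2" using E_pos by (intro power_mono) auto
  also have "\<dots> = t ^ 6 * S\<^sup>2" by (simp add: power_mult_distrib flip: power_mult)
  also have "\<dots> \<le> t ^ 6 * (L ^ 4 * t ^ 3 * X)" using 2 by (intro mult_left_mono) auto
  finally have 3: "(\<tau> * ?d) ^ 4 * E\<^sup>2 \<le> L ^ 4 * t ^ 9 * X"
    by (simp add: power_numeral_reduce mult_ac)
  have "((\<tau> * ?d) ^ 4 * E\<^sup>2) ^ 6 \<le> (L ^ 4 * t ^ 9 * X) ^ 6"
    using 3 E_pos \<tau> by (intro power_mono) auto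
  then have "\<tau> ^ 6 * ((\<tau> * ?d) ^ 4 * E\<^sup>2) ^ 6 \<le> \<tau> ^ 6 * (L ^ 4 * t ^ 9 * X) ^ 6"
    using \<tau> by (intro mult_left_mono) auto
  also have "\<dots> = L ^ 24 * t ^ 54 * (\<tau> * X) ^ 6" by (simp add: power_mult_distrib flip: power_mult)
  also have "\<dots> \<le> L ^ 24 * t ^ 54 * (L ^ 30 * t ^ 12 * ?d ^ 4 * E ^ 3)"
    using pair_energy_D_le[OF r ne] L_pos unfolding X_def \<tau>_def by (intro mult_left_mono) auto
  \<comment> \<open>The factor \<open>?d ^ 4 * E ^ 3\<close> coming from
    \<open>pair_energy_D_le\<close> is split off on both sides in order to be cancelled.\<close>
  finally have "(?d ^ 4 * E ^ 3) * (\<tau> ^ 30 * ?d ^ 20 * E ^ 9) \<le> (?d ^ 4 * E ^ 3) * (L ^ 54 * t ^ 66)"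
    by (simp add: power_mult_distrib flip: power_mult power_add) (simp add: mult_ac flip: power_add)
  moreover have "0 < ?d ^ 4 * E ^ 3" using ne E_pos by (simp add: card_gt_0_iff)
  ultimately show ?thesis unfolding \<tau>_def by (rule mult_left_le_imp_le)
qed

text \<open>By \<open>level_size_bound\<close> the set \<open>D r j\<close> cannot be large, so a
  correlation of size \<open>e0\<close> forces \<open>2 ^ j\<close> to be large, and
  \<open>card_Rj\<close> gains from that. In tenth powers the factors \<open>2 ^ j\<close>
  cancel.\<close>

lemma card_R_bound_large:
  assumes e0: "4096 * L * t\<^sup>2 \<le> e0"
  shows "real (card (R e0)) ^ 10 * e0 ^ 30 * E ^ 9 \<le> L ^ 110 * t ^ 106"
proof -
  have e0p: "0 < e0"
  proof -
    have "0 < 4096 * L * t\<^sup>2" using L_pos t_pos(2)[of 2] by (intro mult_pos_pos) auto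
    with e0 show ?thesis by linarith
  qed
  define M where "M = L ^ 100 * t ^ 106 / (e0 ^ 30 * E ^ 9)"
  have M0: "0 \<le> M" unfolding M_def using L_pos e0p E_pos by auto
  have each: "real (card (Rj e0 j)) ^ 10 \<le> M" for j
  proof (cases "Rj e0 j = {}")
    case True
    then show ?thesis using M0 by simp
  next
    case False
    then obtain r where r: "r \<in> Rj e0 j" by auto
    define \<tau> :: real where "\<tau> = 2 ^ j"
    have \<tau>: "0 < \<tau>" by (simp add: \<tau>_def)
    let ?d = "real (card (D r j))" and ?c = "real (card (Rj e0 j))"
    have rU: "r \<in> U" using r R_sub(2)[of e0 j] by auto
    have le: "e0 \<le> 4 * L * \<tau>\<^sup>2 * ?d" using r by (simp add: Rj_def \<tau>_def power_4_eq)
    have ne: "D r j \<noteq> {}" using le e0p by auto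
    have A: "\<tau> ^ 30 * ?d ^ 20 * E ^ 9 \<le> L ^ 54 * t ^ 66"
      using level_size_bound[OF rU ne] by (simp add: \<tau>_def)
    have "?c * e0 * \<tau> \<le> 4 * L\<^sup>2 * t ^ 4"
      using card_Rj[OF Rj_large[OF e0 r]] by (simp add: \<tau>_def)
    then have B: "(?c * e0 * \<tau>) ^ 10 \<le> (4 * L\<^sup>2 * t ^ 4) ^ 10" using e0p \<tau> by (intro power_mono) auto
    have "e0 ^ 20 \<le> (4 * L * \<tau>\<^sup>2 * ?d) ^ 20" using le e0p by (intro power_mono) auto
    then have "(e0 ^ 20 * E ^ 9) * \<tau> ^ 30 \<le> ((4 * L * \<tau>\<^sup>2 * ?d) ^ 20 * E ^ 9) * \<tau> ^ 30"
      using E_pos \<tau> by (intro mult_right_mono) auto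
    also have "\<dots> = (4 ^ 20 * L ^ 20 * \<tau> ^ 40) * (\<tau> ^ 30 * ?d ^ 20 * E ^ 9)"
      by (simp add: power_mult_distrib flip: power_mult)
    also have "\<dots> \<le> (4 ^ 20 * L ^ 20 * \<tau> ^ 40) * (L ^ 54 * t ^ 66)"
      using A L_pos \<tau> by (intro mult_left_mono) auto
    finally have "\<tau> ^ 30 * (e0 ^ 20 * E ^ 9) \<le> \<tau> ^ 30 * (4 ^ 20 * L ^ 74 * t ^ 66 * \<tau> ^ 10)"
      by (simp add: mult_ac flip: power_add)
    then have C: "e0 ^ 20 * E ^ 9 \<le> 4 ^ 20 * L ^ 74 * t ^ 66 * \<tau> ^ 10"
      using \<tau> by (simp add: mult_le_cancel_left_pos)
    have "(?c * e0 * \<tau>) ^ 10 * (e0 ^ 20 * E ^ 9) \<le> (4 * L\<^sup>2 * t ^ 4) ^ 10 * (4 ^ 20 * L ^ 74 * t ^ 66 * \<tau> ^ 10)"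
      by (rule mult_mono[OF B C]) (use E_pos e0p L_pos in auto)
    also have "\<dots> = \<tau> ^ 10 * (4 ^ 30 * L ^ 94 * t ^ 106)"
      by (simp add: power_mult_distrib flip: power_mult power_add) (simp add: mult_ac flip: power_add)
    also have "(?c * e0 * \<tau>) ^ 10 * (e0 ^ 20 * E ^ 9) = \<tau> ^ 10 * (?c ^ 10 * (e0 ^ 30 * E ^ 9))"
      by (simp add: power_mult_distrib flip: power_add)
    finally have "?c ^ 10 * (e0 ^ 30 * E ^ 9) \<le> 4 ^ 30 * L ^ 94 * t ^ 106"
      using \<tau> by (simp add: mult_le_cancel_left_pos)
    also have "\<dots> \<le> L ^ 6 * L ^ 94 * t ^ 106"
    proof (intro mult_right_mono)
      have "(1024::real) ^ 6 \<le> L ^ 6" using L by (intro power_mono) auto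
      then show "4 ^ 30 \<le> L ^ 6" by simp
    qed (use L_pos in auto)
    finally have "?c ^ 10 * (e0 ^ 30 * E ^ 9) \<le> L ^ 100 * t ^ 106" by (simp flip: power_add)
    then show ?thesis unfolding M_def using e0p E_pos by (simp add: pos_le_divide_eq)
  qed
  define m where "m = root 10 M"
  have m: "m ^ 10 = M" "0 \<le> m" unfolding m_def using M0 by auto
  have "real (card (Rj e0 j)) \<le> m" for j
    by (rule le_of_power_le[of 10]) (use each[of j] m in auto)
  then have "(\<Sum>j<J. real (card (Rj e0 j))) \<le> (\<Sum>j<J. m)" by (rule sum_mono)
  also have "\<dots> = real J * m" by simp
  also have "\<dots> \<le> L * m" using L m by (intro mult_right_mono) auto
  finally have "real (card (R e0)) \<le> L * m" using card_R_le_sum[OF e0p] by linarith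
  then have "real (card (R e0)) ^ 10 \<le> (L * m) ^ 10" by (rule power_mono) simp
  also have "\<dots> = L ^ 10 * M" by (simp add: power_mult_distrib m)
  finally have "real (card (R e0)) ^ 10 * (e0 ^ 30 * E ^ 9) \<le> L ^ 10 * M * (e0 ^ 30 * E ^ 9)"
    using e0p E_pos by (intro mult_right_mono) auto
  also have "\<dots> = L ^ 110 * t ^ 106" unfolding M_def using e0p E_pos by (simp flip: power_add)
  finally show ?thesis by (simp add: mult.assoc)
qed

section \<open>Correlations weighted by quotients of popular differences\<close>

lemma E_le: "E \<le> t ^ 3"
proof -
  have "E \<le> (\<Sum>x\<in>F. t * rep G x)"
    unfolding energy_eq power2_eq_square
    by (intro sum_mono mult_right_mono) (auto simp: rep_def diff_rep_le_card)
  also have "\<dots> = t * t\<^sup>2" using sum_q[OF e_F(1)] by (simp add: sum_distrib_left[symmetric] rep_eq_q)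
  finally show ?thesis by (simp add: power3_eq_cube power2_eq_square)
qed

text \<open>Number of ways to write \<open>s\<close> as a quotient of two elements of
  \<open>P i\<close>.\<close>

definition m :: "nat \<Rightarrow> 'a \<Rightarrow> real"
  where "m i s = (\<Sum>w\<in>U. of_bool (w \<in> P i) * of_bool (s * w \<in> P i))"

text \<open>Arises as the second moment of the weights \<open>om\<close>, see
  \<open>sum_om_squared_le\<close>.\<close>

definition W :: "nat \<Rightarrow> real"
  where "W i = (\<Sum>s\<in>U. (real (eps s))\<^sup>2 * m i s)"

abbreviation "p i \<equiv> real (card (P i))"

lemma sum_of_bool_P: "(\<Sum>w\<in>U. of_bool (w \<in> P i)) = p i"
proof -
  have "(\<Sum>w\<in>U. of_bool (w \<in> P i)) = (\<Sum>w\<in>P i. (1::real))"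
    by (rule sum.mono_neutral_cong_right) (use P_sub in auto)
  then show ?thesis by simp
qed

lemma m_nonneg: "0 \<le> m i s" by (simp add: m_def sum_nonneg)

lemma m_le_p: "m i s \<le> p i"
  unfolding m_def sum_of_bool_P[of i, symmetric] by (intro sum_mono) auto

lemma m_le_eps: "s \<in> U \<Longrightarrow> 4 ^ i * m i s \<le> real (eps s)"
  unfolding m_def eps_eq sum_distrib_left
proof (rule sum_mono)
  fix w
  show "4 ^ i * (of_bool (w \<in> P i) * of_bool (s * w \<in> P i)) \<le> rep G w * rep G (s * w)"
  proof (cases "w \<in> P i \<and> s * w \<in> P i")
    case True
    then have "2 ^ i * 2 ^ i \<le> rep G w * rep G (s * w)" by (intro mult_mono rep_P) auto
    with True show ?thesis by (simp add: power_4_eq power2_eq_square)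
  qed auto
qed

lemma sum_m: "(\<Sum>s\<in>U. m i s) = (p i)\<^sup>2"
proof -
  have "(\<Sum>s\<in>U. m i s) = (\<Sum>w\<in>U. \<Sum>s\<in>U. of_bool (w \<in> P i) * of_bool (s * w \<in> P i))"
    unfolding m_def by (rule sum.swap)
  also have "\<dots> = (\<Sum>w\<in>U. of_bool (w \<in> P i) * (\<Sum>s\<in>U. of_bool (s \<in> P i)))"
    by (rule sum.cong[OF refl], subst sum_distrib_left[symmetric], subst sum_mult_U') auto
  also have "\<dots> = (p i)\<^sup>2" by (simp add: sum_of_bool_P sum_distrib_right[symmetric] power2_eq_square)
  finally show ?thesis .
qed

text \<open>Three independent sources: each \<open>m i s\<close> is at most \<open>p i\<close>; over
  all \<open>s\<close> they add up to the number of pairs in \<open>P i\<close>; and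
  \<open>4 ^ i * m i s\<close> is a part of \<open>eps s\<close>. The next two lemmas take weighted
  geometric means of them.\<close>

lemma class_sum_bounds:
  assumes "X \<subseteq> U" "\<And>s. s \<in> X \<Longrightarrow> 2 ^ l \<le> real (eps s)" "\<And>s. s \<in> X \<Longrightarrow> real (eps s) \<le> 2 * 2 ^ l"
  shows "(\<Sum>s\<in>X. m i s) \<le> real (card (R (2 ^ l))) * p i" "(\<Sum>s\<in>X. m i s) \<le> (p i)\<^sup>2"
    "4 ^ i * (\<Sum>s\<in>X. m i s) \<le> 2 * 2 ^ l * real (card (R (2 ^ l)))"
proof -
  have XR: "X \<subseteq> R (2 ^ l)" using assms by (auto simp: R_def)
  then have c: "real (card X) \<le> real (card (R (2 ^ l)))" using finite_R by (intro of_nat_mono card_mono) auto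
  have fX: "finite X" using assms(1) finU finite_subset by blast
  have "(\<Sum>s\<in>X. m i s) \<le> (\<Sum>s\<in>X. p i)" by (intro sum_mono m_le_p)
  also have "\<dots> \<le> real (card (R (2 ^ l))) * p i" using c by (simp add: mult_right_mono)
  finally show "(\<Sum>s\<in>X. m i s) \<le> real (card (R (2 ^ l))) * p i" .
  have "(\<Sum>s\<in>X. m i s) \<le> (\<Sum>s\<in>U. m i s)" by (rule sum_mono2) (use assms m_nonneg in auto)
  then show "(\<Sum>s\<in>X. m i s) \<le> (p i)\<^sup>2" by (simp add: sum_m)
  have "4 ^ i * (\<Sum>s\<in>X. m i s) \<le> (\<Sum>s\<in>X. 2 * 2 ^ l)"
    unfolding sum_distrib_left
  proof (rule sum_mono)
    fix s assume s: "s \<in> X"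
    then have "s \<in> U" using assms by blast
    from m_le_eps[OF this, of i] assms(3)[OF s] show "4 ^ i * m i s \<le> 2 * 2 ^ l" by linarith
  qed
  also have "\<dots> \<le> 2 * 2 ^ l * real (card (R (2 ^ l)))" using c by (simp add: mult.commute mult_left_mono)
  finally show "4 ^ i * (\<Sum>s\<in>X. m i s) \<le> 2 * 2 ^ l * real (card (R (2 ^ l)))" .
qed

text \<open>One factor is estimated by the number of pairs and three by the correlation, which makes
  the powers of \<open>2 ^ i\<close> and \<open>p i\<close> combine to \<open>p i * 8 ^ i\<close>.
  With \<open>card_R_bound\<close> a power of \<open>2 ^ l\<close> survives, so this is for small
  \<open>l\<close>.\<close>

lemma class_bound_low:
  assumes X: "X \<subseteq> U" "\<And>s. s \<in> X \<Longrightarrow> 2 ^ l \<le> real (eps s)" "\<And>s. s \<in> X \<Longrightarrow> real (eps s) \<le> 2 * 2 ^ l"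
  shows "(64 ^ i * p i * 4 ^ l * (\<Sum>s\<in>X. m i s)) ^ 4 \<le> L ^ 26 * t ^ 36 * (2 ^ l) ^ 5"
proof -
  define a :: real where "a = 2 ^ i"
  define b :: real where "b = 2 ^ l"
  let ?m = "\<Sum>s\<in>X. m i s" and ?R = "real (card (R (2 ^ l)))"
  have a: "0 < a" "64 ^ i = a ^ 6" "4 ^ i = a\<^sup>2" "8 ^ i = a ^ 3"
  proof -
    have "(64::real) ^ i = (8 ^ i)\<^sup>2" by (simp add: power2_eq_square flip: power_mult_distrib)
    then show "64 ^ i = a ^ 6" unfolding power_8_eq a_def by (simp flip: power_mult)
  qed (auto simp: a_def power_4_eq power_8_eq)
  have b: "0 < b" "4 ^ l = b\<^sup>2" by (auto simp: b_def power_4_eq)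
  have m0: "0 \<le> ?m" by (intro sum_nonneg m_nonneg)
  have m1: "?m \<le> (p i)\<^sup>2" and m2: "a\<^sup>2 * ?m \<le> 2 * b * ?R"
    using class_sum_bounds(2,3)[OF X, of i] by (simp_all add: a b_def)
  have Rb: "?R * b\<^sup>2 \<le> 16 * L ^ 4 * t ^ 6" using card_R_bound[of "2 ^ l"] by (simp add: b_def)
  have Pb: "p i * a ^ 3 \<le> L\<^sup>2 * t ^ 3" using card_P[of i] by (simp add: a)
  have "(64 ^ i * p i * 4 ^ l * ?m) ^ 4 = a ^ 18 * (p i) ^ 4 * b ^ 8 * (?m * (a\<^sup>2 * ?m) ^ 3)"
    unfolding a(2) b(2) by (simp add: power_numeral_reduce mult_ac)
  also have "\<dots> \<le> a ^ 18 * (p i) ^ 4 * b ^ 8 * ((p i)\<^sup>2 * (2 * b * ?R) ^ 3)"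
    by (rule mult_left_mono[OF mult_mono[OF m1 power_mono[OF m2]]]) (use a b m0 in auto)
  also have "\<dots> = 8 * (p i * a ^ 3) ^ 6 * (?R * b\<^sup>2) ^ 3 * b ^ 5"
    by (simp add: power_numeral_reduce mult_ac)
  also have "\<dots> \<le> 8 * (L\<^sup>2 * t ^ 3) ^ 6 * (16 * L ^ 4 * t ^ 6) ^ 3 * b ^ 5"
    by (intro mult_right_mono mult_mono mult_left_mono power_mono Pb Rb) (use a b L_pos in auto)
  also have "\<dots> = 32768 * (L ^ 24 * t ^ 36 * b ^ 5)"
    by (simp add: power_mult_distrib flip: power_mult power_add) (simp add: mult_ac flip: power_add)
  also have "\<dots> \<le> L\<^sup>2 * (L ^ 24 * t ^ 36 * b ^ 5)"
  proof (rule mult_right_mono)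
    have "(1024::real)\<^sup>2 \<le> L\<^sup>2" using L by (intro power_mono) auto
    then show "32768 \<le> L\<^sup>2" by simp
  qed (use b L_pos in auto)
  also have "\<dots> = L ^ 26 * t ^ 36 * b ^ 5" by (simp add: mult.assoc flip: power_add)
  finally show ?thesis by (simp add: b_def)
qed

text \<open>Using the three estimates two, one and three times produces
  \<open>?R ^ 5 * b ^ 15\<close> besides powers of \<open>p i * 8 ^ i\<close>. Its square is what
  \<open>card_R_bound_large\<close> controls, so that nothing depends on \<open>l\<close> any
  more.\<close>

lemma class_bound_high:
  assumes X: "X \<subseteq> U" "\<And>s. s \<in> X \<Longrightarrow> 2 ^ l \<le> real (eps s)" "\<And>s. s \<in> X \<Longrightarrow> real (eps s) \<le> 2 * 2 ^ l"
    and l: "4096 * L * t\<^sup>2 \<le> 2 ^ l"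
  shows "(64 ^ i * p i * 4 ^ l * (\<Sum>s\<in>X. m i s)) ^ 12 * E ^ 9 \<le> L ^ 151 * t ^ 166"
proof -
  define a :: real where "a = 2 ^ i"
  define b :: real where "b = 2 ^ l"
  let ?m = "\<Sum>s\<in>X. m i s" and ?R = "real (card (R (2 ^ l)))"
  have a: "0 < a" "64 ^ i = a ^ 6" "4 ^ i = a\<^sup>2" "8 ^ i = a ^ 3"
  proof -
    have "(64::real) ^ i = (8 ^ i)\<^sup>2" by (simp add: power2_eq_square flip: power_mult_distrib)
    then show "64 ^ i = a ^ 6" unfolding power_8_eq a_def by (simp flip: power_mult)
  qed (auto simp: a_def power_4_eq power_8_eq)
  have b: "0 < b" "4 ^ l = b\<^sup>2" by (auto simp: b_def power_4_eq)
  have m0: "0 \<le> ?m" by (intro sum_nonneg m_nonneg)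
  have m1: "?m \<le> ?R * p i" and m2: "?m \<le> (p i)\<^sup>2" and m3: "a\<^sup>2 * ?m \<le> 2 * b * ?R"
    using class_sum_bounds[OF X, of i] by (simp_all add: a b_def)
  have Rb: "?R ^ 10 * b ^ 30 * E ^ 9 \<le> L ^ 110 * t ^ 106" using card_R_bound_large[OF l] by (simp add: b_def)
  have Pb: "p i * a ^ 3 \<le> L\<^sup>2 * t ^ 3" using card_P[of i] by (simp add: a)
  have "(64 ^ i * p i * 4 ^ l * ?m) ^ 6 = a ^ 30 * (p i) ^ 6 * b ^ 12 * (?m\<^sup>2 * (?m * (a\<^sup>2 * ?m) ^ 3))"
    unfolding a(2) b(2) by (simp add: power_numeral_reduce mult_ac)
  also have "\<dots> \<le> a ^ 30 * (p i) ^ 6 * b ^ 12 * ((?R * p i)\<^sup>2 * ((p i)\<^sup>2 * (2 * b * ?R) ^ 3))"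
    by (rule mult_left_mono[OF mult_mono[OF power_mono[OF m1] mult_mono[OF m2 power_mono[OF m3]]]])
       (use a b m0 in auto)
  also have "\<dots> = 8 * (p i * a ^ 3) ^ 10 * (?R ^ 5 * b ^ 15)"
    by (simp add: power_numeral_reduce mult_ac)
  finally have "((64 ^ i * p i * 4 ^ l * ?m) ^ 6)\<^sup>2 \<le> (8 * (p i * a ^ 3) ^ 10 * (?R ^ 5 * b ^ 15))\<^sup>2"
    by (rule power_mono) simp
  then have "(64 ^ i * p i * 4 ^ l * ?m) ^ 12 \<le> (8 * (p i * a ^ 3) ^ 10 * (?R ^ 5 * b ^ 15))\<^sup>2"
    by (simp flip: power_mult)
  then have "(64 ^ i * p i * 4 ^ l * ?m) ^ 12 * E ^ 9 \<le> (8 * (p i * a ^ 3) ^ 10 * (?R ^ 5 * b ^ 15))\<^sup>2 * E ^ 9"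
    using E_pos by (intro mult_right_mono) auto
  also have "\<dots> = 64 * (p i * a ^ 3) ^ 20 * (?R ^ 10 * b ^ 30 * E ^ 9)"
    by (simp add: power_mult_distrib flip: power_mult)
  also have "\<dots> \<le> 64 * (L\<^sup>2 * t ^ 3) ^ 20 * (L ^ 110 * t ^ 106)"
    by (intro mult_mono mult_left_mono power_mono Pb Rb) (use a b L_pos E_pos in auto)
  also have "\<dots> = 64 * (L ^ 150 * t ^ 166)"
    by (simp add: power_mult_distrib flip: power_mult power_add) (simp add: mult_ac flip: power_add)
  also have "\<dots> \<le> L * (L ^ 150 * t ^ 166)" using L L_pos by (intro mult_right_mono) auto
  also have "\<dots> = L ^ 151 * t ^ 166" by (simp add: mult.assoc flip: power_Suc)
  finally show ?thesis .
qed

text \<open>Truncating at \<open>H\<close> of order \<open>t\<^sup>3 / E\<close> loses only a small part of the energy (\<open>tail_energy\<close>).\<close>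

definition h :: "real \<Rightarrow> 'a \<Rightarrow> real"
  where "h H x = (if x \<in> U \<and> rep G x \<le> H then rep G x else 0)"

lemma h_nonneg [simp]: "0 \<le> h H x" by (simp add: h_def)

lemma h_le: "h H x \<le> rep G x" "0 \<le> H \<Longrightarrow> h H x \<le> H" by (auto simp: h_def)

lemma h_mult: "g \<in> G \<Longrightarrow> x \<in> F \<Longrightarrow> h H (g * x) = h H x"
proof -
  assume g: "g \<in> G" and x: "x \<in> F"
  have "g * x \<in> U \<longleftrightarrow> x \<in> U" using U_cancel[OF G_F(3)[OF g], of x 0] x F_0 F_mult[OF G_F(1)[OF g] x] by auto
  then show ?thesis by (simp add: h_def rep_mult[OF g x])
qed

text \<open>By \<open>card_P\<close> the energy carried by the level \<open>2 ^ i\<close> is at most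
  a multiple of \<open>L^2 * t^3 / 2^i\<close>, and only levels with \<open>2 ^ i\<close> above
  \<open>H / 2\<close> contribute.\<close>

lemma tail_energy:
  assumes H: "0 < H"
  shows "(\<Sum>x\<in>U. (rep G x)\<^sup>2 * of_bool (H < rep G x)) \<le> 8 * L ^ 3 * t ^ 3 / H"
proof -
  have "(\<Sum>x\<in>U. (rep G x)\<^sup>2 * of_bool (H < rep G x)) = (\<Sum>i<J. \<Sum>x\<in>P i. (rep G x)\<^sup>2 * of_bool (H < rep G x))"
    by (rule sum_U_dyadic) auto
  also have "\<dots> \<le> (\<Sum>i<J. 8 * L\<^sup>2 * t ^ 3 / H)"
  proof (rule sum_mono)
    fix i
    show "(\<Sum>x\<in>P i. (rep G x)\<^sup>2 * of_bool (H < rep G x)) \<le> 8 * L\<^sup>2 * t ^ 3 / H"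
    proof (cases "H < 2 * 2 ^ i")
      case True
      have "(\<Sum>x\<in>P i. (rep G x)\<^sup>2 * of_bool (H < rep G x)) \<le> (\<Sum>x\<in>P i. (2 * 2 ^ i)\<^sup>2 * 1)"
        by (intro sum_mono mult_mono power_mono rep_P) auto
      also have "\<dots> = 4 * (p i * 4 ^ i)" by (simp add: power_4_eq power_mult_distrib)
      finally have "(\<Sum>x\<in>P i. (rep G x)\<^sup>2 * of_bool (H < rep G x)) * H \<le> 4 * (p i * 4 ^ i) * H"
        using H by (intro mult_right_mono) auto
      also have "\<dots> \<le> 4 * (p i * 4 ^ i) * (2 * 2 ^ i)" using True by (intro mult_left_mono) auto
      also have "\<dots> = 8 * (p i * 8 ^ i)" unfolding power_4_eq power_8_eq by (simp add: power2_eq_square power3_eq_cube)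
      also have "\<dots> \<le> 8 * L\<^sup>2 * t ^ 3" using card_P[of i] by linarith
      finally show ?thesis using H by (simp add: pos_le_divide_eq)
    next
      case False
      have "(\<Sum>x\<in>P i. (rep G x)\<^sup>2 * of_bool (H < rep G x)) = 0"
        by (rule sum.neutral) (use False rep_P(2)[of _ i] in force)
      then show ?thesis using H L_pos by simp
    qed
  qed
  also have "\<dots> = real J * (8 * L\<^sup>2 * t ^ 3 / H)" by simp
  also have "\<dots> \<le> L * (8 * L\<^sup>2 * t ^ 3 / H)" using L H L_pos by (intro mult_right_mono) auto
  finally show ?thesis by (simp add: power_numeral_reduce mult_ac)
qed

section \<open>Pairs of differences with a popular difference\<close>

definition Y :: "real \<Rightarrow> nat \<Rightarrow> real"
  where "Y H i = (\<Sum>u\<in>U. \<Sum>v\<in>U. (h H u)\<^sup>2 * (h H v)\<^sup>2 * of_bool (u - v \<in> P i))"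

text \<open>Substituting \<open>u = a x\<close> and \<open>v = r b x\<close> with \<open>a, b \<in> G\<close> in \<open>Y\<close>, invariance under \<open>G\<close> leaves the weight
  \<open>om H i (r, z)\<close> on each solution of \<open>a - r * b = z\<close>.\<close>

definition om :: "real \<Rightarrow> nat \<Rightarrow> 'a \<times> 'a \<Rightarrow> real"
  where "om H i = (\<lambda>(r, z). \<Sum>x\<in>U. (h H x)\<^sup>2 * (h H (r * x))\<^sup>2 * of_bool (z * x \<in> P i))"

lemma Y_eq_weighted: "t\<^sup>2 * Y H i = (\<Sum>(r, z)\<in>U \<times> U. om H i (r, z) * q r z)"
proof -
  let ?h = "\<lambda>x. (h H x)\<^sup>2"
  have "(\<Sum>(r, z)\<in>U \<times> U. om H i (r, z) * q r z) =
    (\<Sum>r\<in>U. \<Sum>z\<in>U. \<Sum>x\<in>U. ?h x * ?h (r * x) * of_bool (z * x \<in> P i) * q r z)"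
    by (simp only: om_def sum.cartesian_product[symmetric] prod.case sum_distrib_right)
  also have "\<dots> = (\<Sum>r\<in>U. \<Sum>x\<in>U. \<Sum>z\<in>U. ?h x * ?h (r * x) * of_bool (z * x \<in> P i) * q r z)"
    by (rule sum.cong[OF refl], rule sum.swap)
  also have "\<dots> = (\<Sum>r\<in>U. \<Sum>x\<in>U. \<Sum>a\<in>G. \<Sum>b\<in>G. ?h x * ?h (r * x) * of_bool ((a - r * b) * x \<in> P i))"
  proof (rule sum.cong[OF refl], rule sum.cong[OF refl])
    fix r x assume r: "r \<in> U" and x: "x \<in> U"
    have "(\<Sum>z\<in>U. ?h x * ?h (r * x) * of_bool (z * x \<in> P i) * q r z) =
      ?h x * ?h (r * x) * (\<Sum>z\<in>U. q r z * of_bool (z * x \<in> P i))"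
      by (simp only: sum_distrib_left mult_ac)
    also have "(\<Sum>z\<in>U. q r z * of_bool (z * x \<in> P i)) = (\<Sum>z\<in>F. q r z * of_bool (z * x \<in> P i))"
      unfolding sum_F_U[of "\<lambda>z. q r z * of_bool (z * x \<in> P i)"] using P_sub[of i] by auto
    also have "\<dots> = (\<Sum>a\<in>G. \<Sum>b\<in>G. of_bool ((a - r * b) * x \<in> P i))"
      by (rule sum_line_q[symmetric]) (use r in auto)
    finally show "(\<Sum>z\<in>U. ?h x * ?h (r * x) * of_bool (z * x \<in> P i) * q r z) =
      (\<Sum>a\<in>G. \<Sum>b\<in>G. ?h x * ?h (r * x) * of_bool ((a - r * b) * x \<in> P i))"
      by (simp only: sum_distrib_left)
  qed
  also have "\<dots> = (\<Sum>r\<in>U. \<Sum>a\<in>G. \<Sum>x\<in>U. \<Sum>b\<in>G. ?h x * ?h (r * x) * of_bool ((a - r * b) * x \<in> P i))"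
    by (rule sum.cong[OF refl], rule sum.swap)
  also have "\<dots> = (\<Sum>a\<in>G. \<Sum>r\<in>U. \<Sum>x\<in>U. \<Sum>b\<in>G. ?h x * ?h (r * x) * of_bool ((a - r * b) * x \<in> P i))"
    by (rule sum.swap)
  also have "\<dots> = (\<Sum>a\<in>G. \<Sum>r\<in>U. \<Sum>b\<in>G. \<Sum>x\<in>U. ?h x * ?h (r * x) * of_bool ((a - r * b) * x \<in> P i))"
    by (rule sum.cong[OF refl], rule sum.cong[OF refl], rule sum.swap)
  also have "\<dots> = (\<Sum>a\<in>G. \<Sum>b\<in>G. \<Sum>r\<in>U. \<Sum>x\<in>U. ?h x * ?h (r * x) * of_bool ((a - r * b) * x \<in> P i))"
    by (rule sum.cong[OF refl], rule sum.swap)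
  also have "\<dots> = (\<Sum>a\<in>G. \<Sum>b\<in>G. Y H i)"
  proof (rule sum.cong[OF refl], rule sum.cong[OF refl])
    fix a b assume a: "a \<in> G" and b: "b \<in> G"
    have "(\<Sum>r\<in>U. \<Sum>x\<in>U. ?h x * ?h (r * x) * of_bool ((a - r * b) * x \<in> P i)) =
      (\<Sum>x\<in>U. \<Sum>r\<in>U. ?h x * (?h (r * x) * of_bool (a * x - b * (r * x) \<in> P i)))"
      by (subst sum.swap) (simp only: left_diff_distrib right_diff_distrib mult_ac)
    also have "\<dots> = (\<Sum>x\<in>U. ?h x * (\<Sum>r\<in>U. ?h (r * x) * of_bool (a * x - b * (r * x) \<in> P i)))"
      by (simp only: sum_distrib_left)
    also have "\<dots> = (\<Sum>x\<in>U. ?h x * (\<Sum>v\<in>U. ?h v * of_bool (a * x - v \<in> P i)))"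
    proof (rule sum.cong[OF refl])
      fix x assume x: "x \<in> U"
      have "(\<Sum>r\<in>U. ?h (r * x) * of_bool (a * x - b * (r * x) \<in> P i)) =
        (\<Sum>v\<in>U. ?h v * of_bool (a * x - b * v \<in> P i))"
        by (rule sum_mult_U'[OF x])
      also have "\<dots> = (\<Sum>v\<in>U. ?h (b * v) * of_bool (a * x - b * v \<in> P i))"
        by (rule sum.cong[OF refl]) (use b in \<open>auto simp: h_mult\<close>)
      also have "\<dots> = (\<Sum>v\<in>U. ?h v * of_bool (a * x - v \<in> P i))"
        by (rule sum_mult_U[OF G_F(3)[OF b]])
      finally show "?h x * (\<Sum>r\<in>U. ?h (r * x) * of_bool (a * x - b * (r * x) \<in> P i)) =
        ?h x * (\<Sum>v\<in>U. ?h v * of_bool (a * x - v \<in> P i))" by simp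
    qed
    also have "\<dots> = (\<Sum>x\<in>U. ?h (a * x) * (\<Sum>v\<in>U. ?h v * of_bool (a * x - v \<in> P i)))"
      by (rule sum.cong[OF refl]) (use a in \<open>auto simp: h_mult\<close>)
    also have "\<dots> = (\<Sum>u\<in>U. ?h u * (\<Sum>v\<in>U. ?h v * of_bool (u - v \<in> P i)))"
      by (rule sum_mult_U[OF G_F(3)[OF a]])
    also have "\<dots> = Y H i" unfolding Y_def by (simp only: sum_distrib_left mult.assoc)
    finally show "(\<Sum>r\<in>U. \<Sum>x\<in>U. ?h x * ?h (r * x) * of_bool ((a - r * b) * x \<in> P i)) = Y H i" .
  qed
  also have "\<dots> = t\<^sup>2 * Y H i" by (simp add: power2_eq_square)
  finally show ?thesis ..
qed

lemma sum_h_squared_le: "(\<Sum>x\<in>U. (h H x)\<^sup>2) \<le> E"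
proof -
  have "(\<Sum>x\<in>U. (h H x)\<^sup>2) \<le> (\<Sum>x\<in>U. (rep G x)\<^sup>2)" by (intro sum_mono power_mono h_le) auto
  then show ?thesis unfolding energy_U using t_pos(3)[of 2] by linarith
qed

lemma sum_om_le: "(\<Sum>x\<in>U \<times> U. om H i x) \<le> E\<^sup>2 * p i"
proof -
  let ?h = "\<lambda>x. (h H x)\<^sup>2"
  have "(\<Sum>x\<in>U \<times> U. om H i x) = (\<Sum>r\<in>U. \<Sum>z\<in>U. \<Sum>x\<in>U. ?h x * ?h (r * x) * of_bool (z * x \<in> P i))"
    by (simp add: om_def sum.cartesian_product)
  also have "\<dots> = (\<Sum>r\<in>U. \<Sum>x\<in>U. \<Sum>z\<in>U. ?h x * ?h (r * x) * of_bool (z * x \<in> P i))"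
    by (rule sum.cong[OF refl], rule sum.swap)
  also have "\<dots> = (\<Sum>r\<in>U. \<Sum>x\<in>U. ?h x * ?h (r * x) * p i)"
  proof (rule sum.cong[OF refl], rule sum.cong[OF refl])
    fix r x assume x: "x \<in> U"
    have "(\<Sum>z\<in>U. of_bool (z * x \<in> P i)) = p i"
      using sum_mult_U'[OF x, of "\<lambda>z. of_bool (z \<in> P i) :: real"] sum_of_bool_P by simp
    then show "(\<Sum>z\<in>U. ?h x * ?h (r * x) * of_bool (z * x \<in> P i)) = ?h x * ?h (r * x) * p i"
      by (simp only: sum_distrib_left[symmetric])
  qed
  also have "\<dots> = (\<Sum>x\<in>U. \<Sum>r\<in>U. ?h x * ?h (r * x) * p i)" by (rule sum.swap)
  also have "\<dots> = (\<Sum>x\<in>U. ?h x * (\<Sum>r\<in>U. ?h r) * p i)"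
    by (rule sum.cong[OF refl]) (simp only: sum_distrib_left[symmetric] sum_distrib_right[symmetric] sum_mult_U'[where g = ?h])
  also have "\<dots> = (\<Sum>x\<in>U. ?h x) * (\<Sum>r\<in>U. ?h r) * p i" by (simp only: sum_distrib_right)
  also have "\<dots> \<le> E * E * p i"
    by (intro mult_right_mono mult_mono sum_h_squared_le) (use E_pos in \<open>auto intro: sum_nonneg\<close>)
  finally show ?thesis by (simp add: power2_eq_square)
qed

text \<open>In the square, the second variable is written as \<open>s * x\<close>. Multiplicative
  substitutions then separate the sums: \<open>z\<close> yields \<open>m i s\<close>, while
  \<open>r\<close> and \<open>x\<close> yield one factor \<open>g s\<close> each. The truncation
  enters in \<open>g s <= H^2 * eps s\<close>, where a product of four values of \<open>h\<close> is
  reduced to one of two values of \<open>rep\<close>.\<close>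

lemma sum_om_squared_le:
  assumes H: "0 \<le> H"
  shows "(\<Sum>x\<in>U \<times> U. (om H i x)\<^sup>2) \<le> H ^ 4 * W i"
proof -
  let ?h = "\<lambda>x. (h H x)\<^sup>2"
  let ?b = "\<lambda>x. of_bool (x \<in> P i) :: real"
  define g where "g s = (\<Sum>x\<in>U. ?h x * ?h (s * x))" for s
  have sq: "(om H i (r, z))\<^sup>2 = (\<Sum>s\<in>U. \<Sum>x\<in>U. (?h x * ?h (s * x)) * (?h (r * x) * ?h (s * (r * x))) * (?b (z * x) * ?b (s * (z * x))))"
    if "r \<in> U" "z \<in> U" for r z
  proof -
    have "(om H i (r, z))\<^sup>2 = (\<Sum>x\<in>U. ?h x * ?h (r * x) * ?b (z * x) * (\<Sum>y\<in>U. ?h y * ?h (r * y) * ?b (z * y)))"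
      by (simp only: om_def prod.case power2_eq_square[of "sum _ _"] sum_distrib_right)
    also have "\<dots> = (\<Sum>x\<in>U. ?h x * ?h (r * x) * ?b (z * x) * (\<Sum>s\<in>U. ?h (s * x) * ?h (r * (s * x)) * ?b (z * (s * x))))"
      by (rule sum.cong[OF refl])
         (subst sum_mult_U'[where g = "\<lambda>y. ?h y * ?h (r * y) * ?b (z * y)", symmetric], auto)
    also have "\<dots> = (\<Sum>x\<in>U. \<Sum>s\<in>U. (?h x * ?h (s * x)) * (?h (r * x) * ?h (s * (r * x))) * (?b (z * x) * ?b (s * (z * x))))"
      by (simp only: sum_distrib_left mult_ac)
    also have "\<dots> = (\<Sum>s\<in>U. \<Sum>x\<in>U. (?h x * ?h (s * x)) * (?h (r * x) * ?h (s * (r * x))) * (?b (z * x) * ?b (s * (z * x))))"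
      by (rule sum.swap)
    finally show ?thesis .
  qed
  have "(\<Sum>x\<in>U \<times> U. (om H i x)\<^sup>2) = (\<Sum>r\<in>U. \<Sum>z\<in>U. (om H i (r, z))\<^sup>2)"
    by (simp add: sum.cartesian_product split_def)
  also have "\<dots> = (\<Sum>r\<in>U. \<Sum>z\<in>U. \<Sum>s\<in>U. \<Sum>x\<in>U. (?h x * ?h (s * x)) * (?h (r * x) * ?h (s * (r * x))) * (?b (z * x) * ?b (s * (z * x))))"
    by (intro sum.cong refl sq)
  also have "\<dots> = (\<Sum>r\<in>U. \<Sum>s\<in>U. \<Sum>z\<in>U. \<Sum>x\<in>U. (?h x * ?h (s * x)) * (?h (r * x) * ?h (s * (r * x))) * (?b (z * x) * ?b (s * (z * x))))"
    by (rule sum.cong[OF refl], rule sum.swap)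
  also have "\<dots> = (\<Sum>s\<in>U. \<Sum>r\<in>U. \<Sum>z\<in>U. \<Sum>x\<in>U. (?h x * ?h (s * x)) * (?h (r * x) * ?h (s * (r * x))) * (?b (z * x) * ?b (s * (z * x))))"
    by (rule sum.swap)
  also have "\<dots> = (\<Sum>s\<in>U. \<Sum>r\<in>U. \<Sum>x\<in>U. \<Sum>z\<in>U. (?h x * ?h (s * x)) * (?h (r * x) * ?h (s * (r * x))) * (?b (z * x) * ?b (s * (z * x))))"
    by (rule sum.cong[OF refl], rule sum.cong[OF refl], rule sum.swap)
  also have "\<dots> = (\<Sum>s\<in>U. \<Sum>r\<in>U. \<Sum>x\<in>U. (?h x * ?h (s * x)) * (?h (r * x) * ?h (s * (r * x))) * m i s)"
  proof (rule sum.cong[OF refl], rule sum.cong[OF refl], rule sum.cong[OF refl])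
    fix s r x assume x: "x \<in> U"
    have "(\<Sum>z\<in>U. ?b (z * x) * ?b (s * (z * x))) = m i s"
      unfolding m_def by (rule sum_mult_U'[OF x])
    then show "(\<Sum>z\<in>U. (?h x * ?h (s * x)) * (?h (r * x) * ?h (s * (r * x))) * (?b (z * x) * ?b (s * (z * x)))) =
      (?h x * ?h (s * x)) * (?h (r * x) * ?h (s * (r * x))) * m i s"
      by (simp only: sum_distrib_left[symmetric])
  qed
  also have "\<dots> = (\<Sum>s\<in>U. \<Sum>x\<in>U. \<Sum>r\<in>U. (?h x * ?h (s * x)) * (?h (r * x) * ?h (s * (r * x))) * m i s)"
    by (rule sum.cong[OF refl], rule sum.swap)
  also have "\<dots> = (\<Sum>s\<in>U. \<Sum>x\<in>U. (?h x * ?h (s * x)) * g s * m i s)"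
  proof (rule sum.cong[OF refl], rule sum.cong[OF refl])
    fix s x assume x: "x \<in> U"
    have "(\<Sum>r\<in>U. ?h (r * x) * ?h (s * (r * x))) = g s"
      unfolding g_def by (rule sum_mult_U'[OF x])
    then show "(\<Sum>r\<in>U. (?h x * ?h (s * x)) * (?h (r * x) * ?h (s * (r * x))) * m i s) = (?h x * ?h (s * x)) * g s * m i s"
      by (simp only: sum_distrib_left[symmetric] sum_distrib_right[symmetric])
  qed
  also have "\<dots> = (\<Sum>s\<in>U. g s * g s * m i s)"
    unfolding g_def by (simp only: sum_distrib_right)
  also have "\<dots> \<le> (\<Sum>s\<in>U. H ^ 4 * ((real (eps s))\<^sup>2 * m i s))"
  proof (rule sum_mono)
    fix s assume s: "s \<in> U"
    have "g s \<le> (\<Sum>x\<in>U. H\<^sup>2 * (rep G x * rep G (s * x)))"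
      unfolding g_def
    proof (rule sum_mono)
      fix x
      have "?h x * ?h (s * x) = (h H x * h H (s * x)) * (h H x * h H (s * x))" by (simp add: power2_eq_square)
      also have "\<dots> \<le> (H * H) * (rep G x * rep G (s * x))"
        using H by (intro mult_mono h_le) auto
      finally show "?h x * ?h (s * x) \<le> H\<^sup>2 * (rep G x * rep G (s * x))" by (simp add: power2_eq_square)
    qed
    also have "\<dots> = H\<^sup>2 * real (eps s)" by (simp only: eps_eq sum_distrib_left)
    finally have g: "g s \<le> H\<^sup>2 * real (eps s)" .
    have "0 \<le> g s" unfolding g_def by (intro sum_nonneg) auto
    then have "g s * g s \<le> (H\<^sup>2 * real (eps s)) * (H\<^sup>2 * real (eps s))" using g by (intro mult_mono) auto
    then have "g s * g s * m i s \<le> (H\<^sup>2 * real (eps s)) * (H\<^sup>2 * real (eps s)) * m i s"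
      by (rule mult_right_mono) (rule m_nonneg)
    then show "g s * g s * m i s \<le> H ^ 4 * ((real (eps s))\<^sup>2 * m i s)"
      by (simp add: power2_eq_square power4_eq_xxxx mult_ac)
  qed
  also have "\<dots> = H ^ 4 * W i" by (simp add: W_def sum_distrib_left)
  finally show ?thesis .
qed

lemma W_le:
  assumes V: "0 \<le> V" "\<And>l. 64 ^ i * p i * 4 ^ l * (\<Sum>s\<in>dyadic_level eps U l. m i s) \<le> V"
  shows "64 ^ i * p i * W i \<le> 12 * L * V"
proof -
  have lt: "eps s < 2 ^ (3 * J)" if "s \<in> U" for s
  proof -
    have "real (eps s) \<le> t ^ 3" using eps_le_E[OF that] E_le by linarith
    then have "real (eps s) \<le> real (card G ^ 3)" by simp
    then have "eps s \<le> card G ^ 3" by (simp only: of_nat_le_iff)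
    also have "\<dots> < (2 ^ J) ^ 3" using card_G by (intro power_strict_mono) auto
    finally show ?thesis by (simp add: mult.commute flip: power_mult)
  qed
  \<comment> \<open>Correlations are at most \<open>E <= t^3\<close>, which is why
    \<open>3 * J\<close> classes suffice.\<close>
  have "W i = (\<Sum>l<3 * J. \<Sum>s\<in>dyadic_level eps U l. (real (eps s))\<^sup>2 * m i s)"
    unfolding W_def by (rule dyadic_sum) (auto simp: lt)
  also have "\<dots> \<le> (\<Sum>l<3 * J. 4 * (4 ^ l * (\<Sum>s\<in>dyadic_level eps U l. m i s)))"
  proof (rule sum_mono)
    fix l
    have "(\<Sum>s\<in>dyadic_level eps U l. (real (eps s))\<^sup>2 * m i s) \<le> (\<Sum>s\<in>dyadic_level eps U l. (2 * 2 ^ l)\<^sup>2 * m i s)"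
    proof (intro sum_mono mult_right_mono power_mono m_nonneg)
      fix s assume "s \<in> dyadic_level eps U l"
      then have "eps s \<le> 2 * 2 ^ l" by (auto simp: dyadic_level_def)
      then have "real (eps s) \<le> real (2 * 2 ^ l)" by (simp only: of_nat_le_iff)
      then show "real (eps s) \<le> 2 * 2 ^ l" by simp
    qed auto
    then show "(\<Sum>s\<in>dyadic_level eps U l. (real (eps s))\<^sup>2 * m i s) \<le> 4 * (4 ^ l * (\<Sum>s\<in>dyadic_level eps U l. m i s))"
      by (simp add: power_4_eq power_mult_distrib sum_distrib_left[symmetric])
  qed
  finally have "64 ^ i * p i * W i \<le> 64 ^ i * p i * (\<Sum>l<3 * J. 4 * (4 ^ l * (\<Sum>s\<in>dyadic_level eps U l. m i s)))"
    by (intro mult_left_mono) auto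
  also have "\<dots> = (\<Sum>l<3 * J. 4 * (64 ^ i * p i * 4 ^ l * (\<Sum>s\<in>dyadic_level eps U l. m i s)))"
    by (simp only: sum_distrib_left mult_ac)
  also have "\<dots> \<le> (\<Sum>l<3 * J. 4 * V)" by (intro sum_mono mult_left_mono V) auto
  also have "\<dots> = 12 * (real J * V)" by simp
  also have "\<dots> \<le> 12 * (L * V)" using L V by (intro mult_left_mono mult_right_mono) auto
  finally show ?thesis by simp
qed

text \<open>In \<open>weighted_q_sum_le\<close> the first moment is at most \<open>E^2 * p i\<close>
  and the second at most \<open>H^4 * W i\<close>. The factor \<open>4 ^ i\<close> makes both terms
  uniform in \<open>i\<close>: the first by \<open>p i * 4 ^ i <= E\<close>, the second because its
  cube contains \<open>64 ^ i * p i * W i\<close>.\<close>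

lemma Y_le:
  assumes V: "0 \<le> V" "\<And>l. 64 ^ i * p i * 4 ^ l * (\<Sum>s\<in>dyadic_level eps U l. m i s) \<le> V"
    and H: "0 \<le> H" and K: "0 \<le> K" "E\<^sup>2 * H ^ 4 * (12 * L * V) * (L * t ^ 4) \<le> K ^ 3"
  shows "t\<^sup>2 * (4 ^ i * Y H i) \<le> 1024 * E ^ 3 + 2 * L * K"
proof -
  define a :: real where "a = 4 ^ i"
  have a: "0 < a" "a ^ 3 = 64 ^ i" by (auto simp: a_def power_mult[symmetric] mult.commute[of i]) (simp add: power_mult)
  have "(\<Sum>(r, z)\<in>U \<times> U. om H i (r, z) * q r z) \<le> 1024 * (E\<^sup>2 * p i) + 2 * real J * (K / a)"
  proof (rule weighted_q_sum_le)
    show "0 \<le> om H i x" for x by (cases x) (simp add: om_def sum_nonneg)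
    show "(\<Sum>x\<in>U \<times> U. om H i x) \<le> E\<^sup>2 * p i" by (rule sum_om_le)
    show "(\<Sum>x\<in>U \<times> U. (om H i x)\<^sup>2) \<le> H ^ 4 * W i" by (rule sum_om_squared_le[OF H])
    show "0 \<le> K / a" using K a by simp
    have "a ^ 3 * (E\<^sup>2 * p i * (H ^ 4 * W i) * (L * t ^ 4)) = E\<^sup>2 * H ^ 4 * (64 ^ i * p i * W i) * (L * t ^ 4)"
      by (simp add: a)
    also have "\<dots> \<le> E\<^sup>2 * H ^ 4 * (12 * L * V) * (L * t ^ 4)"
      using W_le[OF V] H L_pos E_pos by (intro mult_right_mono mult_left_mono) auto
    also have "\<dots> \<le> K ^ 3" by (rule K)
    finally show "E\<^sup>2 * p i * (H ^ 4 * W i) * (L * t ^ 4) \<le> (K / a) ^ 3"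
      using a by (simp add: power_divide pos_le_divide_eq mult.commute)
  qed
  then have "t\<^sup>2 * Y H i \<le> 1024 * (E\<^sup>2 * p i) + 2 * real J * (K / a)" by (simp add: Y_eq_weighted)
  then have "a * (t\<^sup>2 * Y H i) \<le> a * (1024 * (E\<^sup>2 * p i) + 2 * real J * (K / a))"
    using a by (intro mult_left_mono) auto
  also have "\<dots> = 1024 * (E\<^sup>2 * (p i * a)) + 2 * (real J * K)" using a by (simp add: field_simps)
  also have "\<dots> \<le> 1024 * (E\<^sup>2 * E) + 2 * (L * K)"
    using card_P_energy[of i] L K by (intro add_mono mult_left_mono mult_right_mono) (auto simp: a_def)
  finally show ?thesis by (simp add: a_def power3_eq_cube power2_eq_square mult_ac)
qed

lemma rep_squared_le_levels:
  assumes "w \<in> U"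
  shows "(rep G w)\<^sup>2 \<le> (\<Sum>i<J. 4 * 4 ^ i * of_bool (w \<in> P i))"
proof (cases "diff_rep G w = 0")
  case True
  then show ?thesis by (simp add: rep_def sum_nonneg)
next
  case False
  then obtain i where i: "2 ^ i \<le> diff_rep G w" "diff_rep G w < 2 ^ Suc i"
    using dyadic_exponent[of "diff_rep G w"] by auto
  then have wP: "w \<in> P i" using assms by (auto simp: dyadic_level_def)
  have "(2::nat) ^ i < 2 ^ J" using i diff_rep_le_card[OF finG, of w] card_G by linarith
  then have iJ: "i < J" by (rule power_less_imp_less_exp[rotated]) simp
  have "(rep G w)\<^sup>2 \<le> (2 * 2 ^ i)\<^sup>2" by (intro power_mono rep_P wP) auto
  also have "\<dots> = 4 * 4 ^ i * of_bool (w \<in> P i)" using wP by (simp add: power_4_eq power_mult_distrib)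
  also have "\<dots> \<le> (\<Sum>i<J. 4 * 4 ^ i * of_bool (w \<in> P i))" using iJ by (intro member_le_sum) auto
  finally show ?thesis .
qed

section \<open>Assembling the exponent for subgroups\<close>

text \<open>Triples are weighted by two truncated factors and one full factor. Since
  \<open>h\<close> vanishes at zero, the only degenerate triples have \<open>x = x'\<close>; the
  first alternative is the case in which they dominate.\<close>

lemma energy_cubed_le:
  assumes E8: "8 * t\<^sup>2 \<le> E" and H: "H = 64 * L ^ 3 * t ^ 3 / E"
  shows "E ^ 3 \<le> L ^ 5 * t ^ 7 \<or> E ^ 6 \<le> 64 * L ^ 4 * t ^ 9 * (\<Sum>i<J. 4 * (4 ^ i * Y H i))"
proof -
  have H0: "0 < H" unfolding H using L_pos t_pos(2)[of 3] E_pos by (intro divide_pos_pos mult_pos_pos) auto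
  define \<delta> where "\<delta> = (\<Sum>b\<in>G. h H (e - e * b))"
  have deg: "(\<Sum>y\<in>G. h H (x - y)) = \<delta>" if x: "x \<in> G" for x
  proof -
    have "(\<Sum>y\<in>G. h H (x - y)) = (\<Sum>y\<in>G. h H (x - e * y))"
      by (rule sum.cong[OF refl]) (simp add: e_mult G_F)
    also have "\<dots> = \<delta>" unfolding \<delta>_def by (rule regular_sum[OF e_F(1) x h_mult])
    finally show ?thesis .
  qed
  have "t * \<delta> = (\<Sum>x\<in>G. \<Sum>y\<in>G. h H (x - y))" by (simp add: deg)
  also have "\<dots> = (\<Sum>x\<in>diff_set G. rep G x * h H x)" by (rule sum_diffs_eq) simp
  also have "\<dots> = (\<Sum>x\<in>F. rep G x * h H x)" by (rule sum_diff_set) simp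
  also have "\<dots> = (\<Sum>x\<in>U. rep G x * h H x)" by (subst sum_F_U) (simp add: h_def)
  also have "\<dots> = (\<Sum>x\<in>U. (rep G x)\<^sup>2) - (\<Sum>x\<in>U. (rep G x)\<^sup>2 * of_bool (H < rep G x))"
    unfolding sum_subtractf[symmetric] by (rule sum.cong[OF refl]) (auto simp: h_def power2_eq_square)
  finally have "t * \<delta> = E - t\<^sup>2 - (\<Sum>x\<in>U. (rep G x)\<^sup>2 * of_bool (H < rep G x))" by (simp add: energy_U)
  moreover have "8 * L ^ 3 * t ^ 3 / H = E / 8"
  proof -
    have "8 * c / (64 * c / E) = E / 8" if "0 < c" for c :: real
      using that by simp
    from this[of "L ^ 3 * t ^ 3"] show ?thesis
      unfolding H using L_pos t_pos(2)[of 3] by (simp only: mult.assoc) simp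
  qed
  \<comment> \<open>The zero difference and the tail above \<open>H\<close> take away at most
    \<open>E / 8\<close> each; this fixes the constant \<open>64\<close> in
    \<open>H\<close>.\<close>
  ultimately have "E / 2 \<le> t * \<delta>" using tail_energy[OF H0] E8 by linarith
  then have \<delta>: "(E / 2)\<^sup>2 \<le> (t * \<delta>)\<^sup>2" using E_pos by (intro power_mono) auto
  define S where "S = (\<Sum>y\<in>G. \<Sum>x\<in>G. \<Sum>x'\<in>G. h H (x - y) * h H (x' - y) * rep G (x - x'))"
  have "\<delta>\<^sup>2 * E \<le> t * S" unfolding S_def by (rule regular_triples_ge[OF finG finG]) (rule deg)
  then have "t\<^sup>2 * (\<delta>\<^sup>2 * E) \<le> t\<^sup>2 * (t * S)" by (rule mult_left_mono) simp
  moreover have "(E / 2)\<^sup>2 * E \<le> (t * \<delta>)\<^sup>2 * E" using \<delta> E_pos by (intro mult_right_mono) auto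
  ultimately have S: "E ^ 3 / 4 \<le> t ^ 3 * S"
    by (simp add: power2_eq_square power3_eq_cube mult_ac)
  define f where "f u v = h H u * h H v * (rep G (u - v) * of_bool (u \<noteq> v))" for u v
  define S1 where "S1 = (\<Sum>y\<in>G. \<Sum>x\<in>G. \<Sum>x'\<in>G. f (x - y) (x' - y))"
  have "S = t * (\<Sum>y\<in>G. \<Sum>x\<in>G. (h H (x - y))\<^sup>2) + S1"
  proof -
    have "S = (\<Sum>y\<in>G. \<Sum>x\<in>G. \<Sum>x'\<in>G. of_bool (x = x') * (t * (h H (x - y) * h H (x' - y))) + f (x - y) (x' - y))"
      unfolding S_def f_def by (intro sum.cong refl) (auto simp: rep_0)
    also have "\<dots> = (\<Sum>y\<in>G. \<Sum>x\<in>G. \<Sum>x'\<in>G. of_bool (x = x') * (t * (h H (x - y) * h H (x' - y)))) + S1"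
      by (simp only: sum.distrib S1_def)
    also have "(\<Sum>y\<in>G. \<Sum>x\<in>G. \<Sum>x'\<in>G. of_bool (x = x') * (t * (h H (x - y) * h H (x' - y)))) =
      (\<Sum>y\<in>G. \<Sum>x\<in>G. t * (h H (x - y) * h H (x - y)))"
      by (rule sum.cong[OF refl], rule sum.cong[OF refl], rule sum_of_bool_delta) auto
    finally show ?thesis by (simp only: sum_distrib_left power2_eq_square)
  qed
  moreover have "(\<Sum>y\<in>G. \<Sum>x\<in>G. (h H (x - y))\<^sup>2) \<le> L ^ 4 * t ^ 3"
  proof -
    have "(\<Sum>y\<in>G. \<Sum>x\<in>G. (h H (x - y))\<^sup>2) \<le> (\<Sum>y\<in>G. \<Sum>x\<in>G. (rep G (x - y))\<^sup>2)"
      by (intro sum_mono power_mono h_le) auto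
    also have "\<dots> = (\<Sum>x\<in>G. \<Sum>y\<in>G. (rep G (x - y))\<^sup>2)" by (rule sum.swap)
    also have "\<dots> = third_energy G"
      unfolding third_energy_def by (subst sum_diffs_eq) (auto simp: power2_eq_square power3_eq_cube mult_ac)
    finally show ?thesis using third_energy_le by linarith
  qed
  ultimately have "S \<le> t * (L ^ 4 * t ^ 3) + S1" by (smt (verit) t_pos(1) mult_left_mono)
  then have "t ^ 3 * S \<le> t ^ 3 * (t * (L ^ 4 * t ^ 3) + S1)" by (intro mult_left_mono) auto
  then have S': "E ^ 3 / 4 \<le> L ^ 4 * t ^ 7 + t ^ 3 * S1"
    using S by (simp add: power_numeral_reduce algebra_simps)
  show ?thesis
  proof (cases "E ^ 3 / 8 \<le> L ^ 4 * t ^ 7")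
    case True
    then have "E ^ 3 \<le> 8 * (L ^ 4 * t ^ 7)" by simp
    also have "\<dots> \<le> L * (L ^ 4 * t ^ 7)" using L L_pos by (intro mult_right_mono) auto
    finally show ?thesis by (simp add: power_numeral_reduce)
  next
    case False
    then have "E ^ 3 / 8 \<le> t ^ 3 * S1" using S' by linarith
    then have "(E ^ 3 / 8)\<^sup>2 \<le> (t ^ 3 * S1)\<^sup>2" using E_pos by (intro power_mono) auto
    also have "\<dots> = t ^ 6 * S1\<^sup>2" by (simp add: power_mult_distrib flip: power_mult)
    also have "S1\<^sup>2 \<le> (L ^ 4 * t ^ 3) * (\<Sum>(u, v)\<in>U \<times> U. (f u v)\<^sup>2)"
      unfolding S1_def by (rule triples_cauchy) (use third_energy_le in \<open>auto simp: f_def h_def split: if_splits\<close>)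
    also have "(\<Sum>(u, v)\<in>U \<times> U. (f u v)\<^sup>2) \<le> (\<Sum>i<J. 4 * (4 ^ i * Y H i))"
    proof -
      have "(\<Sum>(u, v)\<in>U \<times> U. (f u v)\<^sup>2) = (\<Sum>u\<in>U. \<Sum>v\<in>U. (f u v)\<^sup>2)"
        by (simp only: sum.cartesian_product)
      also have "\<dots> \<le> (\<Sum>u\<in>U. \<Sum>v\<in>U. \<Sum>i<J. (h H u)\<^sup>2 * (h H v)\<^sup>2 * (4 * 4 ^ i * of_bool (u - v \<in> P i)))"
      proof (intro sum_mono)
        fix u v assume u: "u \<in> U" and v: "v \<in> U"
        show "(f u v)\<^sup>2 \<le> (\<Sum>i<J. (h H u)\<^sup>2 * (h H v)\<^sup>2 * (4 * 4 ^ i * of_bool (u - v \<in> P i)))"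
        proof (cases "u = v")
          case True
          then show ?thesis by (simp add: f_def sum_nonneg)
        next
          case False
          then have "u - v \<in> U" using u v by (auto simp: F_diff)
          from rep_squared_le_levels[OF this]
          have "(h H u)\<^sup>2 * (h H v)\<^sup>2 * (rep G (u - v))\<^sup>2 \<le> (h H u)\<^sup>2 * (h H v)\<^sup>2 * (\<Sum>i<J. 4 * 4 ^ i * of_bool (u - v \<in> P i))"
            by (intro mult_left_mono) auto
          then show ?thesis using False by (simp only: sum_distrib_left f_def power_mult_distrib) simp
        qed
      qed
      also have "\<dots> = (\<Sum>u\<in>U. \<Sum>i<J. \<Sum>v\<in>U. (h H u)\<^sup>2 * (h H v)\<^sup>2 * (4 * 4 ^ i * of_bool (u - v \<in> P i)))"
        by (rule sum.cong[OF refl], rule sum.swap)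
      also have "\<dots> = (\<Sum>i<J. \<Sum>u\<in>U. \<Sum>v\<in>U. (h H u)\<^sup>2 * (h H v)\<^sup>2 * (4 * 4 ^ i * of_bool (u - v \<in> P i)))"
        by (rule sum.swap)
      also have "\<dots> = (\<Sum>i<J. 4 * (4 ^ i * Y H i))" unfolding Y_def by (simp only: sum_distrib_left mult_ac)
      finally show ?thesis .
    qed
    finally have "(E ^ 3 / 8)\<^sup>2 \<le> t ^ 6 * ((L ^ 4 * t ^ 3) * (\<Sum>i<J. 4 * (4 ^ i * Y H i)))"
      using L_pos by (simp add: mult_left_mono)
    then have "E ^ 6 \<le> 64 * (t ^ 6 * ((L ^ 4 * t ^ 3) * (\<Sum>i<J. 4 * (4 ^ i * Y H i))))"
      by (simp add: power_divide flip: power_mult)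
    then show ?thesis by (simp add: mult_ac power_numeral_reduce)
  qed
qed

text \<open>Correlations are split at \<open>t powr (239/100)\<close>. Its exponent must exceed
  \<open>2\<close> for \<open>card_R_bound_large\<close> to apply, and must stay below
  \<open>12/5\<close>, at which \<open>class_bound_low\<close> would lead to exactly
  \<open>49/20\<close>. The final exponent \<open>24499/10000\<close> leaves room on both sides,
  between \<open>610/249\<close> and \<open>49/20\<close>.\<close>

theorem energy_bound:
  assumes t2: "4096 * L * t\<^sup>2 \<le> t powr (239/100)"
  shows "E \<le> L ^ 4 * t powr (24499/10000)"
proof -
  have [simp]: "G \<noteq> {}" using e_G by auto
  \<comment> \<open>All estimates are comparisons of monomials in \<open>t\<close>, \<open>L\<close>
    and \<open>E\<close>; in terms of logarithms the conclusion becomes linear arithmetic.\<close>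
  define l\<^sub>t where "l\<^sub>t = ln t"
  define l\<^sub>L where "l\<^sub>L = ln L"
  define l\<^sub>E where "l\<^sub>E = ln E"
  have t: "t ^ n = exp (n * l\<^sub>t)" for n
    using t_pos(1) by (simp add: l\<^sub>t_def exp_of_nat_mult)
  have Lp: "L ^ n = exp (n * l\<^sub>L)" for n
    using L_pos by (simp add: l\<^sub>L_def exp_of_nat_mult)
  have Ep: "E ^ n = exp (n * l\<^sub>E)" for n
    using E_pos by (simp add: l\<^sub>E_def exp_of_nat_mult)
  have e1: "t = exp l\<^sub>t" "L = exp l\<^sub>L" "E = exp l\<^sub>E"
    using t[of 1] Lp[of 1] Ep[of 1] by auto
  have tp: "t powr x = exp (x * l\<^sub>t)" for x
    using t_pos(1) by (simp add: powr_def l\<^sub>t_def)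
  have nn: "0 \<le> l\<^sub>t" "0 \<le> l\<^sub>L"
    using t_ge_1 L_pos by (auto simp: l\<^sub>t_def l\<^sub>L_def simp del: of_nat_le_iff)
  have goal: ?thesis if "l\<^sub>E \<le> 4 * l\<^sub>L + 24499/10000 * l\<^sub>t"
  proof -
    have "E \<le> exp (4 * l\<^sub>L + 24499/10000 * l\<^sub>t)" unfolding e1(3) using that by simp
    also have "\<dots> = L ^ 4 * t powr (24499/10000)" unfolding Lp tp exp_add by simp
    finally show ?thesis .
  qed
  show ?thesis
  proof (cases "8 * t\<^sup>2 \<le> E")
    case False
    then have "E \<le> 8 * t\<^sup>2" by simp
    also have "\<dots> \<le> L * t\<^sup>2" using L by (intro mult_right_mono) auto
    also have "\<dots> = exp (l\<^sub>L + 2 * l\<^sub>t)" unfolding t exp_add e1(2)[symmetric] by simp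
    finally have "l\<^sub>E \<le> l\<^sub>L + 2 * l\<^sub>t" unfolding e1(3) by simp
    then show ?thesis using nn by (intro goal) linarith
  next
    case True
    define H where "H = 64 * L ^ 3 * t ^ 3 / E"
    have H0: "0 \<le> H" unfolding H_def using L_pos E_pos by simp
    have H_le: "H \<le> exp (4 * l\<^sub>L + 3 * l\<^sub>t - l\<^sub>E)"
    proof -
      have "H \<le> L * L ^ 3 * t ^ 3 / E" unfolding H_def
        using L L_pos E_pos by (intro divide_right_mono mult_right_mono) auto
      also have "\<dots> = L ^ 4 * t ^ 3 / E ^ 1" by (simp add: power_numeral_reduce)
      also have "\<dots> = exp (4 * l\<^sub>L + 3 * l\<^sub>t - l\<^sub>E)" unfolding t Lp Ep exp_add exp_diff by simp
      finally show ?thesis .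
    qed
    \<comment> \<open>The entries are the fourth root of the bound in \<open>class_bound_low\<close>
      at the splitting point, \<open>(36 + 5 * 239/100) / 4 = 959/80\<close>, and the twelfth root
      of the bound in \<open>class_bound_high\<close>, with the powers of \<open>L\<close> rounded
      up.\<close>
    define \<beta> where "\<beta> = max (7 * l\<^sub>L + 959/80 * l\<^sub>t) (13 * l\<^sub>L + 83/6 * l\<^sub>t - 3/4 * l\<^sub>E)"
    have V: "64 ^ i * p i * 4 ^ l * (\<Sum>s\<in>dyadic_level eps U l. m i s) \<le> exp \<beta>" (is "?v \<le> _") for i l
    proof -
      have v0: "0 \<le> ?v" by (simp add: sum_nonneg m_nonneg)
      have X: "dyadic_level eps U l \<subseteq> U" by (auto simp: dyadic_level_def)
      have X': "2 ^ l \<le> real (eps s)" "real (eps s) \<le> 2 * 2 ^ l" if "s \<in> dyadic_level eps U l" for s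
      proof -
        have "2 ^ l \<le> eps s" "eps s \<le> 2 * 2 ^ l" using that by (auto simp: dyadic_level_def)
        then have "real (2 ^ l) \<le> real (eps s)" "real (eps s) \<le> real (2 * 2 ^ l)"
          by (simp_all only: of_nat_le_iff)
        then show "2 ^ l \<le> real (eps s)" "real (eps s) \<le> 2 * 2 ^ l" by simp_all
      qed
      show ?thesis
      proof (cases "(2::real) ^ l \<le> t powr (239/100)")
        case True
        have "?v ^ 4 \<le> L ^ 26 * t ^ 36 * (2 ^ l) ^ 5"
          by (rule class_bound_low[OF X X'])
        also have "\<dots> \<le> L ^ 26 * t ^ 36 * (t powr (239/100)) ^ 5"
          using True L_pos by (intro mult_left_mono power_mono) auto
        also have "\<dots> = exp (26 * l\<^sub>L + 36 * l\<^sub>t + 5 * (239/100 * l\<^sub>t))"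
          unfolding t Lp tp exp_add exp_of_nat_mult[symmetric] by simp
        also have "\<dots> \<le> exp (4 * \<beta>)" using nn unfolding \<beta>_def by (simp add: max_def)
        also have "\<dots> = exp \<beta> ^ 4" using exp_of_nat_mult[of 4 \<beta>] by simp
        finally show ?thesis by (rule power_le_imp_le_base[of _ 3, simplified]) simp
      next
        case False
        then have l: "4096 * L * t\<^sup>2 \<le> 2 ^ l" using t2 by linarith
        have "?v ^ 12 * E ^ 9 \<le> L ^ 151 * t ^ 166"
          by (rule class_bound_high[OF X X' l])
        then have "?v ^ 12 \<le> L ^ 151 * t ^ 166 / E ^ 9" using E_pos by (simp add: field_simps)
        also have "\<dots> = exp (151 * l\<^sub>L + 166 * l\<^sub>t - 9 * l\<^sub>E)"
          unfolding t Lp Ep exp_add exp_diff by simp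
        also have "\<dots> \<le> exp (12 * \<beta>)" using nn unfolding \<beta>_def by (simp add: max_def)
        also have "\<dots> = exp \<beta> ^ 12" using exp_of_nat_mult[of 12 \<beta>] by simp
        finally show ?thesis by (rule power_le_imp_le_base[of _ 11, simplified]) simp
      qed
    qed
    \<comment> \<open>Cube root of \<open>E^2 * H^4 * V * t^4\<close> for \<open>H\<close> of order
      \<open>t^3 / E\<close>; the powers of \<open>L\<close> collect \<open>12\<close>, the two
      factors \<open>L\<close> and the constant in \<open>H\<close>.\<close>
    define K where "K = exp ((19 * l\<^sub>L + 16 * l\<^sub>t - 2 * l\<^sub>E + \<beta>) / 3)"
    have K0: "0 \<le> K" by (simp add: K_def)
    have K: "E\<^sup>2 * H ^ 4 * (12 * L * exp \<beta>) * (L * t ^ 4) \<le> K ^ 3"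
    proof -
      have "E\<^sup>2 * H ^ 4 * (12 * L * exp \<beta>) * (L * t ^ 4)
        \<le> E\<^sup>2 * (exp (4 * l\<^sub>L + 3 * l\<^sub>t - l\<^sub>E)) ^ 4 * (L * L * exp \<beta>) * (L * t ^ 4)"
        using H_le H0 L L_pos E_pos by (intro mult_right_mono mult_left_mono mult_mono power_mono) auto
      also have "\<dots> = L ^ 3 * E\<^sup>2 * (exp (4 * l\<^sub>L + 3 * l\<^sub>t - l\<^sub>E)) ^ 4 * exp \<beta> * t ^ 4"
        by (simp add: power_numeral_reduce)
      also have "\<dots> = exp (3 * l\<^sub>L + 2 * l\<^sub>E + 4 * (4 * l\<^sub>L + 3 * l\<^sub>t - l\<^sub>E) + \<beta> + 4 * l\<^sub>t)"
        unfolding t Lp Ep exp_add[of _ \<beta>] exp_add[of _ "4 * l\<^sub>t"] exp_add[of _ "4 * (4 * l\<^sub>L + 3 * l\<^sub>t - l\<^sub>E)"]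
          exp_add[of _ "2 * l\<^sub>E"] exp_of_nat_mult[symmetric] by simp
      also have "\<dots> = exp (3 * ((19 * l\<^sub>L + 16 * l\<^sub>t - 2 * l\<^sub>E + \<beta>) / 3))" by (simp add: algebra_simps)
      also have "\<dots> = K ^ 3" unfolding K_def exp_of_nat_mult[symmetric] of_nat_numeral ..
      finally show ?thesis .
    qed
    have Y: "t\<^sup>2 * (4 ^ i * Y H i) \<le> L * E ^ 3 + 2 * L * K" for i
    proof -
      have "t\<^sup>2 * (4 ^ i * Y H i) \<le> 1024 * E ^ 3 + 2 * L * K"
        by (rule Y_le[OF _ V H0 K0 K]) simp
      also have "1024 * E ^ 3 \<le> L * E ^ 3" using L E_pos by (intro mult_right_mono) auto
      finally show ?thesis by simp
    qed
    have "E ^ 3 \<le> L ^ 5 * t ^ 7 \<or> E ^ 6 \<le> 64 * L ^ 4 * t ^ 9 * (\<Sum>i<J. 4 * (4 ^ i * Y H i))"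
      by (rule energy_cubed_le[OF True H_def])
    then show ?thesis
    proof
      assume "E ^ 3 \<le> L ^ 5 * t ^ 7"
      also have "\<dots> = exp (5 * l\<^sub>L + 7 * l\<^sub>t)" unfolding t Lp exp_add by simp
      finally have "3 * l\<^sub>E \<le> 5 * l\<^sub>L + 7 * l\<^sub>t" unfolding Ep by simp
      then show ?thesis using nn by (intro goal) linarith
    next
      assume "E ^ 6 \<le> 64 * L ^ 4 * t ^ 9 * (\<Sum>i<J. 4 * (4 ^ i * Y H i))"
      also have "\<dots> = 64 * L ^ 4 * t ^ 7 * (\<Sum>i<J. 4 * (t\<^sup>2 * (4 ^ i * Y H i)))"
        by (simp add: sum_distrib_left power_numeral_reduce mult_ac)
      also have "\<dots> \<le> 64 * L ^ 4 * t ^ 7 * (\<Sum>i<J. 4 * (L * E ^ 3 + 2 * L * K))"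
        using L_pos Y by (intro mult_left_mono sum_mono) auto
      also have "\<dots> = 64 * L ^ 4 * t ^ 7 * (4 * (real J * (L * E ^ 3 + 2 * L * K)))" by simp
      also have "\<dots> \<le> 64 * L ^ 4 * t ^ 7 * (4 * (L * (L * E ^ 3 + 2 * L * K)))"
        using L L_pos K0 E_pos by (intro mult_left_mono mult_right_mono) auto
      also have "\<dots> = 256 * (L ^ 6 * t ^ 7 * (E ^ 3 + 2 * K))" by (simp add: power_numeral_reduce algebra_simps)
      also have "\<dots> \<le> L * (L ^ 6 * t ^ 7 * (E ^ 3 + 2 * K))"
        using L L_pos K0 E_pos by (intro mult_right_mono) auto
      also have "\<dots> \<le> L * (L ^ 6 * t ^ 7 * (L * max (E ^ 3) K))"
      proof -
        have "E ^ 3 + 2 * K \<le> 3 * max (E ^ 3) K" by (simp add: max_def)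
        also have "\<dots> \<le> L * max (E ^ 3) K" using L K0 by (intro mult_right_mono) (auto simp: max_def)
        finally show ?thesis using L_pos by (intro mult_left_mono) auto
      qed
      also have "\<dots> = L ^ 8 * t ^ 7 * max (E ^ 3) K" by (simp add: power_numeral_reduce)
      finally have le: "E ^ 6 \<le> L ^ 8 * t ^ 7 * max (E ^ 3) K" .
      show ?thesis
      proof (cases "K \<le> E ^ 3")
        case True
        then have "E ^ 6 \<le> L ^ 8 * t ^ 7 * E ^ 3" using le by (simp add: max_def split: if_splits)
        also have "\<dots> = exp (8 * l\<^sub>L + 7 * l\<^sub>t + 3 * l\<^sub>E)" unfolding t Lp Ep exp_add by simp
        finally have "6 * l\<^sub>E \<le> 8 * l\<^sub>L + 7 * l\<^sub>t + 3 * l\<^sub>E" unfolding Ep by simp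
        then show ?thesis using nn by (intro goal) linarith
      next
        case False
        then have "E ^ 6 \<le> L ^ 8 * t ^ 7 * K" using le by (simp add: max_def split: if_splits)
        also have "\<dots> = exp (8 * l\<^sub>L + 7 * l\<^sub>t + (19 * l\<^sub>L + 16 * l\<^sub>t - 2 * l\<^sub>E + \<beta>) / 3)"
          unfolding t Lp K_def exp_add[of _ "_ / _"] exp_add[of "8 * l\<^sub>L"] by simp
        finally have "6 * l\<^sub>E \<le> 8 * l\<^sub>L + 7 * l\<^sub>t + (19 * l\<^sub>L + 16 * l\<^sub>t - 2 * l\<^sub>E + \<beta>) / 3"
          unfolding Ep by simp
        \<comment> \<open>Clearing the cube root turns \<open>6\<close> into \<open>18\<close>, and
          \<open>E\<close> in the denominator of \<open>K\<close> adds \<open>2\<close>.\<close>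
        then have 20: "20 * l\<^sub>E \<le> 43 * l\<^sub>L + 37 * l\<^sub>t + \<beta>" by (simp add: field_simps)
        have "\<beta> = 7 * l\<^sub>L + 959/80 * l\<^sub>t \<or> \<beta> = 13 * l\<^sub>L + 83/6 * l\<^sub>t - 3/4 * l\<^sub>E"
          by (simp add: \<beta>_def max_def)
        \<comment> \<open>The two cases give the exponents \<open>3919/1600\<close> and
          \<open>610/249\<close>; in the second the term \<open>3/4 * l\<^sub>E\<close> moves to the
          left.\<close>
        then have "l\<^sub>E \<le> 4 * l\<^sub>L + 24499/10000 * l\<^sub>t"
          using nn 20 by (elim disjE) linarith+
        then show ?thesis by (rule goal)
      qed
    qed
  qed
qed

end

section \<open>Stepanov's method\<close>

text \<open>The derivation \<open>X (X - 1) d/dX\<close> maps \<open>X\<^sup>a (X - 1)\<^sup>b f\<close> to \<open>X\<^sup>a (X - 1)\<^sup>b g\<close>, so that on the fibres of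
  \<open>(x\<^sup>t, (x - 1)\<^sup>t)\<close> vanishing to high order becomes a condition on polynomials of small degree.\<close>

definition log_deriv :: "int poly \<Rightarrow> int poly"
  where "log_deriv f = [:0, -1, 1:] * pderiv f"

lemma log_deriv_add: "log_deriv (f + g) = log_deriv f + log_deriv g"
  by (simp add: log_deriv_def pderiv_add algebra_simps)

lemma log_deriv_mult: "log_deriv (f * g) = f * log_deriv g + log_deriv f * g"
  by (simp add: log_deriv_def pderiv_mult algebra_simps)

lemma log_deriv_smult: "log_deriv (smult c f) = smult c (log_deriv f)"
  by (simp add: log_deriv_def pderiv_smult)

lemma log_deriv_funpow_add: "(log_deriv ^^ n) (f + g) = (log_deriv ^^ n) f + (log_deriv ^^ n) g"
  by (induction n) (auto simp: log_deriv_add)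

lemma log_deriv_funpow_smult: "(log_deriv ^^ n) (smult c f) = smult c ((log_deriv ^^ n) f)"
  by (induction n) (auto simp: log_deriv_smult)

lemma log_deriv_funpow_0: "(log_deriv ^^ n) 0 = 0"
  by (induction n) (auto simp: log_deriv_def)

lemma log_deriv_funpow_sum: "(log_deriv ^^ n) (\<Sum>i\<in>I. f i) = (\<Sum>i\<in>I. (log_deriv ^^ n) (f i))"
  by (induction I rule: infinite_finite_induct) (auto simp: log_deriv_funpow_0 log_deriv_funpow_add)

section \<open>Vanishing to high order modulo a prime\<close>

text \<open>Integer polynomials stand for polynomials over the field with \<open>p\<close> elements.
  At points other than \<open>0\<close> and \<open>1\<close> modulo \<open>p\<close>, and for
  \<open>D <= p\<close>, this amounts to a zero of multiplicity \<open>D\<close>.\<close>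

definition vanishes_mod :: "int \<Rightarrow> int poly \<Rightarrow> int \<Rightarrow> nat \<Rightarrow> bool"
  where "vanishes_mod p f x D \<longleftrightarrow> (\<forall>n<D. p dvd poly ((log_deriv ^^ n) f) x)"

lemma vanishes_mod_0: "vanishes_mod p f x 0"
  by (simp add: vanishes_mod_def)

lemma vanishes_mod_Suc:
  "vanishes_mod p f x (Suc D) \<longleftrightarrow> p dvd poly f x \<and> vanishes_mod p (log_deriv f) x D"
  unfolding vanishes_mod_def
  by (auto simp: less_Suc_eq_0_disj funpow_swap1 simp del: funpow.simps(2))
     (auto simp: funpow_swap1)

lemma vanishes_mod_mono: "vanishes_mod p f x D \<Longrightarrow> D' \<le> D \<Longrightarrow> vanishes_mod p f x D'"
  by (auto simp: vanishes_mod_def)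

lemma vanishes_mod_add:
  "vanishes_mod p f x D \<Longrightarrow> vanishes_mod p g x D \<Longrightarrow> vanishes_mod p (f + g) x D"
  by (auto simp: vanishes_mod_def log_deriv_funpow_add)

lemma vanishes_mod_diff:
  assumes "vanishes_mod p (f + g) x D" "vanishes_mod p g x D"
  shows "vanishes_mod p f x D"
  using assms by (auto simp: vanishes_mod_def log_deriv_funpow_add dvd_add_left_iff)

lemma vanishes_mod_mult:
  "vanishes_mod p g x D \<Longrightarrow> vanishes_mod p (f * g) x D"
proof (induction D arbitrary: f g)
  case (Suc D)
  have "vanishes_mod p (f * log_deriv g + log_deriv f * g) x D"
    using Suc.prems vanishes_mod_mono[OF Suc.prems, of D]
    by (intro vanishes_mod_add Suc.IH) (auto simp: vanishes_mod_Suc)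
  with Suc.prems show ?case
    by (auto simp: vanishes_mod_Suc log_deriv_mult)
qed (simp add: vanishes_mod_0)

lemma vanishes_mod_smult_self: "vanishes_mod p (smult p g) x D"
  by (auto simp: vanishes_mod_def log_deriv_funpow_smult)

text \<open>In the Leibniz rule the term \<open>log_deriv q * g\<close> is harmless by the induction
  hypothesis, which leaves \<open>q * log_deriv g\<close>.\<close>

lemma vanishes_mod_cancel:
  assumes p: "prime p" and q: "\<not> p dvd poly q x"
  shows "vanishes_mod p (q * g) x D \<Longrightarrow> vanishes_mod p g x D"
proof (induction D arbitrary: g)
  case (Suc D)
  from Suc.prems have g: "p dvd poly g x"
    using p q by (auto simp: vanishes_mod_Suc prime_dvd_mult_iff)
  have g': "vanishes_mod p g x D"
    using Suc.IH vanishes_mod_mono[OF Suc.prems] by auto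
  have "vanishes_mod p (q * log_deriv g + log_deriv q * g) x D"
    using Suc.prems by (simp add: vanishes_mod_Suc log_deriv_mult)
  with g' have "vanishes_mod p (q * log_deriv g) x D"
    by (meson vanishes_mod_diff vanishes_mod_mult)
  with Suc.IH g show ?case by (auto simp: vanishes_mod_Suc)
qed (simp add: vanishes_mod_0)

text \<open>Each derivation lowers the power of \<open>X - x\<close> by one and produces a factor
  \<open>k x (x - 1)\<close>. This is a unit modulo \<open>p\<close>, because
  \<open>k < D <= p\<close> and \<open>x\<close> is neither \<open>0\<close> nor
  \<open>1\<close>.\<close>

lemma vanishes_mod_linear_power:
  assumes p: "prime p" and x: "\<not> p dvd x" "\<not> p dvd x - 1"
  shows "vanishes_mod p ([:- x, 1:] ^ k * w) x D \<Longrightarrow> k < D \<Longrightarrow> int D \<le> p \<Longrightarrow> p dvd poly w x"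
proof (induction k arbitrary: w D)
  case 0
  then show ?case by (auto simp: vanishes_mod_def)
next
  case (Suc k)
  then obtain D' where D: "D = Suc D'" by (cases D) auto
  let ?w = "smult (of_nat (Suc k)) ([:0, -1, 1:] * w) + [:- x, 1:] * log_deriv w"
  have "log_deriv ([:- x, 1:] ^ Suc k) = smult (of_nat (Suc k)) ([:0, -1, 1:] * [:- x, 1:] ^ k)"
    unfolding log_deriv_def pderiv_power_Suc by (simp add: pderiv_pCons)
  then have "log_deriv ([:- x, 1:] ^ Suc k * w) = [:- x, 1:] ^ k * ?w"
    by (simp only: log_deriv_mult power_Suc distrib_left distrib_right mult_smult_left
        mult_smult_right mult_ac add_ac)
  then have "vanishes_mod p ([:- x, 1:] ^ k * ?w) x D'"
    using Suc.prems(1) unfolding D vanishes_mod_Suc by simp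
  then have "p dvd poly ?w x"
    using Suc.prems D by (intro Suc.IH[of ?w D']) auto
  then have "p dvd int (Suc k) * (x * (x - 1) * poly w x)"
    by (simp add: algebra_simps)
  moreover have "\<not> p dvd int (Suc k)"
    using Suc.prems by (intro zdvd_not_zless) auto
  ultimately show ?case
    using p x by (auto simp: prime_dvd_mult_iff)
qed

text \<open>Linear factors are split off one at a time by synthetic division; each remainder is a
  multiple of \<open>p\<close> and goes into \<open>h\<close>.\<close>

lemma vanishes_mod_imp_factor:
  assumes p: "prime p" and x: "\<not> p dvd x" "\<not> p dvd x - 1"
    and f: "vanishes_mod p f x D" and D: "int D \<le> p"
  shows "k \<le> D \<Longrightarrow> \<exists>w h. f = [:- x, 1:] ^ k * w + smult p h"
proof (induction k)
  case 0
  then show ?case by (auto intro: exI[of _ f] exI[of _ 0])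
next
  case (Suc k)
  then obtain w h where f_eq: "f = [:- x, 1:] ^ k * w + smult p h" by auto
  have "vanishes_mod p ([:- x, 1:] ^ k * w) x D"
    using f vanishes_mod_smult_self unfolding f_eq by (rule vanishes_mod_diff)
  then have "p dvd poly w x"
    using vanishes_mod_linear_power[OF p x _ _ D] Suc.prems by auto
  then obtain c where c: "poly w x = p * c" by auto
  have "w = [:- x, 1:] * synthetic_div w x + [:poly w x:]"
    using synthetic_div_correct'[of x w] by simp
  then have "w = [:- x, 1:] * synthetic_div w x + smult p [:c:]" by (simp add: c)
  then have "f = [:- x, 1:] ^ k * ([:- x, 1:] * synthetic_div w x + smult p [:c:]) + smult p h"
    using f_eq by simp
  then have "f = [:- x, 1:] ^ Suc k * synthetic_div w x + smult p ([:- x, 1:] ^ k * [:c:] + h)"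
    by (simp only: power_Suc distrib_left distrib_right mult_smult_left
        mult_smult_right mult_ac add_ac smult_add_right)
  then show ?case by blast
qed

text \<open>The last coefficient of \<open>w\<close> not divisible by \<open>p\<close> meets the
  leading coefficient of \<open>q\<close>; every other contribution to that coefficient of the
  product is zero or divisible by \<open>p\<close>.\<close>

lemma monic_prod_not_dvd_coeff:
  fixes q w :: "int poly"
  assumes q: "lead_coeff q = 1" and w: "\<exists>i. \<not> p dvd coeff w i"
  shows "\<exists>i\<ge>degree q. \<not> p dvd coeff (q * w) i"
proof -
  have fin: "finite {i. \<not> p dvd coeff w i}"
    by (rule finite_subset[of _ "{..degree w}"]) (auto intro: le_degree)
  define m where "m = Max {i. \<not> p dvd coeff w i}"
  have m: "\<not> p dvd coeff w m" using Max_in[OF fin] w unfolding m_def by auto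
  have gt: "p dvd coeff w i" if "i > m" for i
    using Max_ge[OF fin, of i] that unfolding m_def by force
  let ?n = "degree q"
  have "coeff (q * w) (?n + m) = (\<Sum>i\<le>?n + m. coeff q i * coeff w (?n + m - i))"
    by (simp add: coeff_mult)
  also have "\<dots> = coeff q ?n * coeff w m + (\<Sum>i\<in>{..?n + m} - {?n}. coeff q i * coeff w (?n + m - i))"
    by (subst sum.remove[of _ ?n]) auto
  finally have eq: "coeff (q * w) (?n + m) = coeff w m + (\<Sum>i\<in>{..?n + m} - {?n}. coeff q i * coeff w (?n + m - i))"
    using q by simp
  have "p dvd (\<Sum>i\<in>{..?n + m} - {?n}. coeff q i * coeff w (?n + m - i))"
  proof (rule dvd_sum)
    fix i assume i: "i \<in> {..?n + m} - {?n}"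
    show "p dvd coeff q i * coeff w (?n + m - i)"
    proof (cases "i < ?n")
      case True then show ?thesis using gt[of "?n + m - i"] by auto
    next
      case False then show ?thesis using i by (auto simp: coeff_eq_0)
    qed
  qed
  with eq m have "\<not> p dvd coeff (q * w) (?n + m)" by (simp add: dvd_add_left_iff)
  then show ?thesis by (intro exI[of _ "?n + m"]) auto
qed

text \<open>The powers for the points of \<open>S\<close> are split off successively. Those already
  split off do not vanish modulo \<open>p\<close> at the next point, so
  \<open>vanishes_mod_cancel\<close> removes them.\<close>

lemma degree_ge_of_vanishes_mod:
  fixes f :: "int poly"
  assumes p: "prime p" and fin: "finite S" and S: "S \<subseteq> {2..<p}"
    and van: "\<And>x. x \<in> S \<Longrightarrow> vanishes_mod p f x D" and D: "int D \<le> p"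
    and f: "\<exists>i. \<not> p dvd coeff f i"
  shows "D * card S \<le> degree f"
proof -
  let ?Q = "\<lambda>S. (\<Prod>x\<in>S. [:- x, 1:] ^ D)"
  have ndvd: "\<not> p dvd x - y" if "x \<in> S" "y \<in> S" "x \<noteq> y" for x y
  proof
    assume "p dvd x - y"
    moreover have "\<bar>x - y\<bar> < p" using that(1,2) S[THEN subsetD, of x] S[THEN subsetD, of y] by auto
    ultimately have "x - y = 0" using dvd_imp_le_int[of "x - y" p] by linarith
    with that show False by auto
  qed
  have "\<exists>w h. f = ?Q S * w + smult p h"
    using fin S van ndvd
  proof (induction S rule: finite_induct)
    case empty
    then show ?case by (auto intro: exI[of _ f] exI[of _ 0])
  next
    case (insert x S)
    then obtain w h where f_eq: "f = ?Q S * w + smult p h" by force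
    have "vanishes_mod p (?Q S * w + smult p h) x D"
      using insert.prems(2)[of x] unfolding f_eq[symmetric] by simp
    then have "vanishes_mod p (?Q S * w) x D"
      by (rule vanishes_mod_diff[OF _ vanishes_mod_smult_self])
    moreover have "\<not> p dvd poly (?Q S) x"
      using p insert by (auto simp: poly_prod poly_power prime_dvd_prod_iff prime_dvd_power_iff
          dest: prime_dvd_power)
    ultimately have w: "vanishes_mod p w x D" using vanishes_mod_cancel[OF p] by blast
    have "x \<ge> 2" "x < p" using insert.prems by auto
    then have "\<not> p dvd x" "\<not> p dvd x - 1" by (auto simp: zdvd_not_zless)
    from vanishes_mod_imp_factor[OF p this w D le_refl] obtain w' h' where
      "w = [:- x, 1:] ^ D * w' + smult p h'" by blast
    then have "f = ?Q (insert x S) * w' + smult p (?Q S * h' + h)"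
      using f_eq insert.hyps by (simp only: prod.insert distrib_left distrib_right mult_smult_left
        mult_smult_right mult_ac add_ac smult_add_right not_False_eq_True simp_thms)
    then show ?case by blast
  qed
  then obtain w h where f_eq: "f = ?Q S * w + smult p h" by blast
  have lead: "lead_coeff (?Q S) = 1"
    by (simp add: lead_coeff_prod lead_coeff_power)
  have deg: "degree (?Q S) = D * card S"
    by (subst degree_prod_eq_sum_degree) (auto simp: degree_power_eq)
  have "\<exists>i. \<not> p dvd coeff w i"
  proof (rule ccontr)
    assume "\<not> ?thesis"
    then have "[:p:] dvd w" by (simp add: const_poly_dvd_iff)
    then have "[:p:] dvd f" unfolding f_eq by (intro dvd_add dvd_mult) (auto simp: const_poly_dvd_iff)
    then show False using f by (simp add: const_poly_dvd_iff)
  qed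
  from monic_prod_not_dvd_coeff[OF lead this] obtain i where
    i: "i \<ge> degree (?Q S)" "\<not> p dvd coeff (?Q S * w) i" by blast
  then have "coeff f i \<noteq> 0" unfolding f_eq by (auto simp: add_eq_0_iff2)
  then show ?thesis using i deg le_degree by fastforce
qed

section \<open>Sparse combinations that do not vanish modulo a prime\<close>

text \<open>The Euler operator. Monomials are its eigenvectors, so its iterates evaluated at
  \<open>1\<close> are the power moments of the exponents weighted by the coefficients.\<close>

definition theta :: "int poly \<Rightarrow> int poly"
  where "theta f = [:0, 1:] * pderiv f"

lemma theta_add: "theta (f + g) = theta f + theta g"
  by (simp add: theta_def pderiv_add algebra_simps)

lemma theta_funpow_add: "(theta ^^ n) (f + g) = (theta ^^ n) f + (theta ^^ n) g"
  by (induction n) (auto simp: theta_add)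

lemma theta_funpow_0: "(theta ^^ n) 0 = 0"
  by (induction n) (auto simp: theta_def)

lemma theta_funpow_sum: "(theta ^^ n) (\<Sum>i\<in>I. f i) = (\<Sum>i\<in>I. (theta ^^ n) (f i))"
  by (induction I rule: infinite_finite_induct) (auto simp: theta_funpow_0 theta_funpow_add)

lemma theta_funpow_smult: "(theta ^^ n) (smult c f) = smult c ((theta ^^ n) f)"
  by (induction n) (auto simp: theta_def pderiv_smult)

lemma theta_monom: "theta (monom c e) = monom (c * int e) e"
proof (cases e)
  case (Suc n)
  then show ?thesis unfolding theta_def pderiv_monom by (simp add: monom_Suc mult.commute)
qed (simp add: theta_def pderiv_monom)

lemma theta_funpow_monom: "(theta ^^ n) (monom c e) = monom (c * int e ^ n) e"
  by (induction n) (auto simp: theta_monom mult_ac)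

lemma theta_funpow_power_eq_0:
  "n < k \<Longrightarrow> poly ((theta ^^ n) ([:-1, 1:] ^ k * w)) 1 = 0"
proof (induction n arbitrary: k w)
  case 0
  then show ?case by (simp add: poly_power)
next
  case (Suc n)
  then obtain k' where k: "k = Suc k'" by (cases k) auto
  have "theta ([:-1, 1:] ^ k * w) = [:-1, 1:] ^ k' * (smult (of_nat k) ([:0, 1:] * w) + [:-1, 1:] * theta w)"
    unfolding theta_def pderiv_mult k pderiv_power_Suc
    by (simp add: pderiv_pCons algebra_simps smult_add_right)
  then show ?case
    using Suc.IH[of k'] Suc.prems k by (simp add: funpow_swap1 del: funpow.simps) (simp add: funpow_swap1)
qed

text \<open>Nonsingularity of a Vandermonde matrix, by elimination: replacing \<open>h e\<close> by
  \<open>h e * (e - e0)\<close> removes one node at the cost of one moment.\<close>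

lemma vandermonde_mod:
  fixes p :: int and h :: "nat \<Rightarrow> int"
  assumes p: "prime p" and fin: "finite S" and S: "\<And>e. e \<in> S \<Longrightarrow> int e < p"
    and van: "\<And>j. j < card S \<Longrightarrow> p dvd (\<Sum>e\<in>S. h e * int e ^ j)"
  shows "\<forall>e\<in>S. p dvd h e"
  using fin S van
proof (induction S arbitrary: h rule: finite_induct)
  case (insert e0 S)
  have *: "\<forall>e\<in>S. p dvd h e * (int e - int e0)"
  proof (rule insert.IH)
    fix j assume j: "j < card S"
    have "(\<Sum>e\<in>S. h e * (int e - int e0) * int e ^ j) =
      (\<Sum>e\<in>insert e0 S. h e * (int e - int e0) * int e ^ j)"
      using insert.hyps by simp
    also have "\<dots> = (\<Sum>e\<in>insert e0 S. h e * int e ^ Suc j) - int e0 * (\<Sum>e\<in>insert e0 S. h e * int e ^ j)"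
      by (simp only: sum_distrib_left flip: sum_subtractf) (simp add: algebra_simps)
    finally show "p dvd (\<Sum>e\<in>S. h e * (int e - int e0) * int e ^ j)"
      using insert.prems(2)[of j] insert.prems(2)[of "Suc j"] j insert.hyps by auto
  qed (use insert in auto)
  have S: "\<forall>e\<in>S. p dvd h e"
  proof
    fix e assume e: "e \<in> S"
    have "\<not> p dvd int e - int e0"
    proof
      assume "p dvd int e - int e0"
      moreover have "\<bar>int e - int e0\<bar> < p" using insert.prems(1)[of e] insert.prems(1)[of e0] e by auto
      ultimately have "int e - int e0 = 0" using dvd_imp_le_int[of "int e - int e0" p] by linarith
      with e insert.hyps show False by auto
    qed
    with * e p show "p dvd h e" by (auto simp: prime_dvd_mult_iff)
  qed
  have "p dvd h e0 + (\<Sum>e\<in>S. h e)"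
    using insert.prems(2)[of 0] insert.hyps by simp
  with S have "p dvd h e0" by (metis dvd_add_left_iff dvd_sum)
  with S show ?case by auto
qed auto

text \<open>If the combination vanished modulo \<open>p\<close>, dividing by the lowest power of
  \<open>(X - 1)^t\<close> with a nonzero coefficient would show that \<open>H c0\<close> is
  divisible by \<open>(X - 1)^t\<close>. But \<open>H c0\<close> has at most
  \<open>A * B <= t\<close> monomials, with distinct exponents below \<open>p\<close>, so
  \<open>t\<close> vanishing moments at \<open>1\<close> make all its coefficients vanish.\<close>

lemma sparse_combination_nonzero:
  fixes p :: int and l :: "nat \<times> nat \<times> nat \<Rightarrow> int"
  assumes p: "prime p" and AB: "A * B \<le> t" "A \<le> t" "int (A + t * B) \<le> p"
    and nz: "\<exists>a<A. \<exists>b<B. \<exists>c<B. \<not> p dvd l (a, b, c)"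
  shows "\<not> [:p:] dvd (\<Sum>(a, b, c)\<in>{..<A} \<times> {..<B} \<times> {..<B}.
    smult (l (a, b, c)) ([:0, 1:] ^ (a + t * b) * [:-1, 1:] ^ (t * c)))"
proof
  define H where "H c = (\<Sum>(a, b)\<in>{..<A} \<times> {..<B}. monom (l (a, b, c)) (a + t * b))" for c
  let ?L = "[:-1, 1:] :: int poly"
  assume dvd: "[:p:] dvd (\<Sum>(a, b, c)\<in>{..<A} \<times> {..<B} \<times> {..<B}.
    smult (l (a, b, c)) ([:0, 1:] ^ (a + t * b) * [:-1, 1:] ^ (t * c)))"
  have eq: "(\<Sum>(a, b, c)\<in>{..<A} \<times> {..<B} \<times> {..<B}.
    smult (l (a, b, c)) ([:0, 1:] ^ (a + t * b) * [:-1, 1:] ^ (t * c))) =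
    (\<Sum>c<B. ?L ^ (t * c) * H c)"
  proof -
    have "(\<Sum>(a, b, c)\<in>{..<A} \<times> {..<B} \<times> {..<B}.
      smult (l (a, b, c)) ([:0, 1:] ^ (a + t * b) * [:-1, 1:] ^ (t * c))) =
      (\<Sum>a<A. \<Sum>b<B. \<Sum>c<B. ?L ^ (t * c) * monom (l (a, b, c)) (a + t * b))"
      by (simp add: sum.cartesian_product split_def monom_altdef mult.commute mult.left_commute)
    also have "\<dots> = (\<Sum>c<B. \<Sum>a<A. \<Sum>b<B. ?L ^ (t * c) * monom (l (a, b, c)) (a + t * b))"
      by (subst (2) sum.swap, subst sum.swap) (rule refl)
    finally show ?thesis
      by (simp add: H_def sum.cartesian_product sum_distrib_left split_def)
  qed
  define c0 where "c0 = (LEAST c. c < B \<and> (\<exists>a<A. \<exists>b<B. \<not> p dvd l (a, b, c)))"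
  have c0: "c0 < B \<and> (\<exists>a<A. \<exists>b<B. \<not> p dvd l (a, b, c0))"
    unfolding c0_def by (rule LeastI_ex) (use nz in blast)
  have low: "[:p:] dvd H c" if "c < c0" for c
    unfolding H_def
  proof (rule dvd_sum, safe)
    fix a b assume "a < A" "b < B"
    then have "p dvd l (a, b, c)" using not_less_Least[of c] that c0 unfolding c0_def by force
    then show "[:p:] dvd monom (l (a, b, c)) (a + t * b)"
      by (auto simp: const_poly_dvd_iff coeff_monom)
  qed
  let ?R = "\<Sum>c\<in>{Suc c0..<B}. ?L ^ (t * (c - Suc c0)) * H c"
  have "(\<Sum>c<B. ?L ^ (t * c) * H c) = (\<Sum>c<c0. ?L ^ (t * c) * H c) + (\<Sum>c\<in>{c0..<B}. ?L ^ (t * c) * H c)"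
    using c0 by (simp add: sum.atLeastLessThan_concat[of 0 c0 B, symmetric] lessThan_atLeast0)
  moreover have "[:p:] dvd (\<Sum>c<c0. ?L ^ (t * c) * H c)"
    by (intro dvd_sum dvd_mult low) auto
  ultimately have "[:p:] dvd (\<Sum>c\<in>{c0..<B}. ?L ^ (t * c) * H c)"
    using dvd unfolding eq by (metis (no_types, lifting) dvd_add_right_iff)
  also have "(\<Sum>c\<in>{c0..<B}. ?L ^ (t * c) * H c) =
    ?L ^ (t * c0) * H c0 + (\<Sum>c\<in>{Suc c0..<B}. ?L ^ (t * c) * H c)"
    using c0 by (simp add: sum.atLeast_Suc_lessThan)
  also have "(\<Sum>c\<in>{Suc c0..<B}. ?L ^ (t * c) * H c) = ?L ^ (t * c0) * (?L ^ t * ?R)"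
    unfolding sum_distrib_left
  proof (rule sum.cong[OF refl])
    fix c assume "c \<in> {Suc c0..<B}"
    then have "t * c = t * c0 + (t + t * (c - Suc c0))"
      by (metis Suc_leD add_mult_distrib2 atLeastLessThan_iff le_add_diff_inverse mult_Suc_right add_Suc_shift Suc_diff_Suc Suc_le_lessD)
    then show "?L ^ (t * c) * H c = ?L ^ (t * c0) * (?L ^ t * (?L ^ (t * (c - Suc c0)) * H c))"
      by (simp add: power_add mult_ac)
  qed
  finally have dvd1: "[:p:] dvd ?L ^ (t * c0) * (H c0 + ?L ^ t * ?R)"
    by (simp add: distrib_left)
  have "prime_elem [:p:]" using p by (intro lift_prime_elem_poly) auto
  moreover have "\<not> [:p:] dvd ?L ^ (t * c0)"
  proof
    assume "[:p:] dvd ?L ^ (t * c0)"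
    then have "p dvd lead_coeff (?L ^ (t * c0))" by (auto simp: const_poly_dvd_iff)
    then show False using prime_gt_1_int[OF p] by (simp add: lead_coeff_power)
  qed
  ultimately have dvd0: "[:p:] dvd H c0 + ?L ^ t * ?R"
    using prime_elem_dvd_multD[OF _ dvd1] by blast
  then obtain g where "H c0 + ?L ^ t * ?R = [:p:] * g" by (rule dvdE)
  then have g: "H c0 + ?L ^ t * ?R = smult p g" by simp
  let ?S = "(\<lambda>(a, b). a + t * b) ` ({..<A} \<times> {..<B})"
  \<comment> \<open>As \<open>A <= t\<close>, the remainder of \<open>a + t * b\<close> modulo
    \<open>t\<close> recovers \<open>a\<close>.\<close>
  have inj: "inj_on (\<lambda>(a, b). a + t * b) ({..<A} \<times> {..<B})"
  proof (rule inj_onI, clarify)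
    fix a b a' b' assume ab: "a < A" "a' < A" "a + t * b = a' + t * b'"
    have at: "a < t" "a' < t" using ab AB by linarith+
    have "a = (a + t * b) mod t" using at by simp
    also have "\<dots> = a'" using at ab by simp
    finally show "a = a' \<and> b = b'" using ab at by auto
  qed
  define h where "h e = (case the_inv_into ({..<A} \<times> {..<B}) (\<lambda>(a, b). a + t * b) e of (a, b) \<Rightarrow> l (a, b, c0))" for e
  have h: "h (a + t * b) = l (a, b, c0)" if "a < A" "b < B" for a b
    using the_inv_into_f_f[OF inj, of "(a, b)"] that by (auto simp: h_def)
  have cardS: "card ?S \<le> t"
    using AB by (simp add: card_image[OF inj])
  have "\<forall>e\<in>?S. p dvd h e"
  proof (rule vandermonde_mod[OF p])
    fix e assume "e \<in> ?S"
    then obtain a b where ab: "e = a + t * b" "a < A" "b < B" by auto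
    then have "e < A + t * b" by simp
    also have "\<dots> \<le> A + t * B" using ab by simp
    finally show "int e < p" using AB by linarith
  next
    fix j assume j: "j < card ?S"
    have "(\<Sum>e\<in>?S. h e * int e ^ j) = (\<Sum>(a, b)\<in>{..<A} \<times> {..<B}. l (a, b, c0) * int (a + t * b) ^ j)"
      by (subst sum.reindex[OF inj]) (auto intro!: sum.cong simp: h simp flip: of_nat_mult of_nat_add)
    also have "\<dots> = poly ((theta ^^ j) (H c0)) 1"
      by (simp add: H_def theta_funpow_sum theta_funpow_monom poly_sum poly_monom split_def)
    also have "\<dots> = poly ((theta ^^ j) (H c0 + ?L ^ t * ?R)) 1"
      using j cardS by (simp add: theta_funpow_add theta_funpow_power_eq_0)
    also have "p dvd \<dots>"
      unfolding g by (simp add: theta_funpow_smult)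
    finally show "p dvd (\<Sum>e\<in>?S. h e * int e ^ j)" .
  qed auto
  with c0 h show False by fastforce
qed

section \<open>Iterated derivations of \<open>X^m (X - 1)^l\<close>\<close>

text \<open>The cofactor left by \<open>n\<close> derivations of \<open>X^m (X - 1)^l\<close>. Its
  degree is at most \<open>n\<close> however large \<open>m\<close> and \<open>l\<close> are, and
  this keeps the number of linear conditions in \<open>stepanov_bound\<close> small.\<close>

fun log_deriv_factor :: "nat \<Rightarrow> nat \<Rightarrow> nat \<Rightarrow> int poly" where
  "log_deriv_factor 0 m l = 1"
| "log_deriv_factor (Suc n) m l =
    [:- int m, int m + int l:] * log_deriv_factor n m l + log_deriv (log_deriv_factor n m l)"

lemma log_deriv_power_prod:
  "log_deriv ([:0, 1:] ^ m * [:-1, 1:] ^ l) =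
    [:- int m, int m + int l:] * ([:0, 1:] ^ m * [:-1, 1:] ^ l)"
proof -
  have X: "log_deriv ([:0, 1:] ^ m) = [:- int m, int m:] * [:0, 1:] ^ m" for m
  proof (induction m)
    case (Suc m)
    have "log_deriv [:0, 1:] = [:-1, 1:] * [:0, 1:]" by (simp add: log_deriv_def pderiv_pCons)
    then have "log_deriv ([:0, 1:] ^ Suc m) =
      [:0, 1:] * ([:- int m, int m:] * [:0, 1:] ^ m) + [:-1, 1:] * [:0, 1:] * [:0, 1:] ^ m"
      by (simp only: power_Suc log_deriv_mult Suc.IH)
    also have "\<dots> = ([:- int m, int m:] + [:-1, 1:]) * ([:0, 1:] * [:0, 1:] ^ m)"
      by (simp only: distrib_right distrib_left mult_ac)
    also have "[:- int m, int m:] + [:-1, 1:] = [:- int (Suc m), int (Suc m):]" by simp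
    finally show ?case by (simp only: power_Suc)
  qed (simp add: log_deriv_def)
  have Y: "log_deriv ([:-1, 1:] ^ l) = [:0, int l:] * [:-1, 1:] ^ l" for l
  proof (induction l)
    case (Suc m)
    have "log_deriv [:-1, 1:] = [:0, 1:] * [:-1, 1:]" by (simp add: log_deriv_def pderiv_pCons)
    then have "log_deriv ([:-1, 1:] ^ Suc m) =
      [:-1, 1:] * ([:0, int m:] * [:-1, 1:] ^ m) + [:0, 1:] * [:-1, 1:] * [:-1, 1:] ^ m"
      by (simp only: power_Suc log_deriv_mult Suc.IH)
    also have "\<dots> = ([:0, int m:] + [:0, 1:]) * ([:-1, 1:] * [:-1, 1:] ^ m)"
      by (simp only: distrib_right distrib_left mult_ac)
    also have "[:0, int m:] + [:0, 1:] = [:0, int (Suc m):]" by simp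
    finally show ?case by (simp only: power_Suc)
  qed (simp add: log_deriv_def)
  have "log_deriv ([:0, 1:] ^ m * [:-1, 1:] ^ l) =
    ([:- int m, int m:] + [:0, int l:]) * ([:0, 1:] ^ m * [:-1, 1:] ^ l)"
    by (simp only: log_deriv_mult X Y distrib_right distrib_left mult_ac add_ac)
  then show ?thesis by simp
qed

lemma log_deriv_funpow_power_prod:
  "(log_deriv ^^ n) ([:0, 1:] ^ m * [:-1, 1:] ^ l) =
    log_deriv_factor n m l * ([:0, 1:] ^ m * [:-1, 1:] ^ l)"
proof (induction n)
  case (Suc n)
  let ?w = "[:0, 1:] ^ m * [:-1, 1:] ^ l :: int poly"
  have "(log_deriv ^^ Suc n) ?w = log_deriv (log_deriv_factor n m l * ?w)"
    using Suc by simp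
  also have "\<dots> = log_deriv_factor n m l * ([:- int m, int m + int l:] * ?w) +
      log_deriv (log_deriv_factor n m l) * ?w"
    unfolding log_deriv_mult[of _ ?w] log_deriv_power_prod ..
  also have "\<dots> = log_deriv_factor (Suc n) m l * ?w"
    by (simp only: log_deriv_factor.simps distrib_right distrib_left mult_ac)
  finally show ?case .
qed simp

lemma degree_log_deriv_le: "degree (log_deriv f) \<le> Suc (degree f)"
proof (cases "pderiv f = 0")
  case False
  then have "degree f \<noteq> 0" by (metis pderiv_eq_0_iff)
  moreover have "degree (log_deriv f) \<le> 2 + (degree f - 1)"
    unfolding log_deriv_def using degree_mult_le[of "[:0, -1, 1:]" "pderiv f"] degree_pderiv[of f]
    by simp
  ultimately show ?thesis by linarith
qed (simp add: log_deriv_def)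

lemma degree_log_deriv_factor_le: "degree (log_deriv_factor n m l) \<le> n"
proof (induction n)
  case (Suc n)
  have "degree ([:- int m, int m + int l:] * log_deriv_factor n m l) \<le> 1 + n"
    by (rule order_trans[OF degree_mult_le]) (use Suc in \<open>auto intro: add_mono\<close>)
  moreover have "degree (log_deriv (log_deriv_factor n m l)) \<le> Suc n"
    using degree_log_deriv_le[of "log_deriv_factor n m l"] Suc by linarith
  ultimately show ?case by (simp add: degree_add_le)
qed simp

text \<open>The auxiliary polynomial is a combination of \<open>X\<^sup>i X\<^bsup>t j\<^esup> (X - 1)\<^bsup>t k\<^esup>\<close> with \<open>i < A\<close> and \<open>j, k < B\<close>. Its
  coefficients come from the pigeonhole principle, and it is nonzero modulo \<open>p\<close> by
  \<open>sparse_combination_nonzero\<close>.\<close>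

lemma stepanov_bound:
  fixes p :: int and T :: "(int \<times> int) set"
  assumes p: "prime p" and fin: "finite T"
    and eqs: "card T * (D * (A + D)) < A * (B * B)"
    and AB: "A * B \<le> t" "A \<le> t" "int (A + t * B) \<le> p" "int D \<le> p"
    and S: "S \<subseteq> {2..<p}"
    and ST: "\<And>x. x \<in> S \<Longrightarrow> \<exists>(u, v)\<in>T. [x ^ t = u] (mod p) \<and> [(x - 1) ^ t = v] (mod p)"
  shows "D * card S \<le> A + 2 * t * B"
proof -
  let ?I = "{..<A} \<times> {..<B} \<times> {..<B}"
  let ?E = "T \<times> {..<D} \<times> {..<A + D}"
  let ?Z = "{0..<p}"
  have finS: "finite S" using S finite_subset by blast
  have ppos: "p > 0" using p by (simp add: prime_gt_0_int)
  \<comment> \<open>Where \<open>x^t = u\<close> and \<open>(x - 1)^t = v\<close>, the high powers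
    become the constants \<open>u^b\<close> and \<open>v^c\<close>. The rest of the
    \<open>n\<close>-th derivative has degree below \<open>A + D\<close>, and its coefficients are
    linear forms in the unknowns \<open>l\<close>.\<close>
  define g where "g = (\<lambda>(u, v) n (a, b, c). smult (u ^ b * v ^ c)
    ([:0, 1:] ^ a * log_deriv_factor n (a + t * b) (t * c)))"
  define form where "form l = (\<lambda>e\<in>?E. (case e of (uv, n, i) \<Rightarrow>
    (\<Sum>x\<in>?I. l x * coeff (g uv n x) i) mod p))" for l
  \<comment> \<open>There are \<open>p ^ (A * B * B)\<close> coefficient vectors, but at most
    \<open>p ^ (card T * D * (A + D))\<close> values of the forms.\<close>
  have "\<not> inj_on form (?I \<rightarrow>\<^sub>E ?Z)"
  proof
    assume "inj_on form (?I \<rightarrow>\<^sub>E ?Z)"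
    moreover have "form ` (?I \<rightarrow>\<^sub>E ?Z) \<subseteq> (?E \<rightarrow>\<^sub>E ?Z)"
      using ppos by (auto simp: form_def)
    ultimately have "card (?I \<rightarrow>\<^sub>E ?Z) \<le> card (?E \<rightarrow>\<^sub>E ?Z)"
      using fin by (intro card_inj_on_le) (auto intro: finite_PiE)
    then have "nat p ^ card ?I \<le> nat p ^ card ?E"
      using fin by (simp add: card_PiE)
    moreover have "nat p > 1" using p by (simp add: prime_gt_1_int)
    ultimately have "card ?I \<le> card ?E" by (rule power_le_imp_le_exp[rotated])
    then show False using eqs by (simp add: card_cartesian_product)
  qed
  then obtain l1 l2 where l12: "l1 \<in> ?I \<rightarrow>\<^sub>E ?Z" "l2 \<in> ?I \<rightarrow>\<^sub>E ?Z" "form l1 = form l2" "l1 \<noteq> l2"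
    by (auto simp: inj_on_def)
  define l where "l x = l1 x - l2 x" for x
  have "\<exists>x\<in>?I. l1 x \<noteq> l2 x"
    using l12 by (meson PiE_ext)
  then obtain a b c where abc: "a < A" "b < B" "c < B" "l1 (a, b, c) \<noteq> l2 (a, b, c)" by auto
  have "\<not> p dvd l (a, b, c)"
  proof
    assume "p dvd l (a, b, c)"
    moreover have "l1 (a, b, c) \<in> ?Z" "l2 (a, b, c) \<in> ?Z"
      using l12(1,2) abc by (auto elim!: PiE_E[where x = "(a, b, c)"])
    then have "\<bar>l (a, b, c)\<bar> < p" by (auto simp: l_def)
    ultimately have "l (a, b, c) = 0" using dvd_imp_le_int[of "l (a, b, c)" p] by linarith
    with abc show False by (simp add: l_def)
  qed
  with abc have nz: "\<exists>a<A. \<exists>b<B. \<exists>c<B. \<not> p dvd l (a, b, c)" by blast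
  have sol: "p dvd coeff (\<Sum>x\<in>?I. smult (l x) (g uv n x)) i" if "uv \<in> T" "n < D" for uv n i
  proof (cases "i < A + D")
    case True
    have "form l1 (uv, n, i) = form l2 (uv, n, i)" using l12 by simp
    then have "(\<Sum>x\<in>?I. l1 x * coeff (g uv n x) i) mod p = (\<Sum>x\<in>?I. l2 x * coeff (g uv n x) i) mod p"
      using that True by (simp add: form_def)
    then have "p dvd (\<Sum>x\<in>?I. l1 x * coeff (g uv n x) i) - (\<Sum>x\<in>?I. l2 x * coeff (g uv n x) i)"
      by (simp add: mod_eq_dvd_iff)
    then show ?thesis by (simp add: coeff_sum l_def left_diff_distrib sum_subtractf)
  next
    case False
    have "coeff (g uv n x) i = 0" if x: "x \<in> ?I" for x
    proof -
      obtain a b c u v where abc: "x = (a, b, c)" "uv = (u, v)" by (cases x, cases uv) auto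
      have "degree (g uv n x) \<le> degree ([:0, 1:] ^ a * log_deriv_factor n (a + t * b) (t * c))"
        unfolding g_def abc by (auto intro: degree_smult_le)
      also have "\<dots> \<le> a + n"
        by (rule order_trans[OF degree_mult_le add_mono[OF _ degree_log_deriv_factor_le]])
           (simp add: degree_power_eq)
      also have "\<dots> < i" using x abc False \<open>n < D\<close> by auto
      finally show ?thesis by (rule coeff_eq_0)
    qed
    then show ?thesis by (simp add: coeff_sum)
  qed
  let ?F = "\<Sum>(a, b, c)\<in>?I. smult (l (a, b, c)) ([:0, 1:] ^ (a + t * b) * [:-1, 1:] ^ (t * c))"
  have "\<not> [:p:] dvd ?F"
    by (rule sparse_combination_nonzero[OF p AB(1,2,3) nz])
  then have F: "\<exists>i. \<not> p dvd coeff ?F i" by (simp add: const_poly_dvd_iff)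
  have "vanishes_mod p ?F x D" if x: "x \<in> S" for x
    unfolding vanishes_mod_def
  proof (intro allI impI)
    fix n assume n: "n < D"
    from ST[OF x] obtain u v where uv: "(u, v) \<in> T" "[x ^ t = u] (mod p)" "[(x - 1) ^ t = v] (mod p)" by auto
    have "(log_deriv ^^ n) ?F = (\<Sum>(a, b, c)\<in>?I. smult (l (a, b, c))
      (log_deriv_factor n (a + t * b) (t * c) * ([:0, 1:] ^ (a + t * b) * [:-1, 1:] ^ (t * c))))"
      by (simp add: log_deriv_funpow_sum log_deriv_funpow_smult log_deriv_funpow_power_prod split_def)
    then have e1: "poly ((log_deriv ^^ n) ?F) x = (\<Sum>(a, b, c)\<in>?I. l (a, b, c) *
      (poly (log_deriv_factor n (a + t * b) (t * c)) x * (x ^ a * (x ^ t) ^ b * ((x - 1) ^ t) ^ c)))"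
      (is "_ = ?s1") by (simp add: poly_sum split_def power_add power_mult)
    have e2: "[?s1 = (\<Sum>(a, b, c)\<in>?I. l (a, b, c) *
      (poly (log_deriv_factor n (a + t * b) (t * c)) x * (x ^ a * u ^ b * v ^ c)))] (mod p)"
      (is "[_ = ?s2] (mod p)")
      unfolding split_def using uv(2,3) by (intro cong_sum cong_mult cong_pow cong_refl)
    have e3: "?s2 = poly (\<Sum>x\<in>?I. smult (l x) (g (u, v) n x)) x"
      unfolding poly_sum by (intro sum.cong refl) (auto simp: g_def)
    have "[:p:] dvd (\<Sum>x\<in>?I. smult (l x) (g (u, v) n x))"
      unfolding const_poly_dvd_iff using sol[OF uv(1) n] by blast
    then have "p dvd ?s2" unfolding e3 by (auto elim!: dvdE)
    then have "p dvd ?s1" using e2 cong_dvd_iff by blast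
    then show "p dvd poly ((log_deriv ^^ n) ?F) x" unfolding e1 .
  qed
  from degree_ge_of_vanishes_mod[OF p finS S this AB(4) F]
  have "D * card S \<le> degree ?F" by blast
  also have "\<dots> \<le> A + 2 * t * B"
  proof (rule degree_sum_le, simp)
    fix x assume "x \<in> ?I"
    then obtain a b c where abc: "x = (a, b, c)" "a < A" "b < B" "c < B" by auto
    have "degree ([:0, 1:] ^ (a + t * b) * [:-1, 1:] ^ (t * c) :: int poly) \<le> (a + t * b) + t * c"
      by (rule order_trans[OF degree_mult_le]) (simp add: degree_power_eq)
    also have "\<dots> \<le> A + t * B + t * B" using abc by (intro add_mono mult_mono) auto
    finally show "degree (case x of (a, b, c) \<Rightarrow> smult (l (a, b, c))
      ([:0, 1:] ^ (a + t * b) * [:-1, 1:] ^ (t * c))) \<le> A + 2 * t * B"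
      using abc by (auto intro: order_trans[OF degree_smult_le])
  qed
  finally show ?thesis .
qed

section \<open>Sizes of one and of many power fibres\<close>

definition power_fibre :: "int \<Rightarrow> nat \<Rightarrow> int \<times> int \<Rightarrow> int set"
  where "power_fibre p t uv = {x \<in> {2..<p}. [x ^ t = fst uv] (mod p) \<and> [(x - 1) ^ t = snd uv] (mod p)}"

lemma finite_power_fibre [simp]: "finite (power_fibre p t uv)"
  by (rule finite_subset[of _ "{2..<p}"]) (auto simp: power_fibre_def)

text \<open>With \<open>D = A\<close> and one fibre the parameter count asks for
  \<open>2 A < B^2\<close>, while \<open>A B <= t\<close>. So \<open>B\<close> has order
  \<open>t^(1/3)\<close>, and the bound \<open>2 t B / A\<close> has order \<open>B^2\<close>, that
  is \<open>t^(2/3)\<close>.\<close>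

lemma card_power_fibre_bound:
  fixes p :: int
  assumes p: "prime p" and t: "512 \<le> t" "int (t * t) \<le> p"
  shows "card (power_fibre p t uv) ^ 3 \<le> 55296 * t\<^sup>2"
proof -
  let ?s = "card (power_fibre p t uv)"
  define B where "B = (LEAST b. 2 * t < b ^ 3)"
  have ex: "2 * t < (2 * t + 1) ^ 3"
    by (simp add: power3_eq_cube algebra_simps)
  have B1: "2 * t < B ^ 3" unfolding B_def by (rule LeastI[of _ "2 * t + 1"]) (rule ex)
  have B0: "B \<ge> 2"
  proof (rule ccontr)
    assume "\<not> B \<ge> 2"
    then have "B = 0 \<or> B = 1" by auto
    then have "B ^ 3 \<le> 1" by auto
    with B1 t show False by linarith
  qed
  have "\<not> 2 * t < (B - 1) ^ 3" unfolding B_def by (rule not_less_Least) (use B0 in \<open>auto simp: B_def\<close>)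
  moreover have "B ^ 3 \<le> (2 * (B - 1)) ^ 3" by (rule power_mono) (use B0 in auto)
  \<comment> \<open>As \<open>B <= 2 * (B - 1)\<close>, the minimality of \<open>B\<close> costs
    only a factor \<open>8\<close>.\<close>
  ultimately have B2: "B ^ 3 \<le> 16 * t" by (simp add: power_mult_distrib)
  have Bt: "2 * B \<le> t"
  proof (rule ccontr)
    assume "\<not> 2 * B \<le> t"
    then have "t \<le> 2 * B" by simp
    then have "t ^ 3 \<le> (2 * B) ^ 3" by (rule power_mono) auto
    also have "\<dots> \<le> 128 * t" using B2 by (simp add: power_mult_distrib)
    finally have "t * t * t \<le> 128 * t" by (simp add: power3_eq_cube)
    then have "t * t \<le> 128" using t by simp
    moreover have "512 * 512 \<le> t * t" using t by (intro mult_mono) auto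
    ultimately show False by linarith
  qed
  define A where "A = t div B"
  have AB: "A * B \<le> t" unfolding A_def by simp
  have "t < A * B + B" unfolding A_def using B0 by (metis Suc_1 Suc_le_lessD add.commute dividend_less_times_div mult.commute not_numeral_le_zero le_zero_eq gr0I)
  then have AB2: "t \<le> 2 * (A * B)" using Bt by linarith
  have A0: "A \<ge> 1" using AB2 t by (cases A) auto
  have At: "A \<le> t" unfolding A_def by simp
  have tB: "2 * (t * B) \<le> t * t" using Bt by (metis mult.commute mult.left_commute mult_le_mono2)
  have "2 * A * B < B ^ 3" using AB B1 by linarith
  then have "2 * A < B * B" by (simp add: power3_eq_cube)
  then have lt: "card {uv} * (A * (A + A)) < A * (B * B)" using A0 by simp
  have "512 * t \<le> t * t" using t by simp
  then have sm: "A + t * B \<le> t * t" using tB At by linarith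
  have "A * ?s \<le> A + 2 * t * B"
  proof (rule stepanov_bound[OF p _ lt AB At])
    show "int (A + t * B) \<le> p" using sm t by linarith
    show "int A \<le> p" using sm t by linarith
  qed (auto simp: power_fibre_def split_def)
  then have "A * ?s * (2 * B) \<le> (A + 2 * t * B) * (2 * B)" by (rule mult_right_mono) simp
  then have "2 * (A * B) * ?s \<le> 2 * (A * B) + 4 * t * (B * B)" by (simp add: algebra_simps)
  moreover have "t * ?s \<le> 2 * (A * B) * ?s" using AB2 by (rule mult_right_mono) simp
  moreover have "1 \<le> B * B" using B0 by simp
  then have "2 * (A * B) \<le> 2 * t * (B * B)" using AB by (metis mult.right_neutral mult_le_mono mult.assoc le_refl)
  ultimately have "t * ?s \<le> t * (6 * (B * B))" by linarith
  then have "?s \<le> 6 * (B * B)" using t by simp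
  then have "?s ^ 3 \<le> (6 * (B * B)) ^ 3" by (rule power_mono) simp
  also have "\<dots> = 216 * (B ^ 3) ^ 2" by (simp add: power_mult_distrib power3_eq_cube power2_eq_square)
  also have "\<dots> \<le> 216 * (16 * t) ^ 2" using B2 by (intro mult_left_mono power_mono) auto
  finally show ?thesis by (simp add: power_mult_distrib)
qed

text \<open>For \<open>n\<close> fibres of size at least \<open>s\<close>, the choice
  \<open>D = A\<close> and \<open>B\<close> about \<open>t / A\<close> gives
  \<open>n s A <= A + 2 t B\<close>, hence \<open>n s A^2 <= 3 t^2\<close>. Since \<open>A\<close>
  is comparable to \<open>s\<close>, this is the claim. The bound for a single fibre keeps
  \<open>s^3\<close> below a multiple of \<open>t^2\<close>, as the parameter count
  requires.\<close>

lemma card_large_power_fibres: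
  fixes p :: int
  assumes p: "prime p" and t: "512 \<le> t" "int (t * t) \<le> p" and s: "1024 \<le> s"
    and T: "T \<subseteq> {0..<p} \<times> {0..<p}" "\<And>uv. uv \<in> T \<Longrightarrow> s \<le> card (power_fibre p t uv)"
  shows "card T * s ^ 3 \<le> 3145728 * t\<^sup>2"
proof (cases "T = {}")
  case False
  have finT: "finite T" using T(1) by (rule finite_subset) auto
  from False obtain uv where "uv \<in> T" by auto
  then have "s ^ 3 \<le> card (power_fibre p t uv) ^ 3" using T(2) by (intro power_mono) auto
  then have s3: "s ^ 3 \<le> 55296 * t\<^sup>2" using card_power_fibre_bound[OF p t, of uv] by linarith
  define A where "A = s div 512"
  define B where "B = t div A"
  have sA: "512 * A \<le> s" unfolding A_def by simp
  have A2: "A \<ge> 2" unfolding A_def using s by (simp add: le_div_geq)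
  have A512: "s \<le> 1024 * A" unfolding A_def using s by linarith
  have A3: "512 * (A ^ 3) \<le> t\<^sup>2"
  proof -
    have "(512 * A) ^ 3 \<le> s ^ 3" using sA by (rule power_mono) simp
    then have "512 ^ 3 * A ^ 3 \<le> 55296 * t\<^sup>2" using s3 by (simp add: power_mult_distrib)
    then show ?thesis by simp
  qed
  have At: "2 * A \<le> t"
  proof (rule ccontr)
    assume "\<not> 2 * A \<le> t"
    then have "t \<le> 2 * A" by simp
    then have "t ^ 2 \<le> (2 * A) ^ 2" by (rule power_mono) simp
    moreover have "512 * A ^ 3 = 512 * A * (A * A)" "(2 * A)\<^sup>2 = 4 * (A * A)"
      by (simp_all add: power3_eq_cube power2_eq_square)
    ultimately have "512 * A * (A * A) \<le> 4 * (A * A)" using A3 by linarith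
    then have "512 * A \<le> 4" using A2 by simp
    with A2 show False by simp
  qed
  have AB: "A * B \<le> t" unfolding B_def by (simp add: mult.commute)
  have "t < A * B + A" unfolding B_def using A2 by (metis Suc_1 Suc_le_lessD add.commute dividend_less_times_div mult.commute not_numeral_le_zero le_zero_eq gr0I)
  then have AB2: "t \<le> 2 * (A * B)" using At by linarith
  have main: "card T * (s * A\<^sup>2) \<le> 3 * t\<^sup>2"
  proof (rule ccontr)
    assume neg: "\<not> ?thesis"
    \<comment> \<open>The parameter count also limits the number of fibres from above, so a
      subfamily of the least size violating the claim is taken.\<close>
    define n where "n = 3 * t\<^sup>2 div (s * A\<^sup>2) + 1"
    have pos: "s * A\<^sup>2 > 0" using s A2 by simp
    have n1: "3 * t\<^sup>2 < n * (s * A\<^sup>2)" unfolding n_def using pos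
      by (metis Suc_eq_plus1 dividend_less_div_times add.commute mult_Suc)
    have n2: "n * (s * A\<^sup>2) \<le> 3 * t\<^sup>2 + s * A\<^sup>2"
      unfolding n_def by (simp add: div_times_less_eq_dividend)
    have "n \<le> card T"
    proof (rule ccontr)
      assume "\<not> n \<le> card T"
      then have "card T \<le> 3 * t\<^sup>2 div (s * A\<^sup>2)" unfolding n_def by simp
      then have "card T * (s * A\<^sup>2) \<le> 3 * t\<^sup>2 div (s * A\<^sup>2) * (s * A\<^sup>2)" by (rule mult_right_mono) simp
      also have "\<dots> \<le> 3 * t\<^sup>2" by (rule div_times_less_eq_dividend)
      finally show False using neg by simp
    qed
    then obtain T' where T': "T' \<subseteq> T" "card T' = n" using obtain_subset_with_card_n by metis
    have finT': "finite T'" using T' finT finite_subset by blast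
    let ?S = "\<Union>uv\<in>T'. power_fibre p t uv"
    have disj: "power_fibre p t uv \<inter> power_fibre p t uv' = {}"
      if "uv \<in> T'" "uv' \<in> T'" "uv \<noteq> uv'" for uv uv'
    proof -
      have "uv = uv'" if "x \<in> power_fibre p t uv" "x \<in> power_fibre p t uv'" for x
      proof -
        have "[fst uv = fst uv'] (mod p)" "[snd uv = snd uv'] (mod p)"
          using that by (auto simp: power_fibre_def intro: cong_trans cong_sym)
        moreover have "uv \<in> {0..<p} \<times> {0..<p}" "uv' \<in> {0..<p} \<times> {0..<p}"
          using T' T \<open>uv \<in> T'\<close> \<open>uv' \<in> T'\<close> by auto
        ultimately show ?thesis by (auto simp: cong_def prod_eq_iff)
      qed
      then show ?thesis using that by auto
    qed
    have "n * s \<le> (\<Sum>uv\<in>T'. card (power_fibre p t uv))"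
      using T' T(2) sum_bounded_below[of T' s "\<lambda>uv. card (power_fibre p t uv)"] by auto
    also have "\<dots> = card ?S"
      using finT' disj by (intro card_UN_disjoint[symmetric]) auto
    finally have nS: "n * s \<le> card ?S" .
    \<comment> \<open>By the choice of \<open>n\<close>, \<open>n s A^2\<close> exceeds
      \<open>3 t^2\<close> by at most \<open>s A^2\<close>, which is again controlled by
      \<open>512 A^3 <= t^2\<close>.\<close>
    have "2 * n * A < B * B"
    proof -
      have "n * ((512 * A) * A\<^sup>2) \<le> n * (s * A\<^sup>2)"
        using sA by (intro mult_left_mono mult_right_mono) auto
      moreover have "s * A\<^sup>2 \<le> (1024 * A) * A\<^sup>2"
        using A512 by (intro mult_right_mono) auto
      moreover have "n * ((512 * A) * A\<^sup>2) = 512 * (n * A ^ 3)" "(1024 * A) * A\<^sup>2 = 1024 * A ^ 3"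
        by (simp_all add: power3_eq_cube power2_eq_square)
      ultimately have "64 * (n * A ^ 3) \<le> t\<^sup>2" using A3 n2 by linarith
      moreover have "t\<^sup>2 \<le> (2 * (A * B))\<^sup>2" using AB2 by (rule power_mono) simp
      ultimately have "64 * (n * A ^ 3) \<le> 4 * (A\<^sup>2 * B\<^sup>2)" by (simp add: power_mult_distrib)
      then have "A\<^sup>2 * (16 * (n * A)) \<le> A\<^sup>2 * B\<^sup>2" by (simp add: power3_eq_cube power2_eq_square algebra_simps)
      then have "16 * (n * A) \<le> B\<^sup>2" using A2 by simp
      moreover have "n * A > 0" unfolding n_def using A2 by simp
      ultimately show ?thesis unfolding power2_eq_square mult.assoc by linarith
    qed
    then have "A * (2 * n * A) < A * (B * B)" using A2 by simp
    moreover have "card T' * (A * (A + A)) = A * (2 * n * A)" using T' by (simp add: algebra_simps)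
    ultimately have lt: "card T' * (A * (A + A)) < A * (B * B)" by simp
    have "t * (2 * B) \<le> t * t"
    proof (rule mult_left_mono)
      have "2 * B \<le> A * B" using A2 by (rule mult_right_mono) simp
      then show "2 * B \<le> t" using AB by linarith
    qed simp
    moreover have "512 * t \<le> t * t" using t by simp
    ultimately have sm: "A + t * B \<le> t * t" using At by linarith
    have "A * card ?S \<le> A + 2 * t * B"
    proof (rule stepanov_bound[OF p finT' lt AB])
      show "A \<le> t" using At by linarith
      show "int (A + t * B) \<le> p" using sm t by linarith
      show "int A \<le> p" using sm t by linarith
    qed (auto simp: power_fibre_def split_def)
    then have "A * (n * s) \<le> A + 2 * t * B" using nS by (metis le_trans mult_le_mono2)
    then have "A * (A * (n * s)) \<le> A * (A + 2 * t * B)" by (rule mult_left_mono) simp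
    then have "n * (s * A\<^sup>2) \<le> A * A + 2 * t * (A * B)" by (simp add: power2_eq_square algebra_simps)
    also have "\<dots> \<le> t * t + 2 * t * t" using At AB by (intro add_mono mult_mono) auto
    finally show False using n1 by (simp add: power2_eq_square)
  qed
  have "card T * s ^ 3 = card T * (s * (s * s))" by (simp add: power3_eq_cube)
  also have "\<dots> \<le> card T * (s * ((1024 * A) * (1024 * A)))"
    using A512 by (intro mult_left_mono mult_mono) auto
  also have "\<dots> = 1048576 * (card T * (s * A\<^sup>2))" by (simp add: power2_eq_square)
  also have "\<dots> \<le> 1048576 * (3 * t\<^sup>2)" using main by (rule mult_left_mono) simp
  finally show ?thesis by simp
qed simp

section \<open>Residues modulo a prime\<close>

lemma card_roots_mod_prime_le:
  fixes p :: nat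
  assumes p: "prime p" and n: "0 < n"
  shows "card {x \<in> {0..<int p}. [x ^ n = u] (mod int p)} \<le> n"
proof -
  have p0: "0 < int p" using prime_gt_0_nat[OF p] by simp
  define c where "c = nat (u mod int p)"
  have c: "int c = u mod int p" unfolding c_def using p0 by simp
  let ?A = "{x \<in> {..<p}. [x ^ n = c] (mod p)}"
  have "{x \<in> {0..<int p}. [x ^ n = u] (mod int p)} \<subseteq> int ` ?A"
  proof
    fix x assume x: "x \<in> {x \<in> {0..<int p}. [x ^ n = u] (mod int p)}"
    define k where "k = nat x"
    have xk: "x = int k" using x by (simp add: k_def)
    have "[int (k ^ n) = int c] (mod int p)" using x unfolding c xk by (simp add: cong_def)
    then have "[k ^ n = c] (mod p)" by (simp only: cong_int_iff)
    then show "x \<in> int ` ?A" using x xk by auto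
  qed
  then have "card {x \<in> {0..<int p}. [x ^ n = u] (mod int p)} \<le> card ?A"
    by (rule surj_card_le[rotated]) simp
  also have "\<dots> \<le> n" by (rule roots_mod_prime_bound[OF p n])
  finally show ?thesis .
qed

lemma card_pairs_mult_le:
  assumes inj: "inj_on f T" and T': "finite T'" "\<And>x. x \<in> T \<Longrightarrow> \<exists>uv\<in>T'. f x \<in> A uv"
    and A: "\<And>uv. finite (A uv)" "\<And>uv. card (A uv) \<le> n"
  shows "card T \<le> card T' * n"
proof -
  have "card T \<le> card (\<Union>uv\<in>T'. A uv)"
    by (rule card_inj_on_le[OF inj]) (use T' A in auto)
  also have "\<dots> \<le> (\<Sum>uv\<in>T'. card (A uv))" by (rule card_UN_le) (rule T')
  also have "\<dots> \<le> (\<Sum>uv\<in>T'. n)" by (rule sum_mono) (rule A)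
  finally show ?thesis by simp
qed

text \<open>Multiplication by \<open>a\<close> permutes the set, so the product of all elements, a
  unit, is unchanged when multiplied by \<open>a ^ card \<Gamma>\<close>.\<close>

lemma subgroup_power_card_cong_1:
  fixes p :: nat and \<Gamma> :: "int set"
  assumes p: "prime p" and G: "\<Gamma> \<subseteq> {1..<int p}" "\<And>x y. x \<in> \<Gamma> \<Longrightarrow> y \<in> \<Gamma> \<Longrightarrow> x * y mod int p \<in> \<Gamma>"
    and a: "a \<in> \<Gamma>"
  shows "[a ^ card \<Gamma> = 1] (mod int p)"
proof -
  have fin: "finite \<Gamma>" using G(1) by (rule finite_subset) simp
  have cop: "coprime x (int p)" if "x \<in> \<Gamma>" for x
  proof -
    have "\<not> int p dvd x" using G(1) that zdvd_not_zless[of x "int p"] by auto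
    then show ?thesis using p by (metis coprime_commute prime_imp_coprime prime_nat_int_transfer)
  qed
  have inj: "inj_on (\<lambda>x. a * x mod int p) \<Gamma>"
  proof (rule inj_onI)
    fix x y assume xy: "x \<in> \<Gamma>" "y \<in> \<Gamma>" "a * x mod int p = a * y mod int p"
    then have "[a * x = a * y] (mod int p)" by (simp add: cong_def)
    then have "[x = y] (mod int p)" using cong_mult_lcancel[OF cop[OF a]] by blast
    moreover have "0 \<le> x" "x < int p" "0 \<le> y" "y < int p" using xy(1,2) G(1) by auto
    ultimately show "x = y" by (intro cong_less_imp_eq_int)
  qed
  have im: "(\<lambda>x. a * x mod int p) ` \<Gamma> = \<Gamma>"
    by (rule endo_inj_surj[OF fin _ inj]) (use G(2)[OF a] in auto)
  have "\<Prod>\<Gamma> = (\<Prod>x\<in>\<Gamma>. a * x mod int p)"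
    using prod.reindex[OF inj, of "\<lambda>x. x"] im by simp
  then have "[\<Prod>\<Gamma> = (\<Prod>x\<in>\<Gamma>. a * x)] (mod int p)"
    by (simp add: cong_def mod_prod_eq)
  also have "(\<Prod>x\<in>\<Gamma>. a * x) = \<Prod>\<Gamma> * a ^ card \<Gamma>" by (simp add: prod.distrib mult.commute)
  finally have "[\<Prod>\<Gamma> * 1 = \<Prod>\<Gamma> * a ^ card \<Gamma>] (mod int p)" by simp
  moreover have "coprime (\<Prod>\<Gamma>) (int p)" by (rule prod_coprime_left) (rule cop)
  ultimately show ?thesis using cong_mult_lcancel cong_sym by blast
qed

lemma prime_coprime_residue:
  fixes p :: nat and x :: int
  assumes "prime p" "\<not> [x = 0] (mod int p)"
  shows "coprime x (int p)"
  using assms by (metis cong_0_iff coprime_commute prime_imp_coprime prime_nat_int_transfer)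

text \<open>Divide \<open>a - r b = z\<close> by \<open>z\<close>: with \<open>x = a / z\<close> one
  has \<open>x - 1 = (r / z) b\<close>. Raising to the power \<open>t\<close> kills \<open>a\<close>
  and \<open>b\<close>, so all solutions for \<open>(r, z)\<close> give distinct points of the fibre
  labelled by the \<open>t\<close>-th powers of \<open>1 / z\<close> and \<open>r / z\<close>. A
  label comes from at most \<open>t^2\<close> pairs, which raises \<open>t^2\<close> to
  \<open>t^4\<close>.\<close>

lemma card_shifted_pairs_level:
  fixes p :: nat and \<Gamma> :: "int set"
  assumes p: "prime p" and G: "\<Gamma> \<subseteq> {1..<int p}" "\<And>x y. x \<in> \<Gamma> \<Longrightarrow> y \<in> \<Gamma> \<Longrightarrow> x * y mod int p \<in> \<Gamma>"
    and t: "512 \<le> card \<Gamma>" "card \<Gamma> * card \<Gamma> \<le> p" and s: "1024 \<le> s"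
  shows "card {(r, z) \<in> {1..<int p} \<times> {1..<int p}. s \<le> card {(a, b) \<in> \<Gamma> \<times> \<Gamma>. [a - r * b = z] (mod int p)}} * s ^ 3
    \<le> 3145728 * card \<Gamma> ^ 4" (is "card ?T * _ \<le> _")
proof -
  define P where "P = int p"
  define t where "t = card \<Gamma>"
  have p': "prime P" using p by (simp add: P_def)
  have P1: "1 < P" using prime_gt_1_int[OF p'] .
  have unit: "coprime x P" if "x \<in> {1..<P}" for x
    using that zdvd_not_zless[of x P] unfolding P_def
    by (intro prime_coprime_residue[OF p]) (auto simp: cong_0_iff)
  have eq: "x = y" if "[x = y] (mod P)" "x \<in> {0..<P}" "y \<in> {0..<P}" for x y
    using that by (intro cong_less_imp_eq_int) auto
  have G0: "x \<in> {1..<P}" "x \<in> {0..<P}" if "x \<in> \<Gamma>" for x using that G(1) by (auto simp: P_def)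
  have one: "[x ^ t = 1] (mod P)" if "x \<in> \<Gamma>" for x
    unfolding t_def P_def by (rule subgroup_power_card_cong_1[OF p G that])
  have "\<exists>w. w \<in> {1..<P} \<and> [z * w = 1] (mod P)" if z: "z \<in> {1..<P}" for z
  proof -
    obtain x where x: "[z * x = 1] (mod P)" using cong_solve_coprime_int[OF unit[OF z]] by auto
    then have x': "[z * (x mod P) = 1] (mod P)" by (simp add: cong_def mod_simps)
    then have "x mod P \<noteq> 0" using P1 by (auto simp: cong_def)
    then have "x mod P \<in> {1..<P}" using P1 pos_mod_sign[of P x] pos_mod_bound[of P x] unfolding atLeastLessThan_iff by linarith
    then show ?thesis using x' by blast
  qed
  then obtain w where w: "\<And>z. z \<in> {1..<P} \<Longrightarrow> w z \<in> {1..<P}" "\<And>z. z \<in> {1..<P} \<Longrightarrow> [z * w z = 1] (mod P)"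
    by metis
  define \<phi> where "\<phi> = (\<lambda>(r, z). (w z ^ t mod P, (w z * r) ^ t mod P))"
  have sub: "?T \<subseteq> {1..<P} \<times> {1..<P}" by (auto simp: P_def)
  have finT: "finite ?T" using sub by (rule finite_subset) simp
  have fibre: "s \<le> card (power_fibre P t (\<phi> rz))" if rz: "rz \<in> ?T" for rz
  proof -
    obtain r z where [simp]: "rz = (r, z)" by (cases rz)
    have r: "r \<in> {1..<P}" and z: "z \<in> {1..<P}" using rz by (auto simp: P_def)
    let ?S = "{(a, b) \<in> \<Gamma> \<times> \<Gamma>. [a - r * b = z] (mod P)}"
    have "s \<le> card ?S" using rz by (simp add: P_def)
    also have "\<dots> \<le> card (power_fibre P t (\<phi> rz))"
    proof (rule card_inj_on_le)
      show "finite (power_fibre P t (\<phi> rz))" by simp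
      show "inj_on (\<lambda>(a, b). a * w z mod P) ?S"
      proof (rule inj_onI, clarify)
        fix a b a' b'
        assume A: "a \<in> \<Gamma>" "b \<in> \<Gamma>" "a' \<in> \<Gamma>" "b' \<in> \<Gamma>" "[a - r * b = z] (mod P)" "[a' - r * b' = z] (mod P)"
          "a * w z mod P = a' * w z mod P"
        then have "[a * w z = a' * w z] (mod P)" by (simp add: cong_def)
        then have "[a = a'] (mod P)" using cong_mult_rcancel[OF unit[OF w(1)[OF z]]] by blast
        then have aa: "a = a'" using A G0 by (intro eq)
        have "[a - (a - r * b) = a - (a' - r * b')] (mod P)"
          by (rule cong_diff[OF cong_refl cong_trans[OF A(5) cong_sym[OF A(6)]]])
        then have "[r * b = r * b'] (mod P)" by (simp add: aa)
        then have "[b = b'] (mod P)" using cong_mult_lcancel[OF unit[OF r]] by blast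
        then have "b = b'" using A G0 by (intro eq)
        with aa show "a = a' \<and> b = b'" by simp
      qed
      show "(\<lambda>(a, b). a * w z mod P) ` ?S \<subseteq> power_fibre P t (\<phi> rz)"
      proof (rule image_subsetI, clarify)
        fix a b assume a: "a \<in> \<Gamma>" and b: "b \<in> \<Gamma>" and ab: "[a - r * b = z] (mod P)"
        define x where "x = a * w z mod P"
        have xc: "[x = a * w z] (mod P)" by (simp add: x_def cong_def)
        have "[x ^ t = (a * w z) ^ t] (mod P)" by (rule cong_pow[OF xc])
        also have "(a * w z) ^ t = a ^ t * w z ^ t" by (rule power_mult_distrib)
        also have "[a ^ t * w z ^ t = 1 * w z ^ t] (mod P)" by (rule cong_mult[OF one[OF a] cong_refl])
        finally have x1: "[x ^ t = w z ^ t] (mod P)" by simp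
        have "[x - 1 = a * w z - z * w z] (mod P)" by (rule cong_diff[OF xc cong_sym[OF w(2)[OF z]]])
        also have "a * w z - z * w z = (a - z) * w z" by (simp add: algebra_simps)
        also have "[(a - z) * w z = (a - (a - r * b)) * w z] (mod P)"
          by (intro cong_mult cong_diff cong_refl cong_sym[OF ab])
        also have "(a - (a - r * b)) * w z = (w z * r) * b" by simp
        finally have xm: "[x - 1 = (w z * r) * b] (mod P)" .
        have "[(x - 1) ^ t = ((w z * r) * b) ^ t] (mod P)" by (rule cong_pow[OF xm])
        also have "((w z * r) * b) ^ t = (w z * r) ^ t * b ^ t" by (rule power_mult_distrib)
        also have "[(w z * r) ^ t * b ^ t = (w z * r) ^ t * 1] (mod P)" by (rule cong_mult[OF cong_refl one[OF b]])
        finally have x2: "[(x - 1) ^ t = (w z * r) ^ t] (mod P)" by simp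
        have nz: "\<not> [y = 0] (mod P)" if "coprime y P" for y
          using that P1 by (auto simp: cong_0_iff coprime_absorb_right)
        have "\<not> [x = 0] (mod P)"
        proof
          assume "[x = 0] (mod P)"
          then have "[a * w z = 0] (mod P)" using cong_trans cong_sym xc by blast
          moreover have "coprime (a * w z) P" using unit[OF G0(1)[OF a]] unit[OF w(1)[OF z]] by simp
          ultimately show False using nz by blast
        qed
        then have "x \<noteq> 0" by auto
        have "\<not> [x - 1 = 0] (mod P)"
        proof
          assume "[x - 1 = 0] (mod P)"
          then have "[w z * r * b = 0] (mod P)" using cong_trans cong_sym xm by blast
          moreover have "coprime (w z * r * b) P"
            using unit[OF G0(1)[OF b]] unit[OF w(1)[OF z]] unit[OF r] by simp
          ultimately show False using nz by blast
        qed
        then have "x \<noteq> 1" by auto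
        have "x \<in> {0..<P}" using P1 by (simp add: x_def)
        with \<open>x \<noteq> 0\<close> \<open>x \<noteq> 1\<close> have "x \<in> {2..<P}" by auto
        then show "a * w z mod P \<in> power_fibre P t (\<phi> rz)"
          unfolding x_def[symmetric] power_fibre_def using x1 x2 by (simp add: \<phi>_def cong_def)
      qed
    qed
    finally show ?thesis .
  qed
  have T's: "card (\<phi> ` ?T) * s ^ 3 \<le> 3145728 * t\<^sup>2"
  proof (rule card_large_power_fibres[OF p' _ _ s])
    show "512 \<le> t" using t by (simp add: t_def)
    have "int (card \<Gamma> * card \<Gamma>) \<le> int p" using t(2) by (simp only: of_nat_le_iff)
    then show "int (t * t) \<le> P" by (simp only: t_def P_def)
    show "\<phi> ` ?T \<subseteq> {0..<P} \<times> {0..<P}" using P1 by (auto simp: \<phi>_def)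
    show "s \<le> card (power_fibre P t uv)" if "uv \<in> \<phi> ` ?T" for uv using that fibre by blast
  qed
  define A where "A = (\<lambda>uv. {x \<in> {0..<P}. [x ^ t = fst uv] (mod P)} \<times> {x \<in> {0..<P}. [x ^ t = snd uv] (mod P)})"
  have "card ?T \<le> card (\<phi> ` ?T) * t\<^sup>2"
  proof (rule card_pairs_mult_le)
    show "inj_on (\<lambda>(r, z). (w z, w z * r mod P)) ?T"
    proof (rule inj_onI, clarify)
      fix r z r' z'
      assume rz: "r \<in> {1..<int p}" "z \<in> {1..<int p}" "r' \<in> {1..<int p}" "z' \<in> {1..<int p}"
        and e: "w z = w z'" "w z * r mod P = w z' * r' mod P"
      have rz: "r \<in> {1..<P}" "z \<in> {1..<P}" "r' \<in> {1..<P}" "z' \<in> {1..<P}" using rz by (auto simp: P_def)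
      have "[z * w z = z' * w z] (mod P)"
        using w(2)[OF rz(2)] w(2)[OF rz(4)] e by (metis cong_sym cong_trans)
      then have "[z = z'] (mod P)" using cong_mult_rcancel[OF unit[OF w(1)[OF rz(2)]]] by blast
      then have "z = z'" by (rule eq) (use rz in auto)
      have "[w z * r = w z * r'] (mod P)" using e by (simp add: cong_def)
      then have "[r = r'] (mod P)" using cong_mult_lcancel[OF unit[OF w(1)[OF rz(2)]]] by blast
      then have "r = r'" by (rule eq) (use rz in auto)
      with \<open>z = z'\<close> show "r = r' \<and> z = z'" by simp
    qed
    show "finite (\<phi> ` ?T)" using finT by simp
    show "\<exists>uv\<in>\<phi> ` ?T. (\<lambda>(r, z). (w z, w z * r mod P)) rz \<in> A uv" if rz: "rz \<in> ?T" for rz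
    proof (rule bexI)
      show "\<phi> rz \<in> \<phi> ` ?T" using rz by (rule imageI)
      obtain r z where [simp]: "rz = (r, z)" by (cases rz)
      have "w z \<in> {1..<P}" using rz by (intro w) (auto simp: P_def)
      then show "(\<lambda>(r, z). (w z, w z * r mod P)) rz \<in> A (\<phi> rz)"
        using P1 by (auto simp: A_def \<phi>_def cong_def power_mod)
    qed
    show "finite (A uv)" for uv
      by (rule finite_subset[of _ "{0..<P} \<times> {0..<P}"]) (auto simp: A_def)
    have t0: "0 < t" using t by (simp add: t_def)
    show "card (A uv) \<le> t\<^sup>2" for uv
      unfolding A_def card_cartesian_product power2_eq_square P_def
      by (intro mult_mono card_roots_mod_prime_le[OF p t0]) auto
  qed
  then have "card ?T * s ^ 3 \<le> card (\<phi> ` ?T) * t\<^sup>2 * s ^ 3" by (rule mult_right_mono) simp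
  also have "\<dots> = card (\<phi> ` ?T) * s ^ 3 * t\<^sup>2" by simp
  also have "\<dots> \<le> 3145728 * t\<^sup>2 * t\<^sup>2" using T's by (rule mult_right_mono) simp
  also have "\<dots> = 3145728 * t ^ 4" by (simp add: power_numeral_reduce)
  finally show ?thesis by (simp only: t_def)
qed

text \<open>The product of all rings \<open>\<int>/n\<close>. The prime is quantified inside the statement, so a type of residues modulo
  \<open>p\<close> is not available; \<open>residue_in p\<close> embeds them all into one ring.\<close>

typedef zprod = "{f :: nat \<Rightarrow> int. \<forall>n. f n mod int n = f n}"
  by (rule exI[of _ "\<lambda>_. 0"]) auto

setup_lifting type_definition_zprod

instantiation zprod :: comm_ring
begin

lift_definition zero_zprod :: zprod is "\<lambda>_. 0" by auto
lift_definition plus_zprod :: "zprod \<Rightarrow> zprod \<Rightarrow> zprod" is "\<lambda>f g n. (f n + g n) mod int n" by auto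
lift_definition minus_zprod :: "zprod \<Rightarrow> zprod \<Rightarrow> zprod" is "\<lambda>f g n. (f n - g n) mod int n" by auto
lift_definition uminus_zprod :: "zprod \<Rightarrow> zprod" is "\<lambda>f n. (- f n) mod int n" by auto
lift_definition times_zprod :: "zprod \<Rightarrow> zprod \<Rightarrow> zprod" is "\<lambda>f g n. (f n * g n) mod int n" by auto

instance
  by standard (transfer; auto simp: fun_eq_iff mod_simps algebra_simps)+

end

lift_definition residue_in :: "nat \<Rightarrow> int \<Rightarrow> zprod" is "\<lambda>m x n. if n = m then x mod int n else 0" by auto

lemma residue_in_arith:
  "residue_in m x - residue_in m y = residue_in m (x - y)"
  "residue_in m x * residue_in m y = residue_in m (x * y)"
  "residue_in m 0 = 0"
  by (transfer; auto simp: fun_eq_iff mod_simps)+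

lemma residue_in_eq_iff: "residue_in m x = residue_in m y \<longleftrightarrow> [x = y] (mod int m)"
proof transfer
  fix m x y
  have "((\<lambda>n. if n = m then x mod int n else 0) = (\<lambda>n. if n = m then y mod int n else 0)) \<longleftrightarrow> x mod int m = y mod int m"
    by (metis (full_types))
  then show "((\<lambda>n. if n = m then x mod int n else 0) = (\<lambda>n. if n = m then y mod int n else 0)) = [x = y] (mod int m)"
    by (simp add: cong_def)
qed

lemma residue_in_mod: "residue_in m (x mod int m) = residue_in m x"
  by (simp add: residue_in_eq_iff)

lemma inj_on_residue_in: "inj_on (residue_in m) {0..<int m}"
  by (rule inj_onI) (auto simp: residue_in_eq_iff intro: cong_less_imp_eq_int)

section \<open>Transfer of energy and level bound to residues\<close>

lemma ring_additive_energy_residue_in: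
  fixes p :: nat
  assumes p: "prime p" and G: "\<Gamma> \<subseteq> {1..<int p}"
  shows "ring_additive_energy (residue_ring (int p)) \<Gamma> = additive_energy (residue_in p ` \<Gamma>)"
proof -
  define R where "R = residue_ring (int p)"
  interpret residues_prime p R by unfold_locales (simp_all add: p R_def)
  have p0: "0 < int p" using prime_gt_0_nat[OF p] by simp
  have minus: "a \<ominus>\<^bsub>R\<^esub> b = (a - b) mod int p" for a b
    by (simp add: a_minus_def res_add_eq res_neg_eq mod_simps)
  let ?e = "residue_in p"
  have inj: "inj_on ?e \<Gamma>" by (rule inj_on_subset[OF inj_on_residue_in]) (use G in auto)
  let ?D = "(\<lambda>(a, b). (a - b) mod int p) ` (\<Gamma> \<times> \<Gamma>)"
  have D: "(\<lambda>(a, b). a - b) ` (?e ` \<Gamma> \<times> ?e ` \<Gamma>) = ?e ` ?D"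
    by (auto simp: image_iff residue_in_arith residue_in_mod) (metis residue_in_mod)+
  have injD: "inj_on ?e ?D" by (rule inj_on_subset[OF inj_on_residue_in]) (use p0 in auto)
  have rep: "diff_rep (?e ` \<Gamma>) (?e x) = card {(a, b) \<in> \<Gamma> \<times> \<Gamma>. (a - b) mod int p = x}" if "x \<in> ?D" for x
  proof -
    have x: "x mod int p = x" using that by auto
    have "{(a, b) \<in> ?e ` \<Gamma> \<times> ?e ` \<Gamma>. a - b = ?e x} = map_prod ?e ?e ` {(a, b) \<in> \<Gamma> \<times> \<Gamma>. (a - b) mod int p = x}"
      using x by (auto simp: residue_in_arith residue_in_eq_iff cong_def image_iff)
    moreover have "inj_on (map_prod ?e ?e) {(a, b) \<in> \<Gamma> \<times> \<Gamma>. (a - b) mod int p = x}"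
      by (rule inj_on_subset[OF map_prod_inj_on[OF inj inj]]) auto
    ultimately show ?thesis by (simp add: diff_rep_def card_image)
  qed
  have "additive_energy (?e ` \<Gamma>) = (\<Sum>x\<in>?D. (diff_rep (?e ` \<Gamma>) (?e x))\<^sup>2)"
    unfolding additive_energy_def D by (simp add: sum.reindex[OF injD])
  also have "\<dots> = ring_additive_energy R \<Gamma>"
    unfolding ring_additive_energy_def ring_diff_rep_def minus by (rule sum.cong[OF refl]) (simp add: rep)
  finally show ?thesis by (simp add: R_def)
qed

lemma subgroup_energy_residues:
  fixes p :: nat and \<Gamma> :: "int set"
  assumes p: "prime p" and G: "\<Gamma> \<subseteq> {1..<int p}" "1 \<in> \<Gamma>" "\<And>x y. x \<in> \<Gamma> \<Longrightarrow> y \<in> \<Gamma> \<Longrightarrow> x * y mod int p \<in> \<Gamma>"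
    and t: "512 \<le> card \<Gamma>" "card \<Gamma> * card \<Gamma> \<le> p"
    and J: "card \<Gamma> < 2 ^ J" and L: "3145728 \<le> L" "real J \<le> L"
  shows "subgroup_energy (residue_in p ` {0..<int p}) (residue_in p ` \<Gamma>) (residue_in p 1) L J"
proof
  let ?e = "residue_in p" and ?F = "residue_in p ` {0..<int p}"
  have p0: "0 < int p" using prime_gt_0_nat[OF p] by simp
  have inF: "?e x \<in> ?F" for x
    using p0 residue_in_mod[of p x] by (metis atLeastLessThan_iff image_eqI pos_mod_bound pos_mod_sign)
  have inj: "inj_on ?e \<Gamma>" by (rule inj_on_subset[OF inj_on_residue_in]) (use G in auto)
  have card: "card (?e ` \<Gamma>) = card \<Gamma>" by (rule card_image[OF inj])
  have zero: "?e x = 0 \<longleftrightarrow> [x = 0] (mod int p)" for x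
    unfolding residue_in_arith(3)[of p, symmetric] residue_in_eq_iff ..
  have U: "?F - {0} = ?e ` {1..<int p}"
    using p0 by (auto simp: zero cong_def image_iff)
  show "finite ?F" by simp
  show "x - y \<in> ?F" "x * y \<in> ?F" if "x \<in> ?F" "y \<in> ?F" for x y
    using that inF by (auto simp: residue_in_arith)
  show "?e 1 * x = x" if "x \<in> ?F" for x using that by (auto simp: residue_in_arith)
  show "\<exists>y\<in>?F. y * x = ?e 1" if x: "x \<in> ?F" "x \<noteq> 0" for x
  proof -
    obtain k where k: "x = ?e k" using x by auto
    then have "coprime k (int p)" using x by (intro prime_coprime_residue[OF p]) (simp add: zero)
    then obtain j where "[k * j = 1] (mod int p)" using cong_solve_coprime_int by blast
    then have "?e j * x = ?e 1" unfolding k residue_in_arith residue_in_eq_iff by (simp add: mult.commute)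
    then show ?thesis using inF by blast
  qed
  show "?e ` \<Gamma> \<subseteq> ?F - {0}" unfolding U using G(1) by (rule image_mono)
  show "?e 1 \<in> ?e ` \<Gamma>" using G(2) by (rule imageI)
  show "x * y \<in> ?e ` \<Gamma>" if xy: "x \<in> ?e ` \<Gamma>" "y \<in> ?e ` \<Gamma>" for x y
  proof -
    obtain a b where ab: "a \<in> \<Gamma>" "b \<in> \<Gamma>" "x = ?e a" "y = ?e b" using xy by auto
    have "x * y = ?e (a * b mod int p)" by (simp add: ab residue_in_arith residue_in_mod)
    then show ?thesis using G(3)[OF ab(1,2)] by blast
  qed
  show "card (?e ` \<Gamma>) < 2 ^ J" unfolding card by (rule J)
  show "1024 \<le> L" "real J \<le> L" using L by auto
  fix s :: nat assume s: "1024 \<le> s"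
  let ?T = "{(r, z) \<in> {1..<int p} \<times> {1..<int p}. s \<le> card {(a, b) \<in> \<Gamma> \<times> \<Gamma>. [a - r * b = z] (mod int p)}}"
  let ?T' = "{(r, z) \<in> (?F - {0}) \<times> (?F - {0}). s \<le> card {(a, b) \<in> ?e ` \<Gamma> \<times> ?e ` \<Gamma>. a - r * b = z}}"
  have finG: "finite \<Gamma>" using G(1) by (rule finite_subset) simp
  have "?T' \<subseteq> map_prod ?e ?e ` ?T"
  proof
    fix rz assume "rz \<in> ?T'"
    then obtain r z where rz_eq: "rz = (?e r, ?e z)" and *: "?e r \<noteq> 0" "?e z \<noteq> 0" "r \<in> {0..<int p}" "z \<in> {0..<int p}"
      and s: "s \<le> card {(a, b) \<in> ?e ` \<Gamma> \<times> ?e ` \<Gamma>. a - ?e r * b = ?e z}" by blast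
    have "r \<noteq> 0" "z \<noteq> 0" using * by (auto simp: zero)
    then have rz: "r \<in> {1..<int p}" "z \<in> {1..<int p}" using * by auto
    note s
    also have "card {(a, b) \<in> ?e ` \<Gamma> \<times> ?e ` \<Gamma>. a - ?e r * b = ?e z} \<le> card {(a, b) \<in> \<Gamma> \<times> \<Gamma>. [a - r * b = z] (mod int p)}"
    proof (rule surj_card_le)
      show "finite {(a, b) \<in> \<Gamma> \<times> \<Gamma>. [a - r * b = z] (mod int p)}"
        by (rule finite_subset[of _ "\<Gamma> \<times> \<Gamma>"]) (use finG in auto)
      show "{(a, b) \<in> ?e ` \<Gamma> \<times> ?e ` \<Gamma>. a - ?e r * b = ?e z} \<subseteq> map_prod ?e ?e ` {(a, b) \<in> \<Gamma> \<times> \<Gamma>. [a - r * b = z] (mod int p)}"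
        by (auto simp: residue_in_arith residue_in_eq_iff)
    qed
    finally have "(r, z) \<in> ?T" using rz by blast
    then show "rz \<in> map_prod ?e ?e ` ?T" by (rule image_eqI[rotated]) (simp add: rz_eq)
  qed
  then have "card ?T' \<le> card ?T"
    by (rule surj_card_le[rotated]) (rule finite_subset[of _ "{1..<int p} \<times> {1..<int p}"], auto)
  then have "card ?T' * s ^ 3 \<le> card ?T * s ^ 3" by (rule mult_right_mono) simp
  also have "\<dots> \<le> 3145728 * card \<Gamma> ^ 4" by (rule card_shifted_pairs_level[OF p G(1,3) t s])
  finally have "real (card ?T' * s ^ 3) \<le> real (3145728 * card \<Gamma> ^ 4)" by (simp only: of_nat_le_iff)
  also have "\<dots> \<le> L * real (card \<Gamma>) ^ 4" using L by (simp add: mult_right_mono)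
  finally show "real (card ?T') * real s ^ 3 \<le> L * real (card (?e ` \<Gamma>)) ^ 4" by (simp add: card)
qed

section \<open>Absorbing constants and logarithms for subgroups\<close>

text \<open>The first comparison is the hypothesis of \<open>energy_bound\<close>; the second fits
  \<open>L^4\<close> into the gap between \<open>24499/10000\<close> and
  \<open>49/20\<close>.\<close>

lemma eventually_polylog_le_powr:
  "eventually (\<lambda>t::real. 4096 * (3145728 * log 2 t) * t\<^sup>2 \<le> t powr (239/100)) at_top"
  "eventually (\<lambda>t::real. (3145728 * log 2 t) ^ 4 * t powr (24499/10000) \<le> t powr (49/20)) at_top"
  by real_asymp+

lemma additive_energy_le_cube:
  assumes A: "finite A"
  shows "real (additive_energy A) \<le> real (card A) ^ 3"
proof -
  have "real (additive_energy A) = (\<Sum>x\<in>diff_set A. rep A x * rep A x)"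
    by (simp add: energy_eq_sum_rep power2_eq_square)
  also have "\<dots> \<le> (\<Sum>x\<in>diff_set A. rep A x * real (card A))"
    using diff_rep_le_card[OF A] by (intro sum_mono mult_left_mono) (auto simp: rep_def)
  also have "\<dots> = real (card A) ^ 3"
    by (simp add: sum_distrib_right[symmetric] sum_rep[OF A] power2_eq_square power3_eq_cube)
  finally show ?thesis .
qed

lemma subgroup_of_residue_units:
  fixes p :: nat
  assumes p: "prime p" and \<Gamma>: "subgroup \<Gamma> (units_of (residue_ring (int p)))"
  shows "\<Gamma> \<subseteq> {1..<int p}" "1 \<in> \<Gamma>" "\<And>x y. x \<in> \<Gamma> \<Longrightarrow> y \<in> \<Gamma> \<Longrightarrow> x * y mod int p \<in> \<Gamma>"
proof -
  define R where "R = residue_ring (int p)"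
  interpret residues_prime p R by unfold_locales (simp_all add: p R_def)
  have \<Gamma>: "subgroup \<Gamma> (units_of R)" using \<Gamma> by (simp add: R_def)
  show "\<Gamma> \<subseteq> {1..<int p}"
    using subgroup.subset[OF \<Gamma>] by (auto simp: units_of_carrier res_units_eq)
  show "1 \<in> \<Gamma>" using subgroup.one_closed[OF \<Gamma>] by (simp add: units_of_one res_one_eq)
  show "x * y mod int p \<in> \<Gamma>" if "x \<in> \<Gamma>" "y \<in> \<Gamma>" for x y
    using subgroup.m_closed[OF \<Gamma> that] by (simp add: units_of_mult res_mult_eq)
qed

lemma log2_bounds:
  assumes "1 < (t::nat)"
  obtains J where "t < 2 ^ J" "real J \<le> 2 * log 2 (real t)" "1 \<le> log 2 (real t)"
proof -
  have l1: "1 \<le> log 2 (real t)" using assms by simp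
  define J where "J = nat (floor (log 2 (real t))) + 1"
  have J: "log 2 (real t) < real J" "real J \<le> log 2 (real t) + 1"
    using l1 unfolding J_def by linarith+
  have "real t = 2 powr (log 2 (real t))" using assms by simp
  also have "\<dots> < 2 powr (real J)" using J by (intro powr_less_mono) auto
  also have "\<dots> = real (2 ^ J)" by (simp add: powr_realpow)
  finally have "t < 2 ^ J" by (simp only: of_nat_less_iff)
  with J l1 show ?thesis by (intro that[of J]) auto
qed

theorem subgroup_energy_estimate:
  "\<exists>C::real. C > 0 \<and> (\<forall>(p::nat) (\<Gamma>::int set).
     prime p \<longrightarrow> subgroup \<Gamma> (units_of (residue_ring (int p))) \<longrightarrow>
     1 < card \<Gamma> \<longrightarrow> real (card \<Gamma>) \<le> sqrt (real p) \<longrightarrow>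
     real (ring_additive_energy (residue_ring (int p)) \<Gamma>) \<le>
       C * real (card \<Gamma>) powr (49/20) * log 2 (real (card \<Gamma>)) powr (1/5))"
proof -
  obtain t0 :: real where t0: "\<And>t. t0 \<le> t \<Longrightarrow> 4096 * (3145728 * log 2 t) * t\<^sup>2 \<le> t powr (239/100)"
      "\<And>t. t0 \<le> t \<Longrightarrow> (3145728 * log 2 t) ^ 4 * t powr (24499/10000) \<le> t powr (49/20)"
    using eventually_conj[OF eventually_polylog_le_powr] unfolding eventually_at_top_linorder by blast
  \<comment> \<open>Chosen so that \<open>E <= t^3\<close> settles the subgroups too small for
    Stepanov's parameters or for the asymptotic comparisons.\<close>
  define C where "C = max 512 t0 ^ 3"
  have C: "1 \<le> C" unfolding C_def by (intro one_le_power) auto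
  show ?thesis
  proof (intro exI conjI allI impI)
    show "0 < C" using C by simp
    fix p :: nat and \<Gamma> :: "int set"
    assume p: "prime p" and sg: "subgroup \<Gamma> (units_of (residue_ring (int p)))"
      and c: "1 < card \<Gamma>" "real (card \<Gamma>) \<le> sqrt (real p)"
    define t where "t = real (card \<Gamma>)"
    have t1: "1 < t" using c by (simp add: t_def)
    note G = subgroup_of_residue_units[OF p sg]
    have fin: "finite \<Gamma>" using G(1) by (rule finite_subset) simp
    let ?H = "residue_in p ` \<Gamma>"
    have inj: "inj_on (residue_in p) \<Gamma>"
      by (rule inj_on_subset[OF inj_on_residue_in]) (use G(1) in auto)
    have card: "card ?H = card \<Gamma>" by (rule card_image[OF inj])
    obtain J where J: "card \<Gamma> < 2 ^ J" "real J \<le> 2 * log 2 t" "1 \<le> log 2 t"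
      using log2_bounds[OF c(1)] unfolding t_def by blast
    have le: "real (additive_energy ?H) \<le> C * t powr (49/20)"
    proof (cases "max 512 t0 \<le> t")
      case False
      have "real (additive_energy ?H) \<le> t ^ 3"
        using additive_energy_le_cube[of ?H] fin by (simp add: card t_def)
      also have "\<dots> \<le> C" unfolding C_def using False t1 by (intro power_mono) auto
      also have "\<dots> = C * 1" by simp
      also have "\<dots> \<le> C * t powr (49/20)" using C t1 by (intro mult_left_mono ge_one_powr_ge_zero) auto
      finally show ?thesis .
    next
      case True
      have "512 \<le> t" "t0 \<le> t" using True by auto
      have "512 \<le> card \<Gamma>" using \<open>512 \<le> t\<close> by (simp add: t_def)
      moreover have "card \<Gamma> * card \<Gamma> \<le> p"
      proof -
        have "t\<^sup>2 \<le> (sqrt (real p))\<^sup>2" using c t1 unfolding t_def by (intro power_mono) auto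
        then have "real (card \<Gamma> * card \<Gamma>) \<le> real p" by (simp add: t_def power2_eq_square)
        then show ?thesis by (simp only: of_nat_le_iff)
      qed
      moreover have "3145728 \<le> 3145728 * log 2 t" "real J \<le> 3145728 * log 2 t" using J by auto
      ultimately interpret subgroup_energy "residue_in p ` {0..<int p}" ?H "residue_in p 1" "3145728 * log 2 t" J
        using J(1) by (intro subgroup_energy_residues[OF p G]) auto
      have "real (additive_energy ?H) \<le> (3145728 * log 2 t) ^ 4 * t powr (24499/10000)"
        using energy_bound t0(1)[OF \<open>t0 \<le> t\<close>] unfolding card t_def by blast
      also have "\<dots> \<le> 1 * t powr (49/20)" using t0(2)[OF \<open>t0 \<le> t\<close>] by simp
      also have "\<dots> \<le> C * t powr (49/20)" using C by (intro mult_right_mono) auto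
      finally show ?thesis .
    qed
    also have "\<dots> = C * t powr (49/20) * 1" by simp
    also have "\<dots> \<le> C * t powr (49/20) * log 2 t powr (1/5)"
      using C J(3) by (intro mult_left_mono ge_one_powr_ge_zero) auto
    finally show "real (ring_additive_energy (residue_ring (int p)) \<Gamma>) \<le>
       C * real (card \<Gamma>) powr (49/20) * log 2 (real (card \<Gamma>)) powr (1/5)"
      unfolding ring_additive_energy_residue_in[OF p G(1)] t_def .
  qed
qed

section \<open>Incidences in grids\<close>

text \<open>Cutting both axes into intervals of at most \<open>k\<close> points each divides a grid into cells. As a line is
  monotone, it meets few of them, and two points of one cell determine at most one line.\<close>

definition rank_cell :: "'a::linorder set \<Rightarrow> nat \<Rightarrow> 'a \<Rightarrow> nat"
  where "rank_cell S k x = card {y \<in> S. y < x} div k"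

lemma rank_cell_mono: "finite S \<Longrightarrow> x \<le> y \<Longrightarrow> rank_cell S k x \<le> rank_cell S k y"
  unfolding rank_cell_def by (intro div_le_mono card_mono) auto

lemma rank_cell_le: "finite S \<Longrightarrow> rank_cell S k x \<le> card S div k"
  unfolding rank_cell_def by (intro div_le_mono card_mono) auto

lemma card_rank_cell_le:
  assumes S: "finite S" and k: "0 < k"
  shows "card {y \<in> S. rank_cell S k y = i} \<le> k"
proof -
  let ?r = "\<lambda>x. card {y \<in> S. y < x}"
  have less: "?r x < ?r y" if "x \<in> S" "y \<in> S" "x < y" for x y
    by (rule psubset_card_mono) (use that S in auto)
  have "inj_on ?r {y \<in> S. rank_cell S k y = i}"
  proof (rule inj_onI)
    fix x y assume "x \<in> {y \<in> S. rank_cell S k y = i}" "y \<in> {y \<in> S. rank_cell S k y = i}" "?r x = ?r y"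
    then show "x = y" using less[of x y] less[of y x] by (cases x y rule: linorder_cases) auto
  qed
  moreover have "?r ` {y \<in> S. rank_cell S k y = i} \<subseteq> {i * k..<i * k + k}"
  proof (rule image_subsetI)
    fix x assume "x \<in> {y \<in> S. rank_cell S k y = i}"
    then have "?r x div k = i" by (simp add: rank_cell_def)
    then show "?r x \<in> {i * k..<i * k + k}"
      using div_mult_mod_eq[of "?r x" k] mod_less_divisor[OF k, of "?r x"] by auto
  qed
  ultimately have "card {y \<in> S. rank_cell S k y = i} \<le> card {i * k..<i * k + k}"
    by (rule card_inj_on_le) simp
  then show ?thesis by simp
qed

lemma card_same_rank_cell_le:
  assumes S: "finite S" and k: "0 < k"
  shows "card {(x, y) \<in> S \<times> S. rank_cell S k x = rank_cell S k y} \<le> card S * k"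
proof -
  have "{(x, y) \<in> S \<times> S. rank_cell S k x = rank_cell S k y} =
    (SIGMA x:S. {y \<in> S. rank_cell S k y = rank_cell S k x})" by auto
  also have "card \<dots> = (\<Sum>x\<in>S. card {y \<in> S. rank_cell S k y = rank_cell S k x})"
    using S by (intro card_SigmaI) auto
  also have "\<dots> \<le> (\<Sum>x\<in>S. k)" by (intro sum_mono card_rank_cell_le S k)
  finally show ?thesis by simp
qed

text \<open>One representative per value of \<open>f\<close> is kept; every other element collides
  with its representative.\<close>

lemma card_le_image_plus_collisions:
  assumes S: "finite S"
  shows "card S \<le> card (f ` S) + card {(x, y) \<in> S \<times> S. x \<noteq> y \<and> f x = f y}"
proof -
  define g where "g = inv_into S f"
  define R where "R = g ` f ` S"
  have g: "g (f x) \<in> S" "f (g (f x)) = f x" if "x \<in> S" for x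
    using that by (auto simp: g_def inv_into_into f_inv_into_f)
  have "card (S - R) \<le> card {(x, y) \<in> S \<times> S. x \<noteq> y \<and> f x = f y}"
  proof (rule card_inj_on_le)
    show "inj_on (\<lambda>x. (x, g (f x))) (S - R)" by (auto simp: inj_on_def)
    show "(\<lambda>x. (x, g (f x))) ` (S - R) \<subseteq> {(x, y) \<in> S \<times> S. x \<noteq> y \<and> f x = f y}"
    proof (rule image_subsetI)
      fix x assume x: "x \<in> S - R"
      then have "x \<noteq> g (f x)" by (auto simp: R_def)
      then show "(x, g (f x)) \<in> {(x, y) \<in> S \<times> S. x \<noteq> y \<and> f x = f y}" using g[of x] x by simp
    qed
    show "finite {(x, y) \<in> S \<times> S. x \<noteq> y \<and> f x = f y}"
      by (rule finite_subset[of _ "S \<times> S"]) (use S in auto)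
  qed
  moreover have "card R \<le> card (f ` S)" unfolding R_def using S by (intro card_image_le) auto
  moreover have "card S = card R + card (S - R)"
  proof -
    have RS: "R \<subseteq> S" using g(1) by (auto simp: R_def)
    show ?thesis using card_Diff_subset[OF finite_subset[OF RS S] RS] card_mono[OF S RS] by linarith
  qed
  ultimately show ?thesis by linarith
qed

text \<open>Both indices of the cell are monotone along the line. The cell is therefore determined
  by the sum of the indices, or by their difference if the slope is negative, and these take at most
  \<open>card C div k + card X div l + 1\<close> values.\<close>

lemma card_line_cells_le:
  fixes C X :: "real set"
  assumes C: "finite C" and X: "finite X" and u: "u \<noteq> 0"
  shows "card ((\<lambda>c. (rank_cell C k c, rank_cell X l (u * c + b))) ` S) \<le> card C div k + card X div l + 1"
    (is "card (?f ` S) \<le> _")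
proof (cases "0 < u")
  case True
  have "card (?f ` S) \<le> card {0..card C div k + card X div l}"
  proof (rule card_inj_on_le)
    show "inj_on (\<lambda>(i, j). i + j) (?f ` S)"
    proof (rule inj_onI, clarify)
      fix c d assume e: "rank_cell C k c + rank_cell X l (u * c + b) = rank_cell C k d + rank_cell X l (u * d + b)"
      have "rank_cell C k c \<le> rank_cell C k d \<and> rank_cell X l (u * c + b) \<le> rank_cell X l (u * d + b)
        \<or> rank_cell C k d \<le> rank_cell C k c \<and> rank_cell X l (u * d + b) \<le> rank_cell X l (u * c + b)"
        using True linear[of c d] by (auto intro!: rank_cell_mono C X)
      then show "rank_cell C k c = rank_cell C k d \<and> rank_cell X l (u * c + b) = rank_cell X l (u * d + b)"
        using e by auto
    qed
    show "(\<lambda>(i, j). i + j) ` (?f ` S) \<subseteq> {0..card C div k + card X div l}"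
      by (auto intro!: add_mono rank_cell_le C X)
  qed simp
  then show ?thesis by simp
next
  case False
  then have u: "u < 0" using u by simp
  have "card (?f ` S) \<le> card {- int (card X div l)..int (card C div k)}"
  proof (rule card_inj_on_le)
    show "inj_on (\<lambda>(i, j). int i - int j) (?f ` S)"
    proof (rule inj_onI, clarify)
      fix c d assume e: "int (rank_cell C k c) - int (rank_cell X l (u * c + b)) = int (rank_cell C k d) - int (rank_cell X l (u * d + b))"
      have "rank_cell C k c \<le> rank_cell C k d \<and> rank_cell X l (u * c + b) \<ge> rank_cell X l (u * d + b)
        \<or> rank_cell C k d \<le> rank_cell C k c \<and> rank_cell X l (u * d + b) \<ge> rank_cell X l (u * c + b)"
        using u linear[of c d] by (auto intro!: rank_cell_mono C X)
      then show "rank_cell C k c = rank_cell C k d \<and> rank_cell X l (u * c + b) = rank_cell X l (u * d + b)"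
        using e by auto
    qed
    show "(\<lambda>(i, j). int i - int j) ` (?f ` S) \<subseteq> {- int (card X div l)..int (card C div k)}"
    proof (rule image_subsetI)
      fix ij assume "ij \<in> ?f ` S"
      then obtain i j where ij: "ij = (i, j)" "i \<le> card C div k" "j \<le> card X div l"
        using rank_cell_le[OF C] rank_cell_le[OF X] by auto
      then have "int i \<le> int (card C div k)" "int j \<le> int (card X div l)" by (simp_all only: of_nat_le_iff)
      then show "(\<lambda>(i, j). int i - int j) ij \<in> {- int (card X div l)..int (card C div k)}"
        unfolding ij(1) by (simp del: of_nat_le_iff zdiv_int)
    qed
  qed simp
  then show ?thesis by (simp del: zdiv_int add: nat_add_distrib)
qed

text \<open>On each line the incidences beyond one per cell are at most the ordered pairs of
  distinct points in a common cell. Such a pair lies on one line only, so over all lines these pairs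
  are counted once.\<close>

lemma card_incidences_le_cells:
  fixes U B C X :: "real set"
  assumes fin: "finite U" "finite B" "finite C" "finite X" and U: "0 \<notin> U" and k: "0 < k" "0 < l"
  shows "card {(u, b, c) \<in> U \<times> B \<times> C. u * c + b \<in> X} \<le>
    card U * card B * (card C div k + card X div l + 1) + (card C * k) * (card X * l)"
proof -
  define S where "S = (\<lambda>(u, b). {c \<in> C. u * c + b \<in> X})"
  define f where "f = (\<lambda>(u, b) c. (rank_cell C k c, rank_cell X l (u * c + b)))"
  define Q where "Q = (\<lambda>ub. {(c, d) \<in> S ub \<times> S ub. c \<noteq> d \<and> f ub c = f ub d})"
  have finS: "finite (S ub)" for ub using fin by (cases ub) (auto simp: S_def)
  have finQ: "finite (Q ub)" for ub
    by (rule finite_subset[of _ "S ub \<times> S ub"]) (use finS in \<open>auto simp: Q_def\<close>)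
  have "{(u, b, c) \<in> U \<times> B \<times> C. u * c + b \<in> X} = (\<lambda>((u, b), c). (u, b, c)) ` (SIGMA ub:U \<times> B. S ub)"
    by (auto simp: S_def image_iff)
  also have "card \<dots> \<le> card (SIGMA ub:U \<times> B. S ub)"
    by (rule card_image_le) (use fin finS in \<open>auto intro: finite_SigmaI\<close>)
  also have "\<dots> = (\<Sum>ub\<in>U \<times> B. card (S ub))" using fin finS by (intro card_SigmaI) auto
  also have "\<dots> \<le> (\<Sum>ub\<in>U \<times> B. (card C div k + card X div l + 1) + card (Q ub))"
  proof (rule sum_mono)
    fix ub assume ub: "ub \<in> U \<times> B"
    obtain u b where [simp]: "ub = (u, b)" by (cases ub)
    have "u \<noteq> 0" using ub U by auto
    have "card (S ub) \<le> card (f ub ` S ub) + card (Q ub)"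
      unfolding Q_def by (rule card_le_image_plus_collisions[OF finS])
    also have "card (f ub ` S ub) \<le> card C div k + card X div l + 1"
      unfolding f_def by simp (rule card_line_cells_le[OF fin(3,4) \<open>u \<noteq> 0\<close>, simplified])
    finally show "card (S ub) \<le> (card C div k + card X div l + 1) + card (Q ub)" by simp
  qed
  also have "\<dots> = card U * card B * (card C div k + card X div l + 1) + (\<Sum>ub\<in>U \<times> B. card (Q ub))"
    by (simp only: sum.distrib sum_constant card_cartesian_product of_nat_id) (simp add: algebra_simps)
  also have "(\<Sum>ub\<in>U \<times> B. card (Q ub)) = card (SIGMA ub:U \<times> B. Q ub)"
    using fin finQ by (intro card_SigmaI[symmetric]) auto
  also have "\<dots> \<le> card ({(x, y) \<in> C \<times> C. rank_cell C k x = rank_cell C k y} \<times> {(x, y) \<in> X \<times> X. rank_cell X l x = rank_cell X l y})"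
  proof (rule card_inj_on_le)
    let ?h = "\<lambda>((u, b), (c, d)). ((c, d), (u * c + b, u * d + b :: real))"
    show "inj_on ?h (SIGMA ub:U \<times> B. Q ub)"
    proof (rule inj_onI, clarsimp simp: Q_def)
      fix u b u' b' c d :: real
      assume cd: "c \<noteq> d" and e: "u * c + b = u' * c + b'" "u * d + b = u' * d + b'"
      have "u * (c - d) = u' * (c - d)" using e by (simp add: algebra_simps)
      then have "u = u'" using cd by simp
      then show "u = u' \<and> b = b'" using e by simp
    qed
    show "?h ` (SIGMA ub:U \<times> B. Q ub) \<subseteq> {(x, y) \<in> C \<times> C. rank_cell C k x = rank_cell C k y} \<times> {(x, y) \<in> X \<times> X. rank_cell X l x = rank_cell X l y}"
      by (auto simp: Q_def S_def f_def)
    show "finite ({(x, y) \<in> C \<times> C. rank_cell C k x = rank_cell C k y} \<times> {(x, y) \<in> X \<times> X. rank_cell X l x = rank_cell X l y})"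
      by (rule finite_subset[of _ "(C \<times> C) \<times> (X \<times> X)"]) (use fin in auto)
  qed
  also have "\<dots> \<le> (card C * k) * (card X * l)"
    unfolding card_cartesian_product by (intro mult_mono card_same_rank_cell_le fin k) auto
  finally show ?thesis by simp
qed

lemma card_incidences_le_trivial:
  fixes U B C X :: "real set"
  assumes fin: "finite U" "finite B" "finite C" "finite X" and U: "0 \<notin> U"
  shows "card {(u, b, c) \<in> U \<times> B \<times> C. u * c + b \<in> X} \<le> card U * card B * card C"
    "card {(u, b, c) \<in> U \<times> B \<times> C. u * c + b \<in> X} \<le> card U * card B * card X"
proof -
  let ?I = "{(u, b, c) \<in> U \<times> B \<times> C. u * c + b \<in> X}"
  have "card ?I \<le> card (U \<times> B \<times> C)" by (rule card_mono) (use fin in auto)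
  then show "card ?I \<le> card U * card B * card C" by (simp add: card_cartesian_product)
  have "card ?I \<le> card (U \<times> B \<times> X)"
  proof (rule card_inj_on_le)
    show "inj_on (\<lambda>(u, b, c). (u, b, u * c + b)) ?I" using U by (auto simp: inj_on_def)
  qed (use fin in auto)
  then show "card ?I \<le> card U * card B * card X" by (simp add: card_cartesian_product)
qed

text \<open>With about \<open>r\<close> cells along each axis the two terms of
  \<open>card_incidences_le_cells\<close> have sizes \<open>N r\<close> and
  \<open>(n m)^2 / r^2\<close>, and \<open>r\<close> is chosen to make them equal. If
  \<open>r < 1\<close>, a single cell gives the linear alternative; if \<open>r\<close> exceeds
  \<open>n\<close> or \<open>m\<close>, the trivial bound is at most \<open>N r\<close>.\<close>

lemma Szemeredi_Trotter_grid:
  fixes U B C X :: "real set"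
  assumes fin: "finite U" "finite B" "finite C" "finite X" and U: "0 \<notin> U"
  defines "I \<equiv> real (card {(u, b, c) \<in> U \<times> B \<times> C. u * c + b \<in> X})"
    and "N \<equiv> real (card U) * real (card B)" and "n \<equiv> real (card C)" and "m \<equiv> real (card X)"
  shows "I \<le> 4 * N \<or> I ^ 3 \<le> 343 * (n * m * N)\<^sup>2"
proof -
  have nn: "0 \<le> N" "0 \<le> n" "0 \<le> m" "0 \<le> I" by (auto simp: N_def n_def m_def I_def)
  have cells: "I \<le> N * (n / real k + m / real l + 1) + n * real k * (m * real l)" if "0 < k" "0 < l" for k l :: nat
  proof -
    have "I \<le> real (card U * card B * (card C div k + card X div l + 1) + (card C * k) * (card X * l))"
      unfolding I_def of_nat_le_iff by (rule card_incidences_le_cells[OF fin U that])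
    also have "\<dots> = N * (real (card C div k) + real (card X div l) + 1) + n * real k * (m * real l)"
      by (simp add: N_def n_def m_def algebra_simps)
    also have "\<dots> \<le> N * (n / real k + m / real l + 1) + n * real k * (m * real l)"
      using nn of_nat_div_le_of_nat[of "card C" k] of_nat_div_le_of_nat[of "card X" l]
      by (intro add_mono mult_left_mono order_refl) (auto simp: n_def m_def)
    finally show ?thesis .
  qed
  have triv: "I \<le> N * n" "I \<le> N * m"
    using card_incidences_le_trivial[OF fin U] unfolding I_def N_def n_def m_def
    by (simp_all only: of_nat_mult[symmetric] of_nat_le_iff)
  show ?thesis
  proof (cases "N = 0 \<or> n = 0 \<or> m = 0")
    case True
    then show ?thesis using triv nn by auto
  next
    case False
    then have pos: "1 \<le> n" "1 \<le> m" "0 < N" using nn by (auto simp: n_def m_def)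
    define r where "r = root 3 ((n * m)\<^sup>2 / N)"
    have r3: "r ^ 3 = (n * m)\<^sup>2 / N" unfolding r_def using pos by (intro real_root_pow_pos2) auto
    have r0: "0 < r" unfolding r_def using pos by simp
    have Nr: "N * r ^ 3 = (n * m)\<^sup>2" using r3 pos by simp
    have cube: "(N * r) ^ 3 = (n * m * N)\<^sup>2"
    proof -
      have "(N * r) ^ 3 = N\<^sup>2 * (N * r ^ 3)" by (simp add: power_numeral_reduce)
      then show ?thesis unfolding Nr by (simp add: power_mult_distrib)
    qed
    have cube': "I ^ 3 \<le> 343 * (n * m * N)\<^sup>2" if "I \<le> 7 * (N * r)"
    proof -
      have "I ^ 3 \<le> (7 * (N * r)) ^ 3" using that nn by (intro power_mono)
      then show ?thesis by (simp add: power_mult_distrib[of 7] cube)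
    qed
    consider "r < 1" | "n < r" | "m < r" | "1 \<le> r" "r \<le> n" "r \<le> m" by linarith
    then show ?thesis
    proof cases
      case 1
      have "I \<le> N * (n / n + m / m + 1) + n * n * (m * m)"
        using cells[of "card C" "card X"] pos by (simp add: n_def m_def)
      also have "n * n * (m * m) = N * r ^ 3" unfolding Nr by (simp add: power2_eq_square)
      also have "N * r ^ 3 \<le> N * 1" using 1 r0 pos by (intro mult_left_mono power_le_one) auto
      finally show ?thesis using pos by simp
    next
      case 2
      then have "N * n \<le> N * r" using pos by (intro mult_left_mono) auto
      moreover have "0 \<le> N * r" using pos r0 by simp
      ultimately have "I \<le> 7 * (N * r)" using triv(1) by linarith
      then show ?thesis using cube' by blast
    next
      case 3
      then have "N * m \<le> N * r" using pos by (intro mult_left_mono) auto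
      moreover have "0 \<le> N * r" using pos r0 by simp
      ultimately have "I \<le> 7 * (N * r)" using triv(2) by linarith
      then show ?thesis using cube' by blast
    next
      case 4
      \<comment> \<open>Rounding \<open>x / r >= 1\<close> down to an integer loses at most a factor
        \<open>2\<close>.\<close>
      have fl: "\<exists>k::nat. 0 < k \<and> real k \<le> x / r \<and> x / real k \<le> 2 * r" if "r \<le> x" for x
      proof (intro exI conjI)
        let ?k = "nat \<lfloor>x / r\<rfloor>"
        have xr: "1 \<le> x / r" using that r0 by simp
        then have k: "1 \<le> \<lfloor>x / r\<rfloor>" by (simp add: le_floor_iff)
        then show "0 < ?k" by simp
        show "real ?k \<le> x / r" using k by simp
        have rk: "real ?k = of_int \<lfloor>x / r\<rfloor>" using k by simp
        have "x / r \<le> of_int \<lfloor>x / r\<rfloor> + 1" by linarith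
        also have "\<dots> \<le> 2 * real ?k" unfolding rk using k by linarith
        finally have "x \<le> 2 * r * real ?k" using r0 by (simp add: field_simps)
        then show "x / real ?k \<le> 2 * r" using k by (simp add: pos_divide_le_eq)
      qed
      obtain k l :: nat where k: "0 < k" "real k \<le> n / r" "n / real k \<le> 2 * r"
        and l: "0 < l" "real l \<le> m / r" "m / real l \<le> 2 * r"
        using fl[OF 4(2)] fl[OF 4(3)] by blast
      have "I \<le> N * (n / real k + m / real l + 1) + n * real k * (m * real l)" by (rule cells[OF k(1) l(1)])
      also have "\<dots> \<le> N * (2 * r + 2 * r + r) + n * (n / r) * (m * (m / r))"
        using k l 4 pos by (intro add_mono mult_mono mult_left_mono) auto
      also have "n * (n / r) * (m * (m / r)) = (n * m)\<^sup>2 / r\<^sup>2" by (simp add: power2_eq_square)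
      also have "\<dots> = N * r" unfolding Nr[symmetric] using r0 by (simp add: power_numeral_reduce)
      finally have "I \<le> 6 * (N * r)" by (simp add: algebra_simps)
      moreover have "0 \<le> N * r" using pos r0 by simp
      ultimately have "I \<le> 7 * (N * r)" by linarith
      then show ?thesis using cube' by blast
    qed
  qed
qed

section \<open>Petridis' lemma\<close>

lemma finite_set_times_real [simp]: "finite (A::real set) \<Longrightarrow> finite B \<Longrightarrow> finite (A * B)"
  by (rule finite_set_times)

lemma set_times_0_notin: "0 \<notin> (A::real set) \<Longrightarrow> 0 \<notin> B \<Longrightarrow> 0 \<notin> A * B"
  by (auto simp: set_times_def)

lemma card_scaled: "s \<noteq> 0 \<Longrightarrow> card ((*) (s::real) ` A) = card A"
  by (rule card_image) (auto simp: inj_on_def)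

text \<open>Petridis' induction on \<open>S\<close>. When \<open>s\<close> is added, let
  \<open>Z'\<close> be the set of \<open>z\<close> whose products with \<open>s\<close> and
  \<open>A\<close> are already present. The product set grows by at most
  \<open>card (Z * A) - card (Z' * A)\<close>, where minimality bounds the subtracted term from
  below, and \<open>S * Z\<close> grows by at least \<open>card Z - card Z'\<close>.\<close>

lemma card_set_times_le_ratio:
  fixes A S Z :: "real set"
  assumes A: "finite A" and Z: "finite Z" and S: "finite S" "0 \<notin> S"
    and min: "\<And>Z'. Z' \<subseteq> Z \<Longrightarrow> K * real (card Z') \<le> real (card (Z' * A))"
    and eq: "real (card (Z * A)) = K * real (card Z)" and K: "0 \<le> K"
  shows "real (card (S * Z * A)) \<le> K * real (card (S * Z))"
  using S
proof (induction S rule: finite_induct)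
  case empty
  then show ?case by (simp add: set_times_def)
next
  case (insert s S)
  have s: "s \<noteq> 0" and S: "finite S" "0 \<notin> S" using insert by auto
  have IH: "real (card (S * Z * A)) \<le> K * real (card (S * Z))" using insert by auto
  define Z' where "Z' = {z \<in> Z. (*) (s * z) ` A \<subseteq> S * Z * A}"
  have Z': "Z' \<subseteq> Z" "finite Z'" using Z by (auto simp: Z'_def)
  have sub: "insert s S * Z * A \<subseteq> S * Z * A \<union> (*) s ` (Z * A - Z' * A)"
  proof
    fix x assume "x \<in> insert s S * Z * A"
    then obtain r z a where x: "x = r * z * a" "r \<in> insert s S" "z \<in> Z" "a \<in> A" by (auto simp: set_times_def)
    show "x \<in> S * Z * A \<union> (*) s ` (Z * A - Z' * A)"
    proof (cases "x \<in> S * Z * A")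
      case False
      then have "r = s" using x by (auto simp: set_times_def)
      have "z * a \<notin> Z' * A"
      proof
        assume "z * a \<in> Z' * A"
        then obtain z' a' where z': "z * a = z' * a'" "z' \<in> Z'" "a' \<in> A" by (auto simp: set_times_def)
        then have "s * z' * a' \<in> S * Z * A" by (auto simp: Z'_def)
        then show False using False x \<open>r = s\<close> z'(1) by (simp add: mult.assoc)
      qed
      then have "z * a \<in> Z * A - Z' * A" using x by (auto simp: set_times_def)
      then show ?thesis using x \<open>r = s\<close> by (auto simp: mult.assoc)
    qed auto
  qed
  have ZA: "Z' * A \<subseteq> Z * A" using Z' by (auto simp: set_times_def)
  have "card (insert s S * Z * A) \<le> card (S * Z * A \<union> (*) s ` (Z * A - Z' * A))"
    by (rule card_mono[OF _ sub]) (use S Z A in auto)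
  also have "\<dots> \<le> card (S * Z * A) + card ((*) s ` (Z * A - Z' * A))" by (rule card_Un_le)
  also have "card ((*) s ` (Z * A - Z' * A)) = card (Z * A) - card (Z' * A)"
    unfolding card_scaled[OF s] by (rule card_Diff_subset[OF _ ZA]) (use Z' A in auto)
  finally have "card (insert s S * Z * A) + card (Z' * A) \<le> card (S * Z * A) + card (Z * A)"
    using card_mono[OF _ ZA] Z A by simp
  then have "real (card (insert s S * Z * A) + card (Z' * A)) \<le> real (card (S * Z * A) + card (Z * A))"
    by (simp only: of_nat_le_iff)
  then have 1: "real (card (insert s S * Z * A)) \<le> K * real (card (S * Z)) + K * real (card Z) - K * real (card Z')"
    using IH eq min[OF Z'(1)] by simp
  have "card (S * Z) + card Z \<le> card (insert s S * Z) + card Z'"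
  proof -
    let ?V = "{z \<in> Z. s * z \<notin> S * Z}"
    have "card (S * Z \<union> (*) s ` ?V) = card (S * Z) + card ((*) s ` ?V)"
      by (rule card_Un_disjoint) (use S Z in auto)
    also have "card ((*) s ` ?V) = card ?V" by (rule card_scaled[OF s])
    finally have "card (S * Z) + card ?V = card (S * Z \<union> (*) s ` ?V)" by simp
    also have "\<dots> \<le> card (insert s S * Z)"
      by (rule card_mono) (use S Z in \<open>auto simp: set_times_def\<close>)
    finally have "card (S * Z) + card ?V \<le> card (insert s S * Z)" .
    moreover have "card Z \<le> card ?V + card Z'"
    proof -
      have "Z \<subseteq> ?V \<union> Z'"
      proof
        fix z assume z: "z \<in> Z"
        show "z \<in> ?V \<union> Z'"
        proof (cases "s * z \<in> S * Z")
          case True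
          then have "(*) (s * z) ` A \<subseteq> S * Z * A" by (auto intro: set_times_intro)
          then show ?thesis using z by (simp add: Z'_def)
        qed (use z in simp)
      qed
      then have "card Z \<le> card (?V \<union> Z')" by (rule card_mono[rotated]) (use Z Z' in auto)
      also have "\<dots> \<le> card ?V + card Z'" by (rule card_Un_le)
      finally show ?thesis .
    qed
    ultimately show ?thesis by linarith
  qed
  then have "real (card (S * Z) + card Z) \<le> real (card (insert s S * Z) + card Z')" by (simp only: of_nat_le_iff)
  then have "K * (real (card (S * Z)) + real (card Z)) \<le> K * (real (card (insert s S * Z)) + real (card Z'))"
    using K by (intro mult_left_mono) auto
  then show ?case using 1 by (simp add: algebra_simps)
qed

lemma minimal_ratio_subset:
  fixes A B :: "real set"
  assumes A: "finite A" and B: "finite B" "B \<noteq> {}"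
  obtains Z K where "Z \<subseteq> B" "Z \<noteq> {}" "0 \<le> K" "K * real (card B) \<le> real (card (B * A))"
    "real (card (Z * A)) = K * real (card Z)" "\<forall>Z'\<subseteq>Z. K * real (card Z') \<le> real (card (Z' * A))"
proof -
  let ?r = "\<lambda>Z. real (card (Z * A)) / real (card Z)"
  have fP: "finite (?r ` (Pow B - {{}}))" "?r ` (Pow B - {{}}) \<noteq> {}" using B by auto
  from Min_in[OF this] obtain Z where Z: "Z \<in> Pow B - {{}}" "Min (?r ` (Pow B - {{}})) = ?r Z" by auto
  have min: "?r Z \<le> ?r Z'" if "Z' \<in> Pow B - {{}}" for Z'
    unfolding Z(2)[symmetric] using fP(1) that by (intro Min_le) auto
  have fin: "finite Z'" if "Z' \<subseteq> B" for Z' using that B(1) by (rule finite_subset)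
  show ?thesis
  proof (rule that[of Z "?r Z"])
    have le: "?r Z * real (card Z') \<le> real (card (Z' * A))" if "Z' \<subseteq> B" for Z'
    proof (cases "Z' = {}")
      case False
      then have "0 < real (card Z')" using fin[OF that] by (simp add: card_gt_0_iff)
      then show ?thesis using min[of Z'] that False by (simp add: pos_le_divide_eq)
    qed simp
    show "?r Z * real (card B) \<le> real (card (B * A))" by (rule le) simp
    show "\<forall>Z'\<subseteq>Z. ?r Z * real (card Z') \<le> real (card (Z' * A))" using Z(1) le by blast
    show "real (card (Z * A)) = ?r Z * real (card Z)" using Z(1) fin[of Z] by auto
  qed (use Z(1) in auto)
qed

text \<open>Take \<open>X\<close> of maximal size with
  \<open>card (X * A * A) <= 4 * M^2 * card X\<close>. If it had less than half of the elements, the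
  complement would contain a set \<open>Z\<close> of minimal ratio \<open>K <= 2 * M\<close>. Then
  \<open>Z * A * A = A * Z * A\<close> has at most \<open>K * card (A * Z) = K^2 * card Z\<close>
  elements, and \<open>Z\<close> could be added to \<open>X\<close>.\<close>

lemma large_subset_small_triple_product:
  fixes A :: "real set"
  assumes A: "finite A" "0 \<notin> A" and M: "real (card (A * A)) \<le> M * real (card A)" and M0: "0 \<le> M"
  obtains X where "X \<subseteq> A" "card A \<le> 2 * card X" "real (card (X * A * A)) \<le> 4 * M\<^sup>2 * real (card A)"
proof -
  define F where "F = {X \<in> Pow A. real (card (X * A * A)) \<le> 4 * M\<^sup>2 * real (card X)}"
  have "{} \<in> F" by (simp add: F_def set_times_def)
  moreover have finF: "finite F" using A by (simp add: F_def)
  ultimately obtain X where X: "X \<in> F" and max: "\<And>Y. Y \<in> F \<Longrightarrow> card Y \<le> card X"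
    using arg_max_nat_lemma[of "\<lambda>X. X \<in> F" "{}" card "card A + 1"] card_mono[OF A(1)]
    by (metis (no_types, lifting) F_def PowD less_Suc_eq_le mem_Collect_eq Suc_eq_plus1)
  have XA: "X \<subseteq> A" and X4: "real (card (X * A * A)) \<le> 4 * M\<^sup>2 * real (card X)" using X by (auto simp: F_def)
  have finX: "finite X" using XA A(1) by (rule finite_subset)
  have "card A \<le> 2 * card X"
  proof (rule ccontr)
    assume "\<not> card A \<le> 2 * card X"
    define B where "B = A - X"
    have cB: "card B = card A - card X" unfolding B_def by (rule card_Diff_subset[OF finX XA])
    then have B2: "card A \<le> 2 * card B" "B \<noteq> {}" using \<open>\<not> card A \<le> 2 * card X\<close> by auto
    have finB: "finite B" using A by (simp add: B_def)
    obtain Z K where Z: "Z \<subseteq> B" "Z \<noteq> {}" "0 \<le> K" "K * real (card B) \<le> real (card (B * A))"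
      "real (card (Z * A)) = K * real (card Z)" "\<forall>Z'\<subseteq>Z. K * real (card Z') \<le> real (card (Z' * A))"
      by (rule minimal_ratio_subset[OF A(1) finB B2(2)])
    have finZ: "finite Z" using Z(1) finB by (rule finite_subset)
    have "K * real (card B) \<le> real (card (A * A))"
    proof -
      have "card (B * A) \<le> card (A * A)" by (rule card_mono) (use A in \<open>auto simp: B_def set_times_def\<close>)
      then show ?thesis using Z(4) by linarith
    qed
    also have "\<dots> \<le> M * (2 * real (card B))"
    proof -
      have "real (card A) \<le> 2 * real (card B)" using B2(1) by linarith
      then show ?thesis using M M0 by (meson mult_left_mono order_trans)
    qed
    finally have "K * real (card B) \<le> (2 * M) * real (card B)" by simp
    moreover have "0 < real (card B)" using B2(2) finB by (simp add: card_gt_0_iff)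
    ultimately have K: "K \<le> 2 * M" by simp
    have "real (card (Z * A * A)) = real (card (A * Z * A))" by (simp add: mult_ac)
    also have "\<dots> \<le> K * real (card (A * Z))" by (rule card_set_times_le_ratio[OF A(1) finZ A Z(6)[rule_format] Z(5,3)])
    also have "\<dots> = K\<^sup>2 * real (card Z)" using Z(5) by (simp add: mult.commute[of A Z] power2_eq_square)
    also have "\<dots> \<le> (2 * M)\<^sup>2 * real (card Z)" using K Z(3) by (intro mult_right_mono power_mono) auto
    finally have ZAA: "real (card (Z * A * A)) \<le> 4 * M\<^sup>2 * real (card Z)" by (simp add: power_mult_distrib)
    have "(X \<union> Z) * A * A \<subseteq> X * A * A \<union> Z * A * A"
      by (fastforce elim!: set_times_elim intro: set_times_intro)
    then have "card ((X \<union> Z) * A * A) \<le> card (X * A * A \<union> Z * A * A)"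
      by (rule card_mono[rotated]) (use A finX finZ in auto)
    also have "\<dots> \<le> card (X * A * A) + card (Z * A * A)" by (rule card_Un_le)
    finally have "real (card ((X \<union> Z) * A * A)) \<le> real (card (X * A * A)) + real (card (Z * A * A))"
      by (simp only: of_nat_add[symmetric] of_nat_le_iff)
    also have "\<dots> \<le> 4 * M\<^sup>2 * (real (card X) + real (card Z))" using X4 ZAA by (simp add: algebra_simps)
    also have "real (card X) + real (card Z) = real (card (X \<union> Z))"
      using Z(1) finX finZ by (subst card_Un_disjoint) (auto simp: B_def)
    finally have "X \<union> Z \<in> F" using XA Z(1) by (auto simp: F_def B_def)
    from max[OF this] have "card Z = 0"
      using Z(1) finX finZ by (subst (asm) card_Un_disjoint) (auto simp: B_def)
    then show False using finZ Z(2) by simp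
  qed
  moreover have "4 * M\<^sup>2 * real (card X) \<le> 4 * M\<^sup>2 * real (card A)"
    using card_mono[OF A(1) XA] by (intro mult_left_mono) auto
  ultimately show ?thesis using that[of X] XA X4 by linarith
qed

section \<open>Sets of reals with small product set\<close>

text \<open>If \<open>p = a - b\<close>, then \<open>x p = (1 / c) (x a c) - x b\<close> for every
  \<open>c\<close> in \<open>A\<close>. So each element of \<open>P * Y\<close> is the value at a
  point of \<open>Y * A * A\<close> of at least \<open>t s\<close> lines with slope in
  \<open>1 / A\<close> and intercept in \<open>- (Y * A)\<close>. With \<open>Y = {1}\<close> this
  bounds the level set itself, and with \<open>Y = X\<close> its dilates; \<open>b\<close> and
  \<open>c\<close> differ in the two cases.\<close>

lemma card_scaled_level_le:
  fixes A Y P :: "real set"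
  assumes A: "finite A" "0 \<notin> A" and Y: "finite Y" "0 \<notin> Y"
    and P: "finite P" "\<And>x. x \<in> P \<Longrightarrow> s \<le> diff_rep A x"
    and b: "1 \<le> b" "real (card (Y * A)) \<le> b * real (card A)"
    and c: "1 \<le> c" "real (card (Y * A * A)) \<le> c * real (card A)"
  shows "real (card (P * Y)) * real s ^ 3 \<le> 343 * (b * c)\<^sup>2 * real (card A) ^ 3"
proof (cases "P * Y = {} \<or> s = 0")
  case True
  then show ?thesis by auto
next
  case False
  then obtain y0 where "y0 \<in> P * Y" by auto
  then obtain p0 where "p0 \<in> P" by (auto elim: set_times_elim)
  define t where "t = real (card A)"
  have st: "real s \<le> t" using P(2)[OF \<open>p0 \<in> P\<close>] diff_rep_le_card[OF A(1), of p0] by (simp add: t_def)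
  have s0: "0 < real s" using False by simp
  then have t0: "0 < t" using st by linarith
  define q where "q = real (card (P * Y))"
  have q0: "0 < q" using False P Y by (auto simp: q_def card_gt_0_iff)
  have "\<forall>y\<in>P * Y. \<exists>p x. p \<in> P \<and> x \<in> Y \<and> y = p * x" by (blast elim: set_times_elim)
  then obtain p x where px: "\<And>y. y \<in> P * Y \<Longrightarrow> p y \<in> P \<and> x y \<in> Y \<and> y = p y * x y" by metis
  define I where "I = {(u, w, v) \<in> (inverse ` A) \<times> (uminus ` (Y * A)) \<times> (Y * A * A). u * v + w \<in> P * Y}"
  let ?R = "\<lambda>y. {(a, b) \<in> A \<times> A. a - b = p y}"
  have finR: "finite (?R y)" for y by (rule finite_subset[of _ "A \<times> A"]) (use A in auto)
  have "card A * s * card (P * Y) \<le> (\<Sum>y\<in>P * Y. card (A \<times> ?R y))"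
  proof -
    have "card (P * Y) * (card A * s) \<le> (\<Sum>y\<in>P * Y. card (A \<times> ?R y))"
    proof (rule sum_bounded_below[where 'a = nat, simplified])
      fix y assume "y \<in> P * Y"
      then show "card A * s \<le> card (A \<times> ?R y)"
        using P(2)[of "p y"] px by (simp add: card_cartesian_product diff_rep_def)
    qed
    then show ?thesis by (simp add: mult_ac)
  qed
  also have "\<dots> = card (SIGMA y:P * Y. A \<times> ?R y)"
    using finR A P Y by (intro card_SigmaI[symmetric]) auto
  also have "\<dots> \<le> card I"
  proof (rule card_inj_on_le)
    let ?h = "\<lambda>(y, c, a, b). (inverse c, - (x y * b), x y * a * c)"
    have val: "inverse c * (x y * a * c) + - (x y * b) = y" if "y \<in> P * Y" "c \<in> A" "a - b = p y" for y c a b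
    proof -
      have "c \<noteq> 0" using that A by auto
      then have "inverse c * (x y * a * c) + - (x y * b) = (a - b) * x y" by (simp add: algebra_simps)
      also have "\<dots> = y" using px[OF that(1)] that(3) by simp
      finally show ?thesis .
    qed
    show "inj_on ?h (SIGMA y:P * Y. A \<times> ?R y)"
    proof (rule inj_onI)
      fix z z' assume z: "z \<in> (SIGMA y:P * Y. A \<times> ?R y)" "z' \<in> (SIGMA y:P * Y. A \<times> ?R y)" and e: "?h z = ?h z'"
      obtain y c a b where z1: "z = (y, c, a, b)" "y \<in> P * Y" "c \<in> A" "a - b = p y" using z(1) by auto
      obtain y' c' a' b' where z2: "z' = (y', c', a', b')" "y' \<in> P * Y" "c' \<in> A" "a' - b' = p y'" using z(2) by auto
      have e': "inverse c = inverse c'" "x y * b = x y' * b'" "x y * a * c = x y' * a' * c'"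
        using e unfolding z1(1) z2(1) prod.case prod.inject neg_equal_iff_equal by blast+
      have "y = inverse c * (x y * a * c) + - (x y * b)" by (rule val[OF z1(2-4), symmetric])
      also have "\<dots> = inverse c' * (x y' * a' * c') + - (x y' * b')" by (simp only: e')
      also have "\<dots> = y'" by (rule val[OF z2(2-4)])
      finally have yy: "y = y'" .
      have "x y \<noteq> 0" using px[OF z1(2)] Y by auto
      moreover have "c \<noteq> 0" using z1(3) A by auto
      ultimately show "z = z'" using e' yy by (simp add: z1(1) z2(1))
    qed
    show "?h ` (SIGMA y:P * Y. A \<times> ?R y) \<subseteq> I"
    proof (rule image_subsetI)
      fix z assume z: "z \<in> (SIGMA y:P * Y. A \<times> ?R y)"
      obtain y c a b where z1: "z = (y, c, a, b)" "y \<in> P * Y" "c \<in> A" "a \<in> A" "b \<in> A" "a - b = p y" using z by auto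
      have "x y \<in> Y" using px[OF z1(2)] by blast
      then have "x y * b \<in> Y * A" "x y * a * c \<in> Y * A * A" using z1 by (auto intro: set_times_intro)
      then show "?h z \<in> I" unfolding I_def using val[OF z1(2,3,6)] z1 by simp
    qed
    show "finite I" unfolding I_def
      by (rule finite_subset[of _ "(inverse ` A) \<times> (uminus ` (Y * A)) \<times> (Y * A * A)"]) (use A Y in auto)
  qed
  finally have "real (card A * s * card (P * Y)) \<le> real (card I)" by (simp only: of_nat_le_iff)
  then have lower: "t * real s * q \<le> real (card I)" by (simp add: t_def q_def)
  define N where "N = real (card (inverse ` A)) * real (card (uminus ` (Y * A)))"
  have N: "0 \<le> N" "N \<le> b * t\<^sup>2"
  proof -
    have "card (inverse ` A) = card A" "card (uminus ` (Y * A)) = card (Y * A)"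
      by (rule card_image, simp add: inj_on_def)+
    then have "N = t * real (card (Y * A))" by (simp add: N_def t_def)
    also have "\<dots> \<le> t * (b * t)" using b t0 unfolding t_def by (intro mult_left_mono) auto
    finally show "N \<le> b * t\<^sup>2" by (simp add: power2_eq_square mult_ac)
  qed (simp add: N_def)
  have bc: "b \<le> (b * c)\<^sup>2"
  proof -
    have "b * 1 \<le> b * c" using b c by (intro mult_left_mono) auto
    also have "\<dots> \<le> (b * c)\<^sup>2" unfolding power2_eq_square using b c mult_mono[of 1 b 1 c] by simp
    finally show ?thesis by simp
  qed
  have "real (card I) \<le> 4 * N \<or> real (card I) ^ 3 \<le> 343 * (real (card (Y * A * A)) * real (card (P * Y)) * N)\<^sup>2"
    unfolding I_def N_def using A Y P by (intro Szemeredi_Trotter_grid) auto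
  then have "q * real s ^ 3 \<le> 343 * (b * c)\<^sup>2 * t ^ 3"
  proof
    assume "real (card I) \<le> 4 * N"
    then have "t * (real s * q) \<le> t * (4 * b * t)" using lower N by (simp add: power2_eq_square mult_ac)
    then have "real s * q \<le> 4 * b * t" using t0 by simp
    \<comment> \<open>In the linear alternative the missing factor \<open>s^2\<close> is supplied by
      \<open>s <= t\<close>.\<close>
    then have "real s * q * (real s)\<^sup>2 \<le> 4 * b * t * t\<^sup>2"
      by (rule mult_mono[OF _ power_mono[OF st]]) (use b t0 in auto)
    also have "\<dots> \<le> 343 * (b * c)\<^sup>2 * t ^ 3"
    proof -
      have "4 * b \<le> 343 * (b * c)\<^sup>2" using bc b by linarith
      then have "4 * b * t ^ 3 \<le> 343 * (b * c)\<^sup>2 * t ^ 3" using t0 by (intro mult_right_mono) auto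
      then show ?thesis by (simp add: power_numeral_reduce mult_ac)
    qed
    finally show ?thesis by (simp add: power_numeral_reduce mult_ac)
  next
    assume "real (card I) ^ 3 \<le> 343 * (real (card (Y * A * A)) * real (card (P * Y)) * N)\<^sup>2"
    moreover have "(t * real s * q) ^ 3 \<le> real (card I) ^ 3" using lower t0 q0 by (intro power_mono) auto
    moreover have "real (card (Y * A * A)) * real (card (P * Y)) * N \<le> (c * t) * q * (b * t\<^sup>2)"
      unfolding q_def by (rule mult_mono[OF mult_mono[OF c(2)[folded t_def] order_refl] N(2)]) (use c t0 N in auto)
    then have "(real (card (Y * A * A)) * real (card (P * Y)) * N)\<^sup>2 \<le> ((c * t) * q * (b * t\<^sup>2))\<^sup>2"
      using N by (intro power_mono) auto
    ultimately have "(t * real s * q) ^ 3 \<le> 343 * ((c * t) * q * (b * t\<^sup>2))\<^sup>2" by linarith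
    moreover have "(t * real s * q) ^ 3 = (t ^ 3 * q\<^sup>2) * (q * real s ^ 3)"
      by (simp add: power_numeral_reduce mult_ac)
    moreover have "343 * ((c * t) * q * (b * t\<^sup>2))\<^sup>2 = (t ^ 3 * q\<^sup>2) * (343 * (b * c)\<^sup>2 * t ^ 3)"
      by (simp add: power_numeral_reduce mult_ac)
    ultimately have "(t ^ 3 * q\<^sup>2) * (q * real s ^ 3) \<le> (t ^ 3 * q\<^sup>2) * (343 * (b * c)\<^sup>2 * t ^ 3)" by simp
    moreover have "0 < t ^ 3 * q\<^sup>2" using t0 q0 by simp
    ultimately show ?thesis using mult_le_cancel_left_pos by blast
  qed
  then show ?thesis by (simp add: q_def t_def)
qed

text \<open>A solution of \<open>a + b = c\<close> is repeated once for each \<open>x\<close> in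
  \<open>X\<close>, as the incidence \<open>(a x) (1 / x) + b = c\<close> with slope in
  \<open>P * X\<close>. This pays off when \<open>P * X\<close> is not much larger than
  \<open>P\<close>.\<close>

lemma card_additive_triples_le:
  fixes P Q R X :: "real set"
  assumes fin: "finite P" "finite Q" "finite R" "finite X" and 0: "0 \<notin> P" "0 \<notin> X"
  defines "T \<equiv> real (card {(a, b) \<in> P \<times> Q. a + b \<in> R})"
  shows "real (card X) * T \<le> 4 * (real (card (P * X)) * real (card Q)) \<or>
    real (card X) * T ^ 3 \<le> 343 * (real (card (P * X)) * real (card Q) * real (card R))\<^sup>2"
proof (cases "card X = 0")
  case False
  define I where "I = {(u, b, c) \<in> (P * X) \<times> Q \<times> (inverse ` X). u * c + b \<in> R}"
  define x where "x = real (card X)"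
  have x0: "0 < x" using False by (simp add: x_def)
  have "card (X \<times> {(a, b) \<in> P \<times> Q. a + b \<in> R}) \<le> card I"
  proof (rule card_inj_on_le)
    show "inj_on (\<lambda>(x, a, b). (a * x, b, inverse x)) (X \<times> {(a, b) \<in> P \<times> Q. a + b \<in> R})"
      using 0 by (auto simp: inj_on_def)
    show "(\<lambda>(x, a, b). (a * x, b, inverse x)) ` (X \<times> {(a, b) \<in> P \<times> Q. a + b \<in> R}) \<subseteq> I"
    proof (rule image_subsetI)
      fix z assume "z \<in> X \<times> {(a, b) \<in> P \<times> Q. a + b \<in> R}"
      then obtain x a b where z: "z = (x, a, b)" "x \<in> X" "a \<in> P" "b \<in> Q" "a + b \<in> R" by auto
      moreover have "x \<noteq> 0" using z 0 by auto
      ultimately show "(\<lambda>(x, a, b). (a * x, b, inverse x)) z \<in> I"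
        unfolding I_def by (auto intro: set_times_intro simp: mult.assoc)
    qed
    show "finite I" unfolding I_def
      by (rule finite_subset[of _ "(P * X) \<times> Q \<times> (inverse ` X)"]) (use fin in auto)
  qed
  then have "real (card (X \<times> {(a, b) \<in> P \<times> Q. a + b \<in> R})) \<le> real (card I)" by (simp only: of_nat_le_iff)
  then have lower: "x * T \<le> real (card I)" by (simp add: T_def x_def card_cartesian_product)
  have ci: "card (inverse ` X) = card X" by (rule card_image) (simp add: inj_on_def)
  have "real (card I) \<le> 4 * (real (card (P * X)) * real (card Q)) \<or>
    real (card I) ^ 3 \<le> 343 * (real (card (inverse ` X)) * real (card R) * (real (card (P * X)) * real (card Q)))\<^sup>2"
    unfolding I_def using fin 0 set_times_0_notin[OF 0] by (intro Szemeredi_Trotter_grid) auto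
  then show ?thesis
  proof
    assume "real (card I) \<le> 4 * (real (card (P * X)) * real (card Q))"
    then show ?thesis using lower by (simp add: x_def)
  next
    assume "real (card I) ^ 3 \<le> 343 * (real (card (inverse ` X)) * real (card R) * (real (card (P * X)) * real (card Q)))\<^sup>2"
    moreover have "(x * T) ^ 3 \<le> real (card I) ^ 3" using lower x0 by (intro power_mono) (auto simp: T_def)
    ultimately have "(x * T) ^ 3 \<le> 343 * (x * real (card R) * (real (card (P * X)) * real (card Q)))\<^sup>2"
      by (simp add: ci x_def)
    moreover have "(x * T) ^ 3 = x\<^sup>2 * (x * T ^ 3)" by (simp add: power_numeral_reduce mult_ac)
    moreover have "343 * (x * real (card R) * (real (card (P * X)) * real (card Q)))\<^sup>2 =
      x\<^sup>2 * (343 * (real (card (P * X)) * real (card Q) * real (card R))\<^sup>2)" by (simp add: power_numeral_reduce mult_ac)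
    ultimately have "x\<^sup>2 * (x * T ^ 3) \<le> x\<^sup>2 * (343 * (real (card (P * X)) * real (card Q) * real (card R))\<^sup>2)" by simp
    then show ?thesis using x0 by (simp add: x_def)
  qed
qed simp

section \<open>Level sets for a set with small product set\<close>

locale small_product_set =
  fixes A X :: "real set" and M :: real and J :: nat
  assumes finA: "finite A" and A0: "0 \<notin> A" and Ane: "A \<noteq> {}" and M1: "1 \<le> M"
    and AA: "real (card (A * A)) \<le> M * real (card A)"
    and XA: "X \<subseteq> A" and cX: "card A \<le> 2 * card X" and XAA: "real (card (X * A * A)) \<le> 4 * M\<^sup>2 * real (card A)"
    and cJ: "card A < 2 ^ J"
begin

abbreviation "t \<equiv> real (card A)"
abbreviation "E \<equiv> real (additive_energy A)"
abbreviation "D \<equiv> diff_set A - {0}"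
abbreviation "P j \<equiv> dyadic_level (diff_rep A) D j"

lemmas [simp] = finA

lemma t_ge_1: "1 \<le> t" "0 < t" "0 < t ^ n"
proof -
  have "0 < card A" using finA Ane by (simp add: card_gt_0_iff)
  then show "1 \<le> t" by linarith
  then show "0 < t" by linarith
  then show "0 < t ^ n" by (rule zero_less_power)
qed

lemma J_ge_1: "1 \<le> real J"
  using cJ t_ge_1(1) by (cases J) auto

lemma finD [simp]: "finite D" "finite (P j)"
  using finA by auto

lemma finX: "finite X" using XA finA by (rule finite_subset)

lemma zero_notin: "0 \<notin> X" "0 \<notin> P j"
  using XA A0 by (auto simp: dyadic_level_def)

lemma P_uminus: "- x \<in> P j \<longleftrightarrow> x \<in> P j"
proof -
  have "- x \<in> diff_set A \<longleftrightarrow> x \<in> diff_set A"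
    by (auto simp: diff_set_def image_iff) (metis minus_diff_eq minus_minus)+
  then show ?thesis by (simp add: dyadic_level_def diff_rep_uminus)
qed

lemma P_rep: "x \<in> P j \<Longrightarrow> 2 ^ j \<le> diff_rep A x" by (simp add: dyadic_level_def)

lemma card_P_le: "real (card (P j)) * 8 ^ j \<le> 343 * M\<^sup>2 * t ^ 3"
proof -
  have "real (card (P j * {1})) * real (2 ^ j) ^ 3 \<le> 343 * (1 * M)\<^sup>2 * t ^ 3"
    by (rule card_scaled_level_le[OF finA A0]) (use M1 AA P_rep in \<open>auto simp: set_times_def\<close>)
  moreover have "P j * {1} = P j" by (auto simp: set_times_def)
  ultimately show ?thesis by (simp add: power_8_eq)
qed

text \<open>Passing from \<open>P j\<close> to its dilates by \<open>X\<close> costs only powers of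
  \<open>M\<close>; this is the purpose of Petridis' subset.\<close>

lemma card_PX_le: "real (card (P j * X)) * 8 ^ j \<le> 5488 * M ^ 6 * t ^ 3"
proof -
  have "card (X * A) \<le> card (A * A)"
    by (rule card_mono) (use finA XA in \<open>auto simp: set_times_def\<close>)
  then have "real (card (X * A)) \<le> M * t" using AA by linarith
  moreover have "1 \<le> 4 * M\<^sup>2" using M1 one_le_power[of M 2] by linarith
  ultimately have "real (card (P j * X)) * real (2 ^ j) ^ 3 \<le> 343 * (M * (4 * M\<^sup>2))\<^sup>2 * t ^ 3"
    using M1 XAA P_rep finX zero_notin by (intro card_scaled_level_le[OF finA A0]) auto
  then show ?thesis by (simp add: power_8_eq power_numeral_reduce mult_ac)
qed

lemma diff_rep_less: "diff_rep A x < 2 ^ J"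
  using diff_rep_le_card[OF finA, of x] cJ by linarith

lemma third_energy_le: "third_energy A \<le> 2800 * real J * M\<^sup>2 * t ^ 3"
proof -
  have M2: "1 \<le> M\<^sup>2" using M1 by simp
  have "third_energy A = (\<Sum>x\<in>diff_set A. (rep A x) ^ 3)" by (simp add: third_energy_def)
  also have "\<dots> = (rep A 0) ^ 3 + (\<Sum>x\<in>D. (rep A x) ^ 3)"
  proof (rule sum.remove)
    obtain a where "a \<in> A" using Ane by auto
    then show "0 \<in> diff_set A" using diff_in_diff_set[of a A a] by simp
  qed (use finA in simp)
  also have "(\<Sum>x\<in>D. (rep A x) ^ 3) = (\<Sum>j<J. \<Sum>x\<in>P j. (rep A x) ^ 3)"
    by (rule dyadic_sum) (use finA in \<open>auto simp: diff_rep_less rep_def\<close>)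
  also have "\<dots> \<le> (\<Sum>j<J. 8 * (343 * M\<^sup>2 * t ^ 3))"
  proof (rule sum_mono)
    fix j
    have "(\<Sum>x\<in>P j. (rep A x) ^ 3) \<le> real (card (P j)) * (8 * 8 ^ j)"
    proof (rule sum_bounded_above)
      fix x assume "x \<in> P j"
      then have "diff_rep A x \<le> 2 * 2 ^ j" by (simp add: dyadic_level_def)
      then have "real (diff_rep A x) \<le> real (2 * 2 ^ j)" by (simp only: of_nat_le_iff)
      then have "(rep A x) ^ 3 \<le> (2 * 2 ^ j) ^ 3" unfolding rep_def by (intro power_mono) auto
      then show "(rep A x) ^ 3 \<le> 8 * 8 ^ j" by (simp add: power_8_eq power_mult_distrib)
    qed
    then show "(\<Sum>x\<in>P j. (rep A x) ^ 3) \<le> 8 * (343 * M\<^sup>2 * t ^ 3)" using card_P_le[of j] by linarith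
  qed
  also have "\<dots> = 2744 * (real J * (M\<^sup>2 * t ^ 3))" by simp
  also have "(rep A 0) ^ 3 \<le> real J * (M\<^sup>2 * t ^ 3)"
  proof -
    have "1 * (1 * t ^ 3) \<le> real J * (M\<^sup>2 * t ^ 3)"
      using J_ge_1 M2 by (intro mult_mono) auto
    then show ?thesis by (simp add: rep_0)
  qed
  finally have "third_energy A \<le> 2745 * (real J * (M\<^sup>2 * t ^ 3))" by simp
  also have "\<dots> \<le> 2800 * (real J * (M\<^sup>2 * t ^ 3))" by (intro mult_right_mono) auto
  finally show ?thesis by simp
qed

text \<open>With \<open>k\<close> minimal, the term of the incidence bound that is linear in the number of lines is harmless.\<close>

lemma level_triples_le_ordered:
  assumes k: "k \<le> i" "k \<le> j"
    and V: "10 ^ 21 * M ^ 20 * t ^ 17 \<le> V ^ 3" "2 * 10 ^ 7 * M ^ 8 * t ^ 5 \<le> V"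
  shows "4 ^ (i + j + k) * real (card {(a, b) \<in> P i \<times> P j. a + b \<in> P k}) \<le> V"
proof -
  define T where "T = real (card {(a, b) \<in> P i \<times> P j. a + b \<in> P k})"
  define x p' p q where "x = real (card X)" and "p' = real (card (P i * X))"
    and "p = real (card (P j))" and "q = real (card (P k))"
  have nn: "0 \<le> T" "0 \<le> p'" "0 \<le> p" "0 \<le> q" by (auto simp: T_def p'_def p_def q_def)
  have tx: "t \<le> 2 * x" using cX unfolding x_def by linarith
  have b: "8 ^ i * p' \<le> 5488 * M ^ 6 * t ^ 3" "8 ^ j * p \<le> 343 * M\<^sup>2 * t ^ 3" "8 ^ k * q \<le> 343 * M\<^sup>2 * t ^ 3"
    using card_PX_le[of i] card_P_le[of j] card_P_le[of k] by (auto simp: p'_def p_def q_def mult.commute)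
  have M0: "0 \<le> M" using M1 by simp
  have "x * T \<le> 4 * (p' * p) \<or> x * T ^ 3 \<le> 343 * (p' * p * q)\<^sup>2"
    unfolding x_def T_def p'_def p_def q_def
    by (rule card_additive_triples_le) (use finX zero_notin in auto)
  then show ?thesis unfolding T_def[symmetric]
  proof
    assume *: "x * T \<le> 4 * (p' * p)"
    have "t * T \<le> 2 * x * T" using tx nn by (intro mult_right_mono)
    then have "t * T \<le> 8 * (p' * p)" using * by linarith
    then have "8 ^ (i + j) * (t * T) \<le> 8 ^ (i + j) * (8 * (p' * p))" by (intro mult_left_mono) auto
    also have "\<dots> = 8 * ((8 ^ i * p') * (8 ^ j * p))" by (simp add: power_add mult_ac)
    also have "\<dots> \<le> 8 * ((5488 * M ^ 6 * t ^ 3) * (343 * M\<^sup>2 * t ^ 3))"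
      by (rule mult_left_mono[OF mult_mono[OF b(1,2)]]) (use nn M0 in auto)
    also have "\<dots> = t * (15059072 * M ^ 8 * t ^ 5)" by (simp add: power_numeral_reduce mult_ac)
    finally have "t * (8 ^ (i + j) * T) \<le> t * (15059072 * M ^ 8 * t ^ 5)" by (simp add: mult_ac)
    then have 1: "8 ^ (i + j) * T \<le> 15059072 * M ^ 8 * t ^ 5" using t_ge_1 by simp
    \<comment> \<open>Minimality of \<open>k\<close> gives \<open>4 ^ k <= 2 ^ (i + j)\<close>,
      which completes \<open>4 ^ (i + j)\<close> to \<open>8 ^ (i + j)\<close>.\<close>
    have "(4::real) ^ (i + j + k) = 4 ^ (i + j) * 2 ^ (2 * k)" by (simp add: power_add power_mult)
    also have "\<dots> \<le> 4 ^ (i + j) * 2 ^ (i + j)" using k by (intro mult_left_mono power_increasing) auto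
    also have "\<dots> = 8 ^ (i + j)" by (simp flip: power_mult_distrib)
    finally have "4 ^ (i + j + k) * T \<le> 8 ^ (i + j) * T" using nn by (intro mult_right_mono) auto
    also note 1
    also have "15059072 * M ^ 8 * t ^ 5 \<le> 2 * 10 ^ 7 * M ^ 8 * t ^ 5" using M0 by (intro mult_right_mono) auto
    also note V(2)
    finally show "4 ^ (i + j + k) * T \<le> V" .
  next
    assume *: "x * T ^ 3 \<le> 343 * (p' * p * q)\<^sup>2"
    let ?v = "4 ^ (i + j + k) * T"
    have "t * T ^ 3 \<le> 2 * x * T ^ 3" using tx nn by (intro mult_right_mono) auto
    then have "t * T ^ 3 \<le> 686 * (p' * p * q)\<^sup>2" using * by linarith
    then have "(8 ^ (i + j + k))\<^sup>2 * (t * T ^ 3) \<le> (8 ^ (i + j + k))\<^sup>2 * (686 * (p' * p * q)\<^sup>2)"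
      by (intro mult_left_mono) auto
    also have "\<dots> = 686 * ((8 ^ i * p') * (8 ^ j * p) * (8 ^ k * q))\<^sup>2"
      by (simp add: power_add power_mult_distrib mult_ac)
    also have "\<dots> \<le> 686 * ((5488 * M ^ 6 * t ^ 3) * (343 * M\<^sup>2 * t ^ 3) * (343 * M\<^sup>2 * t ^ 3))\<^sup>2"
      by (rule mult_left_mono[OF power_mono[OF mult_mono[OF mult_mono[OF b(1,2)] b(3)]]]) (use nn M0 in auto)
    also have "\<dots> = 686 * 645657712\<^sup>2 * M ^ 20 * t ^ 17 * t" by (simp add: power_numeral_reduce mult_ac)
    also have "\<dots> \<le> 10 ^ 21 * M ^ 20 * t ^ 17 * t" using M0 by (intro mult_right_mono) auto
    also have "\<dots> \<le> V ^ 3 * t" using V(1) by (intro mult_right_mono) auto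
    also have "(8 ^ (i + j + k))\<^sup>2 * (t * T ^ 3) = ?v ^ 3 * t"
    proof -
      have "((8::real) ^ n)\<^sup>2 = (4 ^ n) ^ 3" for n by (simp add: power_8_eq power_4_eq flip: power_mult)
      then show ?thesis by (simp add: power_mult_distrib mult_ac)
    qed
    finally have "?v ^ 3 \<le> V ^ 3" using t_ge_1(2) by simp
    moreover have "0 \<le> V"
      using V(2) M0 by (meson mult_nonneg_nonneg of_nat_0_le_iff order_trans zero_le_numeral zero_le_power)
    ultimately show "?v \<le> V" by (metis power_le_imp_le_base numeral_3_eq_3)
  qed
qed

text \<open>Levels are symmetric, so in \<open>u - v = w\<close> any of the three elements can be
  made the sum of the other two. The one of lowest level is put there.\<close>

lemma level_triples_le:
  assumes V: "10 ^ 21 * M ^ 20 * t ^ 17 \<le> V ^ 3" "2 * 10 ^ 7 * M ^ 8 * t ^ 5 \<le> V"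
  shows "4 ^ (i + j + k) * real (card {(u, v) \<in> P i \<times> P j. u - v \<in> P k}) \<le> V"
proof -
  have fin: "finite {(a, b) \<in> P i \<times> P j. a + b \<in> P k}" for i j k
    by (rule finite_subset[of _ "P i \<times> P j"]) auto
  have le: "4 ^ (i + j + k) * real (card {(u, v) \<in> P i \<times> P j. u - v \<in> P k}) \<le> V"
    if c: "card {(u, v) \<in> P i \<times> P j. u - v \<in> P k} \<le> card {(a, b) \<in> P i' \<times> P j'. a + b \<in> P k'}"
      and e: "i' + j' + k' = i + j + k" and k: "k' \<le> i'" "k' \<le> j'" for i' j' k'
  proof -
    have "4 ^ (i + j + k) * real (card {(u, v) \<in> P i \<times> P j. u - v \<in> P k})
      \<le> 4 ^ (i + j + k) * real (card {(a, b) \<in> P i' \<times> P j'. a + b \<in> P k'})"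
      using c by (intro mult_left_mono) auto
    also have "\<dots> \<le> V" unfolding e[symmetric] by (rule level_triples_le_ordered[OF k V])
    finally show ?thesis .
  qed
  consider "k \<le> i" "k \<le> j" | "j \<le> i" "j \<le> k" | "i \<le> j" "i \<le> k" by linarith
  then show ?thesis
  proof cases
    case 1
    have "card {(u, v) \<in> P i \<times> P j. u - v \<in> P k} \<le> card {(a, b) \<in> P i \<times> P j. a + b \<in> P k}"
      by (rule card_inj_on_le[where f = "\<lambda>(u, v). (u, - v)"])
        (use fin in \<open>auto simp: inj_on_def P_uminus\<close>)
    then show ?thesis by (rule le) (use 1 in auto)
  next
    case 2
    have "card {(u, v) \<in> P i \<times> P j. u - v \<in> P k} \<le> card {(a, b) \<in> P i \<times> P k. a + b \<in> P j}"
    proof (rule card_inj_on_le[where f = "\<lambda>(u, v). (u, v - u)"])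
      show "(\<lambda>(u, v). (u, v - u)) ` {(u, v) \<in> P i \<times> P j. u - v \<in> P k} \<subseteq> {(a, b) \<in> P i \<times> P k. a + b \<in> P j}"
      proof (rule image_subsetI)
        fix z assume "z \<in> {(u, v) \<in> P i \<times> P j. u - v \<in> P k}"
        then obtain u v where z: "z = (u, v)" "u \<in> P i" "v \<in> P j" "u - v \<in> P k" by auto
        then have "v - u \<in> P k" using P_uminus[of "u - v" k] by simp
        then show "(\<lambda>(u, v). (u, v - u)) z \<in> {(a, b) \<in> P i \<times> P k. a + b \<in> P j}" using z by simp
      qed
    qed (use fin in \<open>auto simp: inj_on_def\<close>)
    then show ?thesis by (rule le) (use 2 in auto)
  next
    case 3
    have "card {(u, v) \<in> P i \<times> P j. u - v \<in> P k} \<le> card {(a, b) \<in> P j \<times> P k. a + b \<in> P i}"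
      by (rule card_inj_on_le[where f = "\<lambda>(u, v). (v, u - v)"])
        (use fin in \<open>auto simp: inj_on_def\<close>)
    then show ?thesis by (rule le) (use 3 in auto)
  qed
qed

lemma weighted_triples_sum_le:
  assumes V: "10 ^ 21 * M ^ 20 * t ^ 17 \<le> V ^ 3" "2 * 10 ^ 7 * M ^ 8 * t ^ 5 \<le> V"
  shows "(\<Sum>(u, v)\<in>{(u, v) \<in> D \<times> D. u - v \<in> D}. (rep A u * rep A v * rep A (u - v))\<^sup>2) \<le> 64 * real J ^ 3 * V"
proof -
  let ?W = "{(u, v) \<in> D \<times> D. u - v \<in> D}"
  have finW: "finite ?W" by (rule finite_subset[of _ "D \<times> D"]) auto
  have "\<exists>j. x \<in> P j \<and> j < J" if x: "x \<in> D" for x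
  proof -
    have "0 < diff_rep A x"
    proof -
      from x obtain a b where ab: "a \<in> A" "b \<in> A" "x = a - b" by (auto simp: diff_set_def)
      then have "(a, b) \<in> {(a, b) \<in> A \<times> A. a - b = x}" by simp
      moreover have "finite {(a, b) \<in> A \<times> A. a - b = x}"
        by (rule finite_subset[of _ "A \<times> A"]) (use finA in auto)
      ultimately show ?thesis unfolding diff_rep_def card_gt_0_iff by blast
    qed
    then obtain j where j: "2 ^ j \<le> diff_rep A x" "diff_rep A x < 2 ^ Suc j"
      using dyadic_exponent by blast
    have "(2::nat) ^ j < 2 ^ J" using j(1) diff_rep_less[of x] by linarith
    then have "j < J" by (rule power_less_imp_less_exp[rotated]) simp
    then show ?thesis using j x by (auto simp: dyadic_level_def)
  qed
  then obtain lv where lv: "\<And>x. x \<in> D \<Longrightarrow> x \<in> P (lv x)" "\<And>x. x \<in> D \<Longrightarrow> lv x < J" by metis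
  have rep2: "(rep A x)\<^sup>2 \<le> 4 * 4 ^ j" if "x \<in> P j" for x j
  proof -
    have "diff_rep A x \<le> 2 * 2 ^ j" using that by (simp add: dyadic_level_def)
    then have "real (diff_rep A x) \<le> real (2 * 2 ^ j)" by (simp only: of_nat_le_iff)
    then have "(rep A x)\<^sup>2 \<le> (2 * 2 ^ j)\<^sup>2" unfolding rep_def by (intro power_mono) auto
    then show ?thesis by (simp add: power_4_eq power_mult_distrib)
  qed
  define cl where "cl = (\<lambda>(u, v). (lv u, lv v, lv (u - v)))"
  define f where "f = (\<lambda>(u, v). (rep A u * rep A v * rep A (u - v))\<^sup>2)"
  let ?K = "{..<J} \<times> {..<J} \<times> {..<J}"
  have "sum f ?W = (\<Sum>c\<in>?K. sum f {w \<in> ?W. cl w = c})"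
    by (rule sum.group[symmetric]) (use finW lv in \<open>auto simp: cl_def\<close>)
  also have "\<dots> \<le> (\<Sum>c\<in>?K. 64 * V)"
  proof (rule sum_mono)
    fix c assume "c \<in> ?K"
    obtain i j k where c: "c = (i, j, k)" by (cases c)
    have "sum f {w \<in> ?W. cl w = c} \<le> real (card {w \<in> ?W. cl w = c}) * (64 * 4 ^ (i + j + k))"
    proof (rule sum_bounded_above)
      fix w assume "w \<in> {w \<in> ?W. cl w = c}"
      then obtain u v where w: "w = (u, v)" "u \<in> P i" "v \<in> P j" "u - v \<in> P k"
        using lv(1) by (auto simp: cl_def c)
      have "f w = (rep A u)\<^sup>2 * (rep A v)\<^sup>2 * (rep A (u - v))\<^sup>2" by (simp add: f_def w(1) power_mult_distrib)
      also have "\<dots> \<le> (4 * 4 ^ i) * (4 * 4 ^ j) * (4 * 4 ^ k)"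
        by (rule mult_mono[OF mult_mono[OF rep2 rep2] rep2]) (use w in auto)
      also have "\<dots> = 64 * 4 ^ (i + j + k)" by (simp add: power_add)
      finally show "f w \<le> 64 * 4 ^ (i + j + k)" .
    qed
    also have "card {w \<in> ?W. cl w = c} \<le> card {(u, v) \<in> P i \<times> P j. u - v \<in> P k}"
    proof (rule card_mono)
      show "finite {(u, v) \<in> P i \<times> P j. u - v \<in> P k}" by (rule finite_subset[of _ "P i \<times> P j"]) auto
      show "{w \<in> ?W. cl w = c} \<subseteq> {(u, v) \<in> P i \<times> P j. u - v \<in> P k}" using lv(1) by (auto simp: cl_def c)
    qed
    then have "real (card {w \<in> ?W. cl w = c}) * (64 * 4 ^ (i + j + k))
      \<le> real (card {(u, v) \<in> P i \<times> P j. u - v \<in> P k}) * (64 * 4 ^ (i + j + k))" by (intro mult_right_mono) auto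
    also have "\<dots> \<le> 64 * V" using level_triples_le[OF V, of i j k] by (simp add: mult_ac)
    finally show "sum f {w \<in> ?W. cl w = c} \<le> 64 * V" .
  qed
  also have "\<dots> = 64 * real J ^ 3 * V" by (simp add: card_cartesian_product power3_eq_cube)
  finally show ?thesis by (simp add: f_def)
qed

section \<open>Assembling the exponent for reals\<close>

text \<open>Each of the diagonals \<open>x = y\<close>, \<open>x' = y\<close> and
  \<open>x = x'\<close> contributes at most \<open>t * Q\<close> to the triples; the first
  alternative is the case in which they dominate.\<close>

lemma energy_dichotomy:
  assumes V: "10 ^ 21 * M ^ 20 * t ^ 17 \<le> V ^ 3" "2 * 10 ^ 7 * M ^ 8 * t ^ 5 \<le> V"
    and Q: "third_energy A \<le> Q"
  shows "E ^ 3 \<le> 6 * t ^ 4 * Q \<or> E ^ 6 \<le> 256 * t ^ 6 * Q * real J ^ 3 * V"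
proof -
  let ?r = "rep A"
  have "0 \<le> third_energy A" by (simp add: third_energy_def sum_nonneg)
  then have Q0: "0 \<le> Q" using Q by linarith
  define f where "f u v = ?r u * ?r v * ?r (u - v) * of_bool (u \<noteq> 0 \<and> v \<noteq> 0 \<and> u \<noteq> v)" for u v
  define S where "S = (\<Sum>y\<in>A. \<Sum>x\<in>A. \<Sum>x'\<in>A. ?r (x - y) * ?r (x' - y) * ?r (x - x'))"
  define S1 where "S1 = (\<Sum>y\<in>A. \<Sum>x\<in>A. \<Sum>x'\<in>A. f (x - y) (x' - y))"
  have sq: "(\<Sum>x\<in>A. \<Sum>y\<in>A. (?r (x - y))\<^sup>2) \<le> Q"
  proof -
    have "(\<Sum>x\<in>A. \<Sum>y\<in>A. (?r (x - y))\<^sup>2) = third_energy A"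
      unfolding third_energy_def by (subst sum_diffs_eq[OF finA]) (simp add: power2_eq_square power3_eq_cube mult_ac)
    then show ?thesis using Q by simp
  qed
  have delta: "(\<Sum>x\<in>A. of_bool (x = y) * c) = c" and delta': "(\<Sum>x\<in>A. of_bool (y = x) * c) = c"
    if "y \<in> A" for y :: real and c :: real
    using that finA by (simp_all flip: sum_distrib_right)
  have "S \<le> (\<Sum>y\<in>A. \<Sum>x\<in>A. \<Sum>x'\<in>A. f (x - y) (x' - y) + (of_bool (x = y) * (t * (?r (x' - y))\<^sup>2)
      + of_bool (x' = y) * (t * (?r (x - y))\<^sup>2) + of_bool (x = x') * (t * (?r (x - y))\<^sup>2)))"
    unfolding S_def
  proof (intro sum_mono)
    fix y x x'
    have [simp]: "?r (y - x) = ?r (x - y)" for x y using rep_uminus[of A "x - y"] by simp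
    show "?r (x - y) * ?r (x' - y) * ?r (x - x') \<le> f (x - y) (x' - y) + (of_bool (x = y) * (t * (?r (x' - y))\<^sup>2)
      + of_bool (x' = y) * (t * (?r (x - y))\<^sup>2) + of_bool (x = x') * (t * (?r (x - y))\<^sup>2))"
      by (cases "x = y"; cases "x' = y"; cases "x = x'")
        (auto simp: f_def rep_0 power2_eq_square)
  qed
  also have "\<dots> = S1 + ((\<Sum>y\<in>A. \<Sum>x\<in>A. \<Sum>x'\<in>A. of_bool (x = y) * (t * (?r (x' - y))\<^sup>2))
      + (\<Sum>y\<in>A. \<Sum>x\<in>A. \<Sum>x'\<in>A. of_bool (x' = y) * (t * (?r (x - y))\<^sup>2))
      + (\<Sum>y\<in>A. \<Sum>x\<in>A. \<Sum>x'\<in>A. of_bool (x = x') * (t * (?r (x - y))\<^sup>2)))"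
    by (simp only: sum.distrib S1_def)
  also have "(\<Sum>y\<in>A. \<Sum>x\<in>A. \<Sum>x'\<in>A. of_bool (x = y) * (t * (?r (x' - y))\<^sup>2)) = t * (\<Sum>y\<in>A. \<Sum>x'\<in>A. (?r (x' - y))\<^sup>2)"
    unfolding sum_distrib_left by (rule sum.cong[OF refl], subst sum.swap, rule sum.cong[OF refl], rule delta)
  also have "(\<Sum>y\<in>A. \<Sum>x\<in>A. \<Sum>x'\<in>A. of_bool (x' = y) * (t * (?r (x - y))\<^sup>2)) = t * (\<Sum>y\<in>A. \<Sum>x\<in>A. (?r (x - y))\<^sup>2)"
    unfolding sum_distrib_left by (rule sum.cong[OF refl], rule sum.cong[OF refl], rule delta)
  also have "(\<Sum>y\<in>A. \<Sum>x\<in>A. \<Sum>x'\<in>A. of_bool (x = x') * (t * (?r (x - y))\<^sup>2)) = t * (\<Sum>y\<in>A. \<Sum>x\<in>A. (?r (x - y))\<^sup>2)"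
    unfolding sum_distrib_left by (rule sum.cong[OF refl], rule sum.cong[OF refl], rule delta')
  also have "(\<Sum>y\<in>A. \<Sum>x\<in>A. (?r (x - y))\<^sup>2) = (\<Sum>x\<in>A. \<Sum>y\<in>A. (?r (x - y))\<^sup>2)" by (rule sum.swap)
  finally have "S \<le> S1 + 3 * (t * (\<Sum>x\<in>A. \<Sum>y\<in>A. (?r (x - y))\<^sup>2))" by simp
  also have "\<dots> \<le> S1 + 3 * (t * Q)" using sq t_ge_1 by simp
  finally have S: "S \<le> S1 + 3 * (t * Q)" .
  have "E ^ 3 \<le> t ^ 3 * S" unfolding S_def by (rule rep_triples_ge[OF finA])
  also have "\<dots> \<le> t ^ 3 * (S1 + 3 * (t * Q))" using S by (intro mult_left_mono) auto
  also have "\<dots> = t ^ 3 * S1 + 3 * t ^ 4 * Q" by (simp add: power_numeral_reduce algebra_simps)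
  finally have E3: "E ^ 3 \<le> t ^ 3 * S1 + 3 * t ^ 4 * Q" .
  show ?thesis
  proof (cases "E ^ 3 \<le> 6 * t ^ 4 * Q")
    case False
    then have "E ^ 3 \<le> 2 * (t ^ 3 * S1)" using E3 by linarith
    then have "(E ^ 3)\<^sup>2 \<le> (2 * (t ^ 3 * S1))\<^sup>2" by (intro power_mono) auto
    also have "\<dots> = 4 * t ^ 6 * S1\<^sup>2" by (simp add: power_mult_distrib flip: power_mult)
    also have "S1\<^sup>2 \<le> Q * (\<Sum>(u, v)\<in>{(u, v) \<in> D \<times> D. u - v \<in> D}. (f u v)\<^sup>2)"
      unfolding S1_def
    proof (rule triples_cauchy[OF finA finA _ _ Q Q])
      show "finite {(u, v) \<in> D \<times> D. u - v \<in> D}" by (rule finite_subset[of _ "D \<times> D"]) auto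
      fix x x' y assume "x \<in> A" "x' \<in> A" "y \<in> A" and nz: "f (x - y) (x' - y) \<noteq> 0"
      then have "x - y \<noteq> 0" "x' - y \<noteq> 0" "x - y \<noteq> x' - y" unfolding f_def by auto
      then show "(x - y, x' - y) \<in> {(u, v) \<in> D \<times> D. u - v \<in> D}"
        using \<open>x \<in> A\<close> \<open>x' \<in> A\<close> \<open>y \<in> A\<close> by simp
    qed
    also have "(\<Sum>(u, v)\<in>{(u, v) \<in> D \<times> D. u - v \<in> D}. (f u v)\<^sup>2) =
      (\<Sum>(u, v)\<in>{(u, v) \<in> D \<times> D. u - v \<in> D}. (rep A u * rep A v * rep A (u - v))\<^sup>2)"
      by (rule sum.cong[OF refl]) (auto simp: f_def)
    also have "\<dots> \<le> 64 * real J ^ 3 * V" by (rule weighted_triples_sum_le[OF V])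
    finally have "(E ^ 3)\<^sup>2 \<le> 4 * t ^ 6 * (Q * (64 * real J ^ 3 * V))"
      using Q0 by (simp add: mult_left_mono)
    then show ?thesis by (simp add: mult_ac flip: power_mult)
  qed simp
qed

theorem energy_bound:
  assumes Mt: "M \<le> t" and L: "2 * 10 ^ 7 * real J \<le> L"
  shows "E \<le> L\<^sup>2 * M powr (8/5) * t powr (22/9)"
proof -
  have L1: "2 * 10 ^ 7 \<le> L" "real J \<le> L" using L J_ge_1 by auto
  then have L0: "0 < L" by simp
  show ?thesis
  proof (cases "E = 0")
    case True
    then show ?thesis using L0 by simp
  next
    case False
    then have E0: "0 < E" by simp
    have M0: "0 < M" using M1 by simp
    define l\<^sub>t l\<^sub>L l\<^sub>E l\<^sub>M where "l\<^sub>t = ln t" and "l\<^sub>L = ln L" and "l\<^sub>E = ln E" and "l\<^sub>M = ln M"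
    have t: "t ^ n = exp (n * l\<^sub>t)" for n using t_ge_1(2) by (simp add: l\<^sub>t_def exp_of_nat_mult)
    have Lp: "L ^ n = exp (n * l\<^sub>L)" for n using L0 by (simp add: l\<^sub>L_def exp_of_nat_mult)
    have Ep: "E ^ n = exp (n * l\<^sub>E)" for n using E0 by (simp add: l\<^sub>E_def exp_of_nat_mult)
    have Mp: "M ^ n = exp (n * l\<^sub>M)" for n using M0 by (simp add: l\<^sub>M_def exp_of_nat_mult)
    have tp: "t powr x = exp (x * l\<^sub>t)" for x using t_ge_1(2) by (simp add: powr_def l\<^sub>t_def Ane)
    have Mpr: "M powr x = exp (x * l\<^sub>M)" for x using M0 by (simp add: powr_def l\<^sub>M_def)
    have e1: "L = exp l\<^sub>L" "E = exp l\<^sub>E" using Lp[of 1] Ep[of 1] by auto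
    have nn: "0 \<le> l\<^sub>M" "l\<^sub>M \<le> l\<^sub>t" "0 \<le> l\<^sub>t" "0 \<le> l\<^sub>L"
    proof -
      show "0 \<le> l\<^sub>M" using M1 by (simp add: l\<^sub>M_def)
      show "l\<^sub>M \<le> l\<^sub>t" unfolding l\<^sub>M_def l\<^sub>t_def by (rule iffD2[OF ln_le_cancel_iff[OF M0 t_ge_1(2)] Mt])
      then show "0 \<le> l\<^sub>t" using \<open>0 \<le> l\<^sub>M\<close> by linarith
      show "0 \<le> l\<^sub>L" using L1(1) by (simp add: l\<^sub>L_def)
    qed
    have goal: ?thesis if "l\<^sub>E \<le> 2 * l\<^sub>L + 8/5 * l\<^sub>M + 22/9 * l\<^sub>t"
    proof -
      have "E \<le> exp (2 * l\<^sub>L + 8/5 * l\<^sub>M + 22/9 * l\<^sub>t)" unfolding e1(2) using that by simp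
      also have "\<dots> = L\<^sup>2 * M powr (8/5) * t powr (22/9)" unfolding Lp tp Mpr exp_add by simp
      finally show ?thesis .
    qed
    define Q where "Q = 2800 * real J * M\<^sup>2 * t ^ 3"
    have QL: "Q \<le> exp (2 * l\<^sub>L + 2 * l\<^sub>M + 3 * l\<^sub>t)"
    proof -
      have "Q \<le> L * L * M\<^sup>2 * t ^ 3" unfolding Q_def
        using L1 M0 by (intro mult_right_mono mult_mono) auto
      also have "\<dots> = L\<^sup>2 * M\<^sup>2 * t ^ 3" by (simp add: power2_eq_square)
      also have "\<dots> = exp (2 * l\<^sub>L + 2 * l\<^sub>M + 3 * l\<^sub>t)" unfolding Lp Mp t exp_add by simp
      finally show ?thesis .
    qed
    \<comment> \<open>The two lower bounds demanded of \<open>V\<close>, solved for \<open>V\<close>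
      without the constant.\<close>
    define \<beta> where "\<beta> = max (20/3 * l\<^sub>M + 17/3 * l\<^sub>t) (8 * l\<^sub>M + 5 * l\<^sub>t)"
    define V where "V = 2 * 10 ^ 7 * exp \<beta>"
    have V1: "10 ^ 21 * M ^ 20 * t ^ 17 \<le> V ^ 3"
    proof -
      have "M ^ 20 * t ^ 17 = exp (20 * l\<^sub>M + 17 * l\<^sub>t)" unfolding Mp t exp_add by simp
      also have "\<dots> \<le> exp (real 3 * \<beta>)" unfolding \<beta>_def by (simp add: max_def)
      also have "\<dots> = exp \<beta> ^ 3" by (rule exp_of_nat_mult)
      finally have "10 ^ 21 * (M ^ 20 * t ^ 17) \<le> (2 * 10 ^ 7) ^ 3 * exp \<beta> ^ 3"
        using M0 by (intro mult_mono) auto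
      then show ?thesis unfolding V_def by (simp only: power_mult_distrib mult.assoc)
    qed
    have V2: "2 * 10 ^ 7 * M ^ 8 * t ^ 5 \<le> V"
    proof -
      have "M ^ 8 * t ^ 5 = exp (8 * l\<^sub>M + 5 * l\<^sub>t)" unfolding Mp t exp_add by simp
      also have "\<dots> \<le> exp \<beta>" unfolding \<beta>_def by simp
      finally show ?thesis unfolding V_def by simp
    qed
    have VL: "V \<le> exp (l\<^sub>L + \<beta>)" unfolding V_def exp_add e1(1)[symmetric] using L1 by (intro mult_right_mono) auto
    have "E ^ 3 \<le> 6 * t ^ 4 * Q \<or> E ^ 6 \<le> 256 * t ^ 6 * Q * real J ^ 3 * V"
      by (rule energy_dichotomy[OF V1 V2]) (unfold Q_def, rule third_energy_le)
    then show ?thesis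
    proof
      assume "E ^ 3 \<le> 6 * t ^ 4 * Q"
      also have "\<dots> \<le> L * t ^ 4 * exp (2 * l\<^sub>L + 2 * l\<^sub>M + 3 * l\<^sub>t)"
        using L1 QL M0 by (intro mult_mono mult_right_mono) (auto simp: Q_def)
      also have "\<dots> = exp (l\<^sub>L + 4 * l\<^sub>t + (2 * l\<^sub>L + 2 * l\<^sub>M + 3 * l\<^sub>t))"
        unfolding t exp_add[of _ "2 * l\<^sub>L + 2 * l\<^sub>M + 3 * l\<^sub>t"] exp_add[of l\<^sub>L] e1(1)[symmetric] by simp
      finally have "3 * l\<^sub>E \<le> l\<^sub>L + 4 * l\<^sub>t + (2 * l\<^sub>L + 2 * l\<^sub>M + 3 * l\<^sub>t)" unfolding Ep by simp
      then show ?thesis using nn by (intro goal) linarith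
    next
      assume "E ^ 6 \<le> 256 * t ^ 6 * Q * real J ^ 3 * V"
      also have "\<dots> \<le> L * t ^ 6 * exp (2 * l\<^sub>L + 2 * l\<^sub>M + 3 * l\<^sub>t) * L ^ 3 * exp (l\<^sub>L + \<beta>)"
        by (rule mult_mono[OF mult_mono[OF mult_mono[OF mult_right_mono QL] power_mono[OF L1(2)]] VL])
          (use L1 M0 in \<open>auto simp: Q_def V_def\<close>)
      also have "\<dots> = exp (l\<^sub>L + 6 * l\<^sub>t + (2 * l\<^sub>L + 2 * l\<^sub>M + 3 * l\<^sub>t) + 3 * l\<^sub>L + (l\<^sub>L + \<beta>))"
        unfolding t Lp exp_add[of _ "l\<^sub>L + \<beta>"] exp_add[of _ "3 * l\<^sub>L"] exp_add[of _ "2 * l\<^sub>L + 2 * l\<^sub>M + 3 * l\<^sub>t"]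
          exp_add[of l\<^sub>L "6 * l\<^sub>t"] e1(1)[symmetric] by simp
      finally have 6: "6 * l\<^sub>E \<le> l\<^sub>L + 6 * l\<^sub>t + (2 * l\<^sub>L + 2 * l\<^sub>M + 3 * l\<^sub>t) + 3 * l\<^sub>L + (l\<^sub>L + \<beta>)"
        unfolding Ep by simp
      \<comment> \<open>The first case gives \<open>M^(13/9) t^(22/9)\<close>, the second
        \<open>M^(5/3) t^(7/3)\<close>. In the latter, \<open>M <= t\<close> trades the excess
        \<open>1/15\<close> in the exponent of \<open>M\<close> for part of the spare
        \<open>1/9\<close> in that of \<open>t\<close>.\<close>
      have "\<beta> = 20/3 * l\<^sub>M + 17/3 * l\<^sub>t \<or> \<beta> = 8 * l\<^sub>M + 5 * l\<^sub>t" unfolding \<beta>_def max_def by simp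
      then have "l\<^sub>E \<le> 2 * l\<^sub>L + 8/5 * l\<^sub>M + 22/9 * l\<^sub>t" using nn 6 by (elim disjE) linarith+
      then show ?thesis by (rule goal)
    qed
  qed
qed

end

lemma eventually_log_square_le_powr:
  "eventually (\<lambda>t::real. (4 * 10 ^ 7 * log 2 t)\<^sup>2 * t powr (22/9) \<le> t powr (49/20)) at_top"
  by real_asymp

theorem small_product_energy_estimate:
  "\<exists>C::real. C > 0 \<and>
     (\<forall>(M::real) (A::real set).
        M \<ge> 1 \<longrightarrow> finite A \<longrightarrow> card A > 1 \<longrightarrow> 0 \<notin> A \<longrightarrow>
        real (card (A * A)) \<le> M * real (card A) \<longrightarrow>
        real (additive_energy A) \<le>
          C * M powr (8/5) * real (card A) powr (49/20) * log 2 (real (card A)) powr (1/5))"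
proof -
  obtain t0 :: real where t0: "\<And>t. t0 \<le> t \<Longrightarrow> (4 * 10 ^ 7 * log 2 t)\<^sup>2 * t powr (22/9) \<le> t powr (49/20)"
    using eventually_log_square_le_powr unfolding eventually_at_top_linorder by blast
  define C where "C = max 1 t0 ^ 3"
  have C: "1 \<le> C" unfolding C_def by (intro one_le_power) auto
  show ?thesis
  proof (intro exI conjI allI impI)
    show "0 < C" using C by simp
    fix M :: real and A :: "real set"
    assume M: "1 \<le> M" and A: "finite A" "1 < card A" "0 \<notin> A" and AA: "real (card (A * A)) \<le> M * real (card A)"
    define t where "t = real (card A)"
    have t1: "1 < t" using A by (simp add: t_def)
    obtain J where J: "card A < 2 ^ J" "real J \<le> 2 * log 2 t" "1 \<le> log 2 t"
      using log2_bounds[OF A(2)] unfolding t_def by blast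
    \<comment> \<open>The true ratio \<open>card (A * A) / card A\<close> replaces \<open>M\<close>:
      it is at most \<open>M\<close>, and also at most \<open>t\<close>, as
      \<open>energy_bound\<close> requires.\<close>
    define N where "N = real (card (A * A)) / t"
    have N: "real (card (A * A)) = N * t" using t1 by (simp add: N_def)
    obtain a where a: "a \<in> A" using A by fastforce
    have "card A \<le> card (A * A)"
    proof (rule card_inj_on_le[of "(*) a"])
      show "inj_on ((*) a) A" using a A by (auto simp: inj_on_def)
    qed (use a A in \<open>auto intro: set_times_intro\<close>)
    then have N1: "1 \<le> N" using t1 unfolding N_def by (simp add: t_def)
    have "card (A * A) \<le> card (A \<times> A)"
    proof (rule surj_card_le[of _ _ "\<lambda>(a, b). a * b"])
      show "A * A \<subseteq> (\<lambda>(a, b). a * b) ` (A \<times> A)" by (auto simp: set_times_def image_iff)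
    qed (use A in simp)
    then have "real (card (A * A)) \<le> real (card A * card A)" unfolding card_cartesian_product by (simp only: of_nat_le_iff)
    then have Nt: "N \<le> t" using t1 unfolding N_def by (simp add: pos_divide_le_eq t_def)
    have NM: "N \<le> M" using AA t1 unfolding N_def by (simp add: pos_divide_le_eq t_def)
    have Mp: "1 \<le> M powr (8/5)" using M by (intro ge_one_powr_ge_zero) auto
    have le: "real (additive_energy A) \<le> C * M powr (8/5) * t powr (49/20)"
    proof (cases "t0 \<le> t")
      case False
      have "real (additive_energy A) \<le> t ^ 3" using additive_energy_le_cube[OF A(1)] by (simp add: t_def)
      also have "\<dots> \<le> C" unfolding C_def using False t1 by (intro power_mono) auto
      also have "\<dots> = C * 1 * 1" by simp
      also have "\<dots> \<le> C * M powr (8/5) * t powr (49/20)"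
        using C t1 M by (intro mult_mono ge_one_powr_ge_zero) auto
      finally show ?thesis .
    next
      case True
      obtain X where X: "X \<subseteq> A" "card A \<le> 2 * card X" "real (card (X * A * A)) \<le> 4 * N\<^sup>2 * real (card A)"
        by (rule large_subset_small_triple_product[OF A(1,3), of N]) (use N N1 in \<open>auto simp: t_def\<close>)
      interpret small_product_set A X N J
        by standard (use A a N N1 X J in \<open>auto simp: t_def\<close>)
      have "real (additive_energy A) \<le> (4 * 10 ^ 7 * log 2 t)\<^sup>2 * N powr (8/5) * t powr (22/9)"
        unfolding t_def by (rule energy_bound) (use Nt J in \<open>auto simp: t_def\<close>)
      also have "\<dots> = N powr (8/5) * ((4 * 10 ^ 7 * log 2 t)\<^sup>2 * t powr (22/9))" by simp
      also have "\<dots> \<le> M powr (8/5) * t powr (49/20)"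
        using t0[OF True] NM N1 by (intro mult_mono powr_mono2) auto
      also have "\<dots> = 1 * (M powr (8/5) * t powr (49/20))" by simp
      also have "\<dots> \<le> C * (M powr (8/5) * t powr (49/20))" using C by (intro mult_right_mono) auto
      finally show ?thesis by simp
    qed
    also have "\<dots> = C * M powr (8/5) * t powr (49/20) * 1" by simp
    also have "\<dots> \<le> C * M powr (8/5) * t powr (49/20) * log 2 t powr (1/5)"
      using C J(3) by (intro mult_left_mono ge_one_powr_ge_zero) auto
    finally show "real (additive_energy A) \<le>
       C * M powr (8/5) * real (card A) powr (49/20) * log 2 (real (card A)) powr (1/5)"
      unfolding t_def .
  qed
qed

theorem theorem3:
  shows "(\<exists>C::real. C > 0 \<and>
           (\<forall>(M::real) (A::real set).
              M \<ge> 1 \<longrightarrow> finite A \<longrightarrow> card A > 1 \<longrightarrow> 0 \<notin> A \<longrightarrow>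
              real (card (A * A)) \<le> M * real (card A) \<longrightarrow>
              real (additive_energy A) \<le>
                C * M powr (8/5) * real (card A) powr (49/20) * log 2 (real (card A)) powr (1/5)))
       \<and> (\<exists>C::real. C > 0 \<and>
           (\<forall>(p::nat) (\<Gamma>::int set).
              prime p \<longrightarrow> subgroup \<Gamma> (units_of (residue_ring (int p))) \<longrightarrow>
              1 < card \<Gamma> \<longrightarrow> real (card \<Gamma>) \<le> sqrt (real p) \<longrightarrow>
              real (ring_additive_energy (residue_ring (int p)) \<Gamma>) \<le>
                C * real (card \<Gamma>) powr (49/20) * log 2 (real (card \<Gamma>)) powr (1/5)))"
  using small_product_energy_estimate subgroup_energy_estimate by (rule conjI)

end
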